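(* Let $f,g\in A^2(\mathbb{D})$. The following are equivalent: (1) $T_fT_g^*:A^2(\mathbb{D})\to A^2(\mathbb{D})$ is bounded; (2) the operator $u\mapsto |f|\,P_B(|g|u)$ is bounded on $L^2(\mathbb{D},dA)$; (3) the operator $u\mapsto |f|\,P_B^+(|g|u)$ is bounded on $L^2(\mathbb{D},dA)$; (4) there is a constant $C_0$ such that for all arcs $I\subset\mathbb{T}$, (a) $\big\||f|\,P_B^+(|g|\,|g|1_{Q_I})\big\|_{L^2(\mathbb{D})}\le C_0\,\big\||g|1_{Q_I}\big\|_{L^2(\mathbb{D})}$, and (b) $\big\||g|\,P_B^+(|f|\,|f|1_{Q_I})\big\|_{L^2(\mathbb{D})}\le C_0\,\big\||f|1_{Q_I}\big\|_{L^2(\mathbb{D})}$.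
   Context: $\mathbb{D}$ is the open unit disc, $\mathbb{T}$ its boundary, $dA$ is Lebesgue area measure normalized so that $A(\mathbb{D})=1$, and $A^2(\mathbb{D})$ is the subspace of analytic functions in $L^2(\mathbb{D},dA)$. $P_B$ is the Bergman projection $P_Bf(z)=\int_{\mathbb{D}}\frac{f(\zeta)}{(1-\bar\zeta z)^2}dA(\zeta)$ (orthogonal projection onto $A^2(\mathbb{D})$), and $P_B^+$ is the maximal Bergman projection $P_B^+f(z)=\int_{\mathbb{D}}\frac{f(\zeta)}{|1-\bar\zeta z|^2}dA(\zeta)$. For $f\in L^2(\mathbb{D})$, $T_fu=P_B(fu)$ is the (densely defined) Toeplitz operator on $A^2(\mathbb{D})$ and $T_g^*$ is the adjoint of $T_g$. For an arc $I\subset\mathbb{T}$, $|I|$ denotes its normalized length ($|\mathbb{T}|=1$) and $Q_I=\{re^{i\theta}: 1-|I|\le r<1,\ e^{i\theta}\in I\}$ is its Carleson box. *)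

theory Defs
  imports "HOL-Analysis.Analysis" "HOL-Computational_Algebra.Polynomial"
begin

definition disc :: "complex set" where
  "disc = ball 0 1"

definition dA :: "complex measure" where
  "dA = density (restrict_space lborel disc) (\<lambda>_. ennreal (1 / pi))"

definition sqnorm :: "(complex \<Rightarrow> complex) \<Rightarrow> ennreal" where
  "sqnorm u = (\<integral>\<^sup>+ z. ennreal ((cmod (u z))\<^sup>2) \<partial>dA)"

definition L2 :: "(complex \<Rightarrow> complex) set" where
  "L2 = {u. u \<in> borel_measurable dA \<and> sqnorm u < \<infinity>}"

definition l2_inner :: "(complex \<Rightarrow> complex) \<Rightarrow> (complex \<Rightarrow> complex) \<Rightarrow> complex" where
  "l2_inner u v = (\<integral> z. u z * cnj (v z) \<partial>dA)"

definition A2 :: "(complex \<Rightarrow> complex) set" where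
  "A2 = {f. f holomorphic_on disc \<and> f \<in> L2}"

definition bergman_proj :: "(complex \<Rightarrow> complex) \<Rightarrow> complex \<Rightarrow> complex" where
  "bergman_proj u z = (\<integral> \<zeta>. u \<zeta> / (1 - cnj \<zeta> * z)\<^sup>2 \<partial>dA)"

definition max_bergman_proj :: "(complex \<Rightarrow> complex) \<Rightarrow> complex \<Rightarrow> complex" where
  "max_bergman_proj u z = (\<integral> \<zeta>. u \<zeta> / complex_of_real ((cmod (1 - cnj \<zeta> * z))\<^sup>2) \<partial>dA)"

definition toeplitz :: "(complex \<Rightarrow> complex) \<Rightarrow> (complex \<Rightarrow> complex) \<Rightarrow> complex \<Rightarrow> complex" where
  "toeplitz f u = bergman_proj (\<lambda>z. f z * u z)"

definition toeplitz_dom :: "(complex \<Rightarrow> complex) \<Rightarrow> (complex \<Rightarrow> complex) set" where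
  "toeplitz_dom g = {u \<in> A2. (\<lambda>z. g z * u z) \<in> L2}"

definition is_toeplitz_adj :: "(complex \<Rightarrow> complex) \<Rightarrow> (complex \<Rightarrow> complex) \<Rightarrow> (complex \<Rightarrow> complex) \<Rightarrow> bool" where
  "is_toeplitz_adj g v w \<longleftrightarrow> v \<in> A2 \<and> w \<in> A2 \<and>
     (\<forall>u \<in> toeplitz_dom g. l2_inner (toeplitz g u) v = l2_inner u w)"

text \<open>Analytic polynomials (a dense subset of A2).\<close>
definition polys :: "(complex \<Rightarrow> complex) set" where
  "polys = {(\<lambda>z. poly q z) | q. True}"

definition arc :: "real \<Rightarrow> real \<Rightarrow> complex set" where
  "arc a l = {cis (2 * pi * t) | t. a \<le> t \<and> t \<le> a + l}"

definition carleson_box :: "real \<Rightarrow> real \<Rightarrow> complex set" where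
  "carleson_box a l = {complex_of_real r * w | r w. 1 - l \<le> r \<and> r < 1 \<and> w \<in> arc a l}"

definition cabs :: "(complex \<Rightarrow> complex) \<Rightarrow> complex \<Rightarrow> complex" where
  "cabs h z = complex_of_real (cmod (h z))"

end

theory Submission
  imports Defs "HOL-Complex_Analysis.Complex_Analysis"
begin

text \<open>
  Boundedness of \<open>|f| P (|g| \<cdot>)\<close> gives, by the argument of Sarason with the disc automorphisms, a
  product bound for the masses of \<open>|f|\<^sup>2\<close> and \<open>|g|\<^sup>2\<close> on nonisotropic balls. The passage from \<open>P\<close> to
  \<open>P\<^sup>+\<close> rests on the analyticity of \<open>f\<close>: for \<open>\<alpha> = |g|\<^sup>2 1\<^sub>E\<close>, \<open>w = 1 - cnj \<zeta> z\<close> and \<open>\<Phi> = \<integral> \<alpha> / |w|\<^sup>2\<close>, a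
  divergence identity for a quadratic expression in \<open>f' \<Phi> + 2 f \<integral> cnj \<zeta> \<alpha> / (w |w|\<^sup>2)\<close>
  yields \<open>\<integral> |f|\<^sup>2 \<Phi>\<^sup>2 \<lesssim> \<integral> |f|\<^sup>2 \<Phi> \<Theta> + \<integral> |f P (cnj \<zeta> \<alpha>)|\<^sup>2\<close>, where \<open>\<Theta> = \<integral> \<alpha> (1 - |\<zeta>|\<^sup>2) / |w|\<^sup>3\<close>
  has a smaller kernel. The ball condition bounds \<open>\<integral> |f|\<^sup>2 \<Theta>\<^sup>2\<close> by the square root of the best testing
  constant, so that constant is finite; this is testing for \<open>P\<^sup>+\<close>, even on all Borel sets \<open>E\<close>.
  Conversely \<open>1 / |w|\<^sup>2\<close> is comparable to a sum over two shifted dyadic grids of Carleson boxes, so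
  testing on boxes implies boundedness of \<open>P\<^sup>+\<close> by a two-weight theorem for positive dyadic operators.
\<close>

section \<open>The divergence theorem on discs\<close>

text \<open>What separates the two projections is a variance. At fixed z give \<zeta> the weight
  \<alpha> / |w|^2, of total mass \<Phi>. The quantity cnj \<zeta> cnj w / w has modulus 1 up to an
  error of order (1 - |\<zeta>|^2) / |w|, while its weighted integral is
  \<open>Berg \<alpha> z\<close>. So \<Phi>^2 exceeds |\<open>Berg \<alpha> z\<close>|^2 by a
  variance, up to an error of order \<Phi> \<Theta>. The divergence identity is arranged so that,
  once a square has been completed, twice this variance appears as a positive multiple of |f|^2;
  against it stands only -5/4 |z|^2 |f|^2 \<Phi>^2, and 2 r^4 exceeds 5/4 as soon as r^4 >= 3/4. The
  estimate of \<Theta> is circular, since it uses the testing constant that is to be bounded.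
  Therefore z and \<zeta> are first confined to a disc of radius r < 1, where some finite constant
  exists trivially, and the bounds derived from the operator are kept independent of r. Arbitrary
  Borel sets E are tested so that E may be cut by balls.\<close>

lemma lborel_complex:
  "(lborel :: complex measure) = distr (lborel \<Otimes>\<^sub>M lborel) borel (\<lambda>(x, y). Complex x y)"
proof (rule lborel_eqI)
  have meas: "(\<lambda>(x, y). Complex x y) \<in> (lborel \<Otimes>\<^sub>M lborel) \<rightarrow>\<^sub>M borel"
    by (auto simp: borel_measurable_complex_iff case_prod_beta)
  fix l u :: complex assume le: "\<And>b. b \<in> Basis \<Longrightarrow> l \<bullet> b \<le> u \<bullet> b"
  have ne: "1 \<noteq> \<i>" by (simp add: complex_eq_iff)
  have le': "Re l \<le> Re u" "Im l \<le> Im u"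
    using le[of 1] le[of \<i>] by (auto simp: Basis_complex_def inner_complex_def)
  have "(\<lambda>(x, y). Complex x y) -` box l u \<inter> space (lborel \<Otimes>\<^sub>M lborel)
      = box (Re l) (Re u) \<times> box (Im l) (Im u)"
    by (auto simp: box_def Basis_complex_def inner_complex_def space_pair_measure)
  then have "emeasure (distr (lborel \<Otimes>\<^sub>M lborel) borel (\<lambda>(x, y). Complex x y)) (box l u)
      = emeasure (lborel \<Otimes>\<^sub>M lborel) (box (Re l) (Re u) \<times> box (Im l) (Im u))"
    by (subst emeasure_distr[OF meas]) auto
  also have "\<dots> = ennreal (Re u - Re l) * ennreal (Im u - Im l)"
    using le' by (subst lborel.emeasure_pair_measure_Times) (auto simp: emeasure_lborel_box_eq)
  also have "\<dots> = (\<Prod>b\<in>Basis. (u - l) \<bullet> b)"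
    using le' ne by (simp add: Basis_complex_def inner_complex_def ennreal_mult)
  finally show "emeasure (distr (lborel \<Otimes>\<^sub>M lborel) borel (\<lambda>(x, y). Complex x y)) (box l u)
      = (\<Prod>b\<in>Basis. (u - l) \<bullet> b)" .
qed simp

text \<open>Both orders of iteration are recorded: horizontal slices see the x-derivative of a
  function, vertical slices its y-derivative.\<close>

lemma integral_lborel_complex:
  fixes f :: "complex \<Rightarrow> complex"
  assumes "integrable lborel f"
  shows "(\<integral>z. f z \<partial>lborel) = (\<integral>y. (\<integral>x. f (Complex x y) \<partial>lborel) \<partial>lborel)" (is "_ = ?A")
    and "(\<integral>z. f z \<partial>lborel) = (\<integral>x. (\<integral>y. f (Complex x y) \<partial>lborel) \<partial>lborel)" (is "_ = ?B")
proof -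
  have meas: "(\<lambda>(x, y). Complex x y) \<in> (lborel \<Otimes>\<^sub>M lborel) \<rightarrow>\<^sub>M borel"
    by (auto simp: borel_measurable_complex_iff case_prod_beta)
  have fm: "f \<in> borel_measurable borel"
    using assms by (simp add: borel_measurable_integrable)
  have int: "integrable (lborel \<Otimes>\<^sub>M lborel) (\<lambda>(x, y). f (Complex x y))"
    using assms unfolding lborel_complex
    by (subst (asm) integrable_distr_eq[OF meas fm]) (simp add: case_prod_beta')
  have eq: "(\<integral>z. f z \<partial>lborel) = (\<integral>p. (\<lambda>(x, y). f (Complex x y)) p \<partial>(lborel \<Otimes>\<^sub>M lborel))"
    unfolding lborel_complex by (subst integral_distr[OF meas fm]) (simp add: case_prod_beta')
  show "(\<integral>z. f z \<partial>lborel) = ?A"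
    unfolding eq by (rule lborel_pair.integral_snd[OF int, symmetric])
  show "(\<integral>z. f z \<partial>lborel) = ?B"
    unfolding eq by (rule lborel_pair.integral_fst[OF int, symmetric])
qed

lemma Complex_in_cball_iff:
  assumes "0 < r"
  shows "Complex x y \<in> cball 0 r \<longleftrightarrow> \<bar>y\<bar> \<le> r \<and> x \<in> {- sqrt (r\<^sup>2 - y\<^sup>2) .. sqrt (r\<^sup>2 - y\<^sup>2)}"
proof -
  have "Complex x y \<in> cball 0 r \<longleftrightarrow> x\<^sup>2 + y\<^sup>2 \<le> r\<^sup>2"
    using assms by (simp add: cmod_def real_le_rsqrt real_sqrt_le_iff' real_le_lsqrt)
  also have "\<dots> \<longleftrightarrow> \<bar>y\<bar> \<le> r \<and> x\<^sup>2 \<le> r\<^sup>2 - y\<^sup>2"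
    using assms abs_le_square_iff[of y r] by (auto simp: algebra_simps) (smt (verit) zero_le_power2)
  also have "\<dots> \<longleftrightarrow> \<bar>y\<bar> \<le> r \<and> \<bar>x\<bar> \<le> sqrt (r\<^sup>2 - y\<^sup>2)"
    by (metis abs_le_square_iff abs_of_nonneg real_sqrt_abs real_sqrt_le_iff)
  finally show ?thesis by (auto simp: abs_le_iff)
qed

text \<open>A and B are the Wirtinger derivatives of R, so its partial derivatives are A + B in x
  and i (A - B) in y. Since R vanishes at both ends of every chord, the first integrates to 0 along
  each horizontal chord and the second along each vertical one; finally 2 B = (A + B) + i * i (A -
  B).\<close>

lemma integral_cball_dbar_eq_0:
  fixes R A B :: "complex \<Rightarrow> complex"
  assumes r: "0 < r"
    and der: "\<And>z. z \<in> cball 0 r \<Longrightarrow> (R has_derivative (\<lambda>h. A z * h + B z * cnj h)) (at z)"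
    and cont: "continuous_on (cball 0 r) A" "continuous_on (cball 0 r) B"
    and bdry: "\<And>z. cmod z = r \<Longrightarrow> R z = 0"
  shows "(\<integral>z. indicator (cball 0 r) z *\<^sub>R B z \<partial>lborel) = 0"
proof -
  let ?I = "\<lambda>f z. indicator (cball 0 r) z *\<^sub>R f z :: complex"
  have intg: "integrable lborel (?I f)" if "continuous_on (cball 0 r) f" for f :: "complex \<Rightarrow> complex"
    using borel_integrable_compact[OF compact_cball that] by simp
  have Re0: "(\<integral>x. ?I (\<lambda>z. A z + B z) (Complex x y) \<partial>lborel) = 0" for y
  proof (cases "\<bar>y\<bar> \<le> r")
    case True
    \<comment> \<open>Half the length of the horizontal chord at height y; it is 0 when |y| =
      r.\<close>
    define c where "c = sqrt (r\<^sup>2 - y\<^sup>2)"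
    have c0: "0 \<le> c" and c2: "c\<^sup>2 + y\<^sup>2 = r\<^sup>2"
      using True r abs_le_square_iff[of y r] by (auto simp: c_def)
    have iff: "Complex x y \<in> cball 0 r \<longleftrightarrow> x \<in> {-c..c}" for x
      using True Complex_in_cball_iff[OF r, of x y] by (simp only: c_def simp_thms)
    have C: "Complex x y = of_real x + \<i> * of_real y" for x
      by (simp add: complex_eq_iff)
    have "(\<integral>x. indicator {-c..c} x *\<^sub>R (A (Complex x y) + B (Complex x y)) \<partial>lborel)
        = R (Complex c y) - R (Complex (-c) y)"
    proof (rule integral_FTC_Icc)
      fix x assume x: "-c \<le> x" "x \<le> c"
      have "((\<lambda>x. R (of_real x + \<i> * of_real y)) has_derivative
          (\<lambda>h. A (Complex x y) * of_real h + B (Complex x y) * cnj (of_real h))) (at x)"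
      proof (rule has_derivative_compose[of "\<lambda>x. of_real x + \<i> * of_real y" of_real x UNIV R, simplified])
        show "((\<lambda>x. of_real x + \<i> * of_real y) has_derivative of_real) (at x)"
          by (auto intro!: derivative_eq_intros)
        show "(R has_derivative (\<lambda>h. A (Complex x y) * h + B (Complex x y) * cnj h)) (at (of_real x + \<i> * of_real y))"
          using der[of "Complex x y"] iff[of x] x unfolding C by auto
      qed
      then show "((\<lambda>x. R (Complex x y)) has_vector_derivative A (Complex x y) + B (Complex x y)) (at x within {-c..c})"
        unfolding has_vector_derivative_def C
        by (rule has_derivative_at_withinI[OF has_derivative_eq_rhs]) (auto simp: scaleR_conv_of_real algebra_simps)
    next
      have "continuous_on {-c..c} (\<lambda>x. (\<lambda>z. A z + B z) (Complex x y))"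
        by (rule continuous_on_compose2[of "cball 0 r" "\<lambda>z. A z + B z"])
          (use iff in \<open>auto simp: C intro!: continuous_intros cont\<close>)
      then show "continuous_on {-c..c} (\<lambda>x. A (Complex x y) + B (Complex x y))" by simp
    qed (use c0 in auto)
    also have "\<dots> = 0"
      using r c2 by (simp add: bdry cmod_def)
    also have "(\<lambda>x. indicator {-c..c} x *\<^sub>R (A (Complex x y) + B (Complex x y)))
      = (\<lambda>x. ?I (\<lambda>z. A z + B z) (Complex x y))"
      using iff by (auto simp: indicator_def)
    finally show ?thesis .
  next
    case False
    then have "indicator (cball 0 r) (Complex x y) = (0 :: real)" for x
      using Complex_in_cball_iff[OF r, of x y] by (auto simp: indicator_def)
    then show ?thesis by simp
  qed
  have Im0: "(\<integral>y. ?I (\<lambda>z. \<i> * (A z - B z)) (Complex x y) \<partial>lborel) = 0" for x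
  proof (cases "\<bar>x\<bar> \<le> r")
    case True
    define c where "c = sqrt (r\<^sup>2 - x\<^sup>2)"
    have c0: "0 \<le> c" and c2: "x\<^sup>2 + c\<^sup>2 = r\<^sup>2"
      using True r abs_le_square_iff[of x r] by (auto simp: c_def)
    have "Complex x y \<in> cball 0 r \<longleftrightarrow> Complex y x \<in> cball 0 r" for y
      by (simp add: cmod_def add.commute)
    then have iff: "Complex x y \<in> cball 0 r \<longleftrightarrow> y \<in> {-c..c}" for y
      using True Complex_in_cball_iff[OF r, of y x] by (simp only: c_def simp_thms)
    have C: "Complex x y = of_real x + \<i> * of_real y" for y
      by (simp add: complex_eq_iff)
    have "(\<integral>y. indicator {-c..c} y *\<^sub>R (\<i> * (A (Complex x y) - B (Complex x y))) \<partial>lborel)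
        = R (Complex x c) - R (Complex x (-c))"
    proof (rule integral_FTC_Icc)
      fix y assume y: "-c \<le> y" "y \<le> c"
      have "((\<lambda>y. R (of_real x + \<i> * of_real y)) has_derivative
          (\<lambda>h. A (Complex x y) * (\<i> * of_real h) + B (Complex x y) * cnj (\<i> * of_real h))) (at y)"
      proof (rule has_derivative_compose[of "\<lambda>y. of_real x + \<i> * of_real y" "\<lambda>h. \<i> * of_real h" y UNIV R, simplified])
        show "((\<lambda>y. of_real x + \<i> * of_real y) has_derivative (\<lambda>h. \<i> * of_real h)) (at y)"
          by (auto intro!: derivative_eq_intros)
        show "(R has_derivative (\<lambda>h. A (Complex x y) * h + B (Complex x y) * cnj h)) (at (of_real x + \<i> * of_real y))"
          using der[of "Complex x y"] iff[of y] y unfolding C by auto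
      qed
      then show "((\<lambda>y. R (Complex x y)) has_vector_derivative \<i> * (A (Complex x y) - B (Complex x y))) (at y within {-c..c})"
        unfolding has_vector_derivative_def C
        by (rule has_derivative_at_withinI[OF has_derivative_eq_rhs]) (auto simp: scaleR_conv_of_real algebra_simps)
    next
      have "continuous_on {-c..c} (\<lambda>y. (\<lambda>z. \<i> * (A z - B z)) (Complex x y))"
        by (rule continuous_on_compose2[of "cball 0 r" "\<lambda>z. \<i> * (A z - B z)"])
          (use iff in \<open>auto simp: C intro!: continuous_intros cont\<close>)
      then show "continuous_on {-c..c} (\<lambda>y. \<i> * (A (Complex x y) - B (Complex x y)))" by simp
    qed (use c0 in auto)
    also have "\<dots> = 0"
      using r c2 by (simp add: bdry cmod_def)
    also have "(\<lambda>y. indicator {-c..c} y *\<^sub>R (\<i> * (A (Complex x y) - B (Complex x y))))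
      = (\<lambda>y. ?I (\<lambda>z. \<i> * (A z - B z)) (Complex x y))"
      using iff by (auto simp: indicator_def)
    finally show ?thesis .
  next
    case False
    have "indicator (cball 0 r) (Complex x y) = (0 :: real)" for y
      using Complex_in_cball_iff[OF r, of y x] False by (auto simp: indicator_def cmod_def add.commute)
    then show ?thesis by simp
  qed
  have "(\<integral>z. ?I (\<lambda>z. A z + B z) z \<partial>lborel) = 0"
    by (subst integral_lborel_complex(1)[OF intg]) (auto simp: Re0 intro!: continuous_intros cont)
  moreover have "(\<integral>z. ?I (\<lambda>z. \<i> * (A z - B z)) z \<partial>lborel) = 0"
    by (subst integral_lborel_complex(2)[OF intg]) (auto simp: Im0 intro!: continuous_intros cont)
  moreover have "2 * (\<integral>z. ?I B z \<partial>lborel)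
      = (\<integral>z. ?I (\<lambda>z. A z + B z) z \<partial>lborel) + \<i> * (\<integral>z. ?I (\<lambda>z. \<i> * (A z - B z)) z \<partial>lborel)"
  proof -
    have "(\<integral>z. ?I (\<lambda>z. A z + B z) z \<partial>lborel) + \<i> * (\<integral>z. ?I (\<lambda>z. \<i> * (A z - B z)) z \<partial>lborel)
      = (\<integral>z. ?I (\<lambda>z. A z + B z) z + \<i> * ?I (\<lambda>z. \<i> * (A z - B z)) z \<partial>lborel)"
      by (subst Bochner_Integration.integral_add)
        (auto simp del: scaleR_right_diff_distrib integral_mult_right_zero intro!: intg continuous_intros cont
          integrable_mult_right simp flip: integral_mult_right_zero)
    also have "\<dots> = (\<integral>z. 2 * ?I B z \<partial>lborel)"
      by (rule Bochner_Integration.integral_cong) (auto simp: indicator_def algebra_simps)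
    also have "\<dots> = 2 * (\<integral>z. ?I B z \<partial>lborel)"
      by (rule integral_mult_right_zero)
    finally show ?thesis by (rule sym)
  qed
  ultimately show ?thesis by simp
qed

section \<open>Normalized area measure on the disc\<close>

lemma open_disc: "open disc"
  by (simp add: disc_def)

lemma mem_disc [simp]: "z \<in> disc \<longleftrightarrow> cmod z < 1"
  by (simp add: disc_def)

lemma space_dA [simp]: "space dA = disc"
  by (simp add: dA_def space_restrict_space)

lemma sets_dA: "sets dA = sets (restrict_space borel disc)"
  by (simp add: dA_def sets_restrict_space)

lemma sets_dA_iff: "A \<in> sets dA \<longleftrightarrow> A \<in> sets borel \<and> A \<subseteq> disc"
  by (simp add: sets_dA sets_restrict_space_iff open_disc borel_open) auto

lemma measurable_dA:
  assumes "f \<in> borel_measurable borel"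
  shows "f \<in> borel_measurable dA"
proof -
  have "f \<in> borel_measurable (restrict_space borel disc)"
    using assms by (rule measurable_restrict_space1)
  then show ?thesis
    by (simp add: measurable_cong_sets[OF sets_dA refl])
qed

lemma measurable_dA_id [measurable]: "(\<lambda>z. z) \<in> borel_measurable dA"
  by (rule measurable_dA) simp

lemma borel_measurable_cnj [measurable]: "cnj \<in> borel_measurable borel"
  by (intro borel_measurable_continuous_onI continuous_intros)

lemma measurable_dA_continuous:
  assumes "continuous_on disc f"
  shows "f \<in> borel_measurable dA"
  using borel_measurable_continuous_on_restrict[OF assms]
  by (simp add: measurable_cong_sets[OF sets_dA refl])

lemma emeasure_dA:
  assumes "A \<in> sets dA"
  shows "emeasure dA A = emeasure lborel A / pi"
proof -
  have A: "A \<in> sets borel" "A \<subseteq> disc" using assms by (auto simp: sets_dA_iff)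
  have "emeasure dA A = ennreal (1 / pi) * emeasure (restrict_space lborel disc) A"
    unfolding dA_def using A open_disc
    by (subst emeasure_density_const) (auto simp: sets_restrict_space_iff)
  also have "emeasure (restrict_space lborel disc) A = emeasure lborel A"
    using A open_disc by (subst emeasure_restrict_space) auto
  finally show ?thesis
    by (simp add: divide_ennreal_def inverse_ennreal inverse_eq_divide mult.commute)
qed

lemma emeasure_dA_space: "emeasure dA disc = 1"
  by (subst emeasure_dA)
    (auto simp: sets_dA_iff open_disc, simp add: disc_def emeasure_ball unit_ball_vol_2 divide_ennreal)

lemma finite_measure_dA: "finite_measure dA"
  by (rule finite_measureI) (simp add: emeasure_dA_space)

interpretation dA: finite_measure dA
  by (rule finite_measure_dA)

interpretation dA2: pair_sigma_finite dA dA ..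

lemma null_sets_dA_iff: "A \<in> null_sets dA \<longleftrightarrow> A \<in> null_sets lborel \<and> A \<subseteq> disc"
  by (auto simp: null_sets_def sets_dA_iff emeasure_dA ennreal_divide_eq_0_iff)

lemma integral_dA:
  fixes h :: "complex \<Rightarrow> complex"
  assumes "h \<in> borel_measurable dA"
  shows "(\<integral>z. h z \<partial>dA) = (1 / pi) * (\<integral>z. indicator disc z *\<^sub>R h z \<partial>lborel)"
proof -
  have h: "h \<in> borel_measurable (restrict_space lborel disc)"
    using assms by (simp add: dA_def)
  have "(\<integral>z. h z \<partial>dA) = (\<integral>z. (1 / pi) *\<^sub>R h z \<partial>(restrict_space lborel disc))"
    unfolding dA_def by (rule integral_density[OF h]) auto
  also have "\<dots> = (1 / pi) *\<^sub>R (\<integral>z. h z \<partial>(restrict_space lborel disc))"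
    by simp
  also have "(\<integral>z. h z \<partial>(restrict_space lborel disc)) = (\<integral>z. indicator disc z *\<^sub>R h z \<partial>lborel)"
    by (rule integral_restrict_space) (simp add: open_disc)
  finally show ?thesis by (simp add: scaleR_conv_of_real)
qed

lemma cball_sets_dA [measurable]: "r < 1 \<Longrightarrow> cball 0 r \<in> sets dA"
  by (auto simp: sets_dA_iff)

lemma integral_dA_cball_dbar_eq_0:
  assumes "0 < r" "r < 1"
    and "\<And>z. z \<in> cball 0 r \<Longrightarrow> (R has_derivative (\<lambda>h. A z * h + B z * cnj h)) (at z)"
    and "continuous_on (cball 0 r) A" "continuous_on (cball 0 r) B"
    and "\<And>z. cmod z = r \<Longrightarrow> R z = 0"
  shows "(\<integral>z. indicator (cball 0 r) z *\<^sub>R B z \<partial>dA) = 0"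
proof -
  have "(\<lambda>z. indicator (cball 0 r) z *\<^sub>R B z) \<in> borel_measurable borel"
    using borel_measurable_continuous_on_indicator[OF _ assms(5)] by (simp add: borel_closed)
  then have "(\<integral>z. indicator (cball 0 r) z *\<^sub>R B z \<partial>dA)
    = (1 / pi) * (\<integral>z. indicator disc z *\<^sub>R indicator (cball 0 r) z *\<^sub>R B z \<partial>lborel)"
    by (subst integral_dA[OF measurable_dA]) auto
  also have "(\<lambda>z. indicator disc z *\<^sub>R indicator (cball 0 r) z *\<^sub>R B z) = (\<lambda>z. indicator (cball 0 r) z *\<^sub>R B z)"
    using assms(2) by (auto simp: indicator_def)
  also have "(\<integral>z. indicator (cball 0 r) z *\<^sub>R B z \<partial>lborel) = 0"
    by (rule integral_cball_dbar_eq_0[of r R A]) (use assms in auto)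
  finally show ?thesis by simp
qed

section \<open>Wirtinger derivatives and moments of concentric discs\<close>

definition wirtinger :: "(complex \<Rightarrow> complex) \<Rightarrow> complex \<Rightarrow> complex \<Rightarrow> complex \<Rightarrow> bool" where
  "wirtinger R a b z \<longleftrightarrow> (R has_derivative (\<lambda>h. a * h + b * cnj h)) (at z)"

lemma wirtinger_holo: "(f has_field_derivative f') (at z) \<Longrightarrow> wirtinger f f' 0 z"
  by (simp add: wirtinger_def has_field_derivative_def)

lemma wirtinger_antiholo:
  assumes "(f has_field_derivative f') (at z)"
  shows "wirtinger (\<lambda>z. cnj (f z)) 0 (cnj f') z"
  unfolding wirtinger_def
  by (rule has_derivative_eq_rhs[OF has_derivative_cnj[OF assms[unfolded has_field_derivative_def]]])
     (simp add: fun_eq_iff)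

lemma wirtinger_add:
  assumes "wirtinger f a b z" "wirtinger g c d z"
  shows "wirtinger (\<lambda>z. f z + g z) (a + c) (b + d) z"
  unfolding wirtinger_def
  by (rule has_derivative_eq_rhs[OF has_derivative_add[OF assms[unfolded wirtinger_def]]])
     (simp add: fun_eq_iff algebra_simps)

lemma wirtinger_diff:
  assumes "wirtinger f a b z" "wirtinger g c d z"
  shows "wirtinger (\<lambda>z. f z - g z) (a - c) (b - d) z"
  unfolding wirtinger_def
  by (rule has_derivative_eq_rhs[OF has_derivative_diff[OF assms[unfolded wirtinger_def]]])
     (simp add: fun_eq_iff algebra_simps)

lemma wirtinger_mult:
  assumes "wirtinger f a b z" "wirtinger g c d z"
  shows "wirtinger (\<lambda>z. f z * g z) (f z * c + a * g z) (f z * d + b * g z) z"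
  unfolding wirtinger_def
  by (rule has_derivative_eq_rhs[OF has_derivative_mult[OF assms[unfolded wirtinger_def]]])
     (simp add: fun_eq_iff algebra_simps)

lemma wirtinger_const: "wirtinger (\<lambda>_. c) 0 0 z"
  by (simp add: wirtinger_def)

definition cball_moment :: "real \<Rightarrow> nat \<Rightarrow> nat \<Rightarrow> complex" where
  "cball_moment r n m = (\<integral>z. indicator (cball 0 r) z *\<^sub>R (z ^ n * cnj z ^ m) \<partial>dA)"

lemma integrable_dA_cball:
  fixes h :: "complex \<Rightarrow> complex"
  assumes "r < 1" "continuous_on (cball 0 r) h"
  shows "integrable dA (\<lambda>z. indicator (cball 0 r) z *\<^sub>R h z)"
proof -
  have m: "(\<lambda>z. indicator (cball 0 r) z *\<^sub>R h z) \<in> borel_measurable borel"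
    using borel_measurable_continuous_on_indicator[OF _ assms(2)] by (simp add: borel_closed)
  obtain B where "\<And>z. z \<in> cball 0 r \<Longrightarrow> norm (h z) \<le> B"
    using compact_imp_bounded[OF compact_continuous_image[OF assms(2) compact_cball]]
    unfolding bounded_iff by blast
  then show ?thesis
    by (intro dA.integrable_const_bound[of _ "max B 0"] measurable_dA[OF m])
       (auto simp: indicator_def le_max_iff_disj)
qed

lemma cball_moment_cnj: "cball_moment r m n = cnj (cball_moment r n m)"
  unfolding cball_moment_def
  unfolding Bochner_Integration.integral_cnj[symmetric]
  by (rule Bochner_Integration.integral_cong) (auto simp: scaleR_conv_of_real mult.commute)

text \<open>The divergence theorem for
  \<open>z ^ n * cnj (z ^ Suc m) * (r\<^sup>2 - z * cnj z)\<close>, whose last factor supplies the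
  zero on the circle. The recurrence takes the place of a computation in polar coordinates.\<close>

lemma cball_moment_Suc:
  assumes "0 < r" "r < 1"
  shows "of_nat (Suc m) * of_real (r\<^sup>2) * cball_moment r n m = of_nat (m + 2) * cball_moment r (Suc n) (Suc m)"
proof -
  let ?B = "\<lambda>z. of_nat (Suc m) * of_real (r\<^sup>2) * (z ^ n * cnj z ^ m) - of_nat (m + 2) * (z ^ Suc n * cnj z ^ Suc m)"
  let ?A = "\<lambda>z. of_nat n * z ^ (n - 1) * cnj (z ^ Suc m) * (of_real (r\<^sup>2) - z * cnj z)
       - z ^ n * cnj (z ^ Suc m) * cnj z"
  have "(\<integral>z. indicator (cball 0 r) z *\<^sub>R ?B z \<partial>dA) = 0"
  proof (rule integral_dA_cball_dbar_eq_0[where A = ?A])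
    fix z :: complex
    have [derivative_intros]: "((\<lambda>z. z ^ Suc m) has_field_derivative of_nat (Suc m) * z ^ m) (at z)"
      using DERIV_power[OF DERIV_ident, where n = "Suc m"] by simp
    have *: "wirtinger (\<lambda>z. (z ^ n * cnj (z ^ Suc m)) * (of_real (r\<^sup>2) - z * cnj z))
       ((z ^ n * cnj (z ^ Suc m)) * (0 - (z * 0 + 1 * cnj z)) +
          (z ^ n * 0 + of_nat n * z ^ (n - 1) * cnj (z ^ Suc m)) * (of_real (r\<^sup>2) - z * cnj z))
       ((z ^ n * cnj (z ^ Suc m)) * (0 - (z * cnj 1 + 0 * cnj z)) +
          (z ^ n * cnj (of_nat (Suc m) * z ^ m) + 0 * cnj (z ^ Suc m)) * (of_real (r\<^sup>2) - z * cnj z)) z"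
      by (intro wirtinger_mult wirtinger_diff wirtinger_const wirtinger_holo wirtinger_antiholo)
         (rule derivative_eq_intros | simp del: power_Suc of_nat_Suc)+
    show "((\<lambda>z. (z ^ n * cnj (z ^ Suc m)) * (of_real (r\<^sup>2) - z * cnj z)) has_derivative
        (\<lambda>h. ?A z * h + ?B z * cnj h)) (at z)"
      by (rule has_derivative_eq_rhs[OF *[unfolded wirtinger_def]]) (auto simp: algebra_simps)
  next
    fix z :: complex assume "cmod z = r"
    then show "(z ^ n * cnj (z ^ Suc m)) * (of_real (r\<^sup>2) - z * cnj z) = 0"
      by (simp add: complex_norm_square[symmetric] flip: of_real_power)
  qed (use assms in \<open>auto intro!: continuous_intros\<close>)
  moreover have "(\<integral>z. indicator (cball 0 r) z *\<^sub>R ?B z \<partial>dA)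
    = of_nat (Suc m) * of_real (r\<^sup>2) * cball_moment r n m - of_nat (m + 2) * cball_moment r (Suc n) (Suc m)"
  proof -
    have "(\<integral>z. indicator (cball 0 r) z *\<^sub>R ?B z \<partial>dA)
      = (\<integral>z. (of_nat (Suc m) * of_real (r\<^sup>2)) * (indicator (cball 0 r) z *\<^sub>R (z ^ n * cnj z ^ m))
        - of_nat (m + 2) * (indicator (cball 0 r) z *\<^sub>R (z ^ Suc n * cnj z ^ Suc m)) \<partial>dA)"
      by (rule Bochner_Integration.integral_cong) (auto simp: indicator_def)
    also have "\<dots> = of_nat (Suc m) * of_real (r\<^sup>2) * cball_moment r n m - of_nat (m + 2) * cball_moment r (Suc n) (Suc m)"
      unfolding cball_moment_def
      by (subst Bochner_Integration.integral_diff; (simp only: integral_mult_right_zero)?;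
          (intro integrable_mult_right integrable_dA_cball continuous_intros assms)?)
    finally show ?thesis .
  qed
  ultimately show ?thesis by simp
qed

text \<open>Conjugation yields a second recurrence with n in the role of m, between the same two
  moments. Eliminating the higher one leaves the factor (n + 2) (m + 1) - (m + 2) (n + 1) = m - n in
  front of the lower one.\<close>

lemma cball_moment_offdiag:
  assumes "0 < r" "r < 1" "n \<noteq> m"
  shows "cball_moment r n m = 0"
proof -
  have "of_nat (Suc n) * of_real (r\<^sup>2) * cnj (cball_moment r n m) = of_nat (n + 2) * cnj (cball_moment r (Suc n) (Suc m))"
    using cball_moment_Suc[OF assms(1,2), of n m] by (simp only: cball_moment_cnj[of r m n] cball_moment_cnj[of r "Suc m" "Suc n"])
  from arg_cong[OF this, of cnj]
  have 1: "of_nat (Suc n) * of_real (r\<^sup>2) * cball_moment r n m = of_nat (n + 2) * cball_moment r (Suc n) (Suc m)"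
    by (simp only: complex_cnj_mult complex_cnj_cnj complex_cnj_of_nat complex_cnj_complex_of_real)
  have 2: "of_nat (Suc m) * of_real (r\<^sup>2) * cball_moment r n m = of_nat (m + 2) * cball_moment r (Suc n) (Suc m)"
    by (rule cball_moment_Suc[OF assms(1,2)])
  have "(of_nat m - of_nat n) * of_real (r\<^sup>2) * cball_moment r n m
     = of_nat (n + 2) * (of_nat (Suc m) * of_real (r\<^sup>2) * cball_moment r n m)
       - of_nat (m + 2) * (of_nat (Suc n) * of_real (r\<^sup>2) * cball_moment r n m)"
    by (simp add: algebra_simps)
  also have "\<dots> = 0" unfolding 1 2 by simp
  finally show ?thesis using assms by auto
qed

lemma cball_moment_diag:
  assumes "0 < r" "r < 1"
  shows "cball_moment r n n = of_real (r ^ (2 * n + 2) / (n + 1))"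
proof (induction n)
  case 0
  have "cball_moment r 0 0 = complex_of_real (\<integral>z. indicator (cball 0 r) z \<partial>dA)"
    unfolding cball_moment_def by (simp add: scaleR_conv_of_real)
  also have "(\<integral>z. indicator (cball 0 r) z \<partial>dA) = measure dA (cball 0 r)"
    using assms by (simp add: Int_absorb2 subset_iff)
  also have "\<dots> = r\<^sup>2"
    using assms by (simp add: measure_def emeasure_dA emeasure_cball unit_ball_vol_2 divide_ennreal)
  finally show ?case by (simp add: power2_eq_square)
next
  case (Suc n)
  have "of_nat (n + 2) * cball_moment r (Suc n) (Suc n) = of_nat (Suc n) * of_real (r\<^sup>2) * cball_moment r n n"
    using cball_moment_Suc[OF assms] by simp
  also have "\<dots> = of_real (r ^ (2 * Suc n + 2))"
    unfolding Suc.IH by (simp add: power2_eq_square del: of_nat_Suc)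
  finally have "cball_moment r (Suc n) (Suc n) = of_real (r ^ (2 * Suc n + 2)) / of_nat (n + 2)"
    by (metis nonzero_mult_div_cancel_left of_nat_eq_0_iff add_2_eq_Suc' nat.distinct(1))
  then show ?case by (simp add: add.commute)
qed

section \<open>The Bergman projection\<close>

text \<open>The integral of (f - t g)^2 is a nonnegative quadratic polynomial in t; it is evaluated
  at its minimum b / c.\<close>

lemma Cauchy_Schwarz_integral:
  fixes f g :: "'a \<Rightarrow> real"
  assumes f: "f \<in> borel_measurable M" "integrable M (\<lambda>x. (f x)\<^sup>2)"
    and g: "g \<in> borel_measurable M" "integrable M (\<lambda>x. (g x)\<^sup>2)"
  shows "integrable M (\<lambda>x. f x * g x)"
    and "(\<integral>x. f x * g x \<partial>M)\<^sup>2 \<le> (\<integral>x. (f x)\<^sup>2 \<partial>M) * (\<integral>x. (g x)\<^sup>2 \<partial>M)"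
proof -
  have "\<bar>f x * g x\<bar> \<le> (f x)\<^sup>2 + (g x)\<^sup>2" for x
    using sum_squares_bound[of "f x" "g x"] sum_squares_bound[of "- f x" "g x"]
      zero_le_power2[of "f x"] zero_le_power2[of "g x"] by (simp add: abs_le_iff)
  then show int: "integrable M (\<lambda>x. f x * g x)"
    using f g by (intro Bochner_Integration.integrable_bound[OF Bochner_Integration.integrable_add[OF f(2) g(2)]]) auto
  define a b c where "a = (\<integral>x. (f x)\<^sup>2 \<partial>M)" and "b = (\<integral>x. f x * g x \<partial>M)" and "c = (\<integral>x. (g x)\<^sup>2 \<partial>M)"
  have q: "0 \<le> a - 2 * t * b + t\<^sup>2 * c" for t
  proof -
    have "0 \<le> (\<integral>x. (f x - t * g x)\<^sup>2 \<partial>M)" by simp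
    also have "\<dots> = (\<integral>x. (f x)\<^sup>2 - 2 * t * (f x * g x) + t\<^sup>2 * (g x)\<^sup>2 \<partial>M)"
      by (rule Bochner_Integration.integral_cong) (auto simp: power2_eq_square algebra_simps)
    also have "\<dots> = a - 2 * t * b + t\<^sup>2 * c"
      unfolding a_def b_def c_def using f(2) g(2) int by simp
    finally show ?thesis .
  qed
  have ac: "0 \<le> a" "0 \<le> c" by (auto simp: a_def c_def)
  have "b\<^sup>2 \<le> a * c"
  proof (cases "c = 0")
    case True
    have "b = 0"
    proof (rule ccontr)
      assume "b \<noteq> 0"
      \<comment> \<open>With c = 0 the polynomial is affine in t, and at this t it would equal
        -1.\<close>
      then show False using q[of "(a + 1) / (2 * b)"] True by simp
    qed
    then show ?thesis using ac by simp
  next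
    case False
    then have "0 \<le> a - b\<^sup>2 / c" using q[of "b / c"] by (simp add: power2_eq_square field_simps)
    then show ?thesis using False ac by (simp add: field_simps)
  qed
  then show "(\<integral>x. f x * g x \<partial>M)\<^sup>2 \<le> (\<integral>x. (f x)\<^sup>2 \<partial>M) * (\<integral>x. (g x)\<^sup>2 \<partial>M)"
    by (simp add: a_def b_def c_def)
qed

section \<open>Square integrable functions on the disc\<close>

abbreviation (input) norm2sq :: "(complex \<Rightarrow> complex) \<Rightarrow> real" where
  "norm2sq u \<equiv> (\<integral>z. (cmod (u z))\<^sup>2 \<partial>dA)"

lemma L2_iff: "u \<in> L2 \<longleftrightarrow> u \<in> borel_measurable dA \<and> integrable dA (\<lambda>z. (cmod (u z))\<^sup>2)"
  by (auto simp: L2_def sqnorm_def integrable_iff_bounded)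

lemma L2_measurable: "u \<in> L2 \<Longrightarrow> u \<in> borel_measurable dA"
  by (simp add: L2_iff)

lemma L2_integrable_sq: "u \<in> L2 \<Longrightarrow> integrable dA (\<lambda>z. (cmod (u z))\<^sup>2)"
  by (simp add: L2_iff)

lemma sqnorm_eq: "u \<in> L2 \<Longrightarrow> sqnorm u = ennreal (norm2sq u)"
  by (simp add: sqnorm_def L2_iff nn_integral_eq_integral)

text \<open>Moves a bound from \<open>ennreal\<close> to the reals. Since \<open>ennreal\<close>
  sends negative numbers to 0, the real inequality is claimed for nonnegative K.\<close>

lemma L2_I:
  assumes "u \<in> borel_measurable dA" "sqnorm u \<le> ennreal K"
  shows "u \<in> L2" and "0 \<le> K \<Longrightarrow> norm2sq u \<le> K"
proof -
  show u: "u \<in> L2" using assms by (auto simp: L2_def intro: le_less_trans)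
  show "norm2sq u \<le> K" if "0 \<le> K"
    using assms(2) that unfolding sqnorm_eq[OF u] by simp
qed

lemma L2_bound:
  assumes "v \<in> borel_measurable dA" "u \<in> L2" "\<And>z. z \<in> disc \<Longrightarrow> cmod (v z) \<le> K * cmod (u z)"
  shows "v \<in> L2" "norm2sq v \<le> K\<^sup>2 * norm2sq u"
proof -
  have le: "(cmod (v z))\<^sup>2 \<le> K\<^sup>2 * (cmod (u z))\<^sup>2" if "z \<in> disc" for z
    using power_mono[OF assms(3)[OF that], of 2] by (simp add: power_mult_distrib)
  have i: "integrable dA (\<lambda>z. K\<^sup>2 * (cmod (u z))\<^sup>2)"
    using L2_integrable_sq[OF assms(2)] by simp
  have j: "integrable dA (\<lambda>z. (cmod (v z))\<^sup>2)"
    using assms(1) le by (intro Bochner_Integration.integrable_bound[OF i]) (auto intro!: AE_I2)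
  then show "v \<in> L2" using assms(1) by (simp add: L2_iff)
  have "norm2sq v \<le> (\<integral>z. K\<^sup>2 * (cmod (u z))\<^sup>2 \<partial>dA)"
    by (rule integral_mono[OF j i]) (use le in auto)
  then show "norm2sq v \<le> K\<^sup>2 * norm2sq u" by simp
qed

lemma L2_bounded:
  assumes "v \<in> borel_measurable dA" "\<And>z. z \<in> disc \<Longrightarrow> cmod (v z) \<le> K"
  shows "v \<in> L2"
proof (rule L2_bound(1)[of v "\<lambda>_. 1" K])
  show "(\<lambda>_. 1) \<in> L2" by (simp add: L2_iff)
qed (use assms in simp_all)

lemma L2_add:
  assumes "u \<in> L2" "v \<in> L2"
  shows "(\<lambda>z. u z + v z) \<in> L2"
proof -
  have "(cmod (u z + v z))\<^sup>2 \<le> 2 * (cmod (u z))\<^sup>2 + 2 * (cmod (v z))\<^sup>2" for z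
  proof -
    have "(cmod (u z + v z))\<^sup>2 \<le> (cmod (u z) + cmod (v z))\<^sup>2"
      by (intro power_mono norm_triangle_ineq) auto
    also have "\<dots> \<le> 2 * (cmod (u z))\<^sup>2 + 2 * (cmod (v z))\<^sup>2"
      using zero_le_power2[of "cmod (u z) - cmod (v z)"] by (simp add: power2_eq_square algebra_simps)
    finally show ?thesis .
  qed
  note le = this
  have [measurable]: "u \<in> borel_measurable dA" "v \<in> borel_measurable dA" using assms by (simp_all add: L2_iff)
  have "integrable dA (\<lambda>z. (cmod (u z + v z))\<^sup>2)"
  proof (rule Bochner_Integration.integrable_bound)
    show "integrable dA (\<lambda>z. 2 * (cmod (u z))\<^sup>2 + 2 * (cmod (v z))\<^sup>2)"
      using assms by (simp add: L2_iff)
    show "AE z in dA. norm ((cmod (u z + v z))\<^sup>2) \<le> norm (2 * (cmod (u z))\<^sup>2 + 2 * (cmod (v z))\<^sup>2)"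
      using le by (intro AE_I2) simp
  qed measurable
  then show ?thesis by (simp add: L2_iff)
qed

lemma L2_cmult: "u \<in> L2 \<Longrightarrow> (\<lambda>z. c * u z) \<in> L2"
  by (rule L2_bound(1)[of _ u "cmod c"]) (auto simp: norm_mult dest: L2_measurable)

lemma L2_diff: "u \<in> L2 \<Longrightarrow> v \<in> L2 \<Longrightarrow> (\<lambda>z. u z - v z) \<in> L2"
  using L2_add[of u "\<lambda>z. (-1) * v z"] L2_cmult[of v "-1"] by simp

lemma L2_cnj: "u \<in> L2 \<Longrightarrow> (\<lambda>z. cnj (u z)) \<in> L2"
  by (rule L2_bound(1)[of _ u 1]) (auto dest: L2_measurable)

lemma L2_mult:
  assumes "u \<in> L2" "v \<in> L2"
  shows "integrable dA (\<lambda>z. u z * v z)"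
    and "(cmod (\<integral>z. u z * v z \<partial>dA))\<^sup>2 \<le> norm2sq u * norm2sq v"
proof -
  have m: "(\<lambda>z. u z * v z) \<in> borel_measurable dA" using assms by (auto simp: L2_iff)
  note cs = Cauchy_Schwarz_integral[of "\<lambda>z. cmod (u z)" dA "\<lambda>z. cmod (v z)"]
  have "integrable dA (\<lambda>z. norm (u z * v z))"
    using cs(1) assms by (auto simp: norm_mult L2_iff)
  then show "integrable dA (\<lambda>z. u z * v z)" using m by (rule integrable_norm_cancel)
  have "cmod (\<integral>z. u z * v z \<partial>dA) \<le> (\<integral>z. cmod (u z) * cmod (v z) \<partial>dA)"
    using integral_norm_bound[of dA "\<lambda>z. u z * v z"] by (simp add: norm_mult)
  then have "(cmod (\<integral>z. u z * v z \<partial>dA))\<^sup>2 \<le> (\<integral>z. cmod (u z) * cmod (v z) \<partial>dA)\<^sup>2"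
    by (intro power_mono) auto
  also have "\<dots> \<le> norm2sq u * norm2sq v" using cs(2) assms by (auto simp: L2_iff)
  finally show "(cmod (\<integral>z. u z * v z \<partial>dA))\<^sup>2 \<le> norm2sq u * norm2sq v" .
qed

lemma L2_const: "(\<lambda>_. c) \<in> L2"
  by (simp add: L2_iff)

lemma L2_integrable: "u \<in> L2 \<Longrightarrow> integrable dA u"
  using L2_mult(1)[of u "\<lambda>_. 1"] L2_const by simp

lemma A2_D: "f \<in> A2 \<Longrightarrow> f holomorphic_on disc" "f \<in> A2 \<Longrightarrow> f \<in> L2"
  by (auto simp: A2_def)

lemma A2_I:
  assumes "f holomorphic_on disc" "f \<in> L2" shows "f \<in> A2"
  using assms by (simp add: A2_def)

lemma holomorphic_measurable_dA: "f holomorphic_on disc \<Longrightarrow> f \<in> borel_measurable dA"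
  by (intro measurable_dA_continuous holomorphic_on_imp_continuous_on)

section \<open>Exhaustion by discs and coefficients of analytic functions\<close>

definition exhaust :: "nat \<Rightarrow> real" where "exhaust k = 1 - 1 / (real k + 2)"

text \<open>The offset 2 in the definition makes the first radius 1/2, so that all radii are
  positive.\<close>

lemma exhaust: "0 < exhaust k" "exhaust k < 1" "exhaust k \<le> exhaust (Suc k)" "exhaust \<longlonglongrightarrow> 1"
proof -
  show "exhaust \<longlonglongrightarrow> 1" unfolding exhaust_def by real_asymp
qed (auto simp: exhaust_def field_simps)

lemma eventually_in_cball_exhaust: "cmod z < 1 \<Longrightarrow> eventually (\<lambda>k. z \<in> cball 0 (exhaust k)) sequentially"
  using order_tendstoD(1)[OF exhaust(4), of "cmod z"] by (auto elim: eventually_mono)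

lemma tendsto_integral_cball_exhaust:
  fixes h :: "complex \<Rightarrow> complex"
  assumes "integrable dA h"
  shows "(\<lambda>k. \<integral>z. indicator (cball 0 (exhaust k)) z *\<^sub>R h z \<partial>dA) \<longlonglongrightarrow> (\<integral>z. h z \<partial>dA)"
proof (rule integral_dominated_convergence[where w = "\<lambda>z. norm (h z)"])
  show "AE z in dA. (\<lambda>k. indicator (cball 0 (exhaust k)) z *\<^sub>R h z) \<longlonglongrightarrow> h z"
  proof (rule AE_I2)
    fix z assume "z \<in> space dA"
    then have "eventually (\<lambda>k. indicator (cball 0 (exhaust k)) z *\<^sub>R h z = h z) sequentially"
      using eventually_in_cball_exhaust[of z] by (auto elim: eventually_mono)
    then show "(\<lambda>k. indicator (cball 0 (exhaust k)) z *\<^sub>R h z) \<longlonglongrightarrow> h z" by (rule tendsto_eventually)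
  qed
  show "AE z in dA. norm (indicator (cball 0 (exhaust k)) z *\<^sub>R h z) \<le> norm (h z)" for k
    by (auto simp: indicator_def)
qed (use assms exhaust(2) in \<open>auto intro!: borel_measurable_scaleR borel_measurable_indicator cball_sets_dA\<close>)

text \<open>Orthogonality of the monomials on the disc of radius r, applied to partial sums of the
  power series. These are uniformly bounded there, so dominated convergence passes to h.\<close>

lemma moment_cball:
  fixes h :: "complex \<Rightarrow> complex"
  assumes r: "0 < r" "r < 1"
    and sums: "\<And>z. z \<in> disc \<Longrightarrow> (\<lambda>n. c n * z ^ n) sums h z"
  shows "(\<integral>z. indicator (cball 0 r) z *\<^sub>R (h z * cnj z ^ m) \<partial>dA) = c m * of_real (r ^ (2 * m + 2) / (m + 1))"
proof -
  define s where "s N z = (\<Sum>n<N. c n * z ^ n)" for N z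
  \<comment> \<open>Convergence at the larger radius (1 + r) / 2 forces absolute convergence at
    r.\<close>
  have sum: "summable (\<lambda>n. norm (c n * (of_real r) ^ n))"
  proof (rule powser_insidea)
    have *: "norm (of_real ((1 + r) / 2) :: complex) = (1 + r) / 2"
      using r unfolding norm_of_real by simp
    show "summable (\<lambda>n. c n * of_real ((1 + r) / 2) ^ n)"
      using sums[of "of_real ((1 + r) / 2)"] r unfolding mem_disc * by (simp add: sums_iff)
    show "norm (of_real r :: complex) < norm (of_real ((1 + r) / 2) :: complex)"
      unfolding * using r by simp
  qed
  define K where "K = (\<Sum>n. norm (c n * (of_real r) ^ n))"
  have bd: "norm (s N z) \<le> K" if "z \<in> cball 0 r" for N z
  proof -
    have "norm (s N z) \<le> (\<Sum>n<N. norm (c n * z ^ n))" unfolding s_def by (rule norm_sum)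
    also have "\<dots> \<le> (\<Sum>n<N. norm (c n * (of_real r) ^ n))"
      using that r by (intro sum_mono) (auto simp: norm_mult norm_power intro!: mult_left_mono power_mono)
    also have "\<dots> \<le> K" unfolding K_def using sum by (rule sum_le_suminf) auto
    finally show ?thesis .
  qed
  have K: "0 \<le> K" unfolding K_def using sum by (rule suminf_nonneg) auto
  have sc: "continuous_on A (s N)" for A N unfolding s_def by (intro continuous_intros)
  have hm: "h \<in> borel_measurable dA"
  proof (rule borel_measurable_LIMSEQ_metric)
    show "s N \<in> borel_measurable dA" for N by (intro measurable_dA_continuous sc)
    show "(\<lambda>i. s i z) \<longlonglongrightarrow> h z" if "z \<in> space dA" for z
      using sums[of z] that by (simp add: s_def sums_def)
  qed
  have M: "(\<lambda>z. indicator (cball 0 r) z *\<^sub>R (h z * cnj z ^ m)) \<in> borel_measurable dA"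
    "(\<lambda>z. indicator (cball 0 r) z *\<^sub>R (s N z * cnj z ^ m)) \<in> borel_measurable dA" for N
    by (intro borel_measurable_scaleR borel_measurable_indicator borel_measurable_times hm
        cball_sets_dA r measurable_dA_continuous sc continuous_intros)+
  let ?F = "\<lambda>N. \<integral>z. indicator (cball 0 r) z *\<^sub>R (s N z * cnj z ^ m) \<partial>dA"
  have lim: "?F \<longlonglongrightarrow> (\<integral>z. indicator (cball 0 r) z *\<^sub>R (h z * cnj z ^ m) \<partial>dA)"
  proof (rule integral_dominated_convergence[where w = "\<lambda>_. K"])
    show "AE z in dA. (\<lambda>N. indicator (cball 0 r) z *\<^sub>R (s N z * cnj z ^ m)) \<longlonglongrightarrow> indicator (cball 0 r) z *\<^sub>R (h z * cnj z ^ m)"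
      using sums by (intro AE_I2 tendsto_intros) (auto simp: s_def sums_def)
    show "AE z in dA. norm (indicator (cball 0 r) z *\<^sub>R (s N z * cnj z ^ m)) \<le> K" for N
    proof (rule AE_I2)
      fix z assume "z \<in> space dA"
      then show "norm (indicator (cball 0 r) z *\<^sub>R (s N z * cnj z ^ m)) \<le> K"
        using bd[of z N] K mult_mono[of "norm (s N z)" K "cmod z ^ m" 1]
        by (auto simp: indicator_def norm_mult norm_power power_le_one)
    qed
  qed (rule M(1), rule M(2), simp)
  have "?F N = c m * of_real (r ^ (2 * m + 2) / (m + 1))" if "m < N" for N
  proof -
    have "?F N = (\<integral>z. (\<Sum>n<N. c n * (indicator (cball 0 r) z *\<^sub>R (z ^ n * cnj z ^ m))) \<partial>dA)"
      by (rule Bochner_Integration.integral_cong) (auto simp: s_def indicator_def sum_distrib_right mult.assoc)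
    also have "\<dots> = (\<Sum>n<N. (\<integral>z. c n * (indicator (cball 0 r) z *\<^sub>R (z ^ n * cnj z ^ m)) \<partial>dA))"
      by (rule Bochner_Integration.integral_sum) (intro integrable_mult_right integrable_dA_cball continuous_intros r)
    also have "\<dots> = (\<Sum>n<N. c n * cball_moment r n m)"
      by (simp only: integral_mult_right_zero cball_moment_def)
    also have "\<dots> = (\<Sum>n<N. if n = m then c m * cball_moment r m m else 0)"
      using cball_moment_offdiag[OF r] by (intro sum.cong) auto
    also have "\<dots> = c m * cball_moment r m m" using that by simp
    finally show ?thesis using cball_moment_diag[OF r] by simp
  qed
  then have "?F \<longlonglongrightarrow> c m * of_real (r ^ (2 * m + 2) / (m + 1))"
    by (intro tendsto_eventually eventually_sequentiallyI[of "Suc m"]) auto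
  with lim show ?thesis by (rule LIMSEQ_unique)
qed

section \<open>The Bergman projection as a power series\<close>

definition moment :: "(complex \<Rightarrow> complex) \<Rightarrow> nat \<Rightarrow> complex" where
  "moment u n = (\<integral>z. u z * cnj z ^ n \<partial>dA)"

lemma integrable_mult_cnj_power:
  assumes "integrable dA u"
  shows "integrable dA (\<lambda>z. u z * cnj z ^ m)"
proof (rule Bochner_Integration.integrable_bound[OF assms])
  have "norm (u z * cnj z ^ m) \<le> norm (u z)" if "z \<in> disc" for z
    using that mult_left_mono[of "cmod z ^ m" 1 "cmod (u z)"] by (auto simp: norm_mult norm_power power_le_one)
  then show "AE z in dA. norm (u z * cnj z ^ m) \<le> norm (u z)" by (intro AE_I2) auto
qed (use assms in auto)

text \<open>The series need not converge well up to the boundary, so the identity is taken on discs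
  of radius below 1 and the radius tends to 1 by dominated convergence, with h itself as dominating
  function.\<close>

lemma moment_series:
  assumes int: "integrable dA h"
    and sums: "\<And>z. z \<in> disc \<Longrightarrow> (\<lambda>n. c n * z ^ n) sums h z"
  shows "moment h m = c m / (of_nat m + 1)"
proof -
  have "(\<lambda>k. \<integral>z. indicator (cball 0 (exhaust k)) z *\<^sub>R (h z * cnj z ^ m) \<partial>dA) \<longlonglongrightarrow> moment h m"
    unfolding moment_def by (rule tendsto_integral_cball_exhaust[OF integrable_mult_cnj_power[OF int]])
  then have "(\<lambda>k. c m * of_real (exhaust k ^ (2 * m + 2) / (m + 1))) \<longlonglongrightarrow> moment h m"
    by (subst (asm) moment_cball[OF exhaust(1,2), of c h]) (use sums in auto)
  moreover have "(\<lambda>k. c m * of_real (exhaust k ^ (2 * m + 2) / (m + 1))) \<longlonglongrightarrow> c m * of_real (1 ^ (2 * m + 2) / (m + 1))"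
    by (intro tendsto_intros exhaust) auto
  ultimately have "moment h m = c m * of_real (1 ^ (2 * m + 2) / (m + 1))" by (rule LIMSEQ_unique)
  then show ?thesis by (simp add: add.commute)
qed

lemma kernel_bound:
  assumes "cmod z < 1" "cmod \<zeta> < 1"
  shows "1 - cmod z \<le> cmod (1 - cnj \<zeta> * z)" "1 - cmod \<zeta> \<le> cmod (1 - cnj \<zeta> * z)" "cmod (1 - cnj \<zeta> * z) \<le> 2"
    "1 - cnj \<zeta> * z \<noteq> 0"
proof -
  have "cmod (cnj \<zeta> * z) \<le> cmod z" "cmod (cnj \<zeta> * z) \<le> cmod \<zeta>"
    using assms mult_right_mono[of "cmod \<zeta>" 1 "cmod z"] mult_left_mono[of "cmod z" 1 "cmod \<zeta>"]
    by (auto simp: norm_mult)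
  moreover have "1 - cmod (cnj \<zeta> * z) \<le> cmod (1 - cnj \<zeta> * z)"
    using norm_triangle_ineq2[of 1 "cnj \<zeta> * z"] by simp
  moreover have "cmod (1 - cnj \<zeta> * z) \<le> 1 + cmod (cnj \<zeta> * z)"
    using norm_triangle_ineq4[of 1 "cnj \<zeta> * z"] by simp
  ultimately show "1 - cmod z \<le> cmod (1 - cnj \<zeta> * z)" "1 - cmod \<zeta> \<le> cmod (1 - cnj \<zeta> * z)"
    "cmod (1 - cnj \<zeta> * z) \<le> 2" "1 - cnj \<zeta> * z \<noteq> 0" using assms by auto
qed

text \<open>Expands the kernel by 1 / (1 - x)^2 = sum of (n + 1) x^n. All partial sums are bounded
  by the value of the series at |z|, so u times a constant dominates. What follows about the
  projection is read off from moments.\<close>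

lemma bergman_proj_sums:
  assumes int: "integrable dA u" and z: "cmod z < 1"
  shows "(\<lambda>n. of_nat (Suc n) * moment u n * z ^ n) sums bergman_proj u z"
proof -
  define s where "s N \<zeta> = (\<Sum>n<N. of_nat (Suc n) * (cnj \<zeta> * z) ^ n)" for N \<zeta>
  have K: "(\<lambda>n. of_nat (Suc n) * cmod z ^ n) sums (1 / (1 - cmod z)\<^sup>2)"
    using geometric_deriv_sums[of "cmod z"] z by simp
  have bd: "norm (s N \<zeta>) \<le> 1 / (1 - cmod z)\<^sup>2" if "cmod \<zeta> < 1" for N \<zeta>
  proof -
    have "norm (s N \<zeta>) \<le> (\<Sum>n<N. norm (of_nat (Suc n) * (cnj \<zeta> * z) ^ n))" unfolding s_def by (rule norm_sum)
    also have "\<dots> \<le> (\<Sum>n<N. of_nat (Suc n) * cmod z ^ n)"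
    proof (rule sum_mono)
      fix n
      have "cmod \<zeta> ^ n * cmod z ^ n \<le> 1 * cmod z ^ n"
        using that by (intro mult_right_mono power_le_one) auto
      then show "norm (of_nat (Suc n) * (cnj \<zeta> * z) ^ n) \<le> of_nat (Suc n) * cmod z ^ n"
        unfolding norm_mult norm_of_nat norm_power complex_mod_cnj power_mult_distrib
        by (intro mult_left_mono) auto
    qed
    also have "\<dots> \<le> 1 / (1 - cmod z)\<^sup>2"
      unfolding sums_unique[OF K] using sums_summable[OF K] by (intro sum_le_suminf) auto
    finally show ?thesis .
  qed
  let ?F = "\<lambda>N. \<integral>\<zeta>. u \<zeta> * s N \<zeta> \<partial>dA"
  have um [measurable]: "u \<in> borel_measurable dA" using int by auto
  have "?F \<longlonglongrightarrow> (\<integral>\<zeta>. u \<zeta> / (1 - cnj \<zeta> * z)\<^sup>2 \<partial>dA)"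
  proof (rule integral_dominated_convergence[where w = "\<lambda>\<zeta>. norm (u \<zeta>) * (1 / (1 - cmod z)\<^sup>2)"])
    show "AE \<zeta> in dA. (\<lambda>N. u \<zeta> * s N \<zeta>) \<longlonglongrightarrow> u \<zeta> / (1 - cnj \<zeta> * z)\<^sup>2"
    proof (rule AE_I2)
      fix \<zeta> assume "\<zeta> \<in> space dA"
      then have "cmod (cnj \<zeta> * z) < 1"
        using z mult_strict_mono[of "cmod \<zeta>" 1 "cmod z" 1] by (auto simp: norm_mult)
      from tendsto_mult[OF tendsto_const geometric_deriv_sums[OF this, unfolded sums_def]]
      show "(\<lambda>N. u \<zeta> * s N \<zeta>) \<longlonglongrightarrow> u \<zeta> / (1 - cnj \<zeta> * z)\<^sup>2" by (simp add: s_def)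
    qed
    show "AE \<zeta> in dA. norm (u \<zeta> * s N \<zeta>) \<le> norm (u \<zeta>) * (1 / (1 - cmod z)\<^sup>2)" for N
      unfolding norm_mult using bd by (intro AE_I2 mult_left_mono) auto
  qed (use int in \<open>auto simp: s_def\<close>)
  moreover have "?F N = (\<Sum>n<N. of_nat (Suc n) * moment u n * z ^ n)" for N
  proof -
    have "?F N = (\<integral>\<zeta>. (\<Sum>n<N. (of_nat (Suc n) * z ^ n) * (u \<zeta> * cnj \<zeta> ^ n)) \<partial>dA)"
      by (rule Bochner_Integration.integral_cong) (auto simp: s_def sum_distrib_left power_mult_distrib algebra_simps)
    also have "\<dots> = (\<Sum>n<N. (\<integral>\<zeta>. (of_nat (Suc n) * z ^ n) * (u \<zeta> * cnj \<zeta> ^ n) \<partial>dA))"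
      by (rule Bochner_Integration.integral_sum) (intro integrable_mult_right integrable_mult_cnj_power int)
    also have "\<dots> = (\<Sum>n<N. of_nat (Suc n) * moment u n * z ^ n)"
      by (simp only: integral_mult_right_zero) (simp add: moment_def mult_ac)
    finally show ?thesis .
  qed
  ultimately show ?thesis by (simp add: sums_def bergman_proj_def)
qed

lemma holomorphic_series:
  assumes "h holomorphic_on disc"
  obtains c where "\<And>z. z \<in> disc \<Longrightarrow> (\<lambda>n. c n * z ^ n) sums h z"
proof (rule that)
  show "(\<lambda>n. (deriv ^^ n) h 0 / fact n * z ^ n) sums h z" if "z \<in> disc" for z
    using holomorphic_power_series[of h 0 1 z] assms that by (simp add: disc_def)
qed

text \<open>Coefficient n of the projection is n + 1 times a moment, and the moment of an analytic
  function is its Taylor coefficient divided by n + 1. Integrability in place of square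
  integrability lets the lemma apply to products of two functions in A2.\<close>

lemma bergman_proj_reproducing:
  assumes "h holomorphic_on disc" "integrable dA h" "cmod z < 1"
  shows "bergman_proj h z = h z"
proof -
  obtain c where c: "\<And>z. z \<in> disc \<Longrightarrow> (\<lambda>n. c n * z ^ n) sums h z"
    by (rule holomorphic_series[OF assms(1)]) blast
  have "of_nat (Suc n) * moment h n = c n" for n
  proof -
    have "(1 :: complex) + of_nat n \<noteq> 0" by (simp flip: of_nat_Suc)
    then show ?thesis using moment_series[OF assms(2) c, of n] by (simp add: add.commute)
  qed
  then have "(\<lambda>n. c n * z ^ n) sums bergman_proj h z"
    using bergman_proj_sums[OF assms(2,3)] by simp
  then show ?thesis using c[of z] assms(3) sums_unique2 by auto
qed

lemma bergman_proj_holomorphic: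
  assumes "integrable dA u"
  shows "bergman_proj u holomorphic_on disc"
  unfolding disc_def
  by (rule power_series_holomorphic[where a = "\<lambda>n. of_nat (Suc n) * moment u n"])
     (use bergman_proj_sums[OF assms] in auto)

section \<open>Taylor polynomials and Bessel's inequality\<close>

definition taylor_poly :: "(nat \<Rightarrow> complex) \<Rightarrow> nat \<Rightarrow> complex \<Rightarrow> complex" where
  "taylor_poly c N z = (\<Sum>n<N. c n * z ^ n)"

lemma taylor_poly_holomorphic: "taylor_poly c N holomorphic_on S"
  unfolding taylor_poly_def by (intro holomorphic_intros)

lemma taylor_poly_bound: "cmod z < 1 \<Longrightarrow> cmod (taylor_poly c N z) \<le> (\<Sum>n<N. cmod (c n))"
  unfolding taylor_poly_def
  by (rule order.trans[OF norm_sum sum_mono])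
     (auto simp: norm_mult norm_power intro!: mult_left_le power_le_one)

lemma taylor_poly_L2: "taylor_poly c N \<in> L2"
  by (rule L2_bounded[where K = "\<Sum>n<N. cmod (c n)"])
     (auto intro: holomorphic_measurable_dA taylor_poly_holomorphic taylor_poly_bound)

lemma taylor_poly_in_polys: "taylor_poly c N \<in> polys"
proof -
  have "taylor_poly c N = poly (\<Sum>n<N. monom (c n) n)"
    by (simp add: fun_eq_iff taylor_poly_def poly_sum poly_monom)
  then show ?thesis unfolding polys_def by blast
qed

lemma taylor_poly_sums: "(\<lambda>n. (if n < N then c n else 0) * z ^ n) sums taylor_poly c N z"
proof -
  have "(\<lambda>n. if n \<in> {..<N} then c n * z ^ n else 0) sums taylor_poly c N z"
    unfolding taylor_poly_def by (rule sums_If_finite_set) simp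
  moreover have "(\<lambda>n. if n \<in> {..<N} then c n * z ^ n else 0) = (\<lambda>n. (if n < N then c n else 0) * z ^ n)"
    by auto
  ultimately show ?thesis by simp
qed

lemma integral_mult_cnj_taylor_poly:
  assumes "integrable dA u"
  shows "(\<integral>z. u z * cnj (taylor_poly c N z) \<partial>dA) = (\<Sum>n<N. cnj (c n) * moment u n)"
proof -
  have "(\<integral>z. u z * cnj (taylor_poly c N z) \<partial>dA) = (\<integral>z. (\<Sum>n<N. cnj (c n) * (u z * cnj z ^ n)) \<partial>dA)"
    by (rule Bochner_Integration.integral_cong) (auto simp: taylor_poly_def sum_distrib_left mult_ac)
  also have "\<dots> = (\<Sum>n<N. (\<integral>z. cnj (c n) * (u z * cnj z ^ n) \<partial>dA))"
    by (rule Bochner_Integration.integral_sum) (intro integrable_mult_right integrable_mult_cnj_power assms)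
  finally show ?thesis by (simp only: integral_mult_right_zero moment_def)
qed

lemma moment_taylor_poly: "moment (taylor_poly c N) n = (if n < N then c n / (of_nat n + 1) else 0)"
  by (subst moment_series[OF L2_integrable[OF taylor_poly_L2] taylor_poly_sums]) auto

lemma norm2sq_taylor_poly: "norm2sq (taylor_poly c N) = (\<Sum>n<N. (cmod (c n))\<^sup>2 / (n + 1))"
proof -
  have "complex_of_real (norm2sq (taylor_poly c N)) = (\<integral>z. taylor_poly c N z * cnj (taylor_poly c N z) \<partial>dA)"
    unfolding integral_complex_of_real[symmetric]
    by (rule Bochner_Integration.integral_cong) (simp_all only: complex_norm_square)
  also have "\<dots> = (\<Sum>n<N. cnj (c n) * (c n / (of_nat n + 1)))"
    by (subst integral_mult_cnj_taylor_poly[OF L2_integrable[OF taylor_poly_L2]]) (simp add: moment_taylor_poly)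
  also have "\<dots> = (\<Sum>n<N. complex_of_real ((cmod (c n))\<^sup>2 / (n + 1)))"
    by (intro sum.cong) (auto simp: complex_norm_square mult.commute simp flip: of_real_power)
  also have "\<dots> = complex_of_real (\<Sum>n<N. (cmod (c n))\<^sup>2 / (n + 1))" by simp
  finally show ?thesis by (simp only: of_real_eq_iff)
qed

text \<open>The comparison polynomial p is the Taylor polynomial of the projection of u. Its
  coefficients are such that the inner product of u and p equals the squared norm of p, and the
  squared norm of u - p is nonnegative.\<close>

lemma bessel:
  assumes u: "u \<in> L2"
  shows "(\<Sum>n<N. real (Suc n) * (cmod (moment u n))\<^sup>2) \<le> norm2sq u"
proof -
  define c where "c n = of_nat (Suc n) * moment u n" for n
  have N: "norm2sq (taylor_poly c N) = (\<Sum>n<N. real (Suc n) * (cmod (moment u n))\<^sup>2)"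
    unfolding norm2sq_taylor_poly c_def norm_mult norm_of_nat
    by (intro sum.cong) (auto simp: power_mult_distrib power2_eq_square simp del: of_nat_Suc simp flip: of_nat_Suc)
  have I: "(\<integral>z. u z * cnj (taylor_poly c N z) \<partial>dA) = of_real (\<Sum>n<N. real (Suc n) * (cmod (moment u n))\<^sup>2)"
    unfolding integral_mult_cnj_taylor_poly[OF L2_integrable[OF u]] of_real_sum of_real_mult complex_norm_square
    by (intro sum.cong) (auto simp: c_def)
  define p where "p = taylor_poly c N"
  have p: "p \<in> L2" unfolding p_def by (rule taylor_poly_L2)
  have ip: "integrable dA (\<lambda>z. u z * cnj (p z))" by (rule L2_mult(1)[OF u L2_cnj[OF p]])
  have "0 \<le> norm2sq (\<lambda>z. u z - p z)" by simp
  also have "\<dots> = (\<integral>z. (cmod (u z))\<^sup>2 + (cmod (p z))\<^sup>2 - 2 * Re (u z * cnj (p z)) \<partial>dA)"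
    by (intro Bochner_Integration.integral_cong)
       (auto simp: cmod_power2, auto simp: power2_eq_square algebra_simps)
  also have "\<dots> = norm2sq u + norm2sq p - (\<integral>z. 2 * Re (u z * cnj (p z)) \<partial>dA)"
    unfolding
      Bochner_Integration.integral_diff[OF Bochner_Integration.integrable_add[OF L2_integrable_sq[OF u]
          L2_integrable_sq[OF p]] integrable_mult_right[OF integrable_Re[OF ip]]]
      Bochner_Integration.integral_add[OF L2_integrable_sq[OF u] L2_integrable_sq[OF p]] ..
  also have "(\<integral>z. 2 * Re (u z * cnj (p z)) \<partial>dA) = 2 * Re (\<integral>z. u z * cnj (p z) \<partial>dA)"
    unfolding integral_mult_right_zero integral_Re[OF ip] ..
  also have "norm2sq u + norm2sq p - 2 * Re (\<integral>z. u z * cnj (p z) \<partial>dA) = norm2sq u - (\<Sum>n<N. real (Suc n) * (cmod (moment u n))\<^sup>2)"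
    unfolding p_def I N by simp
  finally show ?thesis by simp
qed

text \<open>Fatou's lemma along the Taylor polynomials. Square integrability of h is thereby a
  consequence and not a premise, as the projection requires.\<close>

lemma sqnorm_series_le:
  assumes sums: "\<And>z. z \<in> disc \<Longrightarrow> (\<lambda>n. c n * z ^ n) sums h z"
    and K: "\<And>N. (\<Sum>n<N. (cmod (c n))\<^sup>2 / (n + 1)) \<le> K"
  shows "sqnorm h \<le> ennreal K"
proof -
  have "sqnorm h \<le> (\<integral>\<^sup>+ z. liminf (\<lambda>N. ennreal ((cmod (taylor_poly c N z))\<^sup>2)) \<partial>dA)"
    unfolding sqnorm_def
  proof (rule nn_integral_mono)
    fix z assume "z \<in> space dA"
    then have "(\<lambda>N. taylor_poly c N z) \<longlonglongrightarrow> h z"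
      using sums[of z] by (simp add: sums_def taylor_poly_def)
    then have "(\<lambda>N. ennreal ((cmod (taylor_poly c N z))\<^sup>2)) \<longlonglongrightarrow> ennreal ((cmod (h z))\<^sup>2)"
      by (intro tendsto_ennrealI tendsto_intros)
    from lim_imp_Liminf[OF _ this]
    show "ennreal ((cmod (h z))\<^sup>2) \<le> liminf (\<lambda>N. ennreal ((cmod (taylor_poly c N z))\<^sup>2))"
      by (simp del: ennreal_power)
  qed
  also have "\<dots> \<le> liminf (\<lambda>N. \<integral>\<^sup>+ z. ennreal ((cmod (taylor_poly c N z))\<^sup>2) \<partial>dA)"
    using L2_measurable[OF taylor_poly_L2[of c]] by (intro nn_integral_liminf) simp
  also have "\<dots> \<le> ennreal K"
  proof (rule Liminf_le)
    have "(\<integral>\<^sup>+ z. ennreal ((cmod (taylor_poly c N z))\<^sup>2) \<partial>dA) = ennreal (norm2sq (taylor_poly c N))" for N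
      using sqnorm_eq[OF taylor_poly_L2] by (simp add: sqnorm_def)
    then show "\<forall>\<^sub>F N in sequentially. (\<integral>\<^sup>+ z. ennreal ((cmod (taylor_poly c N z))\<^sup>2) \<partial>dA) \<le> ennreal K"
      using K by (simp add: norm2sq_taylor_poly ennreal_leI)
  qed simp
  finally show ?thesis .
qed

lemma bergman_proj_A2:
  assumes u: "u \<in> L2"
  shows "bergman_proj u \<in> A2"
proof (rule A2_I)
  show h: "bergman_proj u holomorphic_on disc"
    by (rule bergman_proj_holomorphic[OF L2_integrable[OF u]])
  have "sqnorm (bergman_proj u) \<le> ennreal (norm2sq u)"
  proof (rule sqnorm_series_le)
    show "(\<lambda>n. (of_nat (Suc n) * moment u n) * z ^ n) sums bergman_proj u z" if "z \<in> disc" for z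
      using bergman_proj_sums[OF L2_integrable[OF u]] that by simp
    fix N
    have "(\<Sum>n<N. (cmod (of_nat (Suc n) * moment u n))\<^sup>2 / real (n + 1)) = (\<Sum>n<N. real (Suc n) * (cmod (moment u n))\<^sup>2)"
      unfolding norm_mult norm_of_nat
      by (intro sum.cong) (auto simp: power_mult_distrib power2_eq_square simp del: of_nat_Suc simp flip: of_nat_Suc)
    also have "\<dots> \<le> norm2sq u" by (rule bessel[OF u])
    finally show "(\<Sum>n<N. (cmod (of_nat (Suc n) * moment u n))\<^sup>2 / real (n + 1)) \<le> norm2sq u" .
  qed
  then show "bergman_proj u \<in> L2"
    by (rule L2_I(1)[OF holomorphic_measurable_dA[OF h]])
qed

text \<open>The remainder is again a power series, with its first N coefficients removed, so its
  squared norm is at most a tail of a series that converges by Bessel's inequality.\<close>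

lemma taylor_poly_approx:
  assumes h: "h \<in> A2"
    and sums: "\<And>z. z \<in> disc \<Longrightarrow> (\<lambda>n. c n * z ^ n) sums h z"
  shows "(\<lambda>N. norm2sq (\<lambda>z. h z - taylor_poly c N z)) \<longlonglongrightarrow> 0"
proof -
  have hL: "h \<in> L2" using h by (rule A2_D(2))
  define a where "a n = (cmod (c n))\<^sup>2 / real (n + 1)" for n
  have cfc: "cmod (moment h n) = cmod (c n) / real (Suc n)" for n
  proof -
    have "moment h n = c n / (of_nat n + 1)"
      by (rule moment_series[OF L2_integrable[OF hL]]) (rule sums)
    then show ?thesis
      using norm_of_nat[of "Suc n", where 'a = complex] by (simp add: norm_divide add.commute)
  qed
  have "(\<Sum>n<N. a n) \<le> norm2sq h" for N
  proof -
    have "real (Suc n) * (cmod (c n) / real (Suc n))\<^sup>2 = a n" for n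
      unfolding a_def power_divide by (simp add: power2_eq_square del: of_nat_Suc)
    then show ?thesis using bessel[OF hL, of N] unfolding cfc by simp
  qed
  then have sa: "summable a"
    by (intro summableI_nonneg_bounded[where x = "norm2sq h"]) (auto simp: a_def)
  have a0: "0 \<le> a n" for n by (simp add: a_def)
  define t where "t N = (\<Sum>n. a (n + N))" for N
  have le: "norm2sq (\<lambda>z. h z - taylor_poly c N z) \<le> t N" for N
  proof (rule L2_I(2))
    let ?d = "\<lambda>z. h z - taylor_poly c N z"
    show "?d \<in> borel_measurable dA"
      by (intro borel_measurable_diff L2_measurable hL taylor_poly_L2)
    show t0: "0 \<le> t N" unfolding t_def
      using a0 sa by (intro suminf_nonneg) (auto simp: summable_iff_shift)
    show "sqnorm ?d \<le> ennreal (t N)"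
    proof (rule sqnorm_series_le)
      show "(\<lambda>n. (if n < N then 0 else c n) * z ^ n) sums ?d z" if "z \<in> disc" for z
        by (rule sums_cong[THEN iffD1, OF _ sums_diff[OF sums[OF that] taylor_poly_sums]]) auto
      fix M
      have "(\<Sum>n<M. (cmod (if n < N then 0 else c n))\<^sup>2 / real (n + 1)) = (\<Sum>n<M. if n < N then 0 else a n)"
        by (intro sum.cong) (auto simp: a_def)
      also have "\<dots> \<le> (\<Sum>n<M + N. if n < N then 0 else a n)"
        by (rule sum_mono2) (auto simp: a_def)
      also have "\<dots> = (\<Sum>n\<in>{N..<M + N}. a n)"
        by (rule sum.mono_neutral_cong_right) auto
      also have "\<dots> = (\<Sum>n<M. a (n + N))"
        by (rule sum.reindex_bij_witness[of _ "\<lambda>n. n + N" "\<lambda>n. n - N"]) auto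
      also have "\<dots> \<le> t N" unfolding t_def
        using a0 sa by (intro sum_le_suminf) (auto simp: summable_iff_shift)
      finally show "(\<Sum>n<M. (cmod (if n < N then 0 else c n))\<^sup>2 / real (n + 1)) \<le> t N" .
    qed
  qed
  have t: "t \<longlonglongrightarrow> 0" unfolding t_def by (rule suminf_exist_split2[OF sa])
  show ?thesis
    by (rule tendsto_sandwich[OF _ _ tendsto_const t]) (use le in auto)
qed

lemma tendsto_integral_taylor_poly:
  assumes u: "u \<in> L2" and h: "h \<in> A2"
    and sums: "\<And>z. z \<in> disc \<Longrightarrow> (\<lambda>n. c n * z ^ n) sums h z"
  shows "(\<lambda>N. \<integral>z. u z * cnj (taylor_poly c N z) \<partial>dA) \<longlonglongrightarrow> (\<integral>z. u z * cnj (h z) \<partial>dA)"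
proof -
  have hL: "h \<in> L2" using h by (rule A2_D(2))
  have d: "(\<lambda>z. h z - taylor_poly c N z) \<in> L2" for N by (rule L2_diff[OF hL taylor_poly_L2])
  have "(\<lambda>N. (\<integral>z. u z * cnj (h z) \<partial>dA) - (\<integral>z. u z * cnj (taylor_poly c N z) \<partial>dA)) \<longlonglongrightarrow> 0"
  proof (rule Lim_null_comparison[OF always_eventually])
    show "\<forall>N. norm ((\<integral>z. u z * cnj (h z) \<partial>dA) - (\<integral>z. u z * cnj (taylor_poly c N z) \<partial>dA)) \<le> sqrt (norm2sq u * norm2sq (\<lambda>z. h z - taylor_poly c N z))"
    proof
      fix N
      have "(\<integral>z. u z * cnj (h z) \<partial>dA) - (\<integral>z. u z * cnj (taylor_poly c N z) \<partial>dA) = (\<integral>z. u z * cnj (h z - taylor_poly c N z) \<partial>dA)"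
        by (subst Bochner_Integration.integral_diff[symmetric])
           (auto intro!: L2_mult(1) L2_cnj u hL taylor_poly_L2 simp: algebra_simps)
      then show "norm ((\<integral>z. u z * cnj (h z) \<partial>dA) - (\<integral>z. u z * cnj (taylor_poly c N z) \<partial>dA)) \<le> sqrt (norm2sq u * norm2sq (\<lambda>z. h z - taylor_poly c N z))"
        using L2_mult(2)[OF u L2_cnj[OF d]] unfolding complex_mod_cnj by (auto intro!: real_le_rsqrt)
    qed
    have "(\<lambda>N. sqrt (norm2sq u * norm2sq (\<lambda>z. h z - taylor_poly c N z))) \<longlonglongrightarrow> sqrt (norm2sq u * 0)"
      by (intro tendsto_intros taylor_poly_approx[OF h sums])
    then show "(\<lambda>N. sqrt (norm2sq u * norm2sq (\<lambda>z. h z - taylor_poly c N z))) \<longlonglongrightarrow> 0" by simp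
  qed
  from tendsto_diff[OF tendsto_const[of "\<integral>z. u z * cnj (h z) \<partial>dA"] this] show ?thesis by simp
qed

lemma A2_series:
  assumes "h \<in> A2" "z \<in> disc"
  shows "(\<lambda>n. (of_nat (Suc n) * moment h n) * z ^ n) sums h z"
  using bergman_proj_sums[OF L2_integrable[OF A2_D(2)[OF assms(1)]], of z]
    bergman_proj_reproducing[OF A2_D(1)[OF assms(1)] L2_integrable[OF A2_D(2)[OF assms(1)]], of z] assms(2)
  by simp

lemma moment_bergman_proj:
  assumes "u \<in> L2"
  shows "moment (bergman_proj u) n = moment u n"
proof -
  have "moment (bergman_proj u) n = (of_nat (Suc n) * moment u n) / (of_nat n + 1)"
    by (rule moment_series) (use bergman_proj_sums[OF L2_integrable[OF assms]]
        L2_integrable[OF A2_D(2)[OF bergman_proj_A2[OF assms]]] in auto)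
  moreover have "(1 :: complex) + of_nat n \<noteq> 0" by (simp flip: of_nat_Suc)
  ultimately show ?thesis by (simp add: add.commute)
qed

text \<open>A function and its projection have the same moments, hence the same pairing with every
  polynomial; the Taylor polynomials of h converge to h in norm.\<close>

lemma bergman_proj_adjoint:
  assumes u: "u \<in> L2" and h: "h \<in> A2"
  shows "(\<integral>z. bergman_proj u z * cnj (h z) \<partial>dA) = (\<integral>z. u z * cnj (h z) \<partial>dA)"
proof -
  note P = A2_D(2)[OF bergman_proj_A2[OF u]]
  let ?c = "\<lambda>n. of_nat (Suc n) * moment h n"
  have "(\<integral>z. bergman_proj u z * cnj (taylor_poly ?c N z) \<partial>dA) = (\<integral>z. u z * cnj (taylor_poly ?c N z) \<partial>dA)" for N
    by (simp add: integral_mult_cnj_taylor_poly L2_integrable u P moment_bergman_proj)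
  then show ?thesis
    using tendsto_integral_taylor_poly[OF P h A2_series[OF h]] tendsto_integral_taylor_poly[OF u h A2_series[OF h]]
    by (simp add: LIMSEQ_unique)
qed

section \<open>Toeplitz products\<close>

lemma sqnorm_cong: "(\<And>z. z \<in> disc \<Longrightarrow> cmod (u z) = cmod (v z)) \<Longrightarrow> sqnorm u = sqnorm v"
  unfolding sqnorm_def by (intro nn_integral_cong) simp

lemma polys_holomorphic: "p \<in> polys \<Longrightarrow> p holomorphic_on S"
  by (auto simp: polys_def intro!: holomorphic_intros)

lemma polys_bounded:
  assumes "p \<in> polys"
  obtains K where "\<And>z. z \<in> disc \<Longrightarrow> cmod (p z) \<le> K"
proof -
  have "bounded (p ` cball 0 1)"
    by (intro compact_imp_bounded compact_continuous_image compact_cball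
        holomorphic_on_imp_continuous_on polys_holomorphic assms)
  then show ?thesis using that by (force simp: bounded_iff)
qed

lemma L2_mult_poly:
  assumes "u \<in> L2" "p \<in> polys"
  shows "(\<lambda>z. u z * p z) \<in> L2"
proof -
  obtain K where K: "\<And>z. z \<in> disc \<Longrightarrow> cmod (p z) \<le> K" by (rule polys_bounded[OF assms(2)]) blast
  show ?thesis
  proof (rule L2_bound(1)[where K = K and u = u])
    show "(\<lambda>z. u z * p z) \<in> borel_measurable dA"
      by (intro borel_measurable_times L2_measurable assms(1) holomorphic_measurable_dA polys_holomorphic assms(2))
    show "cmod (u z * p z) \<le> K * cmod (u z)" if "z \<in> disc" for z
      using mult_right_mono[OF K[OF that], of "cmod (u z)"] by (simp add: norm_mult mult.commute)
  qed fact
qed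

lemma polys_A2: "p \<in> polys \<Longrightarrow> p \<in> A2"
  using L2_mult_poly[OF L2_const[of 1]] by (intro A2_I polys_holomorphic) auto

lemma toeplitz_eq_mult:
  assumes "f holomorphic_on disc" "u holomorphic_on disc" "integrable dA (\<lambda>z. f z * u z)" "z \<in> disc"
  shows "toeplitz f u z = f z * u z"
  unfolding toeplitz_def
  by (rule bergman_proj_reproducing) (use assms in \<open>auto intro!: holomorphic_intros\<close>)

text \<open>Monomials belong to the domain of the Toeplitz operator. Pairing the adjoint relation
  with them fixes every moment of w, and the moments determine an element of A2.\<close>

lemma toeplitz_adjoint_unique:
  assumes g: "g \<in> A2" and p: "p \<in> polys" and adj: "is_toeplitz_adj g p w" and z: "z \<in> disc"
  shows "w z = bergman_proj (\<lambda>\<zeta>. cnj (g \<zeta>) * p \<zeta>) z"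
proof -
  have w: "w \<in> A2" using adj by (simp add: is_toeplitz_adj_def)
  have gp: "(\<lambda>\<zeta>. cnj (g \<zeta>) * p \<zeta>) \<in> L2" by (rule L2_mult_poly[OF L2_cnj[OF A2_D(2)[OF g]] p])
  have "moment w n = moment (\<lambda>\<zeta>. cnj (g \<zeta>) * p \<zeta>) n" for n
  proof -
    define e where "e = (\<lambda>z :: complex. z ^ n)"
    have "e = poly (monom 1 n)" by (auto simp: e_def poly_monom)
    then have e: "e \<in> polys" unfolding polys_def by blast
    have ge: "(\<lambda>z. g z * e z) \<in> L2" by (rule L2_mult_poly[OF A2_D(2)[OF g] e])
    have dom: "e \<in> toeplitz_dom g" using ge polys_A2[OF e] by (simp add: toeplitz_dom_def)
    have "(\<integral>z. g z * e z * cnj (p z) \<partial>dA) = l2_inner (toeplitz g e) p"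
      unfolding l2_inner_def
      by (intro Bochner_Integration.integral_cong)
         (auto simp: toeplitz_eq_mult[OF A2_D(1)[OF g] polys_holomorphic[OF e] L2_integrable[OF ge]])
    also have "\<dots> = (\<integral>z. e z * cnj (w z) \<partial>dA)"
      using adj dom by (simp add: is_toeplitz_adj_def l2_inner_def)
    finally have "cnj (\<integral>z. g z * e z * cnj (p z) \<partial>dA) = cnj (\<integral>z. e z * cnj (w z) \<partial>dA)" by simp
    then show ?thesis
      unfolding moment_def Bochner_Integration.integral_cnj[symmetric] e_def
      by (simp add: mult_ac)
  qed
  then show ?thesis
    using A2_series[OF w z] bergman_proj_sums[OF L2_integrable[OF gp], of z] z by (simp add: sums_unique2)
qed

text \<open>On the domain of the operator, \<open>toeplitz g u\<close> is the product g u, which is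
  analytic. The relation then says that the projection may be dropped when pairing with the analytic
  function u.\<close>

lemma toeplitz_adjoint_exists:
  assumes g: "g \<in> A2" and p: "p \<in> polys"
  shows "is_toeplitz_adj g p (bergman_proj (\<lambda>\<zeta>. cnj (g \<zeta>) * p \<zeta>))"
proof -
  have gp: "(\<lambda>\<zeta>. cnj (g \<zeta>) * p \<zeta>) \<in> L2" by (rule L2_mult_poly[OF L2_cnj[OF A2_D(2)[OF g]] p])
  let ?w = "bergman_proj (\<lambda>\<zeta>. cnj (g \<zeta>) * p \<zeta>)"
  have "l2_inner (toeplitz g u) p = l2_inner u ?w" if u: "u \<in> toeplitz_dom g" for u
  proof -
    have uA: "u \<in> A2" and gu: "(\<lambda>z. g z * u z) \<in> L2" using u by (auto simp: toeplitz_dom_def)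
    have "l2_inner (toeplitz g u) p = (\<integral>z. g z * u z * cnj (p z) \<partial>dA)"
      unfolding l2_inner_def
      by (intro Bochner_Integration.integral_cong)
         (auto simp: toeplitz_eq_mult[OF A2_D(1)[OF g] A2_D(1)[OF uA] L2_integrable[OF gu]])
    also have "\<dots> = cnj (\<integral>z. (cnj (g z) * p z) * cnj (u z) \<partial>dA)"
      unfolding Bochner_Integration.integral_cnj[symmetric] by (simp add: mult_ac)
    also have "\<dots> = cnj (\<integral>z. ?w z * cnj (u z) \<partial>dA)"
      by (subst bergman_proj_adjoint[OF gp uA]) simp
    also have "\<dots> = l2_inner u ?w"
      unfolding Bochner_Integration.integral_cnj[symmetric] l2_inner_def by (simp add: mult_ac)
    finally show ?thesis .
  qed
  then show ?thesis
    using polys_A2[OF p] bergman_proj_A2[OF gp] by (simp add: is_toeplitz_adj_def)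
qed

section \<open>From polynomials to L2\<close>

lemma kernel_holomorphic:
  assumes "cmod z < 1"
  shows "(\<lambda>\<zeta>. 1 / (1 - cnj z * \<zeta>)\<^sup>2) holomorphic_on disc"
  using kernel_bound(4)[OF _ assms] by (intro holomorphic_intros) auto

lemma L2_mult_kernel:
  assumes "g \<in> L2" "cmod z < 1"
  shows "(\<lambda>\<zeta>. g \<zeta> / (1 - cnj z * \<zeta>)\<^sup>2) \<in> L2"
proof (rule L2_bound(1)[where K = "1 / (1 - cmod z)\<^sup>2" and u = g])
  have "(\<lambda>\<zeta>. g \<zeta> * (1 / (1 - cnj z * \<zeta>)\<^sup>2)) \<in> borel_measurable dA"
    by (intro borel_measurable_times L2_measurable assms holomorphic_measurable_dA kernel_holomorphic)
  then show "(\<lambda>\<zeta>. g \<zeta> / (1 - cnj z * \<zeta>)\<^sup>2) \<in> borel_measurable dA" by simp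
  fix \<zeta> assume "\<zeta> \<in> disc"
  then have "1 / (cmod (1 - cnj z * \<zeta>))\<^sup>2 \<le> 1 / (1 - cmod z)\<^sup>2"
    using kernel_bound(2)[of \<zeta> z] assms by (intro divide_left_mono power_mono mult_pos_pos) auto
  from mult_right_mono[OF this, of "cmod (g \<zeta>)"]
  show "cmod (g \<zeta> / (1 - cnj z * \<zeta>)\<^sup>2) \<le> 1 / (1 - cmod z)\<^sup>2 * cmod (g \<zeta>)"
    by (simp add: norm_divide norm_power)
qed fact

lemma A2_mult_kernel:
  assumes "g \<in> A2" "cmod z < 1"
  shows "(\<lambda>\<zeta>. g \<zeta> / (1 - cnj z * \<zeta>)\<^sup>2) \<in> A2"
proof (rule A2_I)
  have "(\<lambda>\<zeta>. g \<zeta> * (1 / (1 - cnj z * \<zeta>)\<^sup>2)) holomorphic_on disc"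
    by (intro holomorphic_on_mult A2_D(1) kernel_holomorphic assms)
  then show "(\<lambda>\<zeta>. g \<zeta> / (1 - cnj z * \<zeta>)\<^sup>2) holomorphic_on disc" by simp
qed (rule L2_mult_kernel[OF A2_D(2)[OF assms(1)] assms(2)])

lemma bergman_proj_cnj_mult:
  "bergman_proj (\<lambda>\<zeta>. cnj (g \<zeta>) * v \<zeta>) z = (\<integral>\<zeta>. v \<zeta> * cnj (g \<zeta> / (1 - cnj z * \<zeta>)\<^sup>2) \<partial>dA)"
  unfolding bergman_proj_def by (intro Bochner_Integration.integral_cong) (auto simp: mult_ac)

text \<open>The function \<open>g k\<^sub>z\<close> is analytic, so only the analytic part of \<open>u\<close> contributes to
  \<open>P(cnj g u)(z)\<close>; its Taylor polynomials approximate.\<close>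

lemma bergman_proj_cnj_mult_tendsto:
  assumes g: "g \<in> A2" and u: "u \<in> L2" and z: "z \<in> disc"
  shows "(\<lambda>N. bergman_proj (\<lambda>\<zeta>. cnj (g \<zeta>) * taylor_poly (\<lambda>n. of_nat (Suc n) * moment u n) N \<zeta>) z)
    \<longlonglongrightarrow> bergman_proj (\<lambda>\<zeta>. cnj (g \<zeta>) * u \<zeta>) z"
proof -
  define G where "G \<zeta> = g \<zeta> / (1 - cnj z * \<zeta>)\<^sup>2" for \<zeta>
  have G: "G \<in> A2" unfolding G_def by (rule A2_mult_kernel[OF g]) (use z in simp)
  note GL = L2_integrable[OF A2_D(2)[OF G]]
  let ?cu = "\<lambda>n. of_nat (Suc n) * moment u n" and ?cG = "\<lambda>n. of_nat (Suc n) * moment G n"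
  have "(\<integral>\<zeta>. taylor_poly ?cu N \<zeta> * cnj (G \<zeta>) \<partial>dA) = (\<integral>\<zeta>. u \<zeta> * cnj (taylor_poly ?cG N \<zeta>) \<partial>dA)" for N
  proof -
    have "(\<integral>\<zeta>. taylor_poly ?cu N \<zeta> * cnj (G \<zeta>) \<partial>dA) = cnj (\<integral>\<zeta>. G \<zeta> * cnj (taylor_poly ?cu N \<zeta>) \<partial>dA)"
      unfolding Bochner_Integration.integral_cnj[symmetric] by (simp add: mult_ac)
    then show ?thesis
      unfolding integral_mult_cnj_taylor_poly[OF GL] integral_mult_cnj_taylor_poly[OF L2_integrable[OF u]]
      by (simp add: mult_ac)
  qed
  then show ?thesis
    using tendsto_integral_taylor_poly[OF u G A2_series[OF G]]
    unfolding bergman_proj_cnj_mult G_def[symmetric] by simp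
qed

text \<open>On polynomials the Toeplitz product is p -> f P(cnj g p), because f times an element of
  A2 is analytic and integrable. Factors g / |g| of modulus at most 1 exchange cnj g with |g|, and
  only the modulus of f affects norms, so both statements hold with the same C. Polynomials are
  replaced by L2 functions through Fatou's lemma.\<close>

lemma toeplitz_bounded_iff:
  assumes f: "f \<in> A2" and g: "g \<in> A2"
  shows "(\<exists>C::real. \<forall>p \<in> polys. \<exists>w. is_toeplitz_adj g p w \<and>
        sqnorm (toeplitz f w) \<le> ennreal (C\<^sup>2) * sqnorm p)
   \<longleftrightarrow> (\<exists>C::real. \<forall>u \<in> L2.
        sqnorm (\<lambda>z. cabs f z * bergman_proj (\<lambda>\<zeta>. cabs g \<zeta> * u \<zeta>) z)
          \<le> ennreal (C\<^sup>2) * sqnorm u)"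
    (is "(\<exists>C. ?L C) \<longleftrightarrow> (\<exists>C. ?R C)")
proof (rule ex_cong1)
  fix C :: real
  have gm: "g \<in> borel_measurable dA" by (rule L2_measurable[OF A2_D(2)[OF g]])
  have fm: "f \<in> borel_measurable dA" by (rule L2_measurable[OF A2_D(2)[OF f]])
  have ph1: "(\<lambda>\<zeta>. g \<zeta> / cabs g \<zeta>) \<in> borel_measurable dA"
    unfolding cabs_def using gm by measurable
  have toep: "sqnorm (toeplitz f w) = sqnorm (\<lambda>z. f z * w z)" if "w \<in> A2" for w
    by (rule sqnorm_cong)
       (auto simp: toeplitz_eq_mult[OF A2_D(1)[OF f] A2_D(1)[OF that] L2_mult(1)[OF A2_D(2)[OF f] A2_D(2)[OF that]]])
  show "?L C \<longleftrightarrow> ?R C"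
  proof
    assume L: "?L C"
    have poly_bd: "sqnorm (\<lambda>z. f z * bergman_proj (\<lambda>\<zeta>. cnj (g \<zeta>) * p \<zeta>) z) \<le> ennreal (C\<^sup>2) * sqnorm p"
      if p: "p \<in> polys" for p
    proof -
      obtain w where w: "is_toeplitz_adj g p w" "sqnorm (toeplitz f w) \<le> ennreal (C\<^sup>2) * sqnorm p"
        using L p by blast
      have "w \<in> A2" using w(1) by (simp add: is_toeplitz_adj_def)
      then have "sqnorm (toeplitz f w) = sqnorm (\<lambda>z. f z * bergman_proj (\<lambda>\<zeta>. cnj (g \<zeta>) * p \<zeta>) z)"
        unfolding toep[OF \<open>w \<in> A2\<close>]
        by (intro sqnorm_cong) (simp add: toeplitz_adjoint_unique[OF g p w(1)])
      then show ?thesis using w(2) by simp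
    qed
    show "?R C"
    proof
      fix u assume u: "u \<in> L2"
      \<comment> \<open>At zeros of g the quotient is 0, and there
        \<open>cabs g \<zeta> * u \<zeta>\<close> and \<open>cnj (g \<zeta>) * v \<zeta>\<close>
        both vanish, so the two agree everywhere.\<close>
      define v where "v \<zeta> = g \<zeta> / cabs g \<zeta> * u \<zeta>" for \<zeta>
      have vm: "v \<in> borel_measurable dA"
        unfolding v_def[abs_def] by (rule borel_measurable_times[OF ph1 L2_measurable[OF u]])
      have vb: "cmod (v \<zeta>) \<le> 1 * cmod (u \<zeta>)" for \<zeta>
        by (simp add: v_def norm_mult norm_divide cabs_def)
      have v: "v \<in> L2" "norm2sq v \<le> norm2sq u"
        using L2_bound[OF vm u vb] by simp_all
      \<comment> \<open>Taylor polynomials of the projection of v. Bessel's inequality keeps their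
        norms below that of v, hence below that of u.\<close>
      define P where "P N = taylor_poly (\<lambda>n. of_nat (Suc n) * moment v n) N" for N
      have P: "P N \<in> polys" for N unfolding P_def by (rule taylor_poly_in_polys)
      have "norm2sq (P N) = (\<Sum>n<N. real (Suc n) * (cmod (moment v n))\<^sup>2)" for N
        unfolding P_def norm2sq_taylor_poly norm_mult norm_of_nat
        by (intro sum.cong) (auto simp: power_mult_distrib power2_eq_square simp del: of_nat_Suc simp flip: of_nat_Suc)
      then have PN: "sqnorm (P N) \<le> sqnorm u" for N
        using bessel[OF v(1), of N] v(2) u polys_A2[OF P, THEN A2_D(2)] by (simp add: sqnorm_eq ennreal_leI)
      let ?B = "\<lambda>v z. f z * bergman_proj (\<lambda>\<zeta>. cnj (g \<zeta>) * v \<zeta>) z"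
      have "sqnorm (\<lambda>z. cabs f z * bergman_proj (\<lambda>\<zeta>. cabs g \<zeta> * u \<zeta>) z) = sqnorm (?B v)"
      proof (rule sqnorm_cong)
        fix z
        have "cabs g \<zeta> * u \<zeta> = cnj (g \<zeta>) * v \<zeta>" for \<zeta>
          by (simp add: v_def cabs_def complex_norm_square[unfolded power2_eq_square] mult.commute[of "cnj _"] flip: mult.assoc)
             (simp add: complex_norm_square[unfolded power2_eq_square, symmetric])
        then show "cmod (cabs f z * bergman_proj (\<lambda>\<zeta>. cabs g \<zeta> * u \<zeta>) z) = cmod (?B v z)"
          by (simp add: norm_mult cabs_def)
      qed
      also have "\<dots> \<le> (\<integral>\<^sup>+ z. liminf (\<lambda>N. ennreal ((cmod (?B (P N) z))\<^sup>2)) \<partial>dA)"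
        unfolding sqnorm_def
      proof (rule nn_integral_mono)
        fix z assume "z \<in> space dA"
        then have "(\<lambda>N. ?B (P N) z) \<longlonglongrightarrow> ?B v z"
          unfolding P_def by (intro tendsto_intros bergman_proj_cnj_mult_tendsto g v) auto
        then have "(\<lambda>N. ennreal ((cmod (?B (P N) z))\<^sup>2)) \<longlonglongrightarrow> ennreal ((cmod (?B v z))\<^sup>2)"
          by (intro tendsto_ennrealI tendsto_power tendsto_norm)
        from lim_imp_Liminf[OF _ this]
        show "ennreal ((cmod (?B v z))\<^sup>2) \<le> liminf (\<lambda>N. ennreal ((cmod (?B (P N) z))\<^sup>2))"
          by (simp del: ennreal_power)
      qed
      also have "\<dots> \<le> liminf (\<lambda>N. \<integral>\<^sup>+ z. ennreal ((cmod (?B (P N) z))\<^sup>2) \<partial>dA)"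
      proof (rule nn_integral_liminf)
        fix N
        have "(\<lambda>\<zeta>. cnj (g \<zeta>) * P N \<zeta>) \<in> L2" by (rule L2_mult_poly[OF L2_cnj[OF A2_D(2)[OF g]] P])
        then have "bergman_proj (\<lambda>\<zeta>. cnj (g \<zeta>) * P N \<zeta>) \<in> borel_measurable dA"
          by (intro holomorphic_measurable_dA bergman_proj_holomorphic L2_integrable)
        then have "?B (P N) \<in> borel_measurable dA" using fm by (intro borel_measurable_times)
        then show "(\<lambda>z. ennreal ((cmod (?B (P N) z))\<^sup>2)) \<in> borel_measurable dA"
          by measurable
      qed
      also have "\<dots> \<le> ennreal (C\<^sup>2) * sqnorm u"
      proof (rule Liminf_le)
        show "\<forall>\<^sub>F N in sequentially. (\<integral>\<^sup>+ z. ennreal ((cmod (?B (P N) z))\<^sup>2) \<partial>dA) \<le> ennreal (C\<^sup>2) * sqnorm u"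
          using order.trans[OF poly_bd[OF P] mult_left_mono[OF PN]] unfolding sqnorm_def
          by (intro always_eventually) (auto simp del: ennreal_power)
      qed simp
      finally show "sqnorm (\<lambda>z. cabs f z * bergman_proj (\<lambda>\<zeta>. cabs g \<zeta> * u \<zeta>) z) \<le> ennreal (C\<^sup>2) * sqnorm u" .
    qed
  next
    assume R: "?R C"
    show "?L C"
    proof
      fix p assume p: "p \<in> polys"
      have gp: "(\<lambda>\<zeta>. cnj (g \<zeta>) * p \<zeta>) \<in> L2" by (rule L2_mult_poly[OF L2_cnj[OF A2_D(2)[OF g]] p])
      define u where "u \<zeta> = cnj (g \<zeta> / cabs g \<zeta>) * p \<zeta>" for \<zeta>
      have pL: "p \<in> L2" by (rule A2_D(2)[OF polys_A2[OF p]])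
      have "(\<lambda>\<zeta>. cnj (g \<zeta> / cabs g \<zeta>)) \<in> borel_measurable dA"
        using ph1 by measurable
      then have um: "u \<in> borel_measurable dA"
        unfolding u_def[abs_def] by (rule borel_measurable_times[OF _ L2_measurable[OF pL]])
      have ub: "cmod (u \<zeta>) \<le> 1 * cmod (p \<zeta>)" for \<zeta>
        by (simp add: u_def norm_mult norm_divide cabs_def)
      have u: "u \<in> L2" "norm2sq u \<le> norm2sq p"
        using L2_bound[OF um pL ub] by simp_all
      let ?w = "bergman_proj (\<lambda>\<zeta>. cnj (g \<zeta>) * p \<zeta>)"
      have "cabs g \<zeta> * u \<zeta> = cnj (g \<zeta>) * p \<zeta>" for \<zeta>
        by (simp add: u_def cabs_def)
      then have "sqnorm (toeplitz f ?w) = sqnorm (\<lambda>z. cabs f z * bergman_proj (\<lambda>\<zeta>. cabs g \<zeta> * u \<zeta>) z)"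
        unfolding toep[OF bergman_proj_A2[OF gp]]
        by (intro sqnorm_cong) (simp add: norm_mult, simp add: cabs_def)
      also have "\<dots> \<le> ennreal (C\<^sup>2) * sqnorm u" using R u by blast
      also have "\<dots> \<le> ennreal (C\<^sup>2) * sqnorm p"
        using u pL by (intro mult_left_mono) (simp_all add: sqnorm_eq ennreal_leI)
      finally show "\<exists>w. is_toeplitz_adj g p w \<and> sqnorm (toeplitz f w) \<le> ennreal (C\<^sup>2) * sqnorm p"
        using toeplitz_adjoint_exists[OF g p] by blast
    qed
  qed
qed

section \<open>Two-weight testing for laminar families\<close>

text \<open>The weight \<tau> is placed so that a first square bounded by \<tau>^2 times a mass, as
  testing provides, leaves a single factor \<tau> on both terms.\<close>

lemma amgm_weighted:
  fixes x y t \<tau> :: real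
  assumes "0 < \<tau>"
  shows "2 * t * (x * y) \<le> t\<^sup>2 * x\<^sup>2 / \<tau> + \<tau> * y\<^sup>2"
proof -
  have "0 \<le> (t * x - \<tau> * y)\<^sup>2 / \<tau>" using assms by simp
  also have "\<dots> = t\<^sup>2 * x\<^sup>2 / \<tau> + \<tau> * y\<^sup>2 - 2 * t * (x * y)"
    using assms by (simp add: power2_eq_square field_simps)
  finally show ?thesis by simp
qed

text \<open>The variant for an integral b that is not a product but obeys a Cauchy-Schwarz type
  bound b^2 <= w y.\<close>

lemma amgm_weighted':
  fixes b w y t \<tau> :: real
  assumes "0 < \<tau>" "b\<^sup>2 \<le> w * y" "0 \<le> w" "0 \<le> y"
  shows "2 * t * b \<le> t\<^sup>2 * w / \<tau> + \<tau> * y"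
proof -
  have "t * b \<le> \<bar>t\<bar> * sqrt (w * y)"
  proof -
    have "\<bar>b\<bar> \<le> sqrt (w * y)" using real_sqrt_le_mono[OF assms(2)] by simp
    then have "\<bar>t\<bar> * \<bar>b\<bar> \<le> \<bar>t\<bar> * sqrt (w * y)" by (rule mult_left_mono) simp
    moreover have "t * b \<le> \<bar>t\<bar> * \<bar>b\<bar>" unfolding abs_mult[symmetric] by (rule abs_ge_self)
    ultimately show ?thesis by linarith
  qed
  also have "\<dots> = t * (sgn t * sqrt w * sqrt y)" by (simp add: real_sqrt_mult abs_sgn mult_ac)
  finally have "2 * t * b \<le> 2 * t * ((sgn t * sqrt w) * sqrt y)" by simp
  also have "\<dots> \<le> t\<^sup>2 * (sgn t * sqrt w)\<^sup>2 / \<tau> + \<tau> * (sqrt y)\<^sup>2" by (rule amgm_weighted[OF assms(1)])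
  also have "\<dots> \<le> t\<^sup>2 * w / \<tau> + \<tau> * y"
    using assms by (auto simp: power_mult_distrib sgn_if)
  finally show ?thesis .
qed

text \<open>The stopping sets \<open>St k\<close> are the maximal members of the family on which the average of
  \<open>u / g\<close> with respect to \<open>g\<^sup>2\<close> is at least \<open>\<epsilon> 2\<^sup>k\<close>. This half of the sum runs over the members
  on which \<open>u\<close> has the larger normalized energy.\<close>

lemma laminar_half:
  fixes f g u v :: "'a \<Rightarrow> real" and l :: "'a set \<Rightarrow> real"
  assumes fin: "finite D" and sets: "D \<subseteq> sets M"
    and lam: "\<And>A B. A \<in> D \<Longrightarrow> B \<in> D \<Longrightarrow> A \<inter> B = {} \<or> A \<subseteq> B \<or> B \<subseteq> A"
    and l0: "\<And>J. 0 \<le> l J"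
    and nn: "\<And>x. 0 \<le> f x" "\<And>x. 0 \<le> g x" "\<And>x. 0 \<le> u x" "\<And>x. 0 \<le> v x"
    and meas [measurable]: "f \<in> borel_measurable M" "g \<in> borel_measurable M"
      "u \<in> borel_measurable M" "v \<in> borel_measurable M"
    and int: "integrable M (\<lambda>x. (f x)\<^sup>2)" "integrable M (\<lambda>x. (g x)\<^sup>2)"
      "integrable M (\<lambda>x. (u x)\<^sup>2)" "integrable M (\<lambda>x. (v x)\<^sup>2)"
    and \<tau>: "0 < \<tau>"
    and sg: "\<And>J. sg J = (\<integral>x. (g x)\<^sup>2 * indicator J x \<partial>M)"
    and sf: "\<And>J. sf J = (\<integral>x. (f x)\<^sup>2 * indicator J x \<partial>M)"
    and a: "\<And>J. a J = (\<integral>x. g x * u x * indicator J x \<partial>M)"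
    and b: "\<And>J. b J = (\<integral>x. f x * v x * indicator J x \<partial>M)"
    and test: "\<And>S. S \<in> D \<Longrightarrow>
      (\<integral>x. (f x * (\<Sum>J\<in>{J\<in>D. J \<subseteq> S}. l J * sg J * indicator J x))\<^sup>2 \<partial>M) \<le> \<tau>\<^sup>2 * sg S"
    and G: "G \<subseteq> D" "\<And>J. J \<in> G \<Longrightarrow> (b J)\<^sup>2 * sg J \<le> (a J)\<^sup>2 * sf J"
  shows "(\<Sum>J\<in>G. l J * a J * b J) \<le> \<tau> * (24 * (\<integral>x. (u x)\<^sup>2 \<partial>M) + (\<integral>x. (v x)\<^sup>2 \<partial>M))"
proof -
  have igu: "integrable M (\<lambda>x. g x * u x)" and ifv: "integrable M (\<lambda>x. f x * v x)"
    by (auto intro!: Cauchy_Schwarz_integral int)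
  have Dm [measurable]: "J \<in> sets M" if "J \<in> D" for J using sets that by auto
  have nnint: "0 \<le> sg J" "0 \<le> sf J" "0 \<le> a J" "0 \<le> b J" for J
    unfolding sg sf a b by (auto intro!: integral_nonneg_AE mult_nonneg_nonneg nn)
  have ind2: "(indicator J x)\<^sup>2 = (indicator J x :: real)" for J and x :: 'a
    by (simp add: indicator_def)
  \<comment> \<open>By Cauchy-Schwarz a set with zero g-mass has a = 0. After discarding the members
    with a = 0, the averages a / sg make sense on all that remain.\<close>
  have a_sg: "0 < sg J" if "J \<in> D" "0 < a J" for J
  proof -
    have eq: "(g x * indicator J x)\<^sup>2 = (g x)\<^sup>2 * indicator J x" for x
      by (simp only: power_mult_distrib ind2)
    have "(\<integral>x. (g x * indicator J x) * u x \<partial>M)\<^sup>2 \<le> (\<integral>x. (g x * indicator J x)\<^sup>2 \<partial>M) * (\<integral>x. (u x)\<^sup>2 \<partial>M)"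
    proof (rule Cauchy_Schwarz_integral(2))
      show "integrable M (\<lambda>x. (g x * indicator J x)\<^sup>2)"
        unfolding eq by (rule integrable_real_mult_indicator[OF Dm[OF that(1)] int(2)])
      show "(\<lambda>x. g x * indicator J x) \<in> borel_measurable M"
        using Dm[OF that(1)] by measurable
    qed (rule meas int)+
    moreover have "(\<integral>x. (g x * indicator J x) * u x \<partial>M) = a J"
      unfolding a by (rule Bochner_Integration.integral_cong) (simp_all only: mult_ac)
    ultimately have "(a J)\<^sup>2 \<le> sg J * (\<integral>x. (u x)\<^sup>2 \<partial>M)"
      by (simp only: eq sg)
    moreover have "0 < (a J)\<^sup>2" using that by simp
    ultimately show ?thesis using nnint(1)[of J] by (cases "sg J = 0") auto
  qed
  define G0 where "G0 = {J\<in>G. 0 < a J}"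
  have G0: "finite G0" "G0 \<subseteq> D" "\<And>J. J \<in> G0 \<Longrightarrow> J \<in> D" "\<And>J. J \<in> G0 \<Longrightarrow> 0 < a J" "\<And>J. J \<in> G0 \<Longrightarrow> 0 < sg J"
    using G(1) finite_subset[OF G(1) fin] a_sg by (auto simp: G0_def)
  have ne: "J \<noteq> {}" if "J \<in> G0" for J
    using G0(4)[OF that] by (auto simp: a)
  define E where "E J = a J / sg J" for J
  have E0: "0 < E J" if "J \<in> G0" for J using G0(4,5)[OF that] by (simp add: E_def)
  have aE: "a J = E J * sg J" if "J \<in> G0" for J using G0(5)[OF that] by (simp add: E_def)
  \<comment> \<open>A positive lower bound for all averages, so that every member of
    \<open>G0\<close> lies inside a stopping set of generation 0.\<close>
  obtain \<epsilon> where \<epsilon>: "0 < \<epsilon>" "\<And>J. J \<in> G0 \<Longrightarrow> \<epsilon> \<le> E J"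
  proof (cases "G0 = {}")
    case False
    then show ?thesis using that[of "Min (E ` G0)"] G0(1) E0 by auto
  qed (use that[of 1] in auto)
  define t where "t k = \<epsilon> * 2 ^ k" for k :: nat
  have t0: "0 < t k" for k using \<epsilon>(1) by (simp add: t_def)
  have tS: "t (Suc k) = 2 * t k" for k by (simp add: t_def)
  have tmono: "j \<le> k \<Longrightarrow> t j \<le> t k" for j k using \<epsilon>(1) by (simp add: t_def)
  \<comment> \<open>No average reaches level N; only the generations below N are nonempty, and all
    sums over generations are finite.\<close>
  obtain N where N: "\<And>J. J \<in> G0 \<Longrightarrow> E J < t N"
  proof -
    define mx where "mx = Max (insert 0 (E ` G0))"
    obtain N where "mx / \<epsilon> < 2 ^ N" using real_arch_pow[of 2 "mx / \<epsilon>"] by auto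
    then have "mx < t N" using \<epsilon>(1) by (simp add: t_def field_simps)
    moreover have "E J \<le> mx" if "J \<in> G0" for J unfolding mx_def using G0(1) that by (intro Max_ge) auto
    ultimately show ?thesis using that by (meson order.strict_trans1)
  qed
  define St where "St k = {J\<in>G0. t k \<le> E J \<and> (\<forall>L\<in>G0. J \<subset> L \<longrightarrow> E L < t k)}" for k
  have StD: "J \<in> G0" "t k \<le> E J" "L \<in> G0 \<Longrightarrow> J \<subset> L \<Longrightarrow> E L < t k" if "J \<in> St k" for J k L
    using that by (auto simp: St_def)
  have Stfin: "finite (St k)" for k using G0(1) by (simp add: St_def)
  have Stdisj: "S \<inter> S' = {}" if "S \<in> St k" "S' \<in> St k" "S \<noteq> S'" for S S' k
  proof -
    have "S \<in> D" "S' \<in> D" using that StD(1) G0(3) by blast+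
    moreover have "\<not> S \<subset> S'"
      using StD(3)[OF that(1) StD(1)[OF that(2)]] StD(2)[OF that(2)] by (meson not_less)
    moreover have "\<not> S' \<subset> S"
      using StD(3)[OF that(2) StD(1)[OF that(1)]] StD(2)[OF that(1)] by (meson not_less)
    ultimately show ?thesis using lam[of S S'] that(3) by blast
  qed
  have Stmax: "\<exists>S\<in>St k. J \<subseteq> S" if J: "J \<in> G0" "t k \<le> E J" for J k
  proof -
    let ?A = "{L\<in>G0. J \<subseteq> L \<and> t k \<le> E L}"
    have "finite ?A" "J \<in> ?A" using G0(1) J by auto
    then obtain S where S: "S \<in> ?A" "J \<subseteq> S" "\<forall>L\<in>?A. S \<subseteq> L \<longrightarrow> S = L"
      using finite_has_maximal2[of ?A J] by blast
    have "E L < t k" if "L \<in> G0" "S \<subset> L" for L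
    proof (rule ccontr)
      assume "\<not> E L < t k"
      then have "L \<in> ?A" using that S(2) by auto
      then show False using S(3) that(2) by blast
    qed
    then have "S \<in> St k" using S(1) by (simp add: St_def)
    then show ?thesis using S(2) by blast
  qed
  have StN: "St k = {}" if "N \<le> k" for k
  proof -
    have "\<not> t k \<le> E J" if "J \<in> G0" for J using N[OF that] tmono[OF \<open>N \<le> k\<close>] by simp
    then show ?thesis by (auto simp: St_def)
  qed
  define U where "U k = \<Union> (St k)" for k
  have Usub: "U k \<subseteq> U j" if "j \<le> k" for j k
  proof
    fix x assume "x \<in> U k"
    then obtain S where S: "S \<in> St k" "x \<in> S" by (auto simp: U_def)
    have "t j \<le> E S" using StD(2)[OF S(1)] tmono[OF that] by simp
    then obtain S' where "S' \<in> St j" "S \<subseteq> S'" using Stmax[OF StD(1)[OF S(1)]] by blast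
    then show "x \<in> U j" using S(2) by (auto simp: U_def)
  qed
  have indU: "(\<Sum>S\<in>St k. indicator S x) = (indicator (U k) x :: real)" for k x
  proof (cases "x \<in> U k")
    case True
    then obtain S where S: "S \<in> St k" "x \<in> S" by (auto simp: U_def)
    have "(\<Sum>S\<in>St k. indicator S x) = (\<Sum>S'\<in>{S}. indicator S' x :: real)"
      using S Stfin Stdisj[OF S(1)] by (intro sum.mono_neutral_right) (auto simp: indicator_def)
    then show ?thesis using True S by simp
  next
    case False
    then have "(\<Sum>S\<in>St k. indicator S x) = (0 :: real)" by (intro sum.neutral) (auto simp: U_def)
    then show ?thesis using False by simp
  qed
  have Um [measurable]: "U k \<in> sets M" for k
    unfolding U_def using Stfin StD(1) G0(3) Dm by (intro sets.finite_Union) auto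
  \<comment> \<open>A set may be maximal at several levels, so stopping sets are counted together
    with their generation.\<close>
  define P where "P = Sigma {..<N} St"
  have Pfin: "finite P" unfolding P_def using Stfin by blast
  have Psum: "(\<Sum>p\<in>P. F (fst p) (snd p)) = (\<Sum>k<N. \<Sum>S\<in>St k. F k S)" for F :: "nat \<Rightarrow> 'a set \<Rightarrow> real"
    unfolding P_def using Stfin by (subst sum.Sigma) (auto simp: case_prod_beta)
  \<comment> \<open>A discrete form of the energy of the maximal function of u / g with respect to
    g^2.\<close>
  define X where "X = (\<Sum>p\<in>P. (t (fst p))\<^sup>2 * sg (snd p))"

  \<comment> \<open>A Carleson embedding. From t sg <= a on stopping sets, X is at most the integral
    of g u \<phi>, and the integral of g^2 \<phi>^2 is at most 4 X. Weighted Cauchy-Schwarz gives X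
    <= 2 * integral of u^2 + X / 2, and the finite sum X can be absorbed.\<close>
  have X_le: "X \<le> 4 * (\<integral>x. (u x)\<^sup>2 \<partial>M)"
  proof -
    define \<phi> where "\<phi> x = (\<Sum>k<N. t k * indicator (U k) x)" for x :: 'a
    have \<phi>m [measurable]: "\<phi> \<in> borel_measurable M" unfolding \<phi>_def by measurable
    have \<phi>0: "0 \<le> \<phi> x" for x
      unfolding \<phi>_def using t0 by (intro sum_nonneg mult_nonneg_nonneg) (auto intro: less_imp_le)
    \<comment> \<open>At x the sum runs over the geometric levels whose stopping sets contain x, and
      is at most twice its largest term.\<close>
    have \<phi>2: "(\<phi> x)\<^sup>2 \<le> 4 * (\<Sum>k<N. (t k)\<^sup>2 * indicator (U k) x)" for x
    proof (cases "\<exists>k<N. x \<in> U k")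
      case False
      then show ?thesis by (simp add: \<phi>_def)
    next
      case True
      define m where "m = Max {k. k < N \<and> x \<in> U k}"
      have m: "m < N" "x \<in> U m" and le: "\<And>k. k < N \<Longrightarrow> x \<in> U k \<Longrightarrow> k \<le> m"
        using Max_in[of "{k. k < N \<and> x \<in> U k}"] True by (auto simp: m_def)
      have "\<phi> x \<le> (\<Sum>k<N. if k \<le> m then t k else 0)"
        unfolding \<phi>_def using le t0 by (intro sum_mono) (auto simp: indicator_def less_imp_le)
      also have "\<dots> = (\<Sum>k<Suc m. t k)"
        using m(1) by (intro sum.mono_neutral_cong_right) auto
      also have "\<dots> \<le> 2 * t m"
        using \<epsilon>(1) by (simp add: t_def sum_gp_strict flip: sum_distrib_left)
      finally have "(\<phi> x)\<^sup>2 \<le> (2 * t m)\<^sup>2"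
        using \<phi>0 by (intro power_mono) auto
      also have "\<dots> = 4 * ((t m)\<^sup>2 * indicator (U m) x)" using m by (simp add: power2_eq_square)
      also have "(t m)\<^sup>2 * indicator (U m) x \<le> (\<Sum>k<N. (t k)\<^sup>2 * indicator (U k) x)"
        using m by (intro member_le_sum) auto
      finally show ?thesis by simp
    qed
    have iU: "integrable M (\<lambda>x. (g x)\<^sup>2 * indicator (U k) x)" for k
      using int(2) by (intro integrable_real_mult_indicator) auto
    have XU: "X = (\<integral>x. (g x)\<^sup>2 * (\<Sum>k<N. (t k)\<^sup>2 * indicator (U k) x) \<partial>M)"
    proof -
      have "(\<Sum>S\<in>St k. sg S) = (\<integral>x. (g x)\<^sup>2 * indicator (U k) x \<partial>M)" for k
        unfolding sg indU[symmetric] sum_distrib_left using int(2) StD(1) G0(3)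
        by (subst Bochner_Integration.integral_sum) (auto intro!: integrable_real_mult_indicator Dm)
      then have "X = (\<Sum>k<N. \<integral>x. (t k)\<^sup>2 * ((g x)\<^sup>2 * indicator (U k) x) \<partial>M)"
        unfolding X_def Psum[of "\<lambda>k S. (t k)\<^sup>2 * sg S"] by (simp flip: sum_distrib_left)
      also have "\<dots> = (\<integral>x. (\<Sum>k<N. (t k)\<^sup>2 * ((g x)\<^sup>2 * indicator (U k) x)) \<partial>M)"
        using iU by (subst Bochner_Integration.integral_sum) auto
      finally show ?thesis by (simp add: sum_distrib_left mult_ac)
    qed
    have eq1: "(\<Sum>k<N. (t k)\<^sup>2 * ((g x)\<^sup>2 * indicator (U k) x)) = (g x)\<^sup>2 * (\<Sum>k<N. (t k)\<^sup>2 * indicator (U k) x)" for x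
      unfolding sum_distrib_left by (intro sum.cong refl) (simp only: mult_ac)
    have eq2: "(\<Sum>k<N. t k * (g x * u x * indicator (U k) x)) = g x * u x * \<phi> x" for x
      unfolding \<phi>_def sum_distrib_left by (intro sum.cong refl) (simp only: mult_ac)
    have iUs: "integrable M (\<lambda>x. (g x)\<^sup>2 * (\<Sum>k<N. (t k)\<^sup>2 * indicator (U k) x))"
      unfolding eq1[symmetric] by (intro Bochner_Integration.integrable_sum integrable_mult_right iU)
    have iguk: "integrable M (\<lambda>x. t k * (g x * u x * indicator (U k) x))" for k
      by (intro integrable_mult_right integrable_real_mult_indicator Um igu)
    have iguU: "integrable M (\<lambda>x. g x * u x * \<phi> x)"
      unfolding eq2[symmetric] by (intro Bochner_Integration.integrable_sum iguk)
    have "X \<le> (\<Sum>p\<in>P. t (fst p) * a (snd p))"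
      unfolding X_def
    proof (rule sum_mono)
      fix p assume "p \<in> P"
      then have S: "snd p \<in> St (fst p)" by (auto simp: P_def)
      have "t (fst p) * sg (snd p) \<le> a (snd p)"
        unfolding aE[OF StD(1)[OF S]] using StD(2)[OF S] nnint by (intro mult_right_mono) auto
      then show "(t (fst p))\<^sup>2 * sg (snd p) \<le> t (fst p) * a (snd p)"
        using t0[of "fst p"] by (simp add: power2_eq_square mult.assoc)
    qed
    also have "\<dots> = (\<Sum>k<N. t k * (\<Sum>S\<in>St k. a S))"
      unfolding Psum[of "\<lambda>k S. t k * a S"] by (simp add: sum_distrib_left)
    also have "\<dots> = (\<Sum>k<N. \<integral>x. t k * (g x * u x * indicator (U k) x) \<partial>M)"
    proof (rule sum.cong[OF refl])
      fix k
      have "(\<Sum>S\<in>St k. a S) = (\<integral>x. (\<Sum>S\<in>St k. g x * u x * indicator S x) \<partial>M)"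
        unfolding a using StD(1) G0(3) igu
        by (subst Bochner_Integration.integral_sum) (auto intro!: integrable_real_mult_indicator Dm)
      also have "\<dots> = (\<integral>x. g x * u x * indicator (U k) x \<partial>M)"
        by (simp only: sum_distrib_left[symmetric] indU)
      finally show "t k * (\<Sum>S\<in>St k. a S) = (\<integral>x. t k * (g x * u x * indicator (U k) x) \<partial>M)" by simp
    qed
    also have "\<dots> = (\<integral>x. g x * u x * \<phi> x \<partial>M)"
      unfolding eq2[symmetric] by (rule Bochner_Integration.integral_sum[symmetric]) (rule iguk)
    also have "\<dots> \<le> (\<integral>x. 2 * (u x)\<^sup>2 + 1 / 8 * (4 * ((g x)\<^sup>2 * (\<Sum>k<N. (t k)\<^sup>2 * indicator (U k) x))) \<partial>M)"
    proof (rule integral_mono[OF iguU])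
      fix x
      have "g x * u x * \<phi> x \<le> 2 * (u x)\<^sup>2 + 1 / 8 * ((g x)\<^sup>2 * (\<phi> x)\<^sup>2)"
        using amgm_weighted[of 2 "1/2" "g x * \<phi> x" "u x"] by (simp add: power_mult_distrib mult_ac power2_eq_square)
      also have "(g x)\<^sup>2 * (\<phi> x)\<^sup>2 \<le> (g x)\<^sup>2 * (4 * (\<Sum>k<N. (t k)\<^sup>2 * indicator (U k) x))"
        by (intro mult_left_mono \<phi>2) auto
      finally show "g x * u x * \<phi> x \<le> 2 * (u x)\<^sup>2 + 1 / 8 * (4 * ((g x)\<^sup>2 * (\<Sum>k<N. (t k)\<^sup>2 * indicator (U k) x)))"
        by simp
    qed (use int(3) iUs in simp)
    also have "\<dots> = 2 * (\<integral>x. (u x)\<^sup>2 \<partial>M) + X / 2"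
      unfolding XU using int(3) iUs by (subst Bochner_Integration.integral_add) auto
    finally show ?thesis by simp
  qed

  \<comment> \<open>The terms attached to p = (k, S) will be integrated separately off the next
    generation, which costs V, and on each next-generation set inside S, where b is traded for a at
    the cost of Y.\<close>
  define ch where "ch p = {S'\<in>St (Suc (fst p)). S' \<subset> snd p}" for p
  define V where "V p = (\<integral>x. (v x)\<^sup>2 * indicator (snd p - U (Suc (fst p))) x \<partial>M)" for p
  define Y where "Y p = (\<Sum>S'\<in>ch p. (a S')\<^sup>2 / sg S')" for p
  have Pm: "snd p \<in> sets M" if "p \<in> P" for p
    using that StD(1) G0(3) Dm by (auto simp: P_def)

  \<comment> \<open>The sets S - U (k + 1) with S in St k are pairwise disjoint: within one
    generation because stopping sets are, across generations because U decreases in k.\<close>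
  have V_le: "(\<Sum>p\<in>P. V p) \<le> (\<integral>x. (v x)\<^sup>2 \<partial>M)"
  proof -
    have iV: "integrable M (\<lambda>x. (v x)\<^sup>2 * indicator (snd p - U (Suc (fst p))) x)" if "p \<in> P" for p
      using int(4) Pm[OF that] by (intro integrable_real_mult_indicator) auto
    have "(\<Sum>p\<in>P. V p) = (\<integral>x. (\<Sum>p\<in>P. (v x)\<^sup>2 * indicator (snd p - U (Suc (fst p))) x) \<partial>M)"
      unfolding V_def using iV by (subst Bochner_Integration.integral_sum) auto
    also have "\<dots> \<le> (\<integral>x. (v x)\<^sup>2 \<partial>M)"
    proof (rule integral_mono)
      show "integrable M (\<lambda>x. \<Sum>p\<in>P. (v x)\<^sup>2 * indicator (snd p - U (Suc (fst p))) x)"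
        using iV by (intro Bochner_Integration.integrable_sum) auto
      fix x
      have "(\<Sum>p\<in>P. indicator (snd p - U (Suc (fst p))) x) \<le> (1::real)"
      proof (cases "\<exists>p\<in>P. x \<in> snd p - U (Suc (fst p))")
        case True
        then obtain q where q: "q \<in> P" "x \<in> snd q - U (Suc (fst q))" by blast
        have U': "x \<in> U (fst p)" if "p \<in> P" "x \<in> snd p" for p
          using that by (auto simp: P_def U_def)
        have aux: False if "x \<notin> U (Suc j)" "x \<in> U k" "j < k" for j k
          using Usub[of "Suc j" k] that by auto
        have zero: "indicator (snd p - U (Suc (fst p))) x = (0 :: real)" if p: "p \<in> P" "p \<noteq> q" for p
        proof (rule ccontr)
          assume "indicator (snd p - U (Suc (fst p))) x \<noteq> (0 :: real)"
          then have xp: "x \<in> snd p" "x \<notin> U (Suc (fst p))" by (auto simp: indicator_eq_0_iff)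
          have xq: "x \<in> snd q" "x \<notin> U (Suc (fst q))" using q(2) by auto
          have eq: "fst p = fst q"
            using aux[OF xp(2) U'[OF q(1) xq(1)]] aux[OF xq(2) U'[OF p(1) xp(1)]] linorder_neqE_nat by blast
          moreover have "snd p \<in> St (fst p)" "snd q \<in> St (fst p)"
            using p(1) q(1) eq by (auto simp: P_def)
          ultimately have "snd p \<inter> snd q = {}"
            using p(2) by (intro Stdisj) (auto simp: prod_eq_iff)
          then show False using xp(1) xq(1) by blast
        qed
        have "(\<Sum>p\<in>P. indicator (snd p - U (Suc (fst p))) x) = (\<Sum>p\<in>{q}. indicator (snd p - U (Suc (fst p))) x :: real)"
        proof (rule sum.mono_neutral_right[OF Pfin])
          show "\<forall>p\<in>P - {q}. indicator (snd p - U (Suc (fst p))) x = (0 :: real)" using zero by blast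
        qed (use q(1) in simp)
        also have "\<dots> = 1" using q(2) by simp
        finally show ?thesis by simp
      next
        case False
        then show ?thesis by (subst sum.neutral) auto
      qed
      from mult_left_mono[OF this, of "(v x)\<^sup>2"]
      show "(\<Sum>p\<in>P. (v x)\<^sup>2 * indicator (snd p - U (Suc (fst p))) x) \<le> (v x)\<^sup>2"
        by (simp add: sum_distrib_left)
    qed (rule int(4))
    finally show ?thesis .
  qed

  \<comment> \<open>A child occurs under one pair only: a stopping set of a later generation that
    properly contained it would have too small an average. The child also stops at the last level j
    below its own average, and there a^2 / sg <= 4 t_j^2 sg, which is 4 times a term of X.\<close>
  have Y_le: "(\<Sum>p\<in>P. Y p) \<le> 4 * X"
  proof -
    define T where "T = Sigma P ch"
    have chfin: "finite (ch p)" for p unfolding ch_def using Stfin by simp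
    have T: "S' \<in> St (Suc k)" "S' \<subset> S" "S \<in> St k" "k < N" if "((k, S), S') \<in> T" for k S S'
      using that by (auto simp: T_def P_def ch_def)
    have inj: "inj_on snd T"
    proof (rule inj_onI, clarsimp)
      fix k S S' k2 S2
      assume 1: "((k, S), S') \<in> T" and 2: "((k2, S2), S') \<in> T"
      have aux: False if "((k, S), S') \<in> T" "((k2, S2), S') \<in> T" "k < k2" for k S k2 S2
        using StD(3)[OF T(1)[OF that(1)] StD(1)[OF T(3)[OF that(2)]] T(2)[OF that(2)]]
          StD(2)[OF T(3)[OF that(2)]] tmono[of "Suc k" k2] that(3) by simp
      have k: "k = k2" using aux[OF 1 2] aux[OF 2 1] linorder_neqE_nat by blast
      have "S' \<noteq> {}" using ne StD(1) T(1)[OF 1] by blast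
      then show "k = k2 \<and> S = S2"
        using k Stdisj[of S k S2] T[OF 1] T[OF 2] by blast
    qed
    have "(\<Sum>p\<in>P. Y p) = (\<Sum>x\<in>T. (a (snd x))\<^sup>2 / sg (snd x))"
      unfolding Y_def T_def using Pfin chfin by (subst sum.Sigma) (auto simp: case_prod_beta)
    also have "\<dots> = (\<Sum>S'\<in>snd ` T. (a S')\<^sup>2 / sg S')"
      using inj by (simp add: sum.reindex)
    also have "\<dots> \<le> (\<Sum>S'\<in>snd ` T. 4 * ((t (nat \<lfloor>log 2 (E S' / \<epsilon>)\<rfloor>))\<^sup>2 * sg S'))
        \<and> (\<lambda>S'. (nat \<lfloor>log 2 (E S' / \<epsilon>)\<rfloor>, S')) ` snd ` T \<subseteq> P"
    proof (intro conjI sum_mono image_subsetI)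
      fix S' assume "S' \<in> snd ` T"
      then obtain k S where kS: "((k, S), S') \<in> T" by force
      have S': "S' \<in> G0" using StD(1) T(1)[OF kS] by blast
      define j where "j = nat \<lfloor>log 2 (E S' / \<epsilon>)\<rfloor>"
      have e1: "1 \<le> E S' / \<epsilon>" using \<epsilon> S' by simp
      then have l0: "0 \<le> log 2 (E S' / \<epsilon>)" by simp
      have j: "real j \<le> log 2 (E S' / \<epsilon>)" "log 2 (E S' / \<epsilon>) < real (Suc j)"
        unfolding j_def using l0 by (auto simp: of_nat_nat) linarith
      have "2 powr real j \<le> E S' / \<epsilon>" "E S' / \<epsilon> < 2 powr real (Suc j)"
        using j e1 by (simp_all add: le_log_iff log_less_iff)
      then have tj: "t j \<le> E S'" "E S' < t (Suc j)"
        using \<epsilon>(1) unfolding powr_realpow[OF zero_less_numeral] by (simp_all add: t_def field_simps)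
      have "Suc k \<le> j"
      proof (rule ccontr)
        assume "\<not> Suc k \<le> j"
        then have "t (Suc j) \<le> t (Suc k)" by (intro tmono) simp
        then show False using StD(2)[OF T(1)[OF kS]] tj by simp
      qed
      \<comment> \<open>Strict supersets of S' have averages below t (k + 1), hence below t j, so S'
        is still maximal at the higher level j.\<close>
      then have "S' \<in> St j"
        using S' tj StD(3)[OF T(1)[OF kS]] tmono[of "Suc k" j] by (force simp: St_def)
      moreover have "j < N" using StN[of j] calculation by (cases "N \<le> j") auto
      ultimately show "(nat \<lfloor>log 2 (E S' / \<epsilon>)\<rfloor>, S') \<in> P" by (simp add: P_def j_def)
      have "(a S')\<^sup>2 / sg S' = (E S')\<^sup>2 * sg S'"
        using aE[OF S'] G0(5)[OF S'] by (simp add: power2_eq_square)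
      also have "\<dots> \<le> (2 * t j)\<^sup>2 * sg S'"
        using tj nnint E0[OF S'] unfolding tS by (intro mult_right_mono power_mono) auto
      finally show "(a S')\<^sup>2 / sg S' \<le> 4 * ((t (nat \<lfloor>log 2 (E S' / \<epsilon>)\<rfloor>))\<^sup>2 * sg S')"
        by (simp add: j_def power2_eq_square)
    qed
    finally have le: "(\<Sum>p\<in>P. Y p) \<le> (\<Sum>S'\<in>snd ` T. 4 * ((t (nat \<lfloor>log 2 (E S' / \<epsilon>)\<rfloor>))\<^sup>2 * sg S'))"
      and sub: "(\<lambda>S'. (nat \<lfloor>log 2 (E S' / \<epsilon>)\<rfloor>, S')) ` snd ` T \<subseteq> P"
      by auto
    note le
    also have "(\<Sum>S'\<in>snd ` T. 4 * ((t (nat \<lfloor>log 2 (E S' / \<epsilon>)\<rfloor>))\<^sup>2 * sg S'))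
      = (\<Sum>p\<in>(\<lambda>S'. (nat \<lfloor>log 2 (E S' / \<epsilon>)\<rfloor>, S')) ` snd ` T. 4 * ((t (fst p))\<^sup>2 * sg (snd p)))"
      by (subst sum.reindex) (auto intro: inj_onI)
    also have "\<dots> \<le> (\<Sum>p\<in>P. 4 * ((t (fst p))\<^sup>2 * sg (snd p)))"
      using sub Pfin nnint by (intro sum_mono2) auto
    also have "\<dots> = 4 * X" by (simp add: X_def sum_distrib_left)
    finally show ?thesis .
  qed

  \<comment> \<open>A pair from the last generation that still covers J. On J the average is then at
    most the next level t (k + 1) = 2 t k.\<close>
  define h where "h J = (SOME p. p \<in> P \<and> J \<subseteq> snd p \<and> (\<forall>S'\<in>St (Suc (fst p)). \<not> J \<subseteq> S'))" for J
  have h: "h J \<in> P \<and> J \<subseteq> snd (h J) \<and> (\<forall>S'\<in>St (Suc (fst (h J))). \<not> J \<subseteq> S')" if J: "J \<in> G0" for J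
  proof -
    let ?K = "{k. k < N \<and> (\<exists>S\<in>St k. J \<subseteq> S)}"
    have "t 0 \<le> E J" using \<epsilon>(2)[OF J] by (simp add: t_def)
    then obtain S0 where S0: "S0 \<in> St 0" "J \<subseteq> S0" using Stmax[OF J] by blast
    have ltN: "k < N" if "S \<in> St k" for S k
    proof (rule ccontr)
      assume "\<not> k < N"
      then have "St k = {}" by (intro StN) simp
      then show False using that by simp
    qed
    have "0 \<in> ?K" using S0 ltN by blast
    define m where "m = Max ?K"
    have mK: "m \<in> ?K" unfolding m_def using \<open>0 \<in> ?K\<close> by (intro Max_in) auto
    have K': "k \<le> m" if "k \<in> ?K" for k unfolding m_def using that by (intro Max_ge) auto
    obtain S where S: "S \<in> St m" "J \<subseteq> S" using mK by blast
    have "\<not> J \<subseteq> S'" if "S' \<in> St (Suc m)" for S'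
    proof
      assume "J \<subseteq> S'"
      then have "Suc m \<in> ?K" using that ltN[OF that] by blast
      then show False using K'[of "Suc m"] by simp
    qed
    then have "(m, S) \<in> P \<and> J \<subseteq> snd (m, S) \<and> (\<forall>S'\<in>St (Suc (fst (m, S))). \<not> J \<subseteq> S')"
      using S ltN[OF S(1)] by (simp add: P_def)
    then show ?thesis unfolding h_def by (rule someI)
  qed

  \<comment> \<open>Replacing a J by 2 t k sg J turns the group into 2 t k times the integral of f v
    H, where H is a partial sum of the operator tested on S. H vanishes off S, and it is constant on
    each set of generation k + 1, since no member of the group lies inside such a set. The testing
    bound is used twice, once off these sets and once on them.\<close>
  have key: "(\<Sum>J\<in>{J\<in>G0. h J = p}. l J * a J * b J) \<le> \<tau> * (2 * ((t (fst p))\<^sup>2 * sg (snd p)) + V p + Y p)"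
    if p: "p \<in> P" for p
  proof -
    obtain k S where pkS: "p = (k, S)" by force
    have kS: "k < N" "S \<in> St k" using p by (auto simp: P_def pkS)
    define C where "C = {J\<in>G0. h J = p}"
    have C: "J \<in> G0" "J \<in> D" "J \<subseteq> S" "\<And>S'. S' \<in> St (Suc k) \<Longrightarrow> \<not> J \<subseteq> S'" if "J \<in> C" for J
      using that h[of J] G0(3) by (auto simp: C_def pkS)
    have Cfin: "finite C" unfolding C_def using G0(1) by simp
    define H where "H x = (\<Sum>J\<in>C. l J * sg J * indicator J x)" for x
    have Hm [measurable]: "H \<in> borel_measurable M"
      unfolding H_def using C(2) Dm by (intro borel_measurable_sum borel_measurable_times) auto
    have H0: "0 \<le> H x" for x unfolding H_def using l0 nnint by (intro sum_nonneg) auto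
    have SD: "S \<in> D" using StD(1)[OF kS(2)] G0(3) by blast
    define Hs where "Hs x = (\<Sum>J\<in>{J\<in>D. J \<subseteq> S}. l J * sg J * indicator J x)" for x
    have HHs: "H x \<le> Hs x" for x
      unfolding H_def Hs_def
    proof (rule sum_mono2)
      show "C \<subseteq> {J\<in>D. J \<subseteq> S}" using C(2,3) by blast
    qed (use l0 nnint fin in auto)
    have bdd: "\<exists>K. \<forall>x. \<bar>F x\<bar> \<le> K" if "F = (\<lambda>x. \<Sum>J\<in>A. c J * indicator J x)" "finite A" for F :: "'a \<Rightarrow> real" and A and c :: "'a set \<Rightarrow> real"
    proof (intro exI allI)
      fix x show "\<bar>F x\<bar> \<le> (\<Sum>J\<in>A. \<bar>c J\<bar>)"
        unfolding that(1) by (rule order.trans[OF sum_abs sum_mono]) (auto simp: indicator_def)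
    qed
    have isq: "integrable M (\<lambda>x. (f x * F x)\<^sup>2)" if "F \<in> borel_measurable M" "\<forall>x. \<bar>F x\<bar> \<le> K" for F K
    proof (rule Bochner_Integration.integrable_bound)
      show "integrable M (\<lambda>x. K\<^sup>2 * (f x)\<^sup>2)" using int(1) by simp
      show "AE x in M. norm ((f x * F x)\<^sup>2) \<le> norm (K\<^sup>2 * (f x)\<^sup>2)"
      proof (rule AE_I2)
        fix x
        have "(F x)\<^sup>2 \<le> K\<^sup>2" using power_mono[of "\<bar>F x\<bar>" K 2] that(2) by simp
        from mult_right_mono[OF this, of "(f x)\<^sup>2"]
        show "norm ((f x * F x)\<^sup>2) \<le> norm (K\<^sup>2 * (f x)\<^sup>2)"
          by (simp add: power_mult_distrib mult.commute)
      qed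
      show "(\<lambda>x. (f x * F x)\<^sup>2) \<in> borel_measurable M"
        by (intro borel_measurable_power borel_measurable_times meas that(1))
    qed
    obtain K1 where K1: "\<forall>x. \<bar>H x\<bar> \<le> K1" using bdd[of H "\<lambda>J. l J * sg J" C] Cfin by (auto simp: H_def[abs_def])
    obtain K2 where K2: "\<forall>x. \<bar>Hs x\<bar> \<le> K2" using bdd[of Hs "\<lambda>J. l J * sg J" "{J\<in>D. J \<subseteq> S}"] fin by (auto simp: Hs_def[abs_def])
    have Hsm: "Hs \<in> borel_measurable M"
      unfolding Hs_def[abs_def] using Dm by (intro borel_measurable_sum borel_measurable_times) auto
    have ifH: "integrable M (\<lambda>x. (f x * H x)\<^sup>2)" by (rule isq[OF Hm K1])
    have tH: "(\<integral>x. (f x * H x)\<^sup>2 \<partial>M) \<le> \<tau>\<^sup>2 * sg S"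
    proof -
      have "(\<integral>x. (f x * H x)\<^sup>2 \<partial>M) \<le> (\<integral>x. (f x * Hs x)\<^sup>2 \<partial>M)"
        using isq[OF Hsm K2] ifH nn H0 HHs
        by (intro integral_mono power_mono mult_left_mono mult_nonneg_nonneg) auto
      also have "\<dots> \<le> \<tau>\<^sup>2 * sg S" unfolding Hs_def by (rule test[OF SD])
      finally show ?thesis .
    qed
    have ifvH: "integrable M (\<lambda>x. f x * v x * H x)"
      using Cauchy_Schwarz_integral(1)[of "\<lambda>x. f x * H x" M v] ifH int by (simp add: mult_ac)

    have Hsupp: "H x = 0" if "x \<notin> S" for x
      unfolding H_def using C(3) that by (intro sum.neutral) (auto simp: indicator_def)
    have Hconst: "\<exists>\<eta>\<ge>0. \<forall>x\<in>S'. H x = \<eta>" if S': "S' \<in> St (Suc k)" for S'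
    proof -
      have *: "J \<inter> S' = {} \<or> S' \<subseteq> J" if "J \<in> C" for J
        using lam[of J S'] C[OF that] S' StD(1)[OF S'] G0(3) by blast
      obtain y where y: "y \<in> S'" using ne[OF StD(1)[OF S']] by blast
      have "H x = H y" if "x \<in> S'" for x
        unfolding H_def using * that y by (intro sum.cong) (auto simp: indicator_def)
      then show ?thesis using H0[of y] by blast
    qed
    \<comment> \<open>A member of the group that meets S' contains it properly, so S' would lie
      properly inside S and be a child.\<close>
    have Hzero: "H x = 0" if S': "S' \<in> St (Suc k)" "S' \<notin> ch p" "x \<in> S'" for S' x
      unfolding H_def
    proof (rule sum.neutral, clarify)
      fix J assume J: "J \<in> C"
      have "x \<notin> J"
      proof
        assume "x \<in> J"
        then have "S' \<subset> J"
          using lam[of J S'] C[OF J] S' StD(1)[OF S'(1)] G0(3) by blast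
        then have "S' \<subset> S" using C(3)[OF J] by blast
        then show False using S' by (simp add: ch_def pkS)
      qed
      then show "l J * sg J * indicator J x = 0" by simp
    qed

    have "2 * t k * (\<integral>x. f x * v x * H x \<partial>M)
      \<le> (t k)\<^sup>2 / \<tau> * (\<integral>x. (f x * H x)\<^sup>2 \<partial>M) + \<tau> * V p + ((t k)\<^sup>2 / \<tau> * (\<integral>x. (f x * H x)\<^sup>2 \<partial>M) + \<tau> * Y p)"
    proof -
      let ?W = "- U (Suc k)"
      have Wm: "U (Suc k) \<in> sets M" by simp
      have split: "f x * v x * H x = f x * v x * H x * indicator (space M - U (Suc k)) x
          + (\<Sum>S'\<in>ch p. f x * v x * H x * indicator S' x)" if "x \<in> space M" for x
      proof -
        have "(\<Sum>S'\<in>ch p. f x * v x * H x * indicator S' x) = (\<Sum>S'\<in>St (Suc k). f x * v x * H x * indicator S' x)"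
          using Stfin Hzero by (intro sum.mono_neutral_left) (auto simp: ch_def pkS indicator_def)
        also have "\<dots> = f x * v x * H x * indicator (U (Suc k)) x"
          by (simp only: sum_distrib_left[symmetric] indU)
        finally show ?thesis using that by (auto simp: indicator_def)
      qed
      have chm: "S' \<in> sets M" "S' \<in> St (Suc k)" "S' \<in> G0" if "S' \<in> ch p" for S'
        using that StD(1) G0(3) Dm by (auto simp: ch_def pkS)
      have chfin: "finite (ch p)" unfolding ch_def using Stfin by simp
      have i1: "integrable M (\<lambda>x. f x * v x * H x * indicator (space M - U (Suc k)) x)"
        using ifvH Wm by (intro integrable_real_mult_indicator) auto
      have i2: "integrable M (\<lambda>x. f x * v x * H x * indicator S' x)" if "S' \<in> ch p" for S'
        by (intro integrable_real_mult_indicator chm(1) that ifvH)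
      have "(\<integral>x. f x * v x * H x \<partial>M) = (\<integral>x. f x * v x * H x * indicator (space M - U (Suc k)) x
          + (\<Sum>S'\<in>ch p. f x * v x * H x * indicator S' x) \<partial>M)"
        by (rule Bochner_Integration.integral_cong[OF refl split])
      also have "\<dots> = (\<integral>x. f x * v x * H x * indicator (space M - U (Suc k)) x \<partial>M)
          + (\<Sum>S'\<in>ch p. \<integral>x. f x * v x * H x * indicator S' x \<partial>M)"
        by (subst Bochner_Integration.integral_add[OF i1 Bochner_Integration.integrable_sum], erule i2,
            subst Bochner_Integration.integral_sum, erule i2, rule refl)
      finally have eq: "2 * t k * (\<integral>x. f x * v x * H x \<partial>M)
        = 2 * t k * (\<integral>x. f x * v x * H x * indicator (space M - U (Suc k)) x \<partial>M)
          + (\<Sum>S'\<in>ch p. 2 * t k * (\<integral>x. f x * v x * H x * indicator S' x \<partial>M))"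
        by (simp add: distrib_left sum_distrib_left)
      have iv: "integrable M (\<lambda>x. (v x)\<^sup>2 * indicator (S - U (Suc k)) x)"
        using int(4) Dm[OF SD] by (intro integrable_real_mult_indicator) auto
      have first: "2 * t k * (\<integral>x. f x * v x * H x * indicator (space M - U (Suc k)) x \<partial>M)
        \<le> (t k)\<^sup>2 / \<tau> * (\<integral>x. (f x * H x)\<^sup>2 \<partial>M) + \<tau> * V p"
      proof -
        have "2 * t k * (\<integral>x. f x * v x * H x * indicator (space M - U (Suc k)) x \<partial>M)
          = (\<integral>x. 2 * t k * (f x * v x * H x * indicator (space M - U (Suc k)) x) \<partial>M)" by simp
        also have "\<dots> \<le> (\<integral>x. (t k)\<^sup>2 / \<tau> * (f x * H x)\<^sup>2 + \<tau> * ((v x)\<^sup>2 * indicator (S - U (Suc k)) x) \<partial>M)"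
        proof (rule integral_mono)
          show "integrable M (\<lambda>x. 2 * t k * (f x * v x * H x * indicator (space M - U (Suc k)) x))"
            using ifvH by (intro integrable_mult_right integrable_real_mult_indicator) auto
          show "integrable M (\<lambda>x. (t k)\<^sup>2 / \<tau> * (f x * H x)\<^sup>2 + \<tau> * ((v x)\<^sup>2 * indicator (S - U (Suc k)) x))"
            using ifH iv by simp
          fix x assume "x \<in> space M"
          show "2 * t k * (f x * v x * H x * indicator (space M - U (Suc k)) x)
            \<le> (t k)\<^sup>2 / \<tau> * (f x * H x)\<^sup>2 + \<tau> * ((v x)\<^sup>2 * indicator (S - U (Suc k)) x)"
          proof (cases "x \<in> S - U (Suc k)")
            case True
            then show ?thesis using amgm_weighted[OF \<tau>, of "t k" "f x * H x" "v x"] \<open>x \<in> space M\<close>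
              by (simp add: mult_ac)
          next
            case False
            then have "H x * indicator (space M - U (Suc k)) x = 0" using Hsupp by (auto simp: indicator_def)
            then have "2 * t k * (f x * v x * H x * indicator (space M - U (Suc k)) x) = 0"
              by (simp only: mult.assoc mult_zero_right)
            moreover have "0 \<le> (t k)\<^sup>2 / \<tau> * (f x * H x)\<^sup>2 + \<tau> * ((v x)\<^sup>2 * indicator (S - U (Suc k)) x)"
              using \<tau> by simp
            ultimately show ?thesis by linarith
          qed
        qed
        also have "\<dots> = (t k)\<^sup>2 / \<tau> * (\<integral>x. (f x * H x)\<^sup>2 \<partial>M) + \<tau> * V p"
          unfolding V_def pkS using ifH iv by (subst Bochner_Integration.integral_add) auto
        finally show ?thesis .
      qed
      have each: "2 * t k * (\<integral>x. f x * v x * H x * indicator S' x \<partial>M)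
          \<le> (t k)\<^sup>2 / \<tau> * (\<integral>x. (f x * H x)\<^sup>2 * indicator S' x \<partial>M) + \<tau> * ((a S')\<^sup>2 / sg S')"
        if S': "S' \<in> ch p" for S'
      proof -
        obtain \<eta> where \<eta>: "0 \<le> \<eta>" "\<And>x. x \<in> S' \<Longrightarrow> H x = \<eta>" using Hconst[OF chm(2)[OF S']] by blast
        have 1: "(\<integral>x. f x * v x * H x * indicator S' x \<partial>M) = \<eta> * b S'"
          unfolding b integral_mult_right_zero[symmetric]
          by (rule Bochner_Integration.integral_cong) (auto simp: indicator_def \<eta>)
        have 2: "(\<integral>x. (f x * H x)\<^sup>2 * indicator S' x \<partial>M) = \<eta>\<^sup>2 * sf S'"
          unfolding sf integral_mult_right_zero[symmetric]
          by (rule Bochner_Integration.integral_cong) (auto simp: indicator_def \<eta> power_mult_distrib)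
        have s0: "0 < sg S'" by (rule G0(5)[OF chm(3)[OF S']])
        \<comment> \<open>This is where membership in G enters: b^2 is bounded by sf times a^2 / sg,
          and sf times the square of the constant value of H is the integral of (f H)^2 over
          S'.\<close>
        have "S' \<in> G" using chm(3)[OF S'] by (simp add: G0_def)
        then have "(b S')\<^sup>2 * sg S' \<le> (a S')\<^sup>2 * sf S'" by (rule G(2))
        then have "(b S')\<^sup>2 \<le> sf S' * ((a S')\<^sup>2 / sg S')" using s0 by (simp add: field_simps)
        from amgm_weighted'[OF \<tau> this nnint(2), of "t k * \<eta>"]
        show ?thesis using s0 unfolding 1 2 by (simp add: power_mult_distrib mult_ac)
      qed
      have "(\<Sum>S'\<in>ch p. 2 * t k * (\<integral>x. f x * v x * H x * indicator S' x \<partial>M))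
        \<le> (t k)\<^sup>2 / \<tau> * (\<Sum>S'\<in>ch p. \<integral>x. (f x * H x)\<^sup>2 * indicator S' x \<partial>M) + \<tau> * Y p"
        unfolding Y_def sum_distrib_left sum.distrib[symmetric] by (rule sum_mono[OF each])
      also have "(\<Sum>S'\<in>ch p. \<integral>x. (f x * H x)\<^sup>2 * indicator S' x \<partial>M)
          = (\<integral>x. (\<Sum>S'\<in>ch p. (f x * H x)\<^sup>2 * indicator S' x) \<partial>M)"
        using ifH chm by (subst Bochner_Integration.integral_sum) (auto intro!: integrable_real_mult_indicator)
      also have "\<dots> \<le> (\<integral>x. (f x * H x)\<^sup>2 \<partial>M)"
      proof (rule integral_mono[OF _ ifH])
        show "integrable M (\<lambda>x. \<Sum>S'\<in>ch p. (f x * H x)\<^sup>2 * indicator S' x)"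
          using ifH chm by (intro Bochner_Integration.integrable_sum integrable_real_mult_indicator) auto
        fix x
        have "(\<Sum>S'\<in>ch p. indicator S' x) \<le> (\<Sum>S'\<in>St (Suc k). indicator S' x :: real)"
          using Stfin by (intro sum_mono2) (auto simp: ch_def pkS)
        also have "\<dots> \<le> 1" unfolding indU by (simp add: indicator_def)
        finally show "(\<Sum>S'\<in>ch p. (f x * H x)\<^sup>2 * indicator S' x) \<le> (f x * H x)\<^sup>2"
          using mult_left_mono[of "\<Sum>S'\<in>ch p. indicator S' x" 1 "(f x * H x)\<^sup>2"] by (simp add: sum_distrib_left)
      qed
      finally have "(\<Sum>S'\<in>ch p. 2 * t k * (\<integral>x. f x * v x * H x * indicator S' x \<partial>M))
        \<le> (t k)\<^sup>2 / \<tau> * (\<integral>x. (f x * H x)\<^sup>2 \<partial>M) + \<tau> * Y p"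
        using \<tau> by (simp add: mult_left_mono divide_right_mono)
      with first eq show ?thesis by linarith
    qed
    also have "\<dots> \<le> \<tau> * (2 * ((t k)\<^sup>2 * sg S) + V p + Y p)"
    proof -
      have "(t k)\<^sup>2 / \<tau> * (\<integral>x. (f x * H x)\<^sup>2 \<partial>M) \<le> (t k)\<^sup>2 / \<tau> * (\<tau>\<^sup>2 * sg S)"
        using tH \<tau> by (intro mult_left_mono) auto
      also have "\<dots> = \<tau> * ((t k)\<^sup>2 * sg S)" using \<tau> by (simp add: power2_eq_square)
      finally show ?thesis by (simp add: algebra_simps)
    qed
    finally have main: "2 * t k * (\<integral>x. f x * v x * H x \<partial>M) \<le> \<tau> * (2 * ((t k)\<^sup>2 * sg S) + V p + Y p)" .
    have "(\<Sum>J\<in>C. l J * a J * b J) \<le> (\<Sum>J\<in>C. 2 * t k * (l J * sg J * b J))"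
    proof (rule sum_mono)
      fix J assume J: "J \<in> C"
      have "E J \<le> t (Suc k)"
        using Stmax[OF C(1)[OF J], of "Suc k"] C(4)[OF J] by (meson linear)
      then have "a J \<le> 2 * t k * sg J"
        unfolding aE[OF C(1)[OF J]] tS using nnint by (intro mult_right_mono) auto
      from mult_left_mono[OF this, of "l J * b J"]
      show "l J * a J * b J \<le> 2 * t k * (l J * sg J * b J)"
        using l0[of J] nnint(4)[of J] by (simp add: mult_ac)
    qed
    also have "\<dots> = 2 * t k * (\<Sum>J\<in>C. l J * sg J * b J)" by (simp add: sum_distrib_left)
    also have "(\<Sum>J\<in>C. l J * sg J * b J) = (\<Sum>J\<in>C. \<integral>x. (l J * sg J) * (f x * v x * indicator J x) \<partial>M)"
      unfolding b by simp
    also have "\<dots> = (\<integral>x. (\<Sum>J\<in>C. (l J * sg J) * (f x * v x * indicator J x)) \<partial>M)"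
      using ifv C(2) by (subst Bochner_Integration.integral_sum)
        (auto intro!: integrable_mult_right integrable_real_mult_indicator Dm simp del: integral_mult_right_zero)
    also have "\<dots> = (\<integral>x. f x * v x * H x \<partial>M)"
      by (rule Bochner_Integration.integral_cong) (auto simp: H_def sum_distrib_left mult_ac)
    finally show ?thesis using main by (simp add: C_def pkS)
  qed

  have "(\<Sum>J\<in>G. l J * a J * b J) = (\<Sum>J\<in>G0. l J * a J * b J)"
  proof (rule sum.mono_neutral_right)
    show "finite G" using G(1) fin by (rule finite_subset)
    show "\<forall>J\<in>G - G0. l J * a J * b J = 0"
    proof
      fix J assume "J \<in> G - G0"
      then have "\<not> 0 < a J" by (auto simp: G0_def)
      then have "a J = 0" using nnint(3)[of J] by linarith
      then show "l J * a J * b J = 0" by simp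
    qed
  qed (simp add: G0_def)
  also have "\<dots> = (\<Sum>p\<in>P. \<Sum>J\<in>{J\<in>G0. h J = p}. l J * a J * b J)"
    by (rule sum.group[symmetric]) (use G0(1) Pfin h in blast)+
  also have "\<dots> \<le> (\<Sum>p\<in>P. \<tau> * (2 * ((t (fst p))\<^sup>2 * sg (snd p)) + V p + Y p))"
    by (rule sum_mono[OF key])
  also have "\<dots> = \<tau> * (2 * X + (\<Sum>p\<in>P. V p) + (\<Sum>p\<in>P. Y p))"
    by (simp add: X_def sum.distrib sum_distrib_left algebra_simps)
  \<comment> \<open>The 24 is (2 + 4) * 4, from 2 X, from the bound 4 X for the sum of Y, and from X
    <= 4 * integral of u^2.\<close>
  also have "\<dots> \<le> \<tau> * (24 * (\<integral>x. (u x)\<^sup>2 \<partial>M) + (\<integral>x. (v x)\<^sup>2 \<partial>M))"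
    using V_le Y_le X_le \<tau> by (intro mult_left_mono) auto
  finally show ?thesis .
qed

text \<open>Off G the normalized energy of v is the larger one, so the same estimate applies there
  with f and g, and u and v, exchanged; the second testing condition is used for it. Adding the
  halves gives 25 = 24 + 1.\<close>

lemma laminar_two_weight:
  fixes f g u v :: "'a \<Rightarrow> real" and l :: "'a set \<Rightarrow> real"
  assumes fin: "finite D" and sets: "D \<subseteq> sets M"
    and lam: "\<And>A B. A \<in> D \<Longrightarrow> B \<in> D \<Longrightarrow> A \<inter> B = {} \<or> A \<subseteq> B \<or> B \<subseteq> A"
    and l0: "\<And>J. 0 \<le> l J"
    and nn: "\<And>x. 0 \<le> f x" "\<And>x. 0 \<le> g x" "\<And>x. 0 \<le> u x" "\<And>x. 0 \<le> v x"
    and meas: "f \<in> borel_measurable M" "g \<in> borel_measurable M"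
      "u \<in> borel_measurable M" "v \<in> borel_measurable M"
    and int: "integrable M (\<lambda>x. (f x)\<^sup>2)" "integrable M (\<lambda>x. (g x)\<^sup>2)"
      "integrable M (\<lambda>x. (u x)\<^sup>2)" "integrable M (\<lambda>x. (v x)\<^sup>2)"
    and \<tau>: "0 < \<tau>"
    and sg: "\<And>J. sg J = (\<integral>x. (g x)\<^sup>2 * indicator J x \<partial>M)"
    and sf: "\<And>J. sf J = (\<integral>x. (f x)\<^sup>2 * indicator J x \<partial>M)"
    and a: "\<And>J. a J = (\<integral>x. g x * u x * indicator J x \<partial>M)"
    and b: "\<And>J. b J = (\<integral>x. f x * v x * indicator J x \<partial>M)"
    and test1: "\<And>S. S \<in> D \<Longrightarrow>
      (\<integral>x. (f x * (\<Sum>J\<in>{J\<in>D. J \<subseteq> S}. l J * sg J * indicator J x))\<^sup>2 \<partial>M) \<le> \<tau>\<^sup>2 * sg S"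
    and test2: "\<And>S. S \<in> D \<Longrightarrow>
      (\<integral>x. (g x * (\<Sum>J\<in>{J\<in>D. J \<subseteq> S}. l J * sf J * indicator J x))\<^sup>2 \<partial>M) \<le> \<tau>\<^sup>2 * sf S"
  shows "(\<Sum>J\<in>D. l J * a J * b J) \<le> 25 * \<tau> * ((\<integral>x. (u x)\<^sup>2 \<partial>M) + (\<integral>x. (v x)\<^sup>2 \<partial>M))"
proof -
  let ?G = "{J\<in>D. (b J)\<^sup>2 * sg J \<le> (a J)\<^sup>2 * sf J}"
  have 1: "(\<Sum>J\<in>?G. l J * a J * b J) \<le> \<tau> * (24 * (\<integral>x. (u x)\<^sup>2 \<partial>M) + (\<integral>x. (v x)\<^sup>2 \<partial>M))"
    by (rule laminar_half[OF fin sets lam l0 nn meas int \<tau> sg sf a b test1]) auto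
  have 2: "(\<Sum>J\<in>D - ?G. l J * b J * a J) \<le> \<tau> * (24 * (\<integral>x. (v x)\<^sup>2 \<partial>M) + (\<integral>x. (u x)\<^sup>2 \<partial>M))"
    by (rule laminar_half[OF fin sets lam l0 nn(2,1,4,3) meas(2,1,4,3) int(2,1,4,3) \<tau> sf sg b a test2]) auto
  have "(\<Sum>J\<in>D. l J * a J * b J) = (\<Sum>J\<in>D - ?G. l J * a J * b J) + (\<Sum>J\<in>?G. l J * a J * b J)"
    using fin by (intro sum.subset_diff) auto
  also have "(\<Sum>J\<in>D - ?G. l J * a J * b J) = (\<Sum>J\<in>D - ?G. l J * b J * a J)" by (simp add: mult_ac)
  finally show ?thesis using 1 2 by (simp add: algebra_simps)
qed

section \<open>The divergence identity and a Hardy type inequality\<close>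

definition Phi :: "(complex \<Rightarrow> real) \<Rightarrow> complex \<Rightarrow> real" where
  "Phi \<alpha> z = (\<integral>\<zeta>. \<alpha> \<zeta> / (cmod (1 - cnj \<zeta> * z))\<^sup>2 \<partial>dA)"

definition Theta :: "(complex \<Rightarrow> real) \<Rightarrow> complex \<Rightarrow> real" where
  "Theta \<alpha> z = (\<integral>\<zeta>. \<alpha> \<zeta> * (1 - (cmod \<zeta>)\<^sup>2) / (cmod (1 - cnj \<zeta> * z)) ^ 3 \<partial>dA)"

definition Berg :: "(complex \<Rightarrow> real) \<Rightarrow> complex \<Rightarrow> complex" where
  "Berg \<alpha> z = (\<integral>\<zeta>. of_real (\<alpha> \<zeta>) * cnj \<zeta> / (1 - cnj \<zeta> * z)\<^sup>2 \<partial>dA)"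

lemma integral_kernel_measurable:
  fixes k :: "complex \<Rightarrow> complex \<Rightarrow> 'b :: {banach, second_countable_topology}"
  assumes "(\<lambda>(z, \<zeta>). k z \<zeta>) \<in> borel_measurable (dA \<Otimes>\<^sub>M dA)"
  shows "(\<lambda>z. \<integral>\<zeta>. k z \<zeta> \<partial>dA) \<in> borel_measurable dA"
  using assms by (rule dA.borel_measurable_lebesgue_integral)

lemma Phi_measurable [measurable]:
  assumes [measurable]: "\<alpha> \<in> borel_measurable dA"
  shows "Phi \<alpha> \<in> borel_measurable dA"
  unfolding Phi_def[abs_def] by (rule integral_kernel_measurable) measurable

lemma Theta_measurable [measurable]:
  assumes [measurable]: "\<alpha> \<in> borel_measurable dA"
  shows "Theta \<alpha> \<in> borel_measurable dA"
  unfolding Theta_def[abs_def] by (rule integral_kernel_measurable) measurable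

lemma Berg_measurable [measurable]:
  assumes [measurable]: "\<alpha> \<in> borel_measurable dA"
  shows "Berg \<alpha> \<in> borel_measurable dA"
  unfolding Berg_def[abs_def] by (rule integral_kernel_measurable) measurable

section \<open>Integration against product weights\<close>

lemma integral_pair_mult:
  fixes p q :: "complex \<Rightarrow> complex"
  assumes p: "integrable dA p" and q: "integrable dA q"
  shows "integrable (dA \<Otimes>\<^sub>M dA) (\<lambda>x. p (fst x) * q (snd x))"
    and "(\<integral>x. p (fst x) * q (snd x) \<partial>(dA \<Otimes>\<^sub>M dA)) = (\<integral>x. p x \<partial>dA) * (\<integral>x. q x \<partial>dA)"
proof -
  have [measurable]: "p \<in> borel_measurable dA" "q \<in> borel_measurable dA" using p q by auto
  have i: "integrable (dA \<Otimes>\<^sub>M dA) (\<lambda>(x, y). p x * q y)"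
  proof (rule dA2.Fubini_integrable)
    show "(\<lambda>(x, y). p x * q y) \<in> borel_measurable (dA \<Otimes>\<^sub>M dA)" by measurable
    show "integrable dA (\<lambda>x. \<integral>y. norm (case (x, y) of (x, y) \<Rightarrow> p x * q y) \<partial>dA)"
      using p q by (simp add: norm_mult)
    show "AE x in dA. integrable dA (\<lambda>y. case (x, y) of (x, y) \<Rightarrow> p x * q y)"
      using q by simp
  qed
  then show "integrable (dA \<Otimes>\<^sub>M dA) (\<lambda>x. p (fst x) * q (snd x))" by (simp add: case_prod_beta')
  from dA2.integral_fst[OF i]
  show "(\<integral>x. p (fst x) * q (snd x) \<partial>(dA \<Otimes>\<^sub>M dA)) = (\<integral>x. p x \<partial>dA) * (\<integral>x. q x \<partial>dA)"
    by (simp add: case_prod_beta')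
qed

text \<open>Integrates an identity that holds for each parameter pair against the density p. The
  uniform bound on H makes the triple integral absolutely convergent.\<close>

lemma Fubini_vanishing:
  fixes H :: "complex \<Rightarrow> complex \<times> complex \<Rightarrow> complex"
  assumes p: "integrable (dA \<Otimes>\<^sub>M dA) p"
    and H [measurable]: "(\<lambda>(z, x). H z x) \<in> borel_measurable (dA \<Otimes>\<^sub>M (dA \<Otimes>\<^sub>M dA))"
    and bd: "\<And>z x. z \<in> disc \<Longrightarrow> x \<in> space (dA \<Otimes>\<^sub>M dA) \<Longrightarrow> norm (H z x) \<le> C"
    and zero: "\<And>x. x \<in> space (dA \<Otimes>\<^sub>M dA) \<Longrightarrow> (\<integral>z. H z x \<partial>dA) = 0"
  shows "(\<integral>z. (\<integral>x. p x * H z x \<partial>(dA \<Otimes>\<^sub>M dA)) \<partial>dA) = 0"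
    and "integrable dA (\<lambda>z. \<integral>x. p x * H z x \<partial>(dA \<Otimes>\<^sub>M dA))"
proof -
  interpret P: sigma_finite_measure "dA \<Otimes>\<^sub>M dA" by (rule dA2.P.sigma_finite_measure_axioms)
  interpret Q: pair_sigma_finite dA "dA \<Otimes>\<^sub>M dA" ..
  have pm [measurable]: "p \<in> borel_measurable (dA \<Otimes>\<^sub>M dA)" using p by auto
  have m: "(\<lambda>(z, x). p x * H z x) \<in> borel_measurable (dA \<Otimes>\<^sub>M (dA \<Otimes>\<^sub>M dA))" by measurable
  have int: "integrable (dA \<Otimes>\<^sub>M (dA \<Otimes>\<^sub>M dA)) (\<lambda>(z, x). p x * H z x)"
  proof (rule Q.Fubini_integrable[OF m])
    have b: "norm (p x * H z x) \<le> norm (C * norm (p x))" if "z \<in> disc" "x \<in> space (dA \<Otimes>\<^sub>M dA)" for z x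
      using mult_left_mono[OF bd[OF that], of "norm (p x)"] by (simp add: norm_mult mult.commute)
    have ip: "integrable (dA \<Otimes>\<^sub>M dA) (\<lambda>x. C * norm (p x))" using p by simp
    have i: "integrable (dA \<Otimes>\<^sub>M dA) (\<lambda>x. p x * H z x)" if "z \<in> disc" for z
    proof (rule Bochner_Integration.integrable_bound[OF ip])
      show "(\<lambda>x. p x * H z x) \<in> borel_measurable (dA \<Otimes>\<^sub>M dA)"
        using measurable_Pair2[OF m, of z] that by simp
      show "AE x in dA \<Otimes>\<^sub>M dA. norm (p x * H z x) \<le> norm (C * norm (p x))"
        using b[OF that] by (intro AE_I2)
    qed
    then show "AE z in dA. integrable (dA \<Otimes>\<^sub>M dA) (\<lambda>x. case (z, x) of (z, x) \<Rightarrow> p x * H z x)"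
      by (intro AE_I2) simp
    show "integrable dA (\<lambda>z. \<integral>x. norm (case (z, x) of (z, x) \<Rightarrow> p x * H z x) \<partial>(dA \<Otimes>\<^sub>M dA))"
    proof (rule dA.integrable_const_bound[where B = "\<integral>x. norm (C * norm (p x)) \<partial>(dA \<Otimes>\<^sub>M dA)"])
      show "(\<lambda>z. \<integral>x. norm (case (z, x) of (z, x) \<Rightarrow> p x * H z x) \<partial>(dA \<Otimes>\<^sub>M dA)) \<in> borel_measurable dA"
        by (rule dA2.P.borel_measurable_lebesgue_integral) (use m in measurable)
      show "AE z in dA. norm (\<integral>x. norm (case (z, x) of (z, x) \<Rightarrow> p x * H z x) \<partial>(dA \<Otimes>\<^sub>M dA)) \<le> (\<integral>x. norm (C * norm (p x)) \<partial>(dA \<Otimes>\<^sub>M dA))"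
      proof (rule AE_I2)
        fix z assume z: "z \<in> space dA"
        have "(\<integral>x. norm (p x * H z x) \<partial>(dA \<Otimes>\<^sub>M dA)) \<le> (\<integral>x. norm (C * norm (p x)) \<partial>(dA \<Otimes>\<^sub>M dA))"
          using z b ip i by (intro integral_mono integrable_norm) auto
        then show "norm (\<integral>x. norm (case (z, x) of (z, x) \<Rightarrow> p x * H z x) \<partial>(dA \<Otimes>\<^sub>M dA)) \<le> (\<integral>x. norm (C * norm (p x)) \<partial>(dA \<Otimes>\<^sub>M dA))"
          by simp
      qed
    qed
  qed
  from Q.integrable_fst[OF this]
  show "integrable dA (\<lambda>z. \<integral>x. p x * H z x \<partial>(dA \<Otimes>\<^sub>M dA))" .
  have "(\<integral>x. (\<integral>z. p x * H z x \<partial>dA) \<partial>(dA \<Otimes>\<^sub>M dA)) = (\<integral>z. (\<integral>x. p x * H z x \<partial>(dA \<Otimes>\<^sub>M dA)) \<partial>dA)"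
    by (rule Q.Fubini_integral[OF int])
  moreover have "(\<integral>x. (\<integral>z. p x * H z x \<partial>dA) \<partial>(dA \<Otimes>\<^sub>M dA)) = (\<integral>x. 0 \<partial>(dA \<Otimes>\<^sub>M dA))"
    by (rule Bochner_Integration.integral_cong) (simp_all add: zero)
  ultimately show "(\<integral>z. (\<integral>x. p x * H z x \<partial>(dA \<Otimes>\<^sub>M dA)) \<partial>dA) = 0" by simp
qed

text \<open>The support condition gives |1 - cnj \<zeta> z| >= 1 - r for every z in the open disc,
  so all kernels are bounded. The same r limits the region of integration in z.\<close>

locale kernel_weight =
  fixes r :: real and \<alpha> :: "complex \<Rightarrow> real"
  assumes r: "0 < r" "r < 1"
    and \<alpha>0: "\<And>\<zeta>. 0 \<le> \<alpha> \<zeta>"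
    and \<alpha>int: "integrable dA \<alpha>"
    and \<alpha>supp: "\<And>\<zeta>. \<zeta> \<notin> cball 0 r \<Longrightarrow> \<alpha> \<zeta> = 0"
begin

lemma \<alpha>_measurable [measurable]: "\<alpha> \<in> borel_measurable dA"
  using \<alpha>int by auto

lemma kernel_lower:
  assumes "cmod z < 1" "\<zeta> \<in> cball 0 r"
  shows "1 - r \<le> cmod (1 - cnj \<zeta> * z)"
  using kernel_bound(2)[of z \<zeta>] assms r by auto

lemma integrable_weight:
  fixes k :: "complex \<Rightarrow> 'b :: {banach, second_countable_topology}"
  assumes k: "k \<in> borel_measurable dA" and bd: "\<And>\<zeta>. \<zeta> \<in> cball 0 r \<Longrightarrow> norm (k \<zeta>) \<le> C"
  shows "integrable dA (\<lambda>\<zeta>. \<alpha> \<zeta> *\<^sub>R k \<zeta>)"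
proof (rule Bochner_Integration.integrable_bound[where f = "\<lambda>\<zeta>. C * \<alpha> \<zeta>"])
  show "integrable dA (\<lambda>\<zeta>. C * \<alpha> \<zeta>)" using \<alpha>int by simp
  show "AE \<zeta> in dA. norm (\<alpha> \<zeta> *\<^sub>R k \<zeta>) \<le> norm (C * \<alpha> \<zeta>)"
  proof (rule AE_I2)
    fix \<zeta>
    show "norm (\<alpha> \<zeta> *\<^sub>R k \<zeta>) \<le> norm (C * \<alpha> \<zeta>)"
    proof (cases "\<zeta> \<in> cball 0 r")
      case True
      have "norm (\<alpha> \<zeta> *\<^sub>R k \<zeta>) \<le> \<alpha> \<zeta> * C"
        using mult_left_mono[OF bd[OF True] \<alpha>0[of \<zeta>]] \<alpha>0 by simp
      also have "\<dots> \<le> norm (C * \<alpha> \<zeta>)" by (simp add: mult.commute)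
      finally show ?thesis .
    qed (simp add: \<alpha>supp)
  qed
qed (use k in measurable)

lemma integrable_weight_kernel:
  assumes z: "cmod z < 1" and h: "h \<in> borel_measurable dA" "\<And>\<zeta>. \<zeta> \<in> cball 0 r \<Longrightarrow> norm (h \<zeta>) \<le> C"
  shows "integrable dA (\<lambda>\<zeta>. of_real (\<alpha> \<zeta>) * (h \<zeta> * (1 / (1 - cnj \<zeta> * z)) ^ i * cnj (1 / (1 - cnj \<zeta> * z)) ^ j :: complex))"
proof -
  have "integrable dA (\<lambda>\<zeta>. \<alpha> \<zeta> *\<^sub>R (h \<zeta> * (1 / (1 - cnj \<zeta> * z)) ^ i * cnj (1 / (1 - cnj \<zeta> * z)) ^ j :: complex))"
  proof (rule integrable_weight[where C = "max C 0 * (1 / (1 - r)) ^ i * (1 / (1 - r)) ^ j"])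
    show "(\<lambda>\<zeta>. h \<zeta> * (1 / (1 - cnj \<zeta> * z)) ^ i * cnj (1 / (1 - cnj \<zeta> * z)) ^ j) \<in> borel_measurable dA"
      using h(1) by measurable
    fix \<zeta> :: complex assume \<zeta>: "\<zeta> \<in> cball 0 r"
    have "norm (1 / (1 - cnj \<zeta> * z)) \<le> 1 / (1 - r)"
      using kernel_lower[OF z \<zeta>] r by (simp add: norm_divide frac_le)
    then show "norm (h \<zeta> * (1 / (1 - cnj \<zeta> * z)) ^ i * cnj (1 / (1 - cnj \<zeta> * z)) ^ j)
      \<le> max C 0 * (1 / (1 - r)) ^ i * (1 / (1 - r)) ^ j"
      using h(2)[OF \<zeta>] r unfolding norm_mult norm_power complex_mod_cnj
      by (intro mult_mono power_mono mult_nonneg_nonneg zero_le_power) auto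
  qed
  then show ?thesis by (simp add: scaleR_conv_of_real)
qed

definition kernel_moment :: "(complex \<Rightarrow> complex) \<Rightarrow> nat \<Rightarrow> nat \<Rightarrow> complex \<Rightarrow> complex" where
  "kernel_moment h i j z = (\<integral>\<zeta>. of_real (\<alpha> \<zeta>) * (h \<zeta> * (1 / (1 - cnj \<zeta> * z)) ^ i * cnj (1 / (1 - cnj \<zeta> * z)) ^ j) \<partial>dA)"

text \<open>Integrate \<open>\<partial>R / \<partial>cnj z\<close> over \<open>|z| \<le> r\<close>, where \<open>d = r\<^sup>2 - |z|\<^sup>2\<close>, \<open>a\<^sub>\<zeta> = 1 / (1 - cnj \<zeta> z)\<close> and
  \<open>R = d\<^sup>2 cnj f |a\<^sub>\<zeta>|\<^sup>2 (f' |a\<^sub>\<eta>|\<^sup>2 + 2 f cnj \<eta> a\<^sub>\<eta> |a\<^sub>\<eta>|\<^sup>2) + d cnj z |f a\<^sub>\<zeta> a\<^sub>\<eta>|\<^sup>2\<close>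
  vanishes on the circle, and then integrate in \<open>\<zeta>\<close> and \<open>\<eta>\<close> against \<open>\<alpha>\<close>.\<close>

lemma divergence_identity:
  fixes f :: "complex \<Rightarrow> complex"
  assumes f: "f holomorphic_on disc"
  defines "J \<equiv> \<lambda>z. let d = of_real (r\<^sup>2) - z * cnj z; f' = deriv f z; \<Phi> = kernel_moment (\<lambda>_. 1) 1 1 z;
      D = kernel_moment cnj 2 1 z; D' = kernel_moment (\<lambda>\<zeta>. \<zeta>) 1 2 z; K = kernel_moment (\<lambda>\<zeta>. \<zeta> * cnj \<zeta>) 2 2 z in
     (- 2 * d * z * cnj (f z) * f' + d\<^sup>2 * f' * cnj f' + (d - z * cnj z) * f z * cnj (f z) + d * cnj z * f z * cnj f') * (\<Phi> * \<Phi>)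
     + (- 4 * d * z * f z * cnj (f z) + 2 * d\<^sup>2 * f z * cnj f') * (\<Phi> * D)
     + (d\<^sup>2 * cnj (f z) * f' + d * cnj z * f z * cnj (f z)) * (D' * \<Phi>)
     + (2 * d\<^sup>2 * f z * cnj (f z)) * (D' * D)
     + (d\<^sup>2 * cnj (f z) * f' + d * cnj z * f z * cnj (f z)) * (\<Phi> * D')
     + (2 * d\<^sup>2 * f z * cnj (f z)) * (\<Phi> * K)"
  shows "(\<integral>z. indicator (cball 0 r) z *\<^sub>R J z \<partial>dA) = 0"
    and "integrable dA (\<lambda>z. indicator (cball 0 r) z *\<^sub>R J z)"
proof -
  define a where "a \<zeta> z = 1 / (1 - cnj \<zeta> * z)" for \<zeta> z
  define d where "d z = of_real (r\<^sup>2) - z * cnj z" for z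
  \<comment> \<open>The cnj z derivative of R for fixed \<zeta> and \<eta>, arranged as six products
    of a coefficient in z, a function of \<zeta> and a function of \<eta>. In this form the double
    integral factors into kernel moments.\<close>
  define B where "B z \<zeta> \<eta> =
     (- 2 * d z * z * cnj (f z) * deriv f z + (d z)\<^sup>2 * deriv f z * cnj (deriv f z) + (d z - z * cnj z) * f z * cnj (f z) + d z * cnj z * f z * cnj (deriv f z)) * ((1 * a \<zeta> z ^ 1 * cnj (a \<zeta> z) ^ 1) * (1 * a \<eta> z ^ 1 * cnj (a \<eta> z) ^ 1))
     + (- 4 * d z * z * f z * cnj (f z) + 2 * (d z)\<^sup>2 * f z * cnj (deriv f z)) * ((1 * a \<zeta> z ^ 1 * cnj (a \<zeta> z) ^ 1) * (cnj \<eta> * a \<eta> z ^ 2 * cnj (a \<eta> z) ^ 1))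
     + ((d z)\<^sup>2 * cnj (f z) * deriv f z + d z * cnj z * f z * cnj (f z)) * ((\<zeta> * a \<zeta> z ^ 1 * cnj (a \<zeta> z) ^ 2) * (1 * a \<eta> z ^ 1 * cnj (a \<eta> z) ^ 1))
     + (2 * (d z)\<^sup>2 * f z * cnj (f z)) * ((\<zeta> * a \<zeta> z ^ 1 * cnj (a \<zeta> z) ^ 2) * (cnj \<eta> * a \<eta> z ^ 2 * cnj (a \<eta> z) ^ 1))
     + ((d z)\<^sup>2 * cnj (f z) * deriv f z + d z * cnj z * f z * cnj (f z)) * ((1 * a \<zeta> z ^ 1 * cnj (a \<zeta> z) ^ 1) * (\<eta> * a \<eta> z ^ 1 * cnj (a \<eta> z) ^ 2))
     + (2 * (d z)\<^sup>2 * f z * cnj (f z)) * ((1 * a \<zeta> z ^ 1 * cnj (a \<zeta> z) ^ 1) * ((\<eta> * cnj \<eta>) * a \<eta> z ^ 2 * cnj (a \<eta> z) ^ 2))"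
    for z \<zeta> \<eta>
  have f': "deriv f holomorphic_on disc" by (rule holomorphic_deriv[OF f open_disc])
  have cb: "cball 0 r \<subseteq> disc" using r by auto
  have moment: "continuous_on (cball 0 r) f" "continuous_on (cball 0 r) (deriv f)"
    using f f' cb holomorphic_on_imp_continuous_on continuous_on_subset by blast+
  have ne: "1 - cnj \<zeta> * z \<noteq> 0" if "z \<in> cball 0 r" "\<zeta> \<in> cball 0 r" for z \<zeta>
    using kernel_bound(4)[of z \<zeta>] that r by auto

  have B0: "(\<integral>z. indicator (cball 0 r) z *\<^sub>R B z \<zeta> \<eta> \<partial>dA) = 0"
    if \<zeta>: "\<zeta> \<in> cball 0 r" and \<eta>: "\<eta> \<in> cball 0 r" for \<zeta> \<eta>
  proof -
    \<comment> \<open>X and Y are analytic, and R = d^2 X cnj Y + d Y cnj (z Y), so only d and the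
      conjugated factors contribute to the cnj z derivative.\<close>
    define X where "X z = a \<zeta> z * (deriv f z * a \<eta> z + 2 * f z * (cnj \<eta> * (a \<eta> z)\<^sup>2))" for z
    define Y where "Y z = f z * a \<zeta> z * a \<eta> z" for z
    define Y' where "Y' z = deriv f z * a \<zeta> z * a \<eta> z + f z * (cnj \<zeta> * (a \<zeta> z)\<^sup>2 * a \<eta> z + cnj \<eta> * a \<zeta> z * (a \<eta> z)\<^sup>2)" for z
    have ha: "a \<xi> holomorphic_on ball 0 (1 / r)" if "\<xi> \<in> cball 0 r" for \<xi>
    proof -
      have "1 - cnj \<xi> * z \<noteq> 0" if "z \<in> ball 0 (1 / r)" for z
      proof
        assume "1 - cnj \<xi> * z = 0"
        then have "cnj \<xi> * z = 1" by simp
        then have "cmod \<xi> * cmod z = 1" by (metis complex_mod_cnj norm_mult norm_one)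
        moreover have "cmod \<xi> * cmod z < 1"
        proof -
          have "cmod \<xi> * cmod z \<le> r * cmod z" using \<open>\<xi> \<in> cball 0 r\<close> by (intro mult_right_mono) auto
          also have "\<dots> < 1" using \<open>z \<in> ball 0 (1 / r)\<close> r by (simp add: field_simps)
          finally show ?thesis .
        qed
        ultimately show False by simp
      qed
      then show ?thesis unfolding a_def[abs_def] by (intro holomorphic_intros) auto
    qed
    have "1 \<le> 1 / r" using r by simp
    then have dsub: "disc \<subseteq> ball 0 (1 / r)" unfolding disc_def by (rule subset_ball)
    have ha': "a \<xi> holomorphic_on disc" if "\<xi> \<in> cball 0 r" for \<xi>
      using ha[OF that] dsub holomorphic_on_subset by blast
    have da: "(a \<xi> has_field_derivative cnj \<xi> * (a \<xi> z)\<^sup>2) (at z)" if "\<xi> \<in> cball 0 r" "z \<in> cball 0 r" for \<xi> z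
      unfolding a_def using ne[OF that(2,1)]
      by (auto intro!: derivative_eq_intros simp: power2_eq_square field_simps)
    have hX: "X holomorphic_on disc" and hY: "Y holomorphic_on disc"
      unfolding X_def[abs_def] Y_def[abs_def] by (intro holomorphic_intros f f' ha' \<zeta> \<eta>)+
    have zd: "z \<in> disc" if "z \<in> cball 0 r" for z using that cb by blast
    have df: "(f has_field_derivative deriv f z) (at z)" if "z \<in> cball 0 r" for z
      using holomorphic_derivI[OF f open_disc zd[OF that]] .
    have dX: "(X has_field_derivative deriv X z) (at z)" if "z \<in> cball 0 r" for z
      using holomorphic_derivI[OF hX open_disc zd[OF that]] .
    have dY: "(Y has_field_derivative Y' z) (at z)" if "z \<in> cball 0 r" for z
      unfolding Y_def[abs_def] Y'_def
      by (rule derivative_eq_intros df[OF that] da[OF \<zeta> that] da[OF \<eta> that] refl)+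
         (simp add: algebra_simps power2_eq_square)
    have dd: "wirtinger d (- cnj z) (- z) z" for z
    proof -
      have "wirtinger (\<lambda>z. of_real (r\<^sup>2) - z * cnj z) (0 - (z * 0 + 1 * cnj z)) (0 - (z * cnj 1 + 0 * cnj z)) z"
        by (intro wirtinger_diff wirtinger_mult wirtinger_const wirtinger_holo wirtinger_antiholo DERIV_ident)
      then show ?thesis by (simp add: d_def[abs_def])
    qed
    let ?R = "\<lambda>z. (d z * d z) * (X z * cnj (Y z)) + d z * (Y z * cnj (z * Y z))"
    let ?A = "\<lambda>z. ((d z * d z) * (X z * 0 + deriv X z * cnj (Y z)) + (d z * (- cnj z) + (- cnj z) * d z) * (X z * cnj (Y z)))
          + (d z * (Y z * 0 + Y' z * cnj (z * Y z)) + (- cnj z) * (Y z * cnj (z * Y z)))"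
    let ?B = "\<lambda>z. ((d z * d z) * (X z * cnj (Y' z) + 0 * cnj (Y z)) + (d z * (- z) + (- z) * d z) * (X z * cnj (Y z)))
          + (d z * (Y z * cnj (z * Y' z + 1 * Y z) + 0 * cnj (z * Y z)) + (- z) * (Y z * cnj (z * Y z)))"
    have cX: "continuous_on (cball 0 r) X" "continuous_on (cball 0 r) (deriv X)" "continuous_on (cball 0 r) Y"
      using hX hY holomorphic_deriv[OF hX open_disc] cb holomorphic_on_imp_continuous_on continuous_on_subset by blast+
    have ca: "continuous_on (cball 0 r) (a \<xi>)" if "\<xi> \<in> cball 0 r" for \<xi>
      using ha'[OF that] cb holomorphic_on_imp_continuous_on continuous_on_subset by blast
    have cY': "continuous_on (cball 0 r) Y'"
      unfolding Y'_def[abs_def] by (intro continuous_intros moment ca \<zeta> \<eta>)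
    have cd: "continuous_on (cball 0 r) d"
      unfolding d_def[abs_def] by (intro continuous_intros)
    have "(\<integral>z. indicator (cball 0 r) z *\<^sub>R ?B z \<partial>dA) = 0"
    proof (rule integral_dA_cball_dbar_eq_0[OF r, where R = ?R and A = ?A])
      fix z :: complex assume z: "z \<in> cball 0 r"
      have "wirtinger ?R (?A z) (?B z) z"
        by (intro wirtinger_add wirtinger_mult wirtinger_holo wirtinger_antiholo dd dX[OF z] dY[OF z]
            DERIV_mult' DERIV_ident)
      then show "(?R has_derivative (\<lambda>h. ?A z * h + ?B z * cnj h)) (at z)"
        by (simp only: wirtinger_def)
    next
      fix z :: complex assume "cmod z = r"
      then have "d z = 0" by (simp add: d_def complex_norm_square[symmetric] flip: of_real_power)
      then show "?R z = 0" by simp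
    qed (intro continuous_intros cX cY' cd)+
    moreover have "?B z = B z \<zeta> \<eta>" for z
      unfolding X_def Y_def Y'_def B_def by (simp add: power2_eq_square algebra_simps)
    ultimately show ?thesis by simp
  qed

  \<comment> \<open>Cutting off in all three variables makes the integrand bounded by compactness.
    The cut-offs in \<zeta> and \<eta> are invisible after multiplication by \<alpha>.\<close>
  define H where "H z x = (indicator (cball 0 r) z * indicator (cball 0 r) (fst x) * indicator (cball 0 r) (snd x)) *\<^sub>R B z (fst x) (snd x)"
    for z :: complex and x :: "complex \<times> complex"
  have fm [measurable]: "f \<in> borel_measurable dA" "deriv f \<in> borel_measurable dA"
    using f f' by (auto intro: holomorphic_measurable_dA)
  have cbm [measurable]: "cball 0 r \<in> sets dA" using r by (intro cball_sets_dA)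
  have Bm: "(\<lambda>(z, x). B z (fst x) (snd x)) \<in> borel_measurable (dA \<Otimes>\<^sub>M (dA \<Otimes>\<^sub>M dA))"
    unfolding B_def a_def d_def by measurable
  have Hm: "(\<lambda>(z, x). H z x) \<in> borel_measurable (dA \<Otimes>\<^sub>M (dA \<Otimes>\<^sub>M dA))"
    unfolding H_def using Bm by measurable
  obtain C where C: "\<And>z \<zeta> \<eta>. z \<in> cball 0 r \<Longrightarrow> \<zeta> \<in> cball 0 r \<Longrightarrow> \<eta> \<in> cball 0 r \<Longrightarrow> norm (B z \<zeta> \<eta>) \<le> C"
  proof -
    let ?S = "cball 0 r \<times> (cball 0 r \<times> cball (0::complex) r)"
    have cfst: "continuous_on ?S (\<lambda>x. f (fst x))" "continuous_on ?S (\<lambda>x. deriv f (fst x))"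
      by (rule continuous_on_compose2[OF moment(1) continuous_on_fst[OF continuous_on_id]], force,
          rule continuous_on_compose2[OF moment(2) continuous_on_fst[OF continuous_on_id]], force)
    have ca: "continuous_on ?S (\<lambda>x. a (fst (snd x)) (fst x))" "continuous_on ?S (\<lambda>x. a (snd (snd x)) (fst x))"
      unfolding a_def
      by (rule continuous_on_divide;
          (intro continuous_on_diff continuous_on_mult continuous_on_cnj continuous_on_const
             continuous_on_fst continuous_on_snd continuous_on_id)?; (rule ballI, rule ne, force, force)?)+
    have "continuous_on ?S (\<lambda>x. B (fst x) (fst (snd x)) (snd (snd x)))"
      unfolding B_def d_def
      by (intro continuous_on_add continuous_on_diff continuous_on_mult continuous_on_minus continuous_on_power
          continuous_on_cnj continuous_on_const cfst ca continuous_on_fst continuous_on_snd continuous_on_id)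
    then have "bounded ((\<lambda>x. B (fst x) (fst (snd x)) (snd (snd x))) ` ?S)"
      by (intro compact_imp_bounded compact_continuous_image compact_Times compact_cball)
    then obtain C where "\<forall>y\<in>(\<lambda>x. B (fst x) (fst (snd x)) (snd (snd x))) ` ?S. norm y \<le> C"
      unfolding bounded_iff by blast
    then have "norm (B z \<zeta> \<eta>) \<le> C" if "z \<in> cball 0 r" "\<zeta> \<in> cball 0 r" "\<eta> \<in> cball 0 r" for z \<zeta> \<eta>
      using image_eqI[of "B z \<zeta> \<eta>" "\<lambda>x. B (fst x) (fst (snd x)) (snd (snd x))" "(z, \<zeta>, \<eta>)" ?S] that by simp
    then show ?thesis by (rule that)
  qed
  have Hb: "norm (H z x) \<le> max C 0" for z x
    using C[of z "fst x" "snd x"] by (auto simp: H_def indicator_def le_max_iff_disj)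
  have H0: "(\<integral>z. H z x \<partial>dA) = 0" for x
    using B0[of "fst x" "snd x"] by (simp add: H_def indicator_def scaleR_conv_of_real mult.assoc)
  have ai: "integrable dA (\<lambda>\<zeta>. complex_of_real (\<alpha> \<zeta>))" using \<alpha>int by simp
  have zero: "(\<integral>z. (\<integral>x. (of_real (\<alpha> (fst x)) * of_real (\<alpha> (snd x))) * H z x \<partial>(dA \<Otimes>\<^sub>M dA)) \<partial>dA) = 0"
    by (rule Fubini_vanishing(1)[OF integral_pair_mult(1)[OF ai ai] Hm Hb H0])
  have int: "integrable dA (\<lambda>z. \<integral>x. (of_real (\<alpha> (fst x)) * of_real (\<alpha> (snd x))) * H z x \<partial>(dA \<Otimes>\<^sub>M dA))"
    by (rule Fubini_vanishing(2)[OF integral_pair_mult(1)[OF ai ai] Hm Hb H0])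
  have eq: "(\<integral>x. (of_real (\<alpha> (fst x)) * of_real (\<alpha> (snd x))) * H z x \<partial>(dA \<Otimes>\<^sub>M dA)) = indicator (cball 0 r) z *\<^sub>R J z"
    if z: "z \<in> disc" for z :: complex
  proof (cases "z \<in> cball 0 r")
    case True
    have z1: "cmod z < 1" using that by simp
    let ?k = "\<lambda>h i j \<zeta>. of_real (\<alpha> \<zeta>) * (h \<zeta> * a \<zeta> z ^ i * cnj (a \<zeta> z) ^ j)"
    have cn1: "norm (cnj \<zeta>) \<le> 1" "norm \<zeta> \<le> 1" "norm (\<zeta> * cnj \<zeta>) \<le> 1" "norm (1 :: complex) \<le> 1"
      if "\<zeta> \<in> cball 0 r" for \<zeta>
      using that r mult_le_one[of "cmod \<zeta>" "cmod \<zeta>"] by (auto simp: norm_mult)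
    have i: "integrable dA (?k (\<lambda>_. 1) i j)" "integrable dA (?k cnj i j)" "integrable dA (?k (\<lambda>\<zeta>. \<zeta>) i j)"
      "integrable dA (?k (\<lambda>\<zeta>. \<zeta> * cnj \<zeta>) i j)" for i j
    proof -
      have hm: "(\<lambda>_. 1) \<in> borel_measurable dA" "cnj \<in> borel_measurable dA"
        "(\<lambda>\<zeta>. \<zeta>) \<in> borel_measurable dA" "(\<lambda>\<zeta>. \<zeta> * cnj \<zeta>) \<in> borel_measurable dA"
        by (rule measurable_dA; simp)+
      show "integrable dA (?k (\<lambda>_. 1) i j)" "integrable dA (?k cnj i j)" "integrable dA (?k (\<lambda>\<zeta>. \<zeta>) i j)"
        "integrable dA (?k (\<lambda>\<zeta>. \<zeta> * cnj \<zeta>) i j)"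
        unfolding a_def
        by (rule integrable_weight_kernel[OF z1 hm(1), where C = 1], erule cn1(4),
            rule integrable_weight_kernel[OF z1 hm(2), where C = 1], erule cn1(1),
            rule integrable_weight_kernel[OF z1 hm(3), where C = 1], erule cn1(2),
            rule integrable_weight_kernel[OF z1 hm(4), where C = 1], erule cn1(3))
    qed
    have kernel_moment: "(\<integral>\<zeta>. ?k h i j \<zeta> \<partial>dA) = kernel_moment h i j z" for h i j
      by (simp add: kernel_moment_def a_def)
    note pm = integral_pair_mult[OF i(1) i(1)] integral_pair_mult[OF i(1) i(2)] integral_pair_mult[OF i(3) i(1)]
      integral_pair_mult[OF i(3) i(2)] integral_pair_mult[OF i(1) i(3)] integral_pair_mult[OF i(1) i(4)]
    let ?p = "\<lambda>h i j h' i' j' x. ?k h i j (fst x) * ?k h' i' j' (snd x)"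
    let ?c1 = "- 2 * d z * z * cnj (f z) * deriv f z + (d z)\<^sup>2 * deriv f z * cnj (deriv f z) + (d z - z * cnj z) * f z * cnj (f z) + d z * cnj z * f z * cnj (deriv f z)"
    let ?c2 = "- 4 * d z * z * f z * cnj (f z) + 2 * (d z)\<^sup>2 * f z * cnj (deriv f z)"
    let ?c3 = "(d z)\<^sup>2 * cnj (f z) * deriv f z + d z * cnj z * f z * cnj (f z)"
    let ?c4 = "2 * (d z)\<^sup>2 * f z * cnj (f z)"
    have "(of_real (\<alpha> (fst x)) * of_real (\<alpha> (snd x))) * H z x =
        ?c1 * ?p (\<lambda>_. 1) 1 1 (\<lambda>_. 1) 1 1 x + ?c2 * ?p (\<lambda>_. 1) 1 1 cnj 2 1 x + ?c3 * ?p (\<lambda>\<zeta>. \<zeta>) 1 2 (\<lambda>_. 1) 1 1 x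
        + ?c4 * ?p (\<lambda>\<zeta>. \<zeta>) 1 2 cnj 2 1 x + ?c3 * ?p (\<lambda>_. 1) 1 1 (\<lambda>\<zeta>. \<zeta>) 1 2 x
        + ?c4 * ?p (\<lambda>_. 1) 1 1 (\<lambda>\<zeta>. \<zeta> * cnj \<zeta>) 2 2 x" (is "?l x = ?r x") for x
    proof (cases "fst x \<in> cball 0 r \<and> snd x \<in> cball 0 r")
      case t: True
      have "?l x = of_real (\<alpha> (fst x)) * of_real (\<alpha> (snd x)) * B z (fst x) (snd x)"
        using t True by (simp add: H_def)
      also have "\<dots> = ?r x" unfolding B_def by (simp only: distrib_left mult_ac)
      finally show ?thesis .
    next
      case False
      then have "\<alpha> (fst x) = 0 \<or> \<alpha> (snd x) = 0" using \<alpha>supp by blast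
      then show ?thesis by auto
    qed
    then have "(\<integral>x. ?l x \<partial>(dA \<Otimes>\<^sub>M dA)) = (\<integral>x. ?r x \<partial>(dA \<Otimes>\<^sub>M dA))" by simp
    also have "\<dots> = J z"
      unfolding J_def Let_def d_def[symmetric]
      by (simp only: Bochner_Integration.integral_add Bochner_Integration.integrable_add integrable_mult_right pm
          integral_mult_right_zero kernel_moment)
    finally show ?thesis using True by simp
  qed (simp add: H_def)
  then have "(\<integral>z. indicator (cball 0 r) z *\<^sub>R J z \<partial>dA)
    = (\<integral>z. (\<integral>x. (of_real (\<alpha> (fst x)) * of_real (\<alpha> (snd x))) * H z x \<partial>(dA \<Otimes>\<^sub>M dA)) \<partial>dA)"
    by (intro Bochner_Integration.integral_cong) auto
  then show "(\<integral>z. indicator (cball 0 r) z *\<^sub>R J z \<partial>dA) = 0" using zero by simp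
  show "integrable dA (\<lambda>z. indicator (cball 0 r) z *\<^sub>R J z)"
    using int eq by (subst (asm) Bochner_Integration.integrable_cong[OF refl]) auto
qed

end

text \<open>The difference of the two sides is \<open>|d G - cnj z f \<Phi> / 2|\<^sup>2\<close> with \<open>G = f' \<Phi> + 2 f D\<close>.\<close>

lemma Re_divergence_ge:
  fixes z f f' D :: complex and \<Phi> K d :: real
  shows "2 * d\<^sup>2 * (cmod f)\<^sup>2 * (\<Phi> * K - (cmod D)\<^sup>2) + (d - 5 / 4 * (cmod z)\<^sup>2) * (cmod f)\<^sup>2 * \<Phi>\<^sup>2
    \<le> Re ((- 2 * of_real d * z * cnj f * f' + (of_real d)\<^sup>2 * f' * cnj f' + (of_real d - z * cnj z) * f * cnj f + of_real d * cnj z * f * cnj f') * (of_real \<Phi> * of_real \<Phi>)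
     + (- 4 * of_real d * z * f * cnj f + 2 * (of_real d)\<^sup>2 * f * cnj f') * (of_real \<Phi> * D)
     + ((of_real d)\<^sup>2 * cnj f * f' + of_real d * cnj z * f * cnj f) * (cnj D * of_real \<Phi>)
     + (2 * (of_real d)\<^sup>2 * f * cnj f) * (cnj D * D)
     + ((of_real d)\<^sup>2 * cnj f * f' + of_real d * cnj z * f * cnj f) * (of_real \<Phi> * cnj D)
     + (2 * (of_real d)\<^sup>2 * f * cnj f) * (of_real \<Phi> * of_real K))" (is "?l \<le> Re ?J")
proof -
  define G where "G = f' * of_real \<Phi> + 2 * f * D"
  have "Re ?J = ?l + (cmod (of_real d * G - cnj z * f * of_real \<Phi> / 2))\<^sup>2"
    unfolding G_def cmod_power2
    by (cases z; cases f; cases f'; cases D) (simp add: power2_eq_square field_simps)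
  then show ?thesis by simp
qed

lemma of_real_cmod_square: "(complex_of_real (cmod x))\<^sup>2 = x * cnj x"
  using complex_norm_square[of x] by simp

section \<open>Variance of the kernel and the Hardy type inequality\<close>

context kernel_weight
begin

lemma integrable_weight_real:
  fixes k :: "complex \<Rightarrow> real"
  assumes "k \<in> borel_measurable dA" "\<And>\<zeta>. \<zeta> \<in> cball 0 r \<Longrightarrow> \<bar>k \<zeta>\<bar> \<le> C"
  shows "integrable dA (\<lambda>\<zeta>. \<alpha> \<zeta> * k \<zeta>)"
  using integrable_weight[of k C] assms by simp

lemma integrable_weight_complex:
  fixes k :: "complex \<Rightarrow> complex"
  assumes "k \<in> borel_measurable dA" "\<And>\<zeta>. \<zeta> \<in> cball 0 r \<Longrightarrow> cmod (k \<zeta>) \<le> C"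
  shows "integrable dA (\<lambda>\<zeta>. of_real (\<alpha> \<zeta>) * k \<zeta>)"
  using integrable_weight[of k C] assms by (simp add: scaleR_conv_of_real)

lemma integral_weight_mono:
  fixes k k' :: "complex \<Rightarrow> real"
  assumes "integrable dA (\<lambda>\<zeta>. \<alpha> \<zeta> * k \<zeta>)" "integrable dA (\<lambda>\<zeta>. \<alpha> \<zeta> * k' \<zeta>)"
    and "\<And>\<zeta>. \<zeta> \<in> cball 0 r \<Longrightarrow> k \<zeta> \<le> k' \<zeta>"
  shows "(\<integral>\<zeta>. \<alpha> \<zeta> * k \<zeta> \<partial>dA) \<le> (\<integral>\<zeta>. \<alpha> \<zeta> * k' \<zeta> \<partial>dA)"
proof (rule integral_mono[OF assms(1,2)])
  fix \<zeta> show "\<alpha> \<zeta> * k \<zeta> \<le> \<alpha> \<zeta> * k' \<zeta>"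
    using assms(3)[of \<zeta>] \<alpha>0[of \<zeta>] \<alpha>supp[of \<zeta>] by (cases "\<zeta> \<in> cball 0 r") (auto intro: mult_left_mono)
qed

text \<open>For the weight \<alpha> / |w|^2, with w = 1 - cnj \<zeta> z and y = cnj \<zeta> / w,
  this is the integral of |y|^2 and \<open>kernel_vector\<close> is that of y; \<open>Phi\<close> is
  the total mass.\<close>

definition kernel_energy :: "complex \<Rightarrow> real" where
  "kernel_energy z = (\<integral>\<zeta>. \<alpha> \<zeta> * ((cmod \<zeta>)\<^sup>2 / (cmod (1 - cnj \<zeta> * z)) ^ 4) \<partial>dA)"

definition kernel_vector :: "complex \<Rightarrow> complex" where
  "kernel_vector z = (\<integral>\<zeta>. of_real (\<alpha> \<zeta>) * (cnj \<zeta> / ((1 - cnj \<zeta> * z) * of_real ((cmod (1 - cnj \<zeta> * z))\<^sup>2))) \<partial>dA)"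

lemma kernel_moment_Phi: "kernel_moment (\<lambda>_. 1) 1 1 z = of_real (Phi \<alpha> z)"
  unfolding kernel_moment_def Phi_def integral_complex_of_real[symmetric]
  by (rule Bochner_Integration.integral_cong) (simp_all add: of_real_cmod_square)

lemma kernel_moment_D: "kernel_moment cnj 2 1 z = kernel_vector z"
  unfolding kernel_moment_def kernel_vector_def
  by (rule Bochner_Integration.integral_cong)
     (simp_all add: of_real_cmod_square, simp add: power2_eq_square mult_ac)

lemma kernel_moment_cnj_D: "kernel_moment (\<lambda>\<zeta>. \<zeta>) 1 2 z = cnj (kernel_vector z)"
  unfolding kernel_moment_def kernel_moment_D[symmetric] Bochner_Integration.integral_cnj[symmetric]
  by (rule Bochner_Integration.integral_cong) (simp_all add: mult_ac)

lemma kernel_moment_K: "kernel_moment (\<lambda>\<zeta>. \<zeta> * cnj \<zeta>) 2 2 z = of_real (kernel_energy z)"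
proof -
  have *: "complex_of_real (cmod x ^ 4) = (x * cnj x) * (x * cnj x)" for x
  proof -
    have "cmod x ^ 4 = (cmod x)\<^sup>2 * (cmod x)\<^sup>2" by (simp flip: power_add)
    then show ?thesis by (simp only: of_real_mult complex_norm_square)
  qed
  show ?thesis
    unfolding kernel_moment_def kernel_energy_def integral_complex_of_real[symmetric] of_real_mult of_real_divide * complex_norm_square
    by (rule Bochner_Integration.integral_cong) (simp_all add: power_divide power2_eq_square mult_ac)
qed

lemma kernel_facts:
  assumes z: "cmod z < 1" and \<zeta>: "\<zeta> \<in> cball 0 r"
  defines "w \<equiv> cmod (1 - cnj \<zeta> * z)"
  shows "0 < w" "w \<le> 2" "1 / w \<le> 1 / (1 - r)" "0 \<le> 1 - (cmod \<zeta>)\<^sup>2" "1 - (cmod \<zeta>)\<^sup>2 \<le> 2 * w" "1 - (cmod \<zeta>)\<^sup>2 \<le> 1"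
proof -
  have \<zeta>1: "cmod \<zeta> < 1" using \<zeta> r by auto
  show w0: "0 < w" unfolding w_def using kernel_bound(4)[OF z \<zeta>1] by simp
  show "w \<le> 2" unfolding w_def by (rule kernel_bound(3)[OF z \<zeta>1])
  show "1 / w \<le> 1 / (1 - r)" unfolding w_def using kernel_lower[OF z \<zeta>] r by (intro frac_le) auto
  show "0 \<le> 1 - (cmod \<zeta>)\<^sup>2" using \<zeta>1 by (simp add: power_le_one)
  have "1 - (cmod \<zeta>)\<^sup>2 = (1 - cmod \<zeta>) * (1 + cmod \<zeta>)" by (simp add: power2_eq_square algebra_simps)
  also have "\<dots> \<le> w * 2"
    unfolding w_def using kernel_bound(2)[OF z \<zeta>1] \<zeta>1 by (intro mult_mono) auto
  finally show "1 - (cmod \<zeta>)\<^sup>2 \<le> 2 * w" by simp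
  show "1 - (cmod \<zeta>)\<^sup>2 \<le> 1" by simp
qed

lemma integrable_Phi: "cmod z < 1 \<Longrightarrow> integrable dA (\<lambda>\<zeta>. \<alpha> \<zeta> * (1 / (cmod (1 - cnj \<zeta> * z))\<^sup>2))"
proof (rule integrable_weight_real[where C = "(1 / (1 - r))\<^sup>2"])
  fix \<zeta> :: complex assume "cmod z < 1" "\<zeta> \<in> cball 0 r"
  from power_mono[OF kernel_facts(3)[OF this], of 2] kernel_facts(1)[OF this]
  show "\<bar>1 / (cmod (1 - cnj \<zeta> * z))\<^sup>2\<bar> \<le> (1 / (1 - r))\<^sup>2" by (simp add: power_divide)
qed measurable

lemma Phi_eq: "Phi \<alpha> z = (\<integral>\<zeta>. \<alpha> \<zeta> * (1 / (cmod (1 - cnj \<zeta> * z))\<^sup>2) \<partial>dA)"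
  by (simp add: Phi_def)

lemma Theta_eq: "Theta \<alpha> z = (\<integral>\<zeta>. \<alpha> \<zeta> * ((1 - (cmod \<zeta>)\<^sup>2) / (cmod (1 - cnj \<zeta> * z)) ^ 3) \<partial>dA)"
  by (simp add: Theta_def)

lemma Berg_eq: "Berg \<alpha> z = (\<integral>\<zeta>. of_real (\<alpha> \<zeta>) * (cnj \<zeta> / (1 - cnj \<zeta> * z)\<^sup>2) \<partial>dA)"
  by (simp add: Berg_def)

lemma integrable_Theta: "cmod z < 1 \<Longrightarrow> integrable dA (\<lambda>\<zeta>. \<alpha> \<zeta> * ((1 - (cmod \<zeta>)\<^sup>2) / (cmod (1 - cnj \<zeta> * z)) ^ 3))"
proof (rule integrable_weight_real[where C = "(1 / (1 - r)) ^ 3"])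
  fix \<zeta> :: complex assume a: "cmod z < 1" "\<zeta> \<in> cball 0 r"
  from power_mono[OF kernel_facts(3)[OF a], of 3] kernel_facts(1)[OF a]
  have "1 / (cmod (1 - cnj \<zeta> * z)) ^ 3 \<le> (1 / (1 - r)) ^ 3" by (simp add: power_divide)
  moreover have "(1 - (cmod \<zeta>)\<^sup>2) * (1 / (cmod (1 - cnj \<zeta> * z)) ^ 3) \<le> 1 * (1 / (cmod (1 - cnj \<zeta> * z)) ^ 3)"
    using kernel_facts[OF a] by (intro mult_right_mono) auto
  moreover have "0 \<le> (1 - (cmod \<zeta>)\<^sup>2) / (cmod (1 - cnj \<zeta> * z)) ^ 3"
    using kernel_facts[OF a] by simp
  ultimately show "\<bar>(1 - (cmod \<zeta>)\<^sup>2) / (cmod (1 - cnj \<zeta> * z)) ^ 3\<bar> \<le> (1 / (1 - r)) ^ 3" by simp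
qed measurable

lemma kernel_sq_bound:
  assumes "cmod z < 1" "\<zeta> \<in> cball 0 r"
  shows "1 / (cmod (1 - cnj \<zeta> * z))\<^sup>2 \<le> (1 / (1 - r))\<^sup>2"
  using power_mono[OF kernel_facts(3)[OF assms], of 2] kernel_facts(1)[OF assms] by (simp add: power_divide)

lemma Phi_le:
  assumes "cmod z < 1"
  shows "Phi \<alpha> z \<le> (\<integral>\<zeta>. \<alpha> \<zeta> \<partial>dA) * (1 / (1 - r))\<^sup>2"
proof -
  have "Phi \<alpha> z \<le> (\<integral>\<zeta>. \<alpha> \<zeta> * (1 / (1 - r))\<^sup>2 \<partial>dA)"
    unfolding Phi_eq using \<alpha>int
    by (intro integral_weight_mono integrable_Phi assms kernel_sq_bound) simp
  then show ?thesis by simp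
qed

lemma Berg_le:
  assumes z: "cmod z < 1"
  shows "cmod (Berg \<alpha> z) \<le> (\<integral>\<zeta>. \<alpha> \<zeta> \<partial>dA) * (1 / (1 - r))\<^sup>2"
proof -
  have *: "cmod \<zeta> / (cmod (1 - cnj \<zeta> * z))\<^sup>2 \<le> (1 / (1 - r))\<^sup>2" if \<zeta>: "\<zeta> \<in> cball 0 r" for \<zeta>
  proof -
    have "cmod \<zeta> / (cmod (1 - cnj \<zeta> * z))\<^sup>2 \<le> 1 / (cmod (1 - cnj \<zeta> * z))\<^sup>2"
      using \<zeta> r by (intro divide_right_mono) auto
    then show ?thesis using kernel_sq_bound[OF z \<zeta>] by linarith
  qed
  have "cmod (Berg \<alpha> z) \<le> (\<integral>\<zeta>. \<alpha> \<zeta> * (cmod \<zeta> / (cmod (1 - cnj \<zeta> * z))\<^sup>2) \<partial>dA)"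
    unfolding Berg_eq using integral_norm_bound[of dA "\<lambda>\<zeta>. of_real (\<alpha> \<zeta>) * (cnj \<zeta> / (1 - cnj \<zeta> * z)\<^sup>2)"] \<alpha>0
    by (simp add: norm_mult norm_divide norm_power)
  also have "\<dots> \<le> (\<integral>\<zeta>. \<alpha> \<zeta> * (1 / (1 - r))\<^sup>2 \<partial>dA)"
    by (rule integral_weight_mono; (rule integrable_weight_real[where C = "(1 / (1 - r))\<^sup>2"], measurable)?)
       (use * in \<open>auto simp del: power_divide\<close>)
  finally show ?thesis by simp
qed

lemma Phi_nonneg: "0 \<le> Phi \<alpha> z"
  unfolding Phi_eq using \<alpha>0 by (intro integral_nonneg_AE AE_I2) simp

lemma Theta_bounds:
  assumes "cmod z < 1"
  shows "0 \<le> Theta \<alpha> z" "Theta \<alpha> z \<le> 2 * Phi \<alpha> z"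
proof -
  have "(\<integral>\<zeta>. \<alpha> \<zeta> * 0 \<partial>dA) \<le> Theta \<alpha> z" unfolding Theta_eq
    using kernel_facts[OF assms] by (intro integral_weight_mono integrable_Theta assms) auto
  then show "0 \<le> Theta \<alpha> z" by simp
  have "Theta \<alpha> z \<le> (\<integral>\<zeta>. \<alpha> \<zeta> * (2 * (1 / (cmod (1 - cnj \<zeta> * z))\<^sup>2)) \<partial>dA)"
    unfolding Theta_eq
  proof (rule integral_weight_mono[OF integrable_Theta[OF assms]])
    show "integrable dA (\<lambda>\<zeta>. \<alpha> \<zeta> * (2 * (1 / (cmod (1 - cnj \<zeta> * z))\<^sup>2)))"
      using integrable_mult_right[OF integrable_Phi[OF assms], of 2] by (simp add: mult_ac)
    fix \<zeta> :: complex assume "\<zeta> \<in> cball 0 r"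
    note k = kernel_facts[OF assms this]
    show "(1 - (cmod \<zeta>)\<^sup>2) / (cmod (1 - cnj \<zeta> * z)) ^ 3 \<le> 2 * (1 / (cmod (1 - cnj \<zeta> * z))\<^sup>2)"
    proof -
      have "(1 - (cmod \<zeta>)\<^sup>2) / cmod (1 - cnj \<zeta> * z) \<le> 2" using k by (simp add: pos_divide_le_eq)
      from mult_right_mono[OF this, of "1 / (cmod (1 - cnj \<zeta> * z))\<^sup>2"]
      show ?thesis by (simp add: power2_eq_square power3_eq_cube)
    qed
  qed
  also have "\<dots> = 2 * Phi \<alpha> z" unfolding Phi_eq integral_mult_right_zero[symmetric] by (simp add: mult_ac)
  finally show "Theta \<alpha> z \<le> 2 * Phi \<alpha> z" .
qed

text \<open>With \<open>w = 1 - cnj \<zeta> z\<close> one has \<open>(r\<^sup>2 - |z|\<^sup>2) cnj \<zeta> / w = cnj z + A - b\<close>, where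
  \<open>A = r\<^sup>2 cnj \<zeta> cnj w / w\<close> and \<open>b = cnj z (1 - r\<^sup>2 |\<zeta>|\<^sup>2) / w\<close> is controlled by \<open>Theta\<close>; the right-hand side is \<open>\<Phi>\<^sup>2\<close> times the
  variance of this quantity for the weight \<open>\<alpha> / |w|\<^sup>2\<close>, and the mean of \<open>A\<close> gives \<open>Berg\<close>.\<close>

lemma variance_bound:
  assumes z: "z \<in> cball 0 r"
  shows "r ^ 4 * (Phi \<alpha> z)\<^sup>2 - 18 * Phi \<alpha> z * Theta \<alpha> z - (cmod (Berg \<alpha> z))\<^sup>2
    \<le> (r\<^sup>2 - (cmod z)\<^sup>2)\<^sup>2 * (Phi \<alpha> z * kernel_energy z - (cmod (kernel_vector z))\<^sup>2)"
proof -
  have z1: "cmod z < 1" using z r by auto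
  define d where "d = r\<^sup>2 - (cmod z)\<^sup>2"
  define w where "w \<zeta> = 1 - cnj \<zeta> * z" for \<zeta>
  define p where "p \<zeta> = 1 / (cmod (w \<zeta>))\<^sup>2" for \<zeta>
  define y where "y \<zeta> = cnj \<zeta> / w \<zeta>" for \<zeta>
  define A where "A \<zeta> = of_real (r\<^sup>2) * cnj \<zeta> * (cnj (w \<zeta>) / w \<zeta>)" for \<zeta>
  define b where "b \<zeta> = cnj z * of_real (1 - r\<^sup>2 * (cmod \<zeta>)\<^sup>2) / w \<zeta>" for \<zeta>
  \<comment> \<open>The error unit: p e is the kernel of \<open>Theta\<close>.\<close>
  define e where "e \<zeta> = (1 - (cmod \<zeta>)\<^sup>2) / cmod (w \<zeta>)" for \<zeta>
  note k = kernel_facts[OF z1, folded w_def]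
  have wm [measurable]: "w \<in> borel_measurable dA" unfolding w_def[abs_def] by measurable
  have [measurable]: "p \<in> borel_measurable dA" "y \<in> borel_measurable dA" "A \<in> borel_measurable dA"
    "b \<in> borel_measurable dA" "e \<in> borel_measurable dA"
    unfolding p_def[abs_def] y_def[abs_def] A_def[abs_def] b_def[abs_def] e_def[abs_def] by measurable
  have eq: "of_real d * y \<zeta> - cnj z = A \<zeta> - b \<zeta>" if "\<zeta> \<in> cball 0 r" for \<zeta>
  proof -
    have w0: "w \<zeta> \<noteq> 0" using k(1)[OF that] by auto
    have "of_real d * cnj \<zeta> = cnj z * w \<zeta> + of_real (r\<^sup>2) * cnj \<zeta> * cnj (w \<zeta>) - cnj z * of_real (1 - r\<^sup>2 * (cmod \<zeta>)\<^sup>2)"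
      by (simp add: d_def w_def complex_norm_square algebra_simps del: of_real_power)
    then have "of_real d * cnj \<zeta> / w \<zeta> = cnj z + A \<zeta> - b \<zeta>"
      using w0 by (simp add: A_def b_def add_divide_distrib diff_divide_distrib)
    then show ?thesis by (simp add: y_def)
  qed
  have cb: "cmod \<zeta> \<le> 1" "(cmod \<zeta>)\<^sup>2 \<le> r\<^sup>2" if "\<zeta> \<in> cball 0 r" for \<zeta>
    using that r by (auto intro: power_mono)
  have nA: "cmod (A \<zeta>) = r\<^sup>2 * cmod \<zeta>" if "\<zeta> \<in> cball 0 r" for \<zeta>
    using k(1)[OF that] by (simp add: A_def norm_mult norm_divide norm_power)
  have r2: "r\<^sup>2 \<le> 1" "0 \<le> r\<^sup>2" using r by (auto simp: power_le_one)
  have nA1: "cmod (A \<zeta>) \<le> 1" if "\<zeta> \<in> cball 0 r" for \<zeta>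
    unfolding nA[OF that] using cb[OF that] r2 by (intro mult_le_one) auto
  have e0: "0 \<le> e \<zeta>" "e \<zeta> \<le> 2" "1 - (cmod \<zeta>)\<^sup>2 \<le> 2 * e \<zeta>" if "\<zeta> \<in> cball 0 r" for \<zeta>
  proof -
    show "0 \<le> e \<zeta>" "e \<zeta> \<le> 2" using k[OF that] by (auto simp: e_def field_simps)
    have "1 - (cmod \<zeta>)\<^sup>2 = e \<zeta> * cmod (w \<zeta>)" using k(1)[OF that] by (simp add: e_def)
    also have "\<dots> \<le> e \<zeta> * 2" using k(2)[OF that] \<open>0 \<le> e \<zeta>\<close> by (rule mult_left_mono)
    finally show "1 - (cmod \<zeta>)\<^sup>2 \<le> 2 * e \<zeta>" by simp
  qed
  have nb: "cmod (b \<zeta>) \<le> 2 * e \<zeta>" if \<zeta>: "\<zeta> \<in> cball 0 r" for \<zeta>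
  proof -
    let ?s = "(cmod \<zeta>)\<^sup>2"
    have s: "0 \<le> ?s" "?s \<le> 1" "?s \<le> r\<^sup>2" using cb[OF \<zeta>] by (auto simp: power_le_one)
    have "?s * ?s \<le> r\<^sup>2 * ?s" using s by (intro mult_right_mono) auto
    moreover have "(1 - ?s) * (1 - ?s) \<ge> 0" by simp
    ultimately have u: "1 - r\<^sup>2 * ?s \<le> 2 * (1 - ?s)" by (simp add: algebra_simps)
    have u0: "0 \<le> 1 - r\<^sup>2 * ?s" using mult_le_one[OF r2(1) s(1,2)] by simp
    have "cmod (b \<zeta>) = cmod z * (1 - r\<^sup>2 * ?s) / cmod (w \<zeta>)"
      using u0 by (simp add: b_def norm_mult norm_divide del: of_real_diff)
    also have "\<dots> \<le> 1 * (2 * (1 - ?s)) / cmod (w \<zeta>)"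
      using u u0 z1 by (intro divide_right_mono mult_mono) auto
    finally show ?thesis by (simp add: e_def)
  qed
  \<comment> \<open>Here |A|^2 = r^4 |\<zeta>|^2 >= r^4 - 2 e, while |A| <= 1 and |b| <= 2 e, so |A
    - b|^2 >= |A|^2 - 2 |A| |b| >= r^4 - 6 e.\<close>
  have x2: "r ^ 4 - 6 * e \<zeta> \<le> (cmod (of_real d * y \<zeta> - cnj z))\<^sup>2" if \<zeta>: "\<zeta> \<in> cball 0 r" for \<zeta>
  proof -
    have "(cmod (A \<zeta>))\<^sup>2 - 2 * cmod (A \<zeta>) * cmod (b \<zeta>) \<le> (cmod (A \<zeta>) - cmod (b \<zeta>))\<^sup>2"
      by (simp add: power2_eq_square algebra_simps)
    also have "\<dots> \<le> (cmod (A \<zeta> - b \<zeta>))\<^sup>2"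
      unfolding power2_abs[symmetric, of "cmod (A \<zeta>) - cmod (b \<zeta>)"]
      by (intro power_mono norm_triangle_ineq3) auto
    also have "(cmod (A \<zeta> - b \<zeta>))\<^sup>2 = (cmod (of_real d * y \<zeta> - cnj z))\<^sup>2" by (simp only: eq[OF \<zeta>])
    finally have 1: "(cmod (A \<zeta>))\<^sup>2 - 2 * cmod (A \<zeta>) * cmod (b \<zeta>) \<le> (cmod (of_real d * y \<zeta> - cnj z))\<^sup>2" .
    have 2: "cmod (A \<zeta>) * cmod (b \<zeta>) \<le> 1 * (2 * e \<zeta>)"
      using nA1[OF \<zeta>] nb[OF \<zeta>] e0[OF \<zeta>] by (intro mult_mono) auto
    have "(cmod (A \<zeta>))\<^sup>2 = r ^ 4 * (1 - (1 - (cmod \<zeta>)\<^sup>2))"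
      unfolding nA[OF \<zeta>] by (simp add: power_mult_distrib flip: power_mult)
    also have "\<dots> \<ge> r ^ 4 * (1 - 2 * e \<zeta>)"
      using e0[OF \<zeta>] r by (intro mult_left_mono) auto
    finally have "r ^ 4 - r ^ 4 * (2 * e \<zeta>) \<le> (cmod (A \<zeta>))\<^sup>2" by (simp add: algebra_simps)
    moreover have "r ^ 4 * (2 * e \<zeta>) \<le> 1 * (2 * e \<zeta>)"
      using e0[OF \<zeta>] r by (intro mult_right_mono power_le_one) auto
    ultimately show ?thesis using 1 2 by simp
  qed
  have p0: "0 \<le> p \<zeta>" for \<zeta> by (simp add: p_def)
  have pb: "p \<zeta> \<le> (1 / (1 - r))\<^sup>2" if "\<zeta> \<in> cball 0 r" for \<zeta>
    using power_mono[OF k(3)[OF that], of 2] by (simp add: p_def power_divide)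
  have yb: "cmod (y \<zeta>) \<le> 1 / (1 - r)" if "\<zeta> \<in> cball 0 r" for \<zeta>
  proof -
    have "cmod (y \<zeta>) \<le> 1 / cmod (w \<zeta>)"
      using cb(1)[OF that] by (simp add: y_def norm_divide divide_right_mono)
    then show ?thesis using k(3)[OF that] by linarith
  qed
  have ir: "integrable dA (\<lambda>\<zeta>. \<alpha> \<zeta> * (p \<zeta> * h \<zeta>))"
    if [measurable]: "h \<in> borel_measurable dA" and h: "\<And>\<zeta>. \<zeta> \<in> cball 0 r \<Longrightarrow> \<bar>h \<zeta>\<bar> \<le> C" for h C
  proof (rule integrable_weight_real[where C = "(1 / (1 - r))\<^sup>2 * C"])
    fix \<zeta> :: complex assume \<zeta>: "\<zeta> \<in> cball 0 r"
    show "\<bar>p \<zeta> * h \<zeta>\<bar> \<le> (1 / (1 - r))\<^sup>2 * C"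
      unfolding abs_mult using p0[of \<zeta>] pb[OF \<zeta>] h[OF \<zeta>] by (intro mult_mono) auto
  qed measurable
  have ic: "integrable dA (\<lambda>\<zeta>. of_real (\<alpha> \<zeta>) * (of_real (p \<zeta>) * h \<zeta>))"
    if [measurable]: "h \<in> borel_measurable dA" and h: "\<And>\<zeta>. \<zeta> \<in> cball 0 r \<Longrightarrow> cmod (h \<zeta>) \<le> C" for h :: "complex \<Rightarrow> complex" and C
  proof (rule integrable_weight_complex[where C = "(1 / (1 - r))\<^sup>2 * C"])
    fix \<zeta> :: complex assume \<zeta>: "\<zeta> \<in> cball 0 r"
    show "cmod (of_real (p \<zeta>) * h \<zeta>) \<le> (1 / (1 - r))\<^sup>2 * C"
      unfolding norm_mult using p0[of \<zeta>] pb[OF \<zeta>] h[OF \<zeta>] by (intro mult_mono) auto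
  qed measurable
  let ?P = "Phi \<alpha> z" and ?T = "Theta \<alpha> z" and ?F = "Berg \<alpha> z" and ?K = "kernel_energy z" and ?D = "kernel_vector z"
  have P: "?P = (\<integral>\<zeta>. \<alpha> \<zeta> * (p \<zeta> * 1) \<partial>dA)" by (simp add: Phi_eq p_def w_def)
  have T: "?T = (\<integral>\<zeta>. \<alpha> \<zeta> * (p \<zeta> * e \<zeta>) \<partial>dA)"
    unfolding Theta_eq by (rule Bochner_Integration.integral_cong)
      (simp_all add: p_def e_def w_def power2_eq_square power3_eq_cube)
  have K: "?K = (\<integral>\<zeta>. \<alpha> \<zeta> * (p \<zeta> * (cmod (y \<zeta>))\<^sup>2) \<partial>dA)"
  proof -
    have "(cmod x)\<^sup>2 * (cmod x)\<^sup>2 = cmod x ^ 4" for x by (simp flip: power_add)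
    then show ?thesis unfolding kernel_energy_def
      by (intro Bochner_Integration.integral_cong) (simp_all add: p_def y_def w_def norm_divide power_divide)
  qed
  have D: "?D = (\<integral>\<zeta>. of_real (\<alpha> \<zeta>) * (of_real (p \<zeta>) * y \<zeta>) \<partial>dA)"
    unfolding kernel_vector_def by (rule Bochner_Integration.integral_cong) (simp_all add: p_def y_def w_def)
  \<comment> \<open>The phase turns the positive kernel into the analytic one: cnj w / (w |w|^2) = 1
    / w^2.\<close>
  have F: "of_real (r\<^sup>2) * ?F = (\<integral>\<zeta>. of_real (\<alpha> \<zeta>) * (of_real (p \<zeta>) * A \<zeta>) \<partial>dA)"
    unfolding Berg_eq integral_mult_right_zero[symmetric]
  proof (rule Bochner_Integration.integral_cong[OF refl])
    fix \<zeta>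
    show "of_real (r\<^sup>2) * (of_real (\<alpha> \<zeta>) * (cnj \<zeta> / (1 - cnj \<zeta> * z)\<^sup>2)) = of_real (\<alpha> \<zeta>) * (of_real (p \<zeta>) * A \<zeta>)"
    proof (cases "w \<zeta> = 0")
      case False
      moreover have "complex_of_real (p \<zeta>) = 1 / (w \<zeta> * cnj (w \<zeta>))" by (simp add: p_def of_real_cmod_square)
      ultimately show ?thesis
        unfolding A_def w_def[symmetric] by (simp add: field_simps power2_eq_square)
    qed (simp add: p_def A_def w_def[symmetric])
  qed
  define X1 where "X1 = of_real d * ?D - cnj z * of_real ?P"
  define X2 where "X2 = d\<^sup>2 * ?K - 2 * d * Re (z * ?D) + (cmod z)\<^sup>2 * ?P"
  \<comment> \<open>A variance does not change when the constant cnj z is subtracted from d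
    y.\<close>
  have var: "d\<^sup>2 * (?P * ?K - (cmod ?D)\<^sup>2) = ?P * X2 - (cmod X1)\<^sup>2"
    unfolding X1_def X2_def cmod_power2 by (simp add: power2_eq_square algebra_simps)
  have i1: "integrable dA (\<lambda>\<zeta>. \<alpha> \<zeta> * (p \<zeta> * 1))" by (rule ir[where C = 1]) auto
  have iy: "integrable dA (\<lambda>\<zeta>. of_real (\<alpha> \<zeta>) * (of_real (p \<zeta>) * y \<zeta>))" by (rule ic[OF _ yb]) auto
  have iy2: "integrable dA (\<lambda>\<zeta>. \<alpha> \<zeta> * (p \<zeta> * (cmod (y \<zeta>))\<^sup>2))"
    using power_mono[OF yb, of _ 2] by (intro ir[where C = "(1 / (1 - r))\<^sup>2"]) auto
  have ie: "integrable dA (\<lambda>\<zeta>. \<alpha> \<zeta> * (p \<zeta> * e \<zeta>))" using e0 by (intro ir[where C = 2]) auto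
  have iA: "integrable dA (\<lambda>\<zeta>. of_real (\<alpha> \<zeta>) * (of_real (p \<zeta>) * A \<zeta>))" by (rule ic[OF _ nA1]) auto
  have ib: "integrable dA (\<lambda>\<zeta>. of_real (\<alpha> \<zeta>) * (of_real (p \<zeta>) * b \<zeta>))"
  proof (rule ic[where C = 4])
    show "cmod (b \<zeta>) \<le> 4" if "\<zeta> \<in> cball 0 r" for \<zeta> using nb[OF that] e0(2)[OF that] by linarith
  qed auto
  have "X2 = d\<^sup>2 * (\<integral>\<zeta>. \<alpha> \<zeta> * (p \<zeta> * (cmod (y \<zeta>))\<^sup>2) \<partial>dA)
     - 2 * d * (\<integral>\<zeta>. Re (z * (of_real (\<alpha> \<zeta>) * (of_real (p \<zeta>) * y \<zeta>))) \<partial>dA) + (cmod z)\<^sup>2 * (\<integral>\<zeta>. \<alpha> \<zeta> * (p \<zeta> * 1) \<partial>dA)"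
    unfolding X2_def K P by (simp only: D integral_Re[OF integrable_mult_right[OF iy]] integral_mult_right_zero)
  also have "\<dots> = (\<integral>\<zeta>. d\<^sup>2 * (\<alpha> \<zeta> * (p \<zeta> * (cmod (y \<zeta>))\<^sup>2)) - 2 * d * Re (z * (of_real (\<alpha> \<zeta>) * (of_real (p \<zeta>) * y \<zeta>)))
       + (cmod z)\<^sup>2 * (\<alpha> \<zeta> * (p \<zeta> * 1)) \<partial>dA)"
    unfolding integral_mult_right_zero[symmetric]
    by (subst Bochner_Integration.integral_diff[symmetric], intro integrable_mult_right iy2,
        intro integrable_mult_right integrable_Re iy, subst Bochner_Integration.integral_add[symmetric],
        intro Bochner_Integration.integrable_diff integrable_mult_right integrable_Re iy2 iy,
        intro integrable_mult_right i1, rule refl)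
  also have "\<dots> = (\<integral>\<zeta>. \<alpha> \<zeta> * (p \<zeta> * (cmod (of_real d * y \<zeta> - cnj z))\<^sup>2) \<partial>dA)"
    by (rule Bochner_Integration.integral_cong[OF refl], unfold cmod_power2)
       (simp add: power2_eq_square algebra_simps)
  finally have X2: "X2 = \<dots>" .
  have ix: "integrable dA (\<lambda>\<zeta>. \<alpha> \<zeta> * (p \<zeta> * (cmod (of_real d * y \<zeta> - cnj z))\<^sup>2))"
  proof (rule ir[where C = "(1 + 4)\<^sup>2"])
    fix \<zeta> :: complex assume \<zeta>: "\<zeta> \<in> cball 0 r"
    have "cmod (A \<zeta> - b \<zeta>) \<le> 1 + 4"
      using norm_triangle_ineq4[of "A \<zeta>" "b \<zeta>"] nA1[OF \<zeta>] nb[OF \<zeta>] e0(2)[OF \<zeta>] by linarith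
    then show "\<bar>(cmod (of_real d * y \<zeta> - cnj z))\<^sup>2\<bar> \<le> (1 + 4)\<^sup>2"
      unfolding eq[OF \<zeta>] abs_power2 by (rule power_mono) simp
  qed measurable
  have X2_ge: "r ^ 4 * ?P - 6 * ?T \<le> X2"
  proof -
    have "r ^ 4 * ?P - 6 * ?T = (\<integral>\<zeta>. r ^ 4 * (\<alpha> \<zeta> * (p \<zeta> * 1)) - 6 * (\<alpha> \<zeta> * (p \<zeta> * e \<zeta>)) \<partial>dA)"
      unfolding P T using i1 ie by (subst Bochner_Integration.integral_diff) auto
    also have "\<dots> = (\<integral>\<zeta>. \<alpha> \<zeta> * (p \<zeta> * (r ^ 4 - 6 * e \<zeta>)) \<partial>dA)" by (simp add: algebra_simps)
    also have "\<dots> \<le> X2" unfolding X2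
    proof (rule integral_weight_mono[OF _ ix])
      have "integrable dA (\<lambda>\<zeta>. r ^ 4 * (\<alpha> \<zeta> * (p \<zeta> * 1)) - 6 * (\<alpha> \<zeta> * (p \<zeta> * e \<zeta>)))" using i1 ie by simp
      then show "integrable dA (\<lambda>\<zeta>. \<alpha> \<zeta> * (p \<zeta> * (r ^ 4 - 6 * e \<zeta>)))" by (simp add: algebra_simps)
    qed (intro mult_left_mono x2 p0)
    finally show ?thesis .
  qed
  have X1_le: "cmod X1 \<le> cmod (of_real (r\<^sup>2) * ?F) + 2 * ?T"
  proof -
    have "X1 = (\<integral>\<zeta>. of_real d * (of_real (\<alpha> \<zeta>) * (of_real (p \<zeta>) * y \<zeta>)) - cnj z * of_real (\<alpha> \<zeta> * (p \<zeta> * 1)) \<partial>dA)"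
      unfolding X1_def D P integral_complex_of_real[symmetric] integral_mult_right_zero[symmetric]
      by (rule Bochner_Integration.integral_diff[symmetric])
         (intro integrable_mult_right iy integrable_of_real i1)+
    also have "\<dots> = (\<integral>\<zeta>. of_real (\<alpha> \<zeta>) * (of_real (p \<zeta>) * A \<zeta>) - of_real (\<alpha> \<zeta>) * (of_real (p \<zeta>) * b \<zeta>) \<partial>dA)"
    proof (rule Bochner_Integration.integral_cong[OF refl])
      fix \<zeta>
      have "of_real d * (of_real (\<alpha> \<zeta>) * (of_real (p \<zeta>) * y \<zeta>)) - cnj z * of_real (\<alpha> \<zeta> * (p \<zeta> * 1))
        = of_real (\<alpha> \<zeta>) * of_real (p \<zeta>) * (of_real d * y \<zeta> - cnj z)" by (simp add: algebra_simps)
      also have "\<dots> = of_real (\<alpha> \<zeta>) * of_real (p \<zeta>) * (A \<zeta> - b \<zeta>)"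
        using eq[of \<zeta>] \<alpha>supp[of \<zeta>] by (cases "\<zeta> \<in> cball 0 r") auto
      finally show "of_real d * (of_real (\<alpha> \<zeta>) * (of_real (p \<zeta>) * y \<zeta>)) - cnj z * of_real (\<alpha> \<zeta> * (p \<zeta> * 1))
        = of_real (\<alpha> \<zeta>) * (of_real (p \<zeta>) * A \<zeta>) - of_real (\<alpha> \<zeta>) * (of_real (p \<zeta>) * b \<zeta>)" by (simp add: algebra_simps)
    qed
    also have "\<dots> = of_real (r\<^sup>2) * ?F - (\<integral>\<zeta>. of_real (\<alpha> \<zeta>) * (of_real (p \<zeta>) * b \<zeta>) \<partial>dA)"
      unfolding F by (rule Bochner_Integration.integral_diff[OF iA ib])
    finally have "cmod X1 \<le> cmod (of_real (r\<^sup>2) * ?F) + cmod (\<integral>\<zeta>. of_real (\<alpha> \<zeta>) * (of_real (p \<zeta>) * b \<zeta>) \<partial>dA)"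
      by (simp only: norm_triangle_ineq4)
    also have "cmod (\<integral>\<zeta>. of_real (\<alpha> \<zeta>) * (of_real (p \<zeta>) * b \<zeta>) \<partial>dA) \<le> (\<integral>\<zeta>. \<alpha> \<zeta> * (p \<zeta> * cmod (b \<zeta>)) \<partial>dA)"
      using integral_norm_bound[of dA "\<lambda>\<zeta>. of_real (\<alpha> \<zeta>) * (of_real (p \<zeta>) * b \<zeta>)"] \<alpha>0 p0 by (simp add: norm_mult)
    also have "\<dots> \<le> (\<integral>\<zeta>. \<alpha> \<zeta> * (p \<zeta> * (2 * e \<zeta>)) \<partial>dA)"
    proof (rule integral_weight_mono)
      show "integrable dA (\<lambda>\<zeta>. \<alpha> \<zeta> * (p \<zeta> * cmod (b \<zeta>)))"
        using integrable_norm[OF ib] \<alpha>0 p0 by (simp add: norm_mult)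
      show "integrable dA (\<lambda>\<zeta>. \<alpha> \<zeta> * (p \<zeta> * (2 * e \<zeta>)))"
        using integrable_mult_right[OF ie, of 2] by (simp add: mult_ac)
    qed (intro mult_left_mono nb p0)
    also have "\<dots> = 2 * ?T" unfolding T integral_mult_right_zero[symmetric] by (simp add: mult_ac)
    finally show ?thesis by simp
  qed
  have F_le: "cmod (of_real (r\<^sup>2) * ?F) \<le> ?P"
  proof -
    have "cmod (of_real (r\<^sup>2) * ?F) \<le> (\<integral>\<zeta>. \<alpha> \<zeta> * (p \<zeta> * cmod (A \<zeta>)) \<partial>dA)"
      unfolding F using integral_norm_bound[of dA "\<lambda>\<zeta>. of_real (\<alpha> \<zeta>) * (of_real (p \<zeta>) * A \<zeta>)"] \<alpha>0 p0 by (simp add: norm_mult)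
    also have "\<dots> \<le> ?P" unfolding P
    proof (rule integral_weight_mono[OF _ i1])
      show "integrable dA (\<lambda>\<zeta>. \<alpha> \<zeta> * (p \<zeta> * cmod (A \<zeta>)))"
        using integrable_norm[OF iA] \<alpha>0 p0 by (simp add: norm_mult)
    qed (intro mult_left_mono nA1 p0)
    finally show ?thesis .
  qed
  have F_le': "cmod (of_real (r\<^sup>2) * ?F) \<le> cmod ?F"
    unfolding norm_mult norm_of_real using r2 by (simp add: mult_left_le_one_le)
  note PT = Phi_nonneg[of z] Theta_bounds[OF z1]
  let ?a = "cmod (of_real (r\<^sup>2) * ?F)"
  \<comment> \<open>The mean costs 4 \<Phi> \<Theta> + 4 \<Theta>^2 <= 12 \<Phi> \<Theta>; with the
    6 \<Phi> \<Theta> from the second moment this makes 18.\<close>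
  have "(cmod X1)\<^sup>2 \<le> (?a + 2 * ?T)\<^sup>2" using X1_le by (intro power_mono) auto
  also have "\<dots> = ?a\<^sup>2 + 4 * (?a * ?T) + 4 * (?T * ?T)" by (simp add: power2_eq_square algebra_simps)
  also have "\<dots> \<le> (cmod ?F)\<^sup>2 + 4 * (?P * ?T) + 4 * (2 * ?P * ?T)"
    using PT F_le F_le' by (intro add_mono mult_left_mono mult_right_mono power_mono) auto
  finally have X1': "(cmod X1)\<^sup>2 \<le> (cmod ?F)\<^sup>2 + 12 * (?P * ?T)" by simp
  have "?P * (r ^ 4 * ?P - 6 * ?T) \<le> ?P * X2" using X2_ge PT by (intro mult_left_mono) auto
  with X1' show ?thesis
    unfolding d_def[symmetric] var by (simp add: power2_eq_square algebra_simps)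
qed

lemma integrable_cball_bounded:
  fixes h :: "complex \<Rightarrow> real"
  assumes [measurable]: "h \<in> borel_measurable dA" and "\<And>z. z \<in> cball 0 r \<Longrightarrow> \<bar>h z\<bar> \<le> C"
  shows "integrable dA (\<lambda>z. indicator (cball 0 r) z * h z)"
proof (rule dA.integrable_const_bound[where B = "max C 0"])
  have "cball 0 r \<in> sets dA" using r by (intro cball_sets_dA)
  then show "(\<lambda>z. indicator (cball 0 r) z * h z) \<in> borel_measurable dA" by measurable
qed (use assms(2) in \<open>auto simp: indicator_def le_max_iff_disj\<close>)

text \<open>The integral of J is 0, while its real part is bounded below through the completed
  square and twice the variance. The coefficient of |f|^2 \<Phi>^2 is then at least 2 r^4 - 5/4 >=
  1/4, and clearing this quarter turns 2 * 18 and 2 into 144 and 8.\<close>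

lemma hardy_inequality:
  assumes f: "f holomorphic_on disc" and r4: "3 / 4 \<le> r ^ 4"
  shows "(\<integral>z. indicator (cball 0 r) z * ((cmod (f z))\<^sup>2 * (Phi \<alpha> z)\<^sup>2) \<partial>dA)
    \<le> 144 * (\<integral>z. indicator (cball 0 r) z * ((cmod (f z))\<^sup>2 * (Phi \<alpha> z * Theta \<alpha> z)) \<partial>dA)
      + 8 * (\<integral>z. indicator (cball 0 r) z * ((cmod (f z))\<^sup>2 * (cmod (Berg \<alpha> z))\<^sup>2) \<partial>dA)"
    (is "?I1 \<le> 144 * ?I2 + 8 * ?I3")
proof -
  define M where "M = (\<integral>\<zeta>. \<alpha> \<zeta> \<partial>dA) * (1 / (1 - r))\<^sup>2"
  have z1: "cmod z < 1" if "z \<in> cball 0 r" for z using that r by auto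
  have PM: "Phi \<alpha> z \<le> M" if "z \<in> cball 0 r" for z
    unfolding M_def by (rule Phi_le[OF z1[OF that]])
  have TM: "\<bar>Theta \<alpha> z\<bar> \<le> 2 * M" if "z \<in> cball 0 r" for z
    using Theta_bounds[OF z1[OF that]] PM[OF that] by simp
  have BM: "cmod (Berg \<alpha> z) \<le> M" if "z \<in> cball 0 r" for z
    unfolding M_def by (rule Berg_le[OF z1[OF that]])
  have cb: "cball 0 r \<subseteq> disc" using r by auto
  have "bounded (f ` cball 0 r)"
    using f cb by (intro compact_imp_bounded compact_continuous_image compact_cball)
      (blast intro: holomorphic_on_imp_continuous_on continuous_on_subset)
  then obtain C where C: "\<forall>y\<in>f ` cball 0 r. cmod y \<le> C" unfolding bounded_iff by blast
  have fC: "(cmod (f z))\<^sup>2 \<le> C\<^sup>2" if "z \<in> cball 0 r" for z using C that by (intro power_mono) auto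
  have M0: "0 \<le> M" using PM[of 0] Phi_nonneg[of 0] r by auto
  have fm [measurable]: "f \<in> borel_measurable dA" by (rule holomorphic_measurable_dA[OF f])
  have i1: "integrable dA (\<lambda>z. indicator (cball 0 r) z * ((cmod (f z))\<^sup>2 * (Phi \<alpha> z)\<^sup>2))"
  proof (rule integrable_cball_bounded)
    fix z :: complex assume z: "z \<in> cball 0 r"
    show "\<bar>(cmod (f z))\<^sup>2 * (Phi \<alpha> z)\<^sup>2\<bar> \<le> C\<^sup>2 * M\<^sup>2"
      using mult_mono[OF fC[OF z] power_mono[OF PM[OF z] Phi_nonneg, of 2]] by (simp add: abs_mult)
  qed measurable
  have i2: "integrable dA (\<lambda>z. indicator (cball 0 r) z * ((cmod (f z))\<^sup>2 * (Phi \<alpha> z * Theta \<alpha> z)))"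
  proof (rule integrable_cball_bounded)
    fix z :: complex assume z: "z \<in> cball 0 r"
    show "\<bar>(cmod (f z))\<^sup>2 * (Phi \<alpha> z * Theta \<alpha> z)\<bar> \<le> C\<^sup>2 * (M * (2 * M))"
      unfolding abs_mult abs_power2 using fC[OF z] PM[OF z] TM[OF z] Phi_nonneg[of z] M0
      by (intro mult_mono mult_nonneg_nonneg) auto
  qed measurable
  have i3: "integrable dA (\<lambda>z. indicator (cball 0 r) z * ((cmod (f z))\<^sup>2 * (cmod (Berg \<alpha> z))\<^sup>2))"
  proof (rule integrable_cball_bounded)
    fix z :: complex assume z: "z \<in> cball 0 r"
    show "\<bar>(cmod (f z))\<^sup>2 * (cmod (Berg \<alpha> z))\<^sup>2\<bar> \<le> C\<^sup>2 * M\<^sup>2"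
      using mult_mono[OF fC[OF z] power_mono[OF BM[OF z] norm_ge_zero, of 2]] by (simp add: abs_mult)
  qed measurable
  define J where "J z = (let d = of_real (r\<^sup>2) - z * cnj z; f' = deriv f z; \<Phi> = kernel_moment (\<lambda>_. 1) 1 1 z;
      D = kernel_moment cnj 2 1 z; D' = kernel_moment (\<lambda>\<zeta>. \<zeta>) 1 2 z; K = kernel_moment (\<lambda>\<zeta>. \<zeta> * cnj \<zeta>) 2 2 z in
     (- 2 * d * z * cnj (f z) * f' + d\<^sup>2 * f' * cnj f' + (d - z * cnj z) * f z * cnj (f z) + d * cnj z * f z * cnj f') * (\<Phi> * \<Phi>)
     + (- 4 * d * z * f z * cnj (f z) + 2 * d\<^sup>2 * f z * cnj f') * (\<Phi> * D)
     + (d\<^sup>2 * cnj (f z) * f' + d * cnj z * f z * cnj (f z)) * (D' * \<Phi>)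
     + (2 * d\<^sup>2 * f z * cnj (f z)) * (D' * D)
     + (d\<^sup>2 * cnj (f z) * f' + d * cnj z * f z * cnj (f z)) * (\<Phi> * D')
     + (2 * d\<^sup>2 * f z * cnj (f z)) * (\<Phi> * K))" for z
  have J0: "(\<integral>z. indicator (cball 0 r) z *\<^sub>R J z \<partial>dA) = 0"
    unfolding J_def by (rule divergence_identity(1)[OF f])
  have Ji: "integrable dA (\<lambda>z. indicator (cball 0 r) z *\<^sub>R J z)"
    unfolding J_def by (rule divergence_identity(2)[OF f])
  have J_ge: "(cmod (f z))\<^sup>2 * (Phi \<alpha> z)\<^sup>2 / 4 - 36 * ((cmod (f z))\<^sup>2 * (Phi \<alpha> z * Theta \<alpha> z)) - 2 * ((cmod (f z))\<^sup>2 * (cmod (Berg \<alpha> z))\<^sup>2) \<le> Re (J z)"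
    if z: "z \<in> cball 0 r" for z
  proof -
    define d where "d = r\<^sup>2 - (cmod z)\<^sup>2"
    have "complex_of_real (r\<^sup>2) - z * cnj z = complex_of_real d"
      by (simp add: d_def complex_norm_square del: of_real_power)
    then have "2 * d\<^sup>2 * (cmod (f z))\<^sup>2 * (Phi \<alpha> z * kernel_energy z - (cmod (kernel_vector z))\<^sup>2) + (d - 5 / 4 * (cmod z)\<^sup>2) * (cmod (f z))\<^sup>2 * (Phi \<alpha> z)\<^sup>2 \<le> Re (J z)"
      unfolding J_def Let_def kernel_moment_Phi kernel_moment_D kernel_moment_cnj_D kernel_moment_K using Re_divergence_ge by simp
    moreover have "(cmod (f z))\<^sup>2 * (r ^ 4 * (Phi \<alpha> z)\<^sup>2 - 18 * Phi \<alpha> z * Theta \<alpha> z - (cmod (Berg \<alpha> z))\<^sup>2)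
        \<le> (cmod (f z))\<^sup>2 * (d\<^sup>2 * (Phi \<alpha> z * kernel_energy z - (cmod (kernel_vector z))\<^sup>2))"
      unfolding d_def by (rule mult_left_mono[OF variance_bound[OF z]]) simp
    moreover have "((3 / 2 - 5 / 4) :: real) * ((cmod (f z))\<^sup>2 * (Phi \<alpha> z)\<^sup>2) \<le> (2 * r ^ 4 + d - 5 / 4 * (cmod z)\<^sup>2) * ((cmod (f z))\<^sup>2 * (Phi \<alpha> z)\<^sup>2)"
    proof (rule mult_right_mono)
      have "(cmod z)\<^sup>2 \<le> r\<^sup>2" using z by (intro power_mono) auto
      moreover have "(cmod z)\<^sup>2 \<le> 1" using z1[OF z] by (simp add: power_le_one)
      ultimately show "(3 / 2 - 5 / 4) \<le> 2 * r ^ 4 + d - 5 / 4 * (cmod z)\<^sup>2"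
        using r4 by (simp add: d_def)
    qed simp
    ultimately show ?thesis by (simp add: algebra_simps)
  qed
  let ?L = "\<lambda>z. (1 / 4) * (indicator (cball 0 r) z * ((cmod (f z))\<^sup>2 * (Phi \<alpha> z)\<^sup>2))
      - 36 * (indicator (cball 0 r) z * ((cmod (f z))\<^sup>2 * (Phi \<alpha> z * Theta \<alpha> z)))
      - 2 * (indicator (cball 0 r) z * ((cmod (f z))\<^sup>2 * (cmod (Berg \<alpha> z))\<^sup>2))"
  have "(1 / 4) * ?I1 - 36 * ?I2 - 2 * ?I3 = (\<integral>z. ?L z \<partial>dA)"
    using i1 i2 i3 by simp
  also have "\<dots> \<le> 0"
  proof -
    have "(\<integral>z. ?L z \<partial>dA) \<le> (\<integral>z. Re (indicator (cball 0 r) z *\<^sub>R J z) \<partial>dA)"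
    proof (rule integral_mono)
      show "integrable dA ?L" using i1 i2 i3 by simp
      show "?L z \<le> Re (indicator (cball 0 r) z *\<^sub>R J z)" for z
        using J_ge[of z] by (auto simp: indicator_def)
    qed (rule integrable_Re[OF Ji])
    also have "\<dots> = 0" using integral_Re[OF Ji] J0 by simp
    finally show ?thesis .
  qed
  finally show ?thesis by simp
qed

end

section \<open>Necessary conditions for boundedness\<close>

definition op_bounded :: "(complex \<Rightarrow> complex) \<Rightarrow> (complex \<Rightarrow> complex) \<Rightarrow> real \<Rightarrow> bool" where
  "op_bounded f g C \<longleftrightarrow> (\<forall>u \<in> L2.
        sqnorm (\<lambda>z. cabs f z * bergman_proj (\<lambda>\<zeta>. cabs g \<zeta> * u \<zeta>) z) \<le> ennreal (C\<^sup>2) * sqnorm u)"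

text \<open>Testing of |f| P(|g| u) on u = cnj \<zeta> |g| restricted to E, in the form in which it
  enters the Hardy inequality. The factor cnj \<zeta> appears there because it comes with every
  z-derivative of the kernel.\<close>

definition berg_bounded :: "(complex \<Rightarrow> complex) \<Rightarrow> (complex \<Rightarrow> complex) \<Rightarrow> real \<Rightarrow> bool" where
  "berg_bounded f g C \<longleftrightarrow> (\<forall>r E. 0 < r \<longrightarrow> r < 1 \<longrightarrow> E \<in> sets dA \<longrightarrow> E \<subseteq> cball 0 r \<longrightarrow>
     (\<integral>z. indicator (cball 0 r) z * ((cmod (f z))\<^sup>2 * (cmod (Berg (\<lambda>\<zeta>. (cmod (g \<zeta>))\<^sup>2 * indicator E \<zeta>) z))\<^sup>2) \<partial>dA)
       \<le> C\<^sup>2 * (\<integral>\<zeta>. (cmod (g \<zeta>))\<^sup>2 * indicator E \<zeta> \<partial>dA))"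

lemma cabs_L2: "h \<in> L2 \<Longrightarrow> cabs h \<in> L2"
proof (rule L2_bound(1)[where K = 1 and u = h])
  assume "h \<in> L2"
  then have [measurable]: "h \<in> borel_measurable dA" by (rule L2_measurable)
  show "cabs h \<in> borel_measurable dA" unfolding cabs_def[abs_def] by measurable
qed (auto simp: cabs_def)

lemma norm_cabs [simp]: "cmod (cabs h z) = cmod (h z)"
  by (simp add: cabs_def)

lemma bergman_proj_measurable:
  assumes "integrable dA u"
  shows "bergman_proj u \<in> borel_measurable dA"
  by (rule holomorphic_measurable_dA[OF bergman_proj_holomorphic[OF assms]])

lemma op_bounded_L2:
  assumes f: "f \<in> L2" and g: "g \<in> L2" and bd: "op_bounded f g C" and u: "u \<in> L2"
  shows "(\<lambda>z. cabs f z * bergman_proj (\<lambda>\<zeta>. cabs g \<zeta> * u \<zeta>) z) \<in> L2" (is "?w \<in> L2")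
    and "norm2sq (\<lambda>z. cabs f z * bergman_proj (\<lambda>\<zeta>. cabs g \<zeta> * u \<zeta>) z) \<le> C\<^sup>2 * norm2sq u"
proof -
  have "integrable dA (\<lambda>\<zeta>. cabs g \<zeta> * u \<zeta>)" by (rule L2_mult(1)[OF cabs_L2[OF g] u])
  then have m: "?w \<in> borel_measurable dA"
    by (intro borel_measurable_times bergman_proj_measurable L2_measurable cabs_L2 f)
  have le: "sqnorm ?w \<le> ennreal (C\<^sup>2 * norm2sq u)"
    using bd u by (simp add: op_bounded_def sqnorm_eq ennreal_mult)
  show "?w \<in> L2" by (rule L2_I(1)[OF m le])
  show "norm2sq ?w \<le> C\<^sup>2 * norm2sq u" by (rule L2_I(2)[OF m le]) simp
qed

lemma berg_bounded_of_op_bounded: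
  assumes f: "f \<in> L2" and g: "g \<in> L2" and bd: "op_bounded f g C"
  shows "berg_bounded f g C"
  unfolding berg_bounded_def
proof (intro allI impI)
  fix r E assume r: "0 < (r::real)" "r < 1" and E: "E \<in> sets dA" "E \<subseteq> cball 0 r"
  define u where "u \<zeta> = cnj \<zeta> * (cabs g \<zeta> * indicator E \<zeta>)" for \<zeta>
  let ?\<alpha> = "\<lambda>\<zeta>. (cmod (g \<zeta>))\<^sup>2 * indicator E \<zeta>"
  have ga: "integrable dA ?\<alpha>"
    by (rule integrable_real_mult_indicator[OF E(1) L2_integrable_sq[OF g]])
  have gi: "(\<lambda>\<zeta>. cabs g \<zeta> * indicator E \<zeta>) \<in> L2"
  proof (rule L2_bound(1)[where K = 1 and u = g])
    show "(\<lambda>\<zeta>. cabs g \<zeta> * indicator E \<zeta>) \<in> borel_measurable dA"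
      using L2_measurable[OF cabs_L2[OF g]] E(1) by measurable
  qed (auto simp: g norm_mult indicator_def)
  have um: "u \<in> borel_measurable dA"
    unfolding u_def[abs_def] using L2_measurable[OF gi] by measurable
  have u: "u \<in> L2" "norm2sq u \<le> 1\<^sup>2 * norm2sq (\<lambda>\<zeta>. cabs g \<zeta> * indicator E \<zeta>)"
  proof -
    have ub: "cmod (u \<zeta>) \<le> 1 * cmod (cabs g \<zeta> * indicator E \<zeta>)" if "\<zeta> \<in> disc" for \<zeta>
      using that by (simp add: u_def norm_mult mult_left_le_one_le)
    show "u \<in> L2" "norm2sq u \<le> 1\<^sup>2 * norm2sq (\<lambda>\<zeta>. cabs g \<zeta> * indicator E \<zeta>)"
      using L2_bound[OF um gi ub] by blast+
  qed
  have nu: "norm2sq u \<le> (\<integral>\<zeta>. ?\<alpha> \<zeta> \<partial>dA)"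
  proof -
    have "(cmod (cabs g \<zeta> * indicator E \<zeta>))\<^sup>2 = ?\<alpha> \<zeta>" for \<zeta>
      by (simp add: norm_mult power_mult_distrib indicator_def)
    then show ?thesis using u(2) by simp
  qed
  have B: "bergman_proj (\<lambda>\<zeta>. cabs g \<zeta> * u \<zeta>) z = Berg ?\<alpha> z" for z
    unfolding bergman_proj_def Berg_def
    by (intro Bochner_Integration.integral_cong)
       (auto simp: u_def cabs_def indicator_def power2_eq_square)
  note op = op_bounded_L2[OF f g bd u(1)]
  have "(\<integral>z. indicator (cball 0 r) z * ((cmod (f z))\<^sup>2 * (cmod (Berg ?\<alpha> z))\<^sup>2) \<partial>dA)
    \<le> (\<integral>z. (cmod (f z))\<^sup>2 * (cmod (Berg ?\<alpha> z))\<^sup>2 \<partial>dA)"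
  proof (rule integral_mono)
    show i: "integrable dA (\<lambda>z. (cmod (f z))\<^sup>2 * (cmod (Berg ?\<alpha> z))\<^sup>2)"
      using L2_integrable_sq[OF op(1)] by (simp add: B norm_mult power_mult_distrib)
    show "integrable dA (\<lambda>z. indicator (cball 0 r) z * ((cmod (f z))\<^sup>2 * (cmod (Berg ?\<alpha> z))\<^sup>2))"
      using integrable_real_mult_indicator[OF cball_sets_dA[OF r(2)] i] by (simp add: mult.commute)
  qed (auto simp: indicator_def)
  also have "\<dots> \<le> C\<^sup>2 * norm2sq u"
    using op(2) by (simp add: B norm_mult power_mult_distrib)
  also have "\<dots> \<le> C\<^sup>2 * (\<integral>\<zeta>. ?\<alpha> \<zeta> \<partial>dA)" by (intro mult_left_mono nu) simp
  finally show "(\<integral>z. indicator (cball 0 r) z * ((cmod (f z))\<^sup>2 * (cmod (Berg ?\<alpha> z))\<^sup>2) \<partial>dA) \<le> C\<^sup>2 * (\<integral>\<zeta>. ?\<alpha> \<zeta> \<partial>dA)" .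
qed

lemma kernel_weight_square:
  assumes "g \<in> L2" "0 < r" "r < 1" "E \<in> sets dA" "E \<subseteq> cball 0 r"
  shows "kernel_weight r (\<lambda>\<zeta>. (cmod (g \<zeta>))\<^sup>2 * indicator E \<zeta>)"
proof
  show "integrable dA (\<lambda>\<zeta>. (cmod (g \<zeta>))\<^sup>2 * indicator E \<zeta>)"
    by (rule integrable_real_mult_indicator[OF assms(4) L2_integrable_sq[OF assms(1)]])
qed (use assms in \<open>auto simp: indicator_def\<close>)

text \<open>Duality, with v tested against itself: by Fubini its squared norm is the pairing of |f|
  cnj \<zeta> on E with |f| P(|g| v). Cauchy-Schwarz and the operator bound at v make the square of
  this number at most the f-mass of E times C^2 times the squared norm of v. Truncation of v to
  radius r puts it in L2 beforehand, so its norm may be cancelled.\<close>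

lemma berg_bounded_adjoint:
  assumes f: "f \<in> L2" and g: "g \<in> L2" and bd: "op_bounded f g C"
  shows "berg_bounded g f C"
  unfolding berg_bounded_def
proof (intro allI impI)
  fix r E assume r: "0 < (r::real)" "r < 1" and E: "E \<in> sets dA" "E \<subseteq> cball 0 r"
  define \<beta> where "\<beta> \<zeta> = (cmod (f \<zeta>))\<^sup>2 * indicator E \<zeta>" for \<zeta>
  interpret kernel_weight r \<beta> unfolding \<beta>_def[abs_def] by (rule kernel_weight_square[OF f r E])
  have fm [measurable]: "f \<in> borel_measurable dA" and gm [measurable]: "g \<in> borel_measurable dA"
    using f g by (auto dest: L2_measurable)
  have cbm [measurable]: "cball 0 r \<in> sets dA" "E \<in> sets dA" using r E by (auto intro: cball_sets_dA)
  have bm [measurable]: "\<beta> \<in> borel_measurable dA" by (rule \<alpha>_measurable)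
  define M where "M = (\<integral>\<zeta>. \<beta> \<zeta> \<partial>dA) * (1 / (1 - r))\<^sup>2"
  have BM: "cmod (Berg \<beta> z) \<le> M" if "cmod z < 1" for z
    unfolding M_def by (rule Berg_le[OF that])
  have M0: "0 \<le> M" unfolding M_def using \<alpha>0 by (intro mult_nonneg_nonneg integral_nonneg_AE AE_I2) auto
  define v where "v z = cabs g z * Berg \<beta> z * indicator (cball 0 r) z" for z
  have vm: "v \<in> borel_measurable dA" unfolding v_def[abs_def] cabs_def by measurable
  have v: "v \<in> L2"
  proof (rule L2_bound(1)[OF vm g, where K = M])
    fix z assume "z \<in> disc"
    then have "cmod (Berg \<beta> z) * cmod (g z) \<le> M * cmod (g z)" using BM[of z] by (intro mult_right_mono) auto
    then show "cmod (v z) \<le> M * cmod (g z)"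
      using M0 by (auto simp: v_def norm_mult indicator_def mult.commute)
  qed
  have fi: "(\<lambda>\<zeta>. cabs f \<zeta> * indicator E \<zeta> * cnj \<zeta>) \<in> L2" "norm2sq (\<lambda>\<zeta>. cabs f \<zeta> * indicator E \<zeta> * cnj \<zeta>) \<le> (\<integral>\<zeta>. \<beta> \<zeta> \<partial>dA)"
  proof -
    have gi: "(\<lambda>\<zeta>. cabs f \<zeta> * indicator E \<zeta>) \<in> L2"
    proof (rule L2_bound(1)[where K = 1 and u = f])
      show "(\<lambda>\<zeta>. cabs f \<zeta> * indicator E \<zeta>) \<in> borel_measurable dA" unfolding cabs_def by measurable
    qed (auto simp: f norm_mult indicator_def)
    have m: "(\<lambda>\<zeta>. cabs f \<zeta> * indicator E \<zeta> * cnj \<zeta>) \<in> borel_measurable dA" unfolding cabs_def by measurable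
    have b: "cmod (cabs f \<zeta> * indicator E \<zeta> * cnj \<zeta>) \<le> 1 * cmod (cabs f \<zeta> * indicator E \<zeta>)" if "\<zeta> \<in> disc" for \<zeta>
      using that by (auto simp: norm_mult intro!: mult_right_le_one_le)
    note B = L2_bound[OF m gi b]
    show "(\<lambda>\<zeta>. cabs f \<zeta> * indicator E \<zeta> * cnj \<zeta>) \<in> L2" using B(1) by simp
    have "(cmod (cabs f \<zeta> * indicator E \<zeta>))\<^sup>2 = \<beta> \<zeta>" for \<zeta>
      by (simp add: norm_mult power_mult_distrib indicator_def \<beta>_def)
    then show "norm2sq (\<lambda>\<zeta>. cabs f \<zeta> * indicator E \<zeta> * cnj \<zeta>) \<le> (\<integral>\<zeta>. \<beta> \<zeta> \<partial>dA)" using B(2) by simp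
  qed
  define w where "w \<zeta> = cabs f \<zeta> * bergman_proj (\<lambda>z. cabs g z * v z) \<zeta>" for \<zeta>
  have w: "w \<in> L2" "norm2sq w \<le> C\<^sup>2 * norm2sq v"
    using op_bounded_L2[OF f g bd v] by (simp_all add: w_def[abs_def])
  have gv: "integrable dA (\<lambda>z. cnj (v z) * cabs g z)"
    using L2_mult(1)[OF L2_cnj[OF v] cabs_L2[OF g]] .
  have "complex_of_real (norm2sq v) = (\<integral>z. cnj (v z) * cabs g z * Berg \<beta> z \<partial>dA)"
    unfolding integral_complex_of_real[symmetric]
    by (rule Bochner_Integration.integral_cong) (auto simp: v_def indicator_def of_real_cmod_square cabs_def)
  also have "\<dots> = (\<integral>z. (\<integral>\<zeta>. cnj (v z) * cabs g z * (of_real (\<beta> \<zeta>) * cnj \<zeta> / (1 - cnj \<zeta> * z)\<^sup>2) \<partial>dA) \<partial>dA)"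
    unfolding Berg_def integral_mult_right_zero ..
  also have "\<dots> = (\<integral>\<zeta>. (\<integral>z. cnj (v z) * cabs g z * (of_real (\<beta> \<zeta>) * cnj \<zeta> / (1 - cnj \<zeta> * z)\<^sup>2) \<partial>dA) \<partial>dA)"
  proof (rule dA2.Fubini_integral[symmetric])
    have bi: "integrable dA (\<lambda>\<zeta>. complex_of_real (\<beta> \<zeta>))" using \<alpha>int by simp
    have vmm [measurable]: "v \<in> borel_measurable dA" by (rule vm)
    have cg [measurable]: "cabs g \<in> borel_measurable dA" by (rule L2_measurable[OF cabs_L2[OF g]])
    show "integrable (dA \<Otimes>\<^sub>M dA) (\<lambda>(z, \<zeta>). cnj (v z) * cabs g z * (of_real (\<beta> \<zeta>) * cnj \<zeta> / (1 - cnj \<zeta> * z)\<^sup>2))"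
    proof (rule Bochner_Integration.integrable_bound)
      show "integrable (dA \<Otimes>\<^sub>M dA) (\<lambda>x. (1 / (1 - r))\<^sup>2 * norm ((cnj (v (fst x)) * cabs g (fst x)) * of_real (\<beta> (snd x))))"
        by (intro integrable_mult_right integrable_norm integral_pair_mult(1) gv bi)
      show "AE x in dA \<Otimes>\<^sub>M dA. norm (case x of (z, \<zeta>) \<Rightarrow> cnj (v z) * cabs g z * (of_real (\<beta> \<zeta>) * cnj \<zeta> / (1 - cnj \<zeta> * z)\<^sup>2))
        \<le> norm ((1 / (1 - r))\<^sup>2 * norm ((cnj (v (fst x)) * cabs g (fst x)) * of_real (\<beta> (snd x))))"
      proof (rule AE_I2)
        fix x :: "complex \<times> complex" assume x: "x \<in> space (dA \<Otimes>\<^sub>M dA)"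
        obtain z \<zeta> where xz: "x = (z, \<zeta>)" by force
        have z: "cmod z < 1" and \<zeta>1: "cmod \<zeta> < 1" using x by (auto simp: xz space_pair_measure)
        have "cmod (v z) * cmod (g z) * (\<beta> \<zeta> * (cmod \<zeta> / (cmod (1 - cnj \<zeta> * z))\<^sup>2)) \<le> cmod (v z) * cmod (g z) * (\<beta> \<zeta> * (1 / (1 - r))\<^sup>2)"
        proof (cases "\<zeta> \<in> cball 0 r")
          case True
          have "cmod \<zeta> / (cmod (1 - cnj \<zeta> * z))\<^sup>2 \<le> 1 / (cmod (1 - cnj \<zeta> * z))\<^sup>2"
            using \<zeta>1 by (intro divide_right_mono) auto
          also have "\<dots> \<le> (1 / (1 - r))\<^sup>2" by (rule kernel_sq_bound[OF z True])
          finally show ?thesis using \<alpha>0 by (intro mult_left_mono) auto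
        qed (simp add: \<alpha>supp)
        then show "norm (case x of (z, \<zeta>) \<Rightarrow> cnj (v z) * cabs g z * (of_real (\<beta> \<zeta>) * cnj \<zeta> / (1 - cnj \<zeta> * z)\<^sup>2))
          \<le> norm ((1 / (1 - r))\<^sup>2 * norm ((cnj (v (fst x)) * cabs g (fst x)) * of_real (\<beta> (snd x))))"
          using \<alpha>0[of \<zeta>] by (simp add: xz norm_mult norm_divide norm_power mult_ac)
      qed
    qed measurable
  qed
  also have "\<dots> = (\<integral>\<zeta>. (cabs f \<zeta> * indicator E \<zeta> * cnj \<zeta>) * cnj (w \<zeta>) \<partial>dA)"
  proof (rule Bochner_Integration.integral_cong[OF refl])
    fix \<zeta>
    have "cnj (bergman_proj (\<lambda>z. cabs g z * v z) \<zeta>) = (\<integral>z. cnj (v z) * cabs g z / (1 - cnj \<zeta> * z)\<^sup>2 \<partial>dA)"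
      unfolding bergman_proj_def Bochner_Integration.integral_cnj[symmetric]
      by (rule Bochner_Integration.integral_cong) (auto simp: cabs_def mult_ac)
    moreover have "(\<integral>z. cnj (v z) * cabs g z * (of_real (\<beta> \<zeta>) * cnj \<zeta> / (1 - cnj \<zeta> * z)\<^sup>2) \<partial>dA)
      = (of_real (\<beta> \<zeta>) * cnj \<zeta>) * (\<integral>z. cnj (v z) * cabs g z / (1 - cnj \<zeta> * z)\<^sup>2 \<partial>dA)"
      unfolding integral_mult_right_zero[symmetric] by (rule Bochner_Integration.integral_cong) (auto simp: mult_ac)
    ultimately show "(\<integral>z. cnj (v z) * cabs g z * (of_real (\<beta> \<zeta>) * cnj \<zeta> / (1 - cnj \<zeta> * z)\<^sup>2) \<partial>dA)
      = (cabs f \<zeta> * indicator E \<zeta> * cnj \<zeta>) * cnj (w \<zeta>)"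
      by (simp add: w_def \<beta>_def cabs_def indicator_def power2_eq_square)
  qed
  finally have "(cmod (complex_of_real (norm2sq v)))\<^sup>2 \<le> (\<integral>\<zeta>. \<beta> \<zeta> \<partial>dA) * (C\<^sup>2 * norm2sq v)"
    using L2_mult(2)[OF fi(1) L2_cnj[OF w(1)]] fi(2) w(2)
      mult_mono[OF fi(2) w(2)] \<alpha>0
    by (simp only: complex_mod_cnj) (smt (verit) integral_nonneg_AE AE_I2 zero_le_power2)
  then have le: "(norm2sq v)\<^sup>2 \<le> C\<^sup>2 * (\<integral>\<zeta>. \<beta> \<zeta> \<partial>dA) * norm2sq v" by (simp add: mult_ac)
  have b0: "0 \<le> (\<integral>\<zeta>. \<beta> \<zeta> \<partial>dA)" using \<alpha>0 by (intro integral_nonneg_AE AE_I2)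
  have "norm2sq v \<le> C\<^sup>2 * (\<integral>\<zeta>. \<beta> \<zeta> \<partial>dA)"
  proof (cases "norm2sq v = 0")
    case True
    then show ?thesis using b0 by simp
  next
    case False
    then have "0 < norm2sq v" by (simp add: order.not_eq_order_implies_strict)
    then show ?thesis using le by (simp add: power2_eq_square)
  qed
  moreover have "norm2sq v = (\<integral>z. indicator (cball 0 r) z * ((cmod (g z))\<^sup>2 * (cmod (Berg \<beta> z))\<^sup>2) \<partial>dA)"
    by (rule Bochner_Integration.integral_cong) (auto simp: v_def norm_mult power_mult_distrib indicator_def)
  ultimately show "(\<integral>z. indicator (cball 0 r) z * ((cmod (g z))\<^sup>2 * (cmod (Berg (\<lambda>\<zeta>. (cmod (f \<zeta>))\<^sup>2 * indicator E \<zeta>) z))\<^sup>2) \<partial>dA)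
    \<le> C\<^sup>2 * (\<integral>\<zeta>. (cmod (f \<zeta>))\<^sup>2 * indicator E \<zeta> \<partial>dA)"
    unfolding \<beta>_def[abs_def] by simp
qed

text \<open>Multiplying the kernel by \<open>(1 - cnj (\<phi> \<zeta>) \<phi> z)\<^sup>2\<close>, with \<open>\<phi>\<close> the disc automorphism vanishing
  at \<open>b\<close>, costs a factor 4 in norm and leaves an operator of rank one.\<close>

lemma sarason_condition:
  assumes f: "f \<in> L2" and g: "g \<in> L2" and bd: "op_bounded f g C" and b: "cmod b < 1"
  shows "(1 - (cmod b)\<^sup>2) ^ 4 * ((\<integral>z. (cmod (f z))\<^sup>2 / (cmod (1 - cnj b * z)) ^ 4 \<partial>dA) * (\<integral>z. (cmod (g z))\<^sup>2 / (cmod (1 - cnj b * z)) ^ 4 \<partial>dA)) \<le> 16 * C\<^sup>2"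
proof -
  define \<phi> where "\<phi> z = (z - b) / (1 - cnj b * z)" for z
  have ne: "1 - cnj b * z \<noteq> 0" if "cmod z < 1" for z using kernel_bound(4)[OF that b] .
  have \<phi>1: "cmod (\<phi> z) \<le> 1" if z: "cmod z < 1" for z
  proof -
    have "(cmod (z - b))\<^sup>2 \<le> (cmod (1 - cnj b * z))\<^sup>2"
    proof -
      have "(cmod (1 - cnj b * z))\<^sup>2 - (cmod (z - b))\<^sup>2 = (1 - (cmod z)\<^sup>2) * (1 - (cmod b)\<^sup>2)"
        unfolding cmod_power2 by (simp add: power2_eq_square algebra_simps)
      moreover have "0 \<le> (1 - (cmod z)\<^sup>2) * (1 - (cmod b)\<^sup>2)"
        using z b by (intro mult_nonneg_nonneg) (auto simp: power_le_one)
      ultimately show ?thesis by linarith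
    qed
    then have "cmod (z - b) \<le> cmod (1 - cnj b * z)" by (rule power2_le_imp_le) simp
    then show ?thesis using ne[OF z] by (simp add: \<phi>_def norm_divide)
  qed
  \<comment> \<open>The square of this expression cancels the kernel (1 - cnj \<zeta> z)^(-2) and
    leaves a function of z times a function of \<zeta>.\<close>
  have \<phi>id: "1 - cnj (\<phi> \<zeta>) * \<phi> z = of_real (1 - (cmod b)\<^sup>2) * (1 - cnj \<zeta> * z) / ((1 - cnj b * z) * cnj (1 - cnj b * \<zeta>))"
    if "cmod z < 1" "cmod \<zeta> < 1" for z \<zeta>
  proof -
    have n: "1 - cnj b * z \<noteq> 0" "cnj (1 - cnj b * \<zeta>) \<noteq> 0"
      using ne[OF that(1)] ne[OF that(2)] complex_cnj_zero_iff by blast+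
    have "(1 - cnj b * z) * cnj (1 - cnj b * \<zeta>) - cnj (\<zeta> - b) * (z - b) = of_real (1 - (cmod b)\<^sup>2) * (1 - cnj \<zeta> * z)"
      by (simp add: of_real_cmod_square algebra_simps)
    moreover have "1 - cnj (\<phi> \<zeta>) * \<phi> z = ((1 - cnj b * z) * cnj (1 - cnj b * \<zeta>) - cnj (\<zeta> - b) * (z - b)) / ((1 - cnj b * z) * cnj (1 - cnj b * \<zeta>))"
    proof -
      have "cnj (\<phi> \<zeta>) * \<phi> z = cnj (\<zeta> - b) * (z - b) / ((1 - cnj b * z) * cnj (1 - cnj b * \<zeta>))"
        unfolding \<phi>_def complex_cnj_divide times_divide_times_eq by (simp only: mult.commute)
      moreover have "1 = (1 - cnj b * z) * cnj (1 - cnj b * \<zeta>) / ((1 - cnj b * z) * cnj (1 - cnj b * \<zeta>))"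
        using n by (metis divide_self mult_eq_0_iff)
      ultimately show ?thesis by (simp only: diff_divide_distrib)
    qed
    ultimately show ?thesis by simp
  qed
  have \<phi>m [measurable]: "\<phi> \<in> borel_measurable dA" unfolding \<phi>_def[abs_def] by measurable
  \<comment> \<open>For this u the remaining \<zeta> factor is |g|^2 / |1 - cnj b \<zeta>|^4, whose
    integral is at the same time the squared norm of u.\<close>
  define u where "u \<zeta> = cabs g \<zeta> / (1 - cnj b * \<zeta>)\<^sup>2" for \<zeta>
  have u: "u \<in> L2" unfolding u_def[abs_def] by (rule L2_mult_kernel[OF cabs_L2[OF g] b])
  define U where "U i \<zeta> = cnj (\<phi> \<zeta>) ^ i * u \<zeta>" for i \<zeta>
  have U: "U i \<in> L2" "norm2sq (U i) \<le> norm2sq u" for i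
  proof -
    have m: "U i \<in> borel_measurable dA" unfolding U_def[abs_def] using L2_measurable[OF u] by measurable
    have b: "cmod (U i \<zeta>) \<le> 1 * cmod (u \<zeta>)" if "\<zeta> \<in> disc" for \<zeta>
      unfolding U_def norm_mult norm_power complex_mod_cnj
      using \<phi>1[of \<zeta>] that by (intro mult_right_mono power_le_one) auto
    show "U i \<in> L2" "norm2sq (U i) \<le> norm2sq u" using L2_bound[OF m u b] by simp_all
  qed
  define T where "T i z = cabs f z * bergman_proj (\<lambda>\<zeta>. cabs g \<zeta> * U i \<zeta>) z" for i z
  have T: "T i \<in> L2" "norm2sq (T i) \<le> C\<^sup>2 * norm2sq u" for i
    using op_bounded_L2[OF f g bd U(1)[of i]] mult_left_mono[OF U(2)[of i], of "C\<^sup>2"] by (auto simp: T_def[abs_def])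
  define Gb where "Gb = (\<integral>z. (cmod (g z))\<^sup>2 / (cmod (1 - cnj b * z)) ^ 4 \<partial>dA)"
  define Fb where "Fb = (\<integral>z. (cmod (f z))\<^sup>2 / (cmod (1 - cnj b * z)) ^ 4 \<partial>dA)"
  have Gb: "norm2sq u = Gb" unfolding Gb_def u_def
    by (rule Bochner_Integration.integral_cong) (auto simp: norm_divide norm_power power_divide simp flip: power_mult)
  \<comment> \<open>Expanding the square (1 - cnj (\<phi> \<zeta>) \<phi> z)^2 gives three terms. In
    each the power of cnj (\<phi> \<zeta>) goes into the argument of the operator and the power of
    \<phi> z stays outside; both have modulus at most 1.\<close>
  have key: "T 0 z - 2 * \<phi> z * T 1 z + (\<phi> z)\<^sup>2 * T 2 z = cabs f z * (of_real ((1 - (cmod b)\<^sup>2)\<^sup>2 * Gb) / (1 - cnj b * z)\<^sup>2)"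
    if z: "cmod z < 1" for z
  proof -
    have i: "integrable dA (\<lambda>\<zeta>. cabs g \<zeta> * U i \<zeta> / (1 - cnj \<zeta> * z)\<^sup>2)" for i
    proof -
      have "integrable dA (\<lambda>\<zeta>. U i \<zeta> * cnj (cabs g \<zeta> / (1 - cnj z * \<zeta>)\<^sup>2))"
        by (intro L2_mult(1) U L2_cnj L2_mult_kernel cabs_L2 g z)
      then show ?thesis by (simp add: cabs_def mult_ac)
    qed
    have "T 0 z - 2 * \<phi> z * T 1 z + (\<phi> z)\<^sup>2 * T 2 z
       = cabs f z * ((\<integral>\<zeta>. cabs g \<zeta> * U 0 \<zeta> / (1 - cnj \<zeta> * z)\<^sup>2 \<partial>dA)
          - 2 * \<phi> z * (\<integral>\<zeta>. cabs g \<zeta> * U 1 \<zeta> / (1 - cnj \<zeta> * z)\<^sup>2 \<partial>dA)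
          + (\<phi> z)\<^sup>2 * (\<integral>\<zeta>. cabs g \<zeta> * U 2 \<zeta> / (1 - cnj \<zeta> * z)\<^sup>2 \<partial>dA))"
      by (simp add: T_def bergman_proj_def algebra_simps)
    also have "\<dots> = cabs f z * (\<integral>\<zeta>. cabs g \<zeta> * U 0 \<zeta> / (1 - cnj \<zeta> * z)\<^sup>2 - 2 * \<phi> z * (cabs g \<zeta> * U 1 \<zeta> / (1 - cnj \<zeta> * z)\<^sup>2)
         + (\<phi> z)\<^sup>2 * (cabs g \<zeta> * U 2 \<zeta> / (1 - cnj \<zeta> * z)\<^sup>2) \<partial>dA)"
      unfolding Bochner_Integration.integral_add[OF Bochner_Integration.integrable_diff[OF i integrable_mult_right[OF i]] integrable_mult_right[OF i]]
        Bochner_Integration.integral_diff[OF i integrable_mult_right[OF i]] integral_mult_right_zero ..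
    also have "(\<integral>\<zeta>. cabs g \<zeta> * U 0 \<zeta> / (1 - cnj \<zeta> * z)\<^sup>2 - 2 * \<phi> z * (cabs g \<zeta> * U 1 \<zeta> / (1 - cnj \<zeta> * z)\<^sup>2)
         + (\<phi> z)\<^sup>2 * (cabs g \<zeta> * U 2 \<zeta> / (1 - cnj \<zeta> * z)\<^sup>2) \<partial>dA)
      = (\<integral>\<zeta>. of_real ((1 - (cmod b)\<^sup>2)\<^sup>2) / (1 - cnj b * z)\<^sup>2 * of_real ((cmod (g \<zeta>))\<^sup>2 / (cmod (1 - cnj b * \<zeta>)) ^ 4) \<partial>dA)"
    proof (rule Bochner_Integration.integral_cong[OF refl])
      fix \<zeta> assume "\<zeta> \<in> space dA"
      then have \<zeta>: "cmod \<zeta> < 1" by simp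
      let ?w = "1 - cnj \<zeta> * z" and ?p = "1 - cnj b * z" and ?q = "1 - cnj b * \<zeta>"
      have n: "?w \<noteq> 0" "?p \<noteq> 0" "?q \<noteq> 0" "cnj ?q \<noteq> 0"
        using kernel_bound(4)[OF z \<zeta>] ne[OF z] ne[OF \<zeta>] complex_cnj_zero_iff by blast+
      have "cabs g \<zeta> * U 0 \<zeta> / ?w\<^sup>2 - 2 * \<phi> z * (cabs g \<zeta> * U 1 \<zeta> / ?w\<^sup>2) + (\<phi> z)\<^sup>2 * (cabs g \<zeta> * U 2 \<zeta> / ?w\<^sup>2)
        = (cabs g \<zeta>)\<^sup>2 / ?q\<^sup>2 * ((1 - cnj (\<phi> \<zeta>) * \<phi> z) / ?w)\<^sup>2"
      proof -
        have "c * (Y ^ 0 * (c / q\<^sup>2)) / w\<^sup>2 - 2 * X * (c * (Y ^ 1 * (c / q\<^sup>2)) / w\<^sup>2) + X\<^sup>2 * (c * (Y\<^sup>2 * (c / q\<^sup>2)) / w\<^sup>2)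
          = c\<^sup>2 / q\<^sup>2 * ((1 - Y * X) / w)\<^sup>2" for X Y c q w :: complex
          by (simp add: power2_eq_square divide_inverse algebra_simps)
        then show ?thesis unfolding U_def u_def .
      qed
      also have "(1 - cnj (\<phi> \<zeta>) * \<phi> z) / ?w = of_real (1 - (cmod b)\<^sup>2) / (?p * cnj ?q)"
        unfolding \<phi>id[OF z \<zeta>] using n(1) by simp
      also have "(cabs g \<zeta>)\<^sup>2 / ?q\<^sup>2 * (of_real (1 - (cmod b)\<^sup>2) / (?p * cnj ?q))\<^sup>2
        = of_real ((1 - (cmod b)\<^sup>2)\<^sup>2) / ?p\<^sup>2 * (of_real ((cmod (g \<zeta>))\<^sup>2) / (?q * cnj ?q)\<^sup>2)"
        by (simp add: cabs_def power_divide power_mult_distrib mult_ac)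
      also have "(?q * cnj ?q)\<^sup>2 = of_real ((cmod ?q) ^ 4)"
        unfolding complex_norm_square[symmetric] of_real_power[symmetric] power_mult[symmetric] by simp
      finally show "cabs g \<zeta> * U 0 \<zeta> / ?w\<^sup>2 - 2 * \<phi> z * (cabs g \<zeta> * U 1 \<zeta> / ?w\<^sup>2) + (\<phi> z)\<^sup>2 * (cabs g \<zeta> * U 2 \<zeta> / ?w\<^sup>2)
        = of_real ((1 - (cmod b)\<^sup>2)\<^sup>2) / ?p\<^sup>2 * of_real ((cmod (g \<zeta>))\<^sup>2 / (cmod ?q) ^ 4)" by simp
    qed
    also have "\<dots> = of_real ((1 - (cmod b)\<^sup>2)\<^sup>2) / (1 - cnj b * z)\<^sup>2 * of_real Gb"
      unfolding integral_mult_right_zero integral_complex_of_real Gb_def ..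
    finally show ?thesis by simp
  qed
  have Fi: "integrable dA (\<lambda>z. (cmod (f z))\<^sup>2 / (cmod (1 - cnj b * z)) ^ 4)"
  proof -
    have "(\<lambda>z. f z / (1 - cnj b * z)\<^sup>2) \<in> L2" by (rule L2_mult_kernel[OF f b])
    from L2_integrable_sq[OF this] show ?thesis
      by (simp add: norm_divide norm_power power_divide flip: power_mult)
  qed
  have "((1 - (cmod b)\<^sup>2)\<^sup>2 * Gb)\<^sup>2 * Fb = (\<integral>z. ((1 - (cmod b)\<^sup>2)\<^sup>2 * Gb)\<^sup>2 * ((cmod (f z))\<^sup>2 / (cmod (1 - cnj b * z)) ^ 4) \<partial>dA)"
    by (simp only: integral_mult_right_zero Fb_def)
  also have "\<dots> \<le> (\<integral>z. 4 * ((cmod (T 0 z))\<^sup>2 + 2 * (cmod (T 1 z))\<^sup>2 + (cmod (T 2 z))\<^sup>2) \<partial>dA)"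
  proof (rule integral_mono)
    show "integrable dA (\<lambda>z. ((1 - (cmod b)\<^sup>2)\<^sup>2 * Gb)\<^sup>2 * ((cmod (f z))\<^sup>2 / (cmod (1 - cnj b * z)) ^ 4))"
      by (rule integrable_mult_right[OF Fi])
    show "integrable dA (\<lambda>z. 4 * ((cmod (T 0 z))\<^sup>2 + 2 * (cmod (T 1 z))\<^sup>2 + (cmod (T 2 z))\<^sup>2))"
      using L2_integrable_sq[OF T(1)] by simp
    fix z assume "z \<in> space dA"
    then have z: "cmod z < 1" by simp
    let ?x = "cmod (T 0 z)" and ?y = "cmod (T 1 z)" and ?v = "cmod (T 2 z)"
    have "cmod (cabs f z * (of_real ((1 - (cmod b)\<^sup>2)\<^sup>2 * Gb) / (1 - cnj b * z)\<^sup>2)) \<le> ?x + 2 * ?y + ?v"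
    proof -
      have "cmod (T 0 z - 2 * \<phi> z * T 1 z + (\<phi> z)\<^sup>2 * T 2 z) \<le> ?x + cmod (2 * \<phi> z * T 1 z) + cmod ((\<phi> z)\<^sup>2 * T 2 z)"
        by (rule order.trans[OF norm_triangle_ineq add_right_mono[OF norm_triangle_ineq4]])
      also have "cmod (2 * \<phi> z * T 1 z) \<le> 2 * ?y"
        using mult_right_mono[OF \<phi>1[OF z], of ?y] by (simp add: norm_mult)
      also have "cmod ((\<phi> z)\<^sup>2 * T 2 z) \<le> ?v"
        using mult_right_mono[OF power_le_one[OF _ \<phi>1[OF z], of 2], of ?v] by (simp add: norm_mult norm_power)
      finally show ?thesis unfolding key[OF z] by simp
    qed
    then have "(cmod (cabs f z * (of_real ((1 - (cmod b)\<^sup>2)\<^sup>2 * Gb) / (1 - cnj b * z)\<^sup>2)))\<^sup>2 \<le> (?x + 2 * ?y + ?v)\<^sup>2"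
      by (intro power_mono) auto
    also have "\<dots> \<le> 4 * (?x\<^sup>2 + 2 * ?y\<^sup>2 + ?v\<^sup>2)"
      using zero_le_power2[of "?x - ?y"] zero_le_power2[of "?x - ?v"] zero_le_power2[of "?y - ?v"]
      by (simp add: power2_eq_square algebra_simps)
    finally have "(cmod (cabs f z * (of_real ((1 - (cmod b)\<^sup>2)\<^sup>2 * Gb) / (1 - cnj b * z)\<^sup>2)))\<^sup>2 \<le> 4 * (?x\<^sup>2 + 2 * ?y\<^sup>2 + ?v\<^sup>2)" .
    note * = this
    show "((1 - (cmod b)\<^sup>2)\<^sup>2 * Gb)\<^sup>2 * ((cmod (f z))\<^sup>2 / (cmod (1 - cnj b * z)) ^ 4) \<le> 4 * (?x\<^sup>2 + 2 * ?y\<^sup>2 + ?v\<^sup>2)"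
    proof -
      have "(cmod (cabs f z * (of_real K / p\<^sup>2)))\<^sup>2 = K\<^sup>2 * ((cmod (f z))\<^sup>2 / (cmod p) ^ 4)" for K p
        by (simp add: norm_mult norm_divide norm_power power_mult_distrib power_divide mult_ac flip: power_mult)
      from this[of "(1 - (cmod b)\<^sup>2)\<^sup>2 * Gb"] * show ?thesis by (simp only:)
    qed
  qed
  also have "\<dots> = 4 * (norm2sq (T 0) + 2 * norm2sq (T 1) + norm2sq (T 2))"
    using L2_integrable_sq[OF T(1)] by simp
  \<comment> \<open>A factor 4 comes from Cauchy-Schwarz with weights 1, 2, 1, and 1 + 2 + 1 from
    the three norms.\<close>
  also have "\<dots> \<le> 16 * C\<^sup>2 * Gb" using T(2)[of 0] T(2)[of 1] T(2)[of 2] unfolding Gb by simp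
  finally have le: "((1 - (cmod b)\<^sup>2)\<^sup>2 * Gb)\<^sup>2 * Fb \<le> 16 * C\<^sup>2 * Gb" .
  have "0 \<le> Gb" unfolding Gb_def by (intro integral_nonneg_AE AE_I2) simp
  show ?thesis
  proof (cases "Gb = 0")
    case True
    then show ?thesis by (simp add: Gb_def[symmetric])
  next
    case False
    then have G0: "0 < Gb" using \<open>0 \<le> Gb\<close> by simp
    have "((1 - (cmod b)\<^sup>2) ^ 4 * (Fb * Gb)) * Gb \<le> (16 * C\<^sup>2) * Gb"
      using le by (simp add: power_mult_distrib power2_eq_square mult_ac flip: power_mult)
        (simp add: power4_eq_xxxx mult_ac)
    then show ?thesis using G0 by (simp add: Fb_def Gb_def)
  qed
qed

text \<open>The previous condition at a point b pulled from a towards 0 by about half the radius.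
  Then 1 - |b|^2 is bounded below, and |1 - cnj b z| on the ball is bounded above, by multiples of
  the radius. The constant is 16 * 4^4 * (3/2)^8.\<close>

lemma ball_condition:
  assumes f: "f \<in> L2" and g: "g \<in> L2" and bd: "op_bounded f g C" and a: "cmod a < 1" and R: "0 < R"
  defines "B \<equiv> {z \<in> disc. cmod (1 - cnj a * z) < R}"
  shows "B \<in> sets dA"
    and "(\<integral>z. (cmod (f z))\<^sup>2 * indicator B z \<partial>dA) * (\<integral>z. (cmod (g z))\<^sup>2 * indicator B z \<partial>dA) \<le> 104976 * C\<^sup>2 * R ^ 4"
proof -
  have "(\<lambda>z. cmod (1 - cnj a * z)) \<in> borel_measurable dA" by measurable
  then have "{z \<in> space dA. cmod (1 - cnj a * z) < R} \<in> sets dA" by measurable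
  then show Bm [measurable]: "B \<in> sets dA" by (simp add: B_def)
  \<comment> \<open>Every ball of radius above 2 is the whole disc, and S <= 2 keeps the factor 1 -
    S / 2 in b nonnegative.\<close>
  define S where "S = min R 2"
  have S: "0 < S" "S \<le> 2" "S \<le> R" using R by (auto simp: S_def)
  have BS: "cmod (1 - cnj a * z) \<le> S" "cmod z < 1" if "z \<in> B" for z
    using that kernel_bound(3)[of z a] a by (auto simp: B_def S_def)
  define b where "b = a * of_real (1 - S / 2)"
  have nb: "cmod b = cmod a * (1 - S / 2)" using S by (simp add: b_def norm_mult del: of_real_diff)
  have "cmod a * (1 - S / 2) \<le> cmod a * 1" using S by (intro mult_left_mono) auto
  then have b: "cmod b < 1" using nb a by simp
  \<comment> \<open>If |a| <= 1/2 then b is far from the circle anyway; otherwise the shift has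
    length |a| S / 2 >= S / 4.\<close>
  have low: "S / 4 \<le> 1 - (cmod b)\<^sup>2"
  proof -
    have "S / 4 \<le> 1 - cmod b"
    proof (cases "cmod a \<le> 1 / 2")
      case True
      then have "cmod b \<le> 1 / 2" using \<open>cmod a * (1 - S / 2) \<le> cmod a * 1\<close> nb by simp
      then show ?thesis using S by simp
    next
      case False
      then have "1 / 2 * (S / 2) \<le> cmod a * (S / 2)" using S by (intro mult_right_mono) auto
      then show ?thesis using a nb by (simp add: algebra_simps)
    qed
    also have "\<dots> \<le> 1 - (cmod b)\<^sup>2" using b by (simp add: power2_eq_square mult_left_le)
    finally show ?thesis .
  qed
  have up: "cmod (1 - cnj b * z) \<le> 3 / 2 * S" if "z \<in> B" for z
  proof -
    have "1 - cnj b * z = (1 - cnj a * z) + of_real (S / 2) * (cnj a * z)"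
      by (simp add: b_def algebra_simps)
    then have "cmod (1 - cnj b * z) \<le> cmod (1 - cnj a * z) + cmod (of_real (S / 2) * (cnj a * z))"
      by (simp only: norm_triangle_ineq)
    also have "cmod (of_real (S / 2) * (cnj a * z)) \<le> S / 2 * (1 * 1)"
      unfolding norm_mult norm_of_real complex_mod_cnj using S a BS(2)[OF that]
      by (intro mult_mono) auto
    finally show ?thesis using BS(1)[OF that] by simp
  qed
  have bound: "(\<integral>z. (cmod (h z))\<^sup>2 * indicator B z \<partial>dA) \<le> (3 / 2 * S) ^ 4 * (\<integral>z. (cmod (h z))\<^sup>2 / (cmod (1 - cnj b * z)) ^ 4 \<partial>dA)"
    if h: "h \<in> L2" for h
  proof -
    have "(\<lambda>z. h z / (1 - cnj b * z)\<^sup>2) \<in> L2" by (rule L2_mult_kernel[OF h b])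
    from L2_integrable_sq[OF this]
    have i: "integrable dA (\<lambda>z. (cmod (h z))\<^sup>2 / (cmod (1 - cnj b * z)) ^ 4)"
      by (simp add: norm_divide norm_power power_divide flip: power_mult)
    have "(\<integral>z. (cmod (h z))\<^sup>2 * indicator B z \<partial>dA) \<le> (\<integral>z. (3 / 2 * S) ^ 4 * ((cmod (h z))\<^sup>2 / (cmod (1 - cnj b * z)) ^ 4) \<partial>dA)"
    proof (rule integral_mono)
      show "integrable dA (\<lambda>z. (cmod (h z))\<^sup>2 * indicator B z)"
        by (rule integrable_real_mult_indicator[OF Bm L2_integrable_sq[OF h]])
      show "integrable dA (\<lambda>z. (3 / 2 * S) ^ 4 * ((cmod (h z))\<^sup>2 / (cmod (1 - cnj b * z)) ^ 4))"
        using i by (rule integrable_mult_right)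
      fix z
      show "(cmod (h z))\<^sup>2 * indicator B z \<le> (3 / 2 * S) ^ 4 * ((cmod (h z))\<^sup>2 / (cmod (1 - cnj b * z)) ^ 4)"
      proof (cases "z \<in> B")
        case True
        have p: "0 < cmod (1 - cnj b * z)" using kernel_bound(4)[OF BS(2)[OF True] b] by simp
        have "(cmod (1 - cnj b * z)) ^ 4 \<le> (3 / 2 * S) ^ 4" by (intro power_mono up[OF True]) simp
        then have "1 \<le> (3 / 2 * S) ^ 4 / (cmod (1 - cnj b * z)) ^ 4" using p by (simp add: pos_le_divide_eq)
        from mult_left_mono[OF this, of "(cmod (h z))\<^sup>2"] show ?thesis using True by (simp add: mult_ac)
      qed simp
    qed
    then show ?thesis by (simp only: integral_mult_right_zero)
  qed
  let ?F = "\<integral>z. (cmod (f z))\<^sup>2 / (cmod (1 - cnj b * z)) ^ 4 \<partial>dA" and ?G = "\<integral>z. (cmod (g z))\<^sup>2 / (cmod (1 - cnj b * z)) ^ 4 \<partial>dA"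
  have FG0: "0 \<le> ?F" "0 \<le> ?G" by (auto intro!: integral_nonneg_AE)
  have "(S / 4) ^ 4 * (?F * ?G) \<le> (1 - (cmod b)\<^sup>2) ^ 4 * (?F * ?G)"
    using FG0 S low by (intro mult_right_mono power_mono) auto
  also have "\<dots> \<le> 16 * C\<^sup>2" by (rule sarason_condition[OF f g bd b])
  finally have FG: "(S / 4) ^ 4 * (?F * ?G) \<le> 16 * C\<^sup>2" .
  have "(\<integral>z. (cmod (f z))\<^sup>2 * indicator B z \<partial>dA) * (\<integral>z. (cmod (g z))\<^sup>2 * indicator B z \<partial>dA)
    \<le> ((3 / 2 * S) ^ 4 * ?F) * ((3 / 2 * S) ^ 4 * ?G)"
    using S FG0 by (intro mult_mono bound f g) (auto intro!: integral_nonneg_AE mult_nonneg_nonneg)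
  also have "\<dots> = (6561 * S ^ 4) * ((S / 4) ^ 4 * (?F * ?G))"
    by (simp add: power_mult_distrib power_divide power4_eq_xxxx)
  also have "\<dots> \<le> (6561 * S ^ 4) * (16 * C\<^sup>2)" using S by (intro mult_left_mono FG) auto
  also have "\<dots> = 104976 * C\<^sup>2 * S ^ 4" by simp
  also have "\<dots> \<le> 104976 * C\<^sup>2 * R ^ 4" using S by (intro mult_left_mono power_mono) auto
  finally show "(\<integral>z. (cmod (f z))\<^sup>2 * indicator B z \<partial>dA) * (\<integral>z. (cmod (g z))\<^sup>2 * indicator B z \<partial>dA) \<le> 104976 * C\<^sup>2 * R ^ 4" .
qed

section \<open>Uniform testing\<close>

text \<open>The pseudohyperbolic distance is at most 1, by the identity for the difference of the
  squares.\<close>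

lemma cmod_diff_le_kernel:
  assumes "cmod z < 1" "cmod \<zeta> < 1"
  shows "cmod (z - \<zeta>) \<le> cmod (1 - cnj \<zeta> * z)"
proof -
  have "(cmod (1 - cnj \<zeta> * z))\<^sup>2 - (cmod (z - \<zeta>))\<^sup>2 = (1 - (cmod z)\<^sup>2) * (1 - (cmod \<zeta>)\<^sup>2)"
    unfolding cmod_power2 by (simp add: power2_eq_square algebra_simps)
  moreover have "0 \<le> (1 - (cmod z)\<^sup>2) * (1 - (cmod \<zeta>)\<^sup>2)"
    using assms by (intro mult_nonneg_nonneg) (auto simp: power_le_one)
  ultimately have "(cmod (z - \<zeta>))\<^sup>2 \<le> (cmod (1 - cnj \<zeta> * z))\<^sup>2" by linarith
  then show ?thesis by (rule power2_le_imp_le) simp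
qed

text \<open>Since 1 - cnj \<zeta> \<zeta>' = (1 - cnj \<zeta> z) + cnj \<zeta> (z - \<zeta>'), and
  |z - \<zeta>'| <= |1 - cnj \<zeta>' z|. With constant 1 in the triangle inequality, doubling a
  radius is enough in the localization below.\<close>

lemma kernel_triangle:
  assumes "cmod z < 1" "cmod \<zeta> < 1" "cmod \<zeta>' < 1"
  shows "cmod (1 - cnj \<zeta> * \<zeta>') \<le> cmod (1 - cnj \<zeta> * z) + cmod (1 - cnj \<zeta>' * z)"
proof -
  have "1 - cnj \<zeta> * \<zeta>' = (1 - cnj \<zeta> * z) + cnj \<zeta> * (z - \<zeta>')" by (simp add: algebra_simps)
  then have "cmod (1 - cnj \<zeta> * \<zeta>') \<le> cmod (1 - cnj \<zeta> * z) + cmod (cnj \<zeta> * (z - \<zeta>'))"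
    by (simp only: norm_triangle_ineq)
  also have "cmod (cnj \<zeta> * (z - \<zeta>')) = cmod \<zeta> * cmod (z - \<zeta>')"
    by (simp only: norm_mult complex_mod_cnj)
  also have "cmod \<zeta> * cmod (z - \<zeta>') \<le> 1 * cmod (1 - cnj \<zeta>' * z)"
    using assms cmod_diff_le_kernel by (intro mult_mono) auto
  finally show ?thesis by simp
qed

text \<open>Of two points, one with the smaller \<rho> may be taken as the inner variable, by
  symmetry. Ties are counted twice, whence an inequality.\<close>

lemma nn_integral_square_ordered:
  fixes a :: "complex \<Rightarrow> ennreal" and \<rho> :: "complex \<Rightarrow> real"
  assumes [measurable]: "a \<in> borel_measurable dA" "\<rho> \<in> borel_measurable dA"
  shows "(\<integral>\<^sup>+x. a x \<partial>dA)\<^sup>2 \<le> 2 * (\<integral>\<^sup>+x. a x * (\<integral>\<^sup>+y. a y * indicator {y. \<rho> y \<le> \<rho> x} y \<partial>dA) \<partial>dA)"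
proof -
  define P where "P x y = a x * (a y * indicator {y. \<rho> y \<le> \<rho> x} y)" for x y
  have Pm: "(\<lambda>(x, y). P x y) \<in> borel_measurable (dA \<Otimes>\<^sub>M dA)"
    unfolding P_def indicator_def[abs_def] by measurable
  have P1: "(\<lambda>y. P x y) \<in> borel_measurable dA" for x
    unfolding P_def indicator_def[abs_def] by measurable
  have P2: "(\<lambda>y. P y x) \<in> borel_measurable dA" for x
    unfolding P_def indicator_def[abs_def] by measurable
  have "(\<integral>\<^sup>+x. a x \<partial>dA)\<^sup>2 = (\<integral>\<^sup>+x. (\<integral>\<^sup>+y. a x * a y \<partial>dA) \<partial>dA)"
    by (simp add: nn_integral_cmult nn_integral_multc power2_eq_square)
  also have "\<dots> \<le> (\<integral>\<^sup>+x. (\<integral>\<^sup>+y. P x y + P y x \<partial>dA) \<partial>dA)"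
  proof (intro nn_integral_mono)
    fix x y show "a x * a y \<le> P x y + P y x"
      by (cases "\<rho> y \<le> \<rho> x") (auto simp: P_def indicator_def mult.commute)
  qed
  also have "\<dots> = (\<integral>\<^sup>+x. (\<integral>\<^sup>+y. P x y \<partial>dA) \<partial>dA) + (\<integral>\<^sup>+x. (\<integral>\<^sup>+y. P y x \<partial>dA) \<partial>dA)"
    using Pm P1 P2
    by (subst nn_integral_add[symmetric])
       (auto intro!: nn_integral_cong nn_integral_add dA.borel_measurable_nn_integral simp: measurable_split_conv
          dest: measurable_pair_swap)
  also have "(\<integral>\<^sup>+x. (\<integral>\<^sup>+y. P y x \<partial>dA) \<partial>dA) = (\<integral>\<^sup>+x. (\<integral>\<^sup>+y. P x y \<partial>dA) \<partial>dA)"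
    by (rule dA2.Fubini'[OF Pm])
  also have "(\<integral>\<^sup>+x. (\<integral>\<^sup>+y. P x y \<partial>dA) \<partial>dA) = (\<integral>\<^sup>+x. a x * (\<integral>\<^sup>+y. a y * indicator {y. \<rho> y \<le> \<rho> x} y \<partial>dA) \<partial>dA)"
    unfolding P_def by (intro nn_integral_cong nn_integral_cmult) (simp add: indicator_def[abs_def])
  finally show ?thesis by (simp add: mult_2)
qed

text \<open>What boundedness of the operator contributes here is the ball condition with constant A;
  \<open>berg_bounded\<close> is assumed where it is used. Neither involves r, so constants built
  from A and C are uniform in r. The condition on \<open>r ^ 4\<close> is that of the Hardy
  inequality.\<close>

locale toeplitz_weights =
  fixes f g :: "complex \<Rightarrow> complex" and r A :: real
  assumes f: "f \<in> L2" and g: "g \<in> L2" and f_holo: "f holomorphic_on disc"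
    and r: "0 < r" "r < 1" and r4: "3 / 4 \<le> r ^ 4" and A0: "0 \<le> A"
    and ball: "\<And>a R. cmod a < 1 \<Longrightarrow> 0 < R \<Longrightarrow>
      (\<integral>z. (cmod (f z))\<^sup>2 * indicator {z\<in>disc. cmod (1 - cnj a * z) < R} z \<partial>dA)
       * (\<integral>z. (cmod (g z))\<^sup>2 * indicator {z\<in>disc. cmod (1 - cnj a * z) < R} z \<partial>dA) \<le> A\<^sup>2 * R ^ 4"
begin

definition mass :: "complex set \<Rightarrow> real" where
  "mass E = (\<integral>\<zeta>. (cmod (g \<zeta>))\<^sup>2 * indicator E \<zeta> \<partial>dA)"

definition weight_on :: "complex set \<Rightarrow> complex \<Rightarrow> real" where
  "weight_on E \<zeta> = (cmod (g \<zeta>))\<^sup>2 * indicator E \<zeta>"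

definition tested :: "real \<Rightarrow> bool" where
  "tested \<tau> \<longleftrightarrow> (\<forall>E. E \<in> sets dA \<longrightarrow> E \<subseteq> cball 0 r \<longrightarrow>
     (\<integral>z. indicator (cball 0 r) z * ((cmod (f z))\<^sup>2 * (Phi (weight_on E) z)\<^sup>2) \<partial>dA) \<le> \<tau> * mass E)"

lemma kernel_weight_weight_on: "E \<in> sets dA \<Longrightarrow> E \<subseteq> cball 0 r \<Longrightarrow> kernel_weight r (weight_on E)"
  unfolding weight_on_def[abs_def] by (rule kernel_weight_square[OF g r])

lemma f_measurable [measurable]: "f \<in> borel_measurable dA" and g_measurable [measurable]: "g \<in> borel_measurable dA"
  using f g by (auto dest: L2_measurable)

lemma cball_measurable [measurable]: "cball 0 r \<in> sets dA"
  using r by (intro cball_sets_dA)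

lemma mass_nonneg: "0 \<le> mass E"
  unfolding mass_def by (intro integral_nonneg_AE AE_I2) simp

lemma f_bounded: obtains K where "\<And>z. z \<in> cball 0 r \<Longrightarrow> (cmod (f z))\<^sup>2 \<le> K"
proof -
  have cb: "cball 0 r \<subseteq> disc" using r by auto
  have "bounded (f ` cball 0 r)"
    using f_holo cb by (intro compact_imp_bounded compact_continuous_image compact_cball)
      (blast intro: holomorphic_on_imp_continuous_on continuous_on_subset)
  then obtain C where C: "\<forall>y\<in>f ` cball 0 r. cmod y \<le> C" unfolding bounded_iff by blast
  show ?thesis using C by (intro that[of "C\<^sup>2"] power_mono) auto
qed

text \<open>For fixed r all potentials are bounded on the disc of radius r. The last conclusion
  provides some testing constant, of a size depending on r, from which the absorption argument can
  start.\<close>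

lemma
  assumes E: "E \<in> sets dA" "E \<subseteq> cball 0 r"
  shows integrable_f_Phi: "integrable dA (\<lambda>z. indicator (cball 0 r) z * ((cmod (f z))\<^sup>2 * (Phi (weight_on E) z)\<^sup>2))"
    and integrable_f_Theta: "integrable dA (\<lambda>z. indicator (cball 0 r) z * ((cmod (f z))\<^sup>2 * (Theta (weight_on E) z)\<^sup>2))"
    and tested_ex: "(\<integral>z. indicator (cball 0 r) z * ((cmod (f z))\<^sup>2 * (Phi (weight_on E) z)\<^sup>2) \<partial>dA)
      \<le> (norm2sq f * (mass disc * (1 / (1 - r)) ^ 4)) * mass E"
proof -
  interpret kernel_weight r "weight_on E" by (rule kernel_weight_weight_on[OF E])
  obtain K where K: "\<And>z. z \<in> cball 0 r \<Longrightarrow> (cmod (f z))\<^sup>2 \<le> K" by (rule f_bounded) blast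
  define M where "M = mass E * (1 / (1 - r))\<^sup>2"
  have P: "0 \<le> Phi (weight_on E) z" "Phi (weight_on E) z \<le> M" if "z \<in> cball 0 r" for z
    using Phi_nonneg[of z] Phi_le[of z] that r by (auto simp: M_def mass_def weight_on_def)
  have T: "0 \<le> Theta (weight_on E) z" "Theta (weight_on E) z \<le> 2 * M" if "z \<in> cball 0 r" for z
    using Theta_bounds[of z] P(2)[OF that] that r by auto
  show i: "integrable dA (\<lambda>z. indicator (cball 0 r) z * ((cmod (f z))\<^sup>2 * (Phi (weight_on E) z)\<^sup>2))"
  proof (rule integrable_cball_bounded)
    fix z :: complex assume z: "z \<in> cball 0 r"
    show "\<bar>(cmod (f z))\<^sup>2 * (Phi (weight_on E) z)\<^sup>2\<bar> \<le> K * M\<^sup>2"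
      using mult_mono[OF K[OF z] power_mono[OF P(2)[OF z] P(1)[OF z], of 2]] order.trans[OF zero_le_power2 K[OF z]]
      by (simp add: abs_mult)
  qed measurable
  show "integrable dA (\<lambda>z. indicator (cball 0 r) z * ((cmod (f z))\<^sup>2 * (Theta (weight_on E) z)\<^sup>2))"
  proof (rule integrable_cball_bounded)
    fix z :: complex assume z: "z \<in> cball 0 r"
    show "\<bar>(cmod (f z))\<^sup>2 * (Theta (weight_on E) z)\<^sup>2\<bar> \<le> K * (2 * M)\<^sup>2"
      using mult_mono[OF K[OF z] power_mono[OF T(2)[OF z] T(1)[OF z], of 2]] order.trans[OF zero_le_power2 K[OF z]]
      by (simp add: abs_mult)
  qed measurable
  have "(\<integral>z. indicator (cball 0 r) z * ((cmod (f z))\<^sup>2 * (Phi (weight_on E) z)\<^sup>2) \<partial>dA) \<le> (\<integral>z. (cmod (f z))\<^sup>2 * M\<^sup>2 \<partial>dA)"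
  proof (rule integral_mono[OF i])
    show "integrable dA (\<lambda>z. (cmod (f z))\<^sup>2 * M\<^sup>2)" using L2_integrable_sq[OF f] by simp
    show "indicator (cball 0 r) z * ((cmod (f z))\<^sup>2 * (Phi (weight_on E) z)\<^sup>2) \<le> (cmod (f z))\<^sup>2 * M\<^sup>2" for z
      using P[of z] by (cases "z \<in> cball 0 r") (auto intro!: mult_left_mono power_mono)
  qed
  also have "\<dots> = norm2sq f * M\<^sup>2" by simp
  also have "M\<^sup>2 = (mass E * (1 / (1 - r)) ^ 4) * mass E"
    by (simp add: M_def power_mult_distrib power2_eq_square power4_eq_xxxx)
  also have "norm2sq f * \<dots> \<le> norm2sq f * ((mass disc * (1 / (1 - r)) ^ 4) * mass E)"
  proof -
    have "mass E \<le> mass disc" unfolding mass_def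
      using E L2_integrable_sq[OF g]
      by (intro integral_mono integrable_real_mult_indicator) (auto simp: sets_dA_iff open_disc indicator_def)
    then show ?thesis using mass_nonneg r by (intro mult_left_mono mult_right_mono) auto
  qed
  finally show "(\<integral>z. indicator (cball 0 r) z * ((cmod (f z))\<^sup>2 * (Phi (weight_on E) z)\<^sup>2) \<partial>dA)
      \<le> (norm2sq f * (mass disc * (1 / (1 - r)) ^ 4)) * mass E" by (simp add: mult.assoc)
qed

text \<open>Cauchy-Schwarz on B: one factor is the f-mass of B, the other is controlled by testing E
  cut by B, hence by s^4 times the g-mass of B. The ball condition bounds the product of the two
  masses.\<close>

lemma local_bound:
  assumes s: "0 \<le> s" "tested (s ^ 4)" and E: "E \<in> sets dA" "E \<subseteq> cball 0 r"
    and a: "cmod a < 1" and R: "0 < R"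
  defines "B \<equiv> {z \<in> disc. cmod (1 - cnj a * z) < R}"
  shows "(\<integral>\<^sup>+z. ennreal ((cmod (f z))\<^sup>2 * indicator (cball 0 r) z) * indicator B z *
      (\<integral>\<^sup>+\<zeta>. ennreal (weight_on E \<zeta> * (1 / (cmod (1 - cnj \<zeta> * z))\<^sup>2)) * indicator B \<zeta> \<partial>dA) \<partial>dA) \<le> ennreal (s\<^sup>2 * A * R\<^sup>2)"
proof -
  have "(\<lambda>z. cmod (1 - cnj a * z)) \<in> borel_measurable dA" by measurable
  then have "{z \<in> space dA. cmod (1 - cnj a * z) < R} \<in> sets dA" by measurable
  then have Bm [measurable]: "B \<in> sets dA" by (simp add: B_def)
  have EB: "E \<inter> B \<in> sets dA" "E \<inter> B \<subseteq> cball 0 r" using E by auto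
  interpret kernel_weight r "weight_on (E \<inter> B)" by (rule kernel_weight_weight_on[OF EB])
  have inner: "(\<integral>\<^sup>+\<zeta>. ennreal (weight_on E \<zeta> * (1 / (cmod (1 - cnj \<zeta> * z))\<^sup>2)) * indicator B \<zeta> \<partial>dA) = ennreal (Phi (weight_on (E \<inter> B)) z)"
    if "cmod z < 1" for z
  proof -
    have "(\<integral>\<^sup>+\<zeta>. ennreal (weight_on E \<zeta> * (1 / (cmod (1 - cnj \<zeta> * z))\<^sup>2)) * indicator B \<zeta> \<partial>dA)
      = (\<integral>\<^sup>+\<zeta>. ennreal (weight_on (E \<inter> B) \<zeta> * (1 / (cmod (1 - cnj \<zeta> * z))\<^sup>2)) \<partial>dA)"
      by (intro nn_integral_cong) (simp add: weight_on_def indicator_def)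
    also have "\<dots> = ennreal (Phi (weight_on (E \<inter> B)) z)"
      unfolding Phi_eq using \<alpha>0 by (intro nn_integral_eq_integral integrable_Phi that AE_I2) simp
    finally show ?thesis .
  qed
  let ?x = "\<lambda>z. cmod (f z) * indicator B z" and ?y = "\<lambda>z. indicator (cball 0 r) z * (cmod (f z) * Phi (weight_on (E \<inter> B)) z)"
  have x2: "(?x z)\<^sup>2 = (cmod (f z))\<^sup>2 * indicator B z" for z
    by (simp add: power_mult_distrib indicator_def)
  have ix: "integrable dA (\<lambda>z. (?x z)\<^sup>2)"
    unfolding x2 by (rule integrable_real_mult_indicator[OF Bm L2_integrable_sq[OF f]])
  have y2: "(?y z)\<^sup>2 = indicator (cball 0 r) z * ((cmod (f z))\<^sup>2 * (Phi (weight_on (E \<inter> B)) z)\<^sup>2)" for z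
    by (simp add: power_mult_distrib indicator_def)
  have iy: "integrable dA (\<lambda>z. (?y z)\<^sup>2)" unfolding y2 by (rule integrable_f_Phi[OF EB])
  have xm: "?x \<in> borel_measurable dA" and ym: "?y \<in> borel_measurable dA" by measurable
  note CS = Cauchy_Schwarz_integral[OF xm ix ym iy]
  have "mass (E \<inter> B) \<le> mass B" unfolding mass_def
    using EB L2_integrable_sq[OF g]
    by (intro integral_mono integrable_real_mult_indicator) (auto simp: indicator_def)
  then have y: "(\<integral>z. (?y z)\<^sup>2 \<partial>dA) \<le> s ^ 4 * mass B"
    unfolding y2 using s EB by (intro order.trans[OF s(2)[unfolded tested_def, rule_format, OF EB]] mult_left_mono) auto
  have "(\<integral>z. ?x z * ?y z \<partial>dA)\<^sup>2 \<le> (\<integral>z. (?x z)\<^sup>2 \<partial>dA) * (\<integral>z. (?y z)\<^sup>2 \<partial>dA)" by (rule CS(2))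
  also have "\<dots> \<le> (\<integral>z. (?x z)\<^sup>2 \<partial>dA) * (s ^ 4 * mass B)"
    by (intro mult_left_mono y integral_nonneg_AE AE_I2) simp
  also have "\<dots> = s ^ 4 * ((\<integral>z. (cmod (f z))\<^sup>2 * indicator B z \<partial>dA) * mass B)"
    unfolding x2 by (simp only: mult_ac)
  also have "\<dots> \<le> s ^ 4 * (A\<^sup>2 * R ^ 4)"
    unfolding mass_def B_def using s(1) by (intro mult_left_mono ball a R) auto
  also have "\<dots> = (s\<^sup>2 * A * R\<^sup>2)\<^sup>2"
    by (simp add: power_mult_distrib flip: power_mult)
  finally have le: "(\<integral>z. ?x z * ?y z \<partial>dA) \<le> s\<^sup>2 * A * R\<^sup>2"
    by (rule power2_le_imp_le) (use A0 in simp)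
  have "(\<integral>\<^sup>+z. ennreal ((cmod (f z))\<^sup>2 * indicator (cball 0 r) z) * indicator B z *
      (\<integral>\<^sup>+\<zeta>. ennreal (weight_on E \<zeta> * (1 / (cmod (1 - cnj \<zeta> * z))\<^sup>2)) * indicator B \<zeta> \<partial>dA) \<partial>dA)
    = (\<integral>\<^sup>+z. ennreal (?x z * ?y z) \<partial>dA)"
  proof (rule nn_integral_cong)
    fix z assume "z \<in> space dA"
    then have "cmod z < 1" by simp
    from inner[OF this] Phi_nonneg[of z]
    show "ennreal ((cmod (f z))\<^sup>2 * indicator (cball 0 r) z) * indicator B z *
      (\<integral>\<^sup>+\<zeta>. ennreal (weight_on E \<zeta> * (1 / (cmod (1 - cnj \<zeta> * z))\<^sup>2)) * indicator B \<zeta> \<partial>dA) = ennreal (?x z * ?y z)"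
      by (auto simp: indicator_def power2_eq_square simp flip: ennreal_mult' ennreal_mult'' mult.assoc)
  qed
  also have "\<dots> = ennreal (\<integral>z. ?x z * ?y z \<partial>dA)"
    using Phi_nonneg by (intro nn_integral_eq_integral CS(1) AE_I2) simp
  also have "\<dots> \<le> ennreal (s\<^sup>2 * A * R\<^sup>2)" by (rule ennreal_leI[OF le])
  finally show ?thesis .
qed

text \<open>Take the smallest ball about \<zeta>, of radius 2^k (1 - |\<zeta>|^2), that contains z.
  Then |1 - cnj \<zeta> z| is at least half this radius, for k = 0 because 1 - |\<zeta>|^2 <= 2 |1 -
  cnj \<zeta> z|; the 8 is the cube of this half inverted.\<close>

lemma Theta_kernel_dyadic:
  assumes z: "cmod z < 1" and \<zeta>: "\<zeta> \<in> cball 0 r" and n: "2 < 2 ^ n * (1 - (cmod \<zeta>)\<^sup>2)"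
  obtains k where "k < Suc n" "cmod (1 - cnj \<zeta> * z) < 2 ^ k * (1 - (cmod \<zeta>)\<^sup>2)"
    "(1 - (cmod \<zeta>)\<^sup>2) / (cmod (1 - cnj \<zeta> * z)) ^ 3 \<le> 8 * (1 / 8) ^ k / (1 - (cmod \<zeta>)\<^sup>2)\<^sup>2"
proof -
  define T where "T = 1 - (cmod \<zeta>)\<^sup>2"
  define \<rho> where "\<rho> = cmod (1 - cnj \<zeta> * z)"
  have \<zeta>1: "cmod \<zeta> < 1" using \<zeta> r by auto
  have "(cmod \<zeta>)\<^sup>2 < 1\<^sup>2" using \<zeta>1 by (intro power_strict_mono) auto
  then have T0: "0 < T" by (simp add: T_def)
  have T2: "T \<le> 2 * \<rho>"
  proof -
    have "T = (1 - cmod \<zeta>) * (1 + cmod \<zeta>)" by (simp add: T_def power2_eq_square algebra_simps)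
    also have "\<dots> \<le> \<rho> * 2" unfolding \<rho>_def
      using kernel_bound(2)[OF z \<zeta>1] \<zeta>1 by (intro mult_mono) auto
    finally show ?thesis by simp
  qed
  have \<rho>2: "\<rho> < 2 ^ n * T" using n kernel_bound(3)[OF z \<zeta>1] by (simp add: T_def \<rho>_def)
  define k where "k = (LEAST k. \<rho> < 2 ^ k * T)"
  have k: "\<rho> < 2 ^ k * T" unfolding k_def by (rule LeastI[of _ n]) (rule \<rho>2)
  have kn: "k \<le> n" unfolding k_def by (rule Least_le) (rule \<rho>2)
  have low: "2 ^ k * T / 2 \<le> \<rho>"
  proof (cases k)
    case 0
    then show ?thesis using T2 by simp
  next
    case (Suc j)
    then have "\<not> \<rho> < 2 ^ j * T" unfolding k_def by (intro not_less_Least) simp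
    then show ?thesis using Suc by simp
  qed
  have \<rho>0: "0 < \<rho>" using T0 T2 by simp
  have "(2 ^ k * T / 2) ^ 3 \<le> \<rho> ^ 3" using low T0 by (intro power_mono) auto
  then have "T / \<rho> ^ 3 \<le> T / (2 ^ k * T / 2) ^ 3" using T0 \<rho>0 by (intro divide_left_mono) auto
  also have "(2 ^ k * T / 2) ^ 3 = 8 ^ k * (T * T\<^sup>2) / 8"
  proof -
    have "(2 ^ k :: real) ^ 3 = (2 ^ 3) ^ k" by (simp only: mult.commute flip: power_mult)
    then have "(2 ^ k :: real) ^ 3 = 8 ^ k" by simp
    then show ?thesis by (simp add: power_mult_distrib power_divide power2_eq_square power3_eq_cube)
  qed
  also have "T / (8 ^ k * (T * T\<^sup>2) / 8) = 8 * (1 / 8) ^ k / T\<^sup>2"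
    using T0 by (simp add: power_one_over field_simps)
  finally show ?thesis using that[of k] k kn by (simp add: T_def \<rho>_def)
qed

text \<open>With T = 1 - |\<zeta>|^2, in the ball of index k the kernel is of size 8^(-k) / T^2,
  while the localized integral is of size 4^k T^2. The gain 2^(-k) is due to the factor T / |w| by
  which the kernel of \<open>Theta\<close> is smaller than that of \<open>Phi\<close>; with the
  latter the scales would all contribute equally.\<close>

lemma Theta_inner_bound:
  assumes s: "0 \<le> s" "tested (s ^ 4)" and E: "E \<in> sets dA" "E \<subseteq> cball 0 r" and \<zeta>: "\<zeta> \<in> cball 0 r"
  defines "\<theta> \<equiv> \<lambda>z \<zeta>. (1 - (cmod \<zeta>)\<^sup>2) / (cmod (1 - cnj \<zeta> * z)) ^ 3"
  shows "(\<integral>\<^sup>+z. ennreal ((cmod (f z))\<^sup>2 * indicator (cball 0 r) z) * (ennreal (\<theta> z \<zeta>) *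
      (\<integral>\<^sup>+\<zeta>'. ennreal (weight_on E \<zeta>' * \<theta> z \<zeta>') * indicator {\<zeta>'. cmod (1 - cnj \<zeta>' * z) \<le> cmod (1 - cnj \<zeta> * z)} \<zeta>' \<partial>dA)) \<partial>dA)
    \<le> ennreal (128 * s\<^sup>2 * A)"
proof -
  interpret kernel_weight r "weight_on E" by (rule kernel_weight_weight_on[OF E])
  have Em [measurable]: "E \<in> sets dA" by (rule E(1))
  have Nm [measurable]: "weight_on E \<in> borel_measurable dA" by (rule \<alpha>_measurable)
  define T where "T = 1 - (cmod \<zeta>)\<^sup>2"
  have \<zeta>1: "cmod \<zeta> < 1" using \<zeta> r by auto
  have "(cmod \<zeta>)\<^sup>2 < 1\<^sup>2" using \<zeta>1 by (intro power_strict_mono) auto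
  then have T0: "0 < T" by (simp add: T_def)
  obtain n where n: "2 < 2 ^ n * T"
  proof -
    obtain n where "2 / T < 2 ^ n" using real_arch_pow[of 2 "2 / T"] by auto
    then show ?thesis using T0 that[of n] by (simp add: pos_divide_less_eq)
  qed
  \<comment> \<open>The exponent is \<open>Suc k\<close> because the triangle inequality places
    \<zeta>' only within twice the radius that captures z.\<close>
  define B where "B k = {z \<in> disc. cmod (1 - cnj \<zeta> * z) < 2 ^ Suc k * T}" for k
  have Bm [measurable]: "B k \<in> sets dA" for k
  proof -
    have "(\<lambda>z. cmod (1 - cnj \<zeta> * z)) \<in> borel_measurable dA" by measurable
    then have "{z \<in> space dA. cmod (1 - cnj \<zeta> * z) < 2 ^ Suc k * T} \<in> sets dA" by measurable
    then show ?thesis by (simp add: B_def)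
  qed
  \<comment> \<open>The 16 combines the 8 of the dyadic bound in \<zeta> with the 2 lost when the
    kernel in \<zeta>' is bounded by that of \<open>Phi\<close>.\<close>
  define c where "c k = 16 * (1 / 8) ^ k / T\<^sup>2" for k :: nat
  have c0: "0 \<le> c k" for k by (simp add: c_def)
  let ?W = "\<lambda>z. ennreal ((cmod (f z))\<^sup>2 * indicator (cball 0 r) z)"
  let ?K = "\<lambda>k z. \<integral>\<^sup>+\<zeta>'. ennreal (weight_on E \<zeta>' * (1 / (cmod (1 - cnj \<zeta>' * z))\<^sup>2)) * indicator (B k) \<zeta>' \<partial>dA"
  let ?S = "\<lambda>z. {\<zeta>'. cmod (1 - cnj \<zeta>' * z) \<le> cmod (1 - cnj \<zeta> * z)}"
  have Kmm: "(\<lambda>z. ?K k z) \<in> borel_measurable dA" for k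
    by (rule dA.borel_measurable_nn_integral) measurable
  have point: "ennreal (\<theta> z \<zeta>) * (\<integral>\<^sup>+\<zeta>'. ennreal (weight_on E \<zeta>' * \<theta> z \<zeta>') * indicator (?S z) \<zeta>' \<partial>dA)
    \<le> (\<Sum>k<Suc n. ennreal (c k) * (indicator (B k) z * ?K k z))" if z: "cmod z < 1" for z
  proof -
    obtain k where k: "k < Suc n" "cmod (1 - cnj \<zeta> * z) < 2 ^ k * T" "\<theta> z \<zeta> \<le> 8 * (1 / 8) ^ k / T\<^sup>2"
      using Theta_kernel_dyadic[OF z \<zeta> n[unfolded T_def]] unfolding T_def \<theta>_def by blast
    have kT: "0 < 2 ^ k * T" "2 ^ Suc k * T = 2 * (2 ^ k * T)" using T0 by auto
    have zB: "z \<in> B k" using z k(2) kT unfolding B_def by auto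
    have inn: "(\<integral>\<^sup>+\<zeta>'. ennreal (weight_on E \<zeta>' * \<theta> z \<zeta>') * indicator (?S z) \<zeta>' \<partial>dA)
      \<le> (\<integral>\<^sup>+\<zeta>'. ennreal 2 * (ennreal (weight_on E \<zeta>' * (1 / (cmod (1 - cnj \<zeta>' * z))\<^sup>2)) * indicator (B k) \<zeta>') \<partial>dA)"
    proof (rule nn_integral_mono)
      fix \<zeta>' assume "\<zeta>' \<in> space dA"
      then have \<zeta>': "cmod \<zeta>' < 1" by simp
      show "ennreal (weight_on E \<zeta>' * \<theta> z \<zeta>') * indicator (?S z) \<zeta>'
        \<le> ennreal 2 * (ennreal (weight_on E \<zeta>' * (1 / (cmod (1 - cnj \<zeta>' * z))\<^sup>2)) * indicator (B k) \<zeta>')"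
      proof (cases "\<zeta>' \<in> ?S z \<and> \<zeta>' \<in> cball 0 r")
        case True
        note kf = kernel_facts[OF z conjunct2[OF True]]
        have "cmod (1 - cnj \<zeta> * \<zeta>') \<le> cmod (1 - cnj \<zeta> * z) + cmod (1 - cnj \<zeta>' * z)"
          by (rule kernel_triangle[OF z \<zeta>1 \<zeta>'])
        moreover have "cmod (1 - cnj \<zeta>' * z) \<le> cmod (1 - cnj \<zeta> * z)" using True by simp
        ultimately have B': "\<zeta>' \<in> B k" using k(2) kT(2) \<zeta>' unfolding B_def by auto
        have "(1 - (cmod \<zeta>')\<^sup>2) / cmod (1 - cnj \<zeta>' * z) \<le> 2" using kf by (simp add: pos_divide_le_eq)
        from mult_right_mono[OF this, of "1 / (cmod (1 - cnj \<zeta>' * z))\<^sup>2"]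
        have "\<theta> z \<zeta>' \<le> 2 * (1 / (cmod (1 - cnj \<zeta>' * z))\<^sup>2)"
          by (simp add: \<theta>_def power2_eq_square power3_eq_cube)
        from mult_left_mono[OF this \<alpha>0[of \<zeta>']]
        have "ennreal (weight_on E \<zeta>' * \<theta> z \<zeta>') \<le> ennreal (2 * (weight_on E \<zeta>' * (1 / (cmod (1 - cnj \<zeta>' * z))\<^sup>2)))"
          by (intro ennreal_leI) (simp add: mult_ac)
        also have "\<dots> = ennreal 2 * ennreal (weight_on E \<zeta>' * (1 / (cmod (1 - cnj \<zeta>' * z))\<^sup>2))"
          by (rule ennreal_mult') simp
        finally show ?thesis using True B' by simp
      next
        case False
        then show ?thesis using \<alpha>supp[of \<zeta>'] by (auto simp: indicator_def)
      qed
    qed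
    have "ennreal (\<theta> z \<zeta>) * (\<integral>\<^sup>+\<zeta>'. ennreal (weight_on E \<zeta>' * \<theta> z \<zeta>') * indicator (?S z) \<zeta>' \<partial>dA)
      \<le> ennreal (8 * (1 / 8) ^ k / T\<^sup>2) * (\<integral>\<^sup>+\<zeta>'. ennreal 2 * (ennreal (weight_on E \<zeta>' * (1 / (cmod (1 - cnj \<zeta>' * z))\<^sup>2)) * indicator (B k) \<zeta>') \<partial>dA)"
      by (rule mult_mono[OF ennreal_leI[OF k(3)] inn]) auto
    also have "\<dots> = ennreal (c k) * (indicator (B k) z * ?K k z)"
    proof -
      have "ennreal (c k) = ennreal (8 * (1 / 8) ^ k / T\<^sup>2) * ennreal 2"
        by (subst ennreal_mult'[symmetric]) (simp_all add: c_def)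
      then show ?thesis using zB by (subst nn_integral_cmult) (auto simp: mult.assoc)
    qed
    also have "\<dots> \<le> (\<Sum>k<Suc n. ennreal (c k) * (indicator (B k) z * ?K k z))"
      using k(1) by (intro member_le_sum) auto
    finally show ?thesis .
  qed
  have "(\<integral>\<^sup>+z. ?W z * (ennreal (\<theta> z \<zeta>) *
      (\<integral>\<^sup>+\<zeta>'. ennreal (weight_on E \<zeta>' * \<theta> z \<zeta>') * indicator (?S z) \<zeta>' \<partial>dA)) \<partial>dA)
    \<le> (\<integral>\<^sup>+z. (\<Sum>k<Suc n. ennreal (c k) * (?W z * indicator (B k) z * ?K k z)) \<partial>dA)"
  proof (rule nn_integral_mono)
    fix z assume "z \<in> space dA"
    then have "cmod z < 1" by simp
    from mult_left_mono[OF point[OF this], of "?W z"]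
    show "?W z * (ennreal (\<theta> z \<zeta>) * (\<integral>\<^sup>+\<zeta>'. ennreal (weight_on E \<zeta>' * \<theta> z \<zeta>') * indicator (?S z) \<zeta>' \<partial>dA))
      \<le> (\<Sum>k<Suc n. ennreal (c k) * (?W z * indicator (B k) z * ?K k z))"
      by (simp add: sum_distrib_left mult_ac del: sum.lessThan_Suc)
  qed
  also have "\<dots> = (\<Sum>k<Suc n. ennreal (c k) * (\<integral>\<^sup>+z. ?W z * indicator (B k) z * ?K k z \<partial>dA))"
    using Kmm by (simp add: nn_integral_sum nn_integral_cmult del: sum.lessThan_Suc)
  also have "\<dots> \<le> (\<Sum>k<Suc n. ennreal (c k) * ennreal (s\<^sup>2 * A * (2 ^ Suc k * T)\<^sup>2))"
    unfolding B_def using T0 by (intro sum_mono mult_left_mono local_bound s E \<zeta>1) auto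
  also have "\<dots> = ennreal (\<Sum>k<Suc n. c k * (s\<^sup>2 * A * (2 ^ Suc k * T)\<^sup>2))"
    using c0 A0 by (simp add: ennreal_mult'[symmetric] sum_ennreal del: sum.lessThan_Suc power_Suc)
  also have "\<dots> \<le> ennreal (128 * s\<^sup>2 * A)"
  proof (rule ennreal_leI)
    \<comment> \<open>16 * 8^(-k) * 4 * 4^k = 64 * 2^(-k), and the geometric series doubles the
      first term.\<close>
    have "c k * (s\<^sup>2 * A * (2 ^ Suc k * T)\<^sup>2) = (64 * s\<^sup>2 * A) * (1 / 2) ^ k" for k
    proof -
      have "((2 :: real) ^ Suc k)\<^sup>2 = 4 * 4 ^ k" by (simp add: power2_eq_square flip: power_mult_distrib)
      moreover have "(1 / 8 :: real) ^ k * 4 ^ k = (1 / 2) ^ k" by (simp flip: power_mult_distrib)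
      ultimately show ?thesis using T0 by (simp add: c_def power_mult_distrib mult_ac)
    qed
    then have "(\<Sum>k<Suc n. c k * (s\<^sup>2 * A * (2 ^ Suc k * T)\<^sup>2)) = (64 * s\<^sup>2 * A) * (\<Sum>k<Suc n. (1 / 2) ^ k)"
      by (simp only: sum_distrib_left)
    also have "\<dots> \<le> (64 * s\<^sup>2 * A) * 2"
      using A0 by (intro mult_left_mono) (simp_all add: sum_gp_strict del: sum.lessThan_Suc)
    finally show "(\<Sum>k<Suc n. c k * (s\<^sup>2 * A * (2 ^ Suc k * T)\<^sup>2)) \<le> 128 * s\<^sup>2 * A" by simp
  qed
  finally show ?thesis .
qed

text \<open>By symmetry only the pairs with \<open>|1 - cnj \<zeta>' z| \<le> |1 - cnj \<zeta> z|\<close> matter in the square of \<open>Theta\<close>. For fixed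
  \<open>\<zeta>\<close> the kernel splits dyadically over the balls \<open>|1 - cnj \<zeta> z| < 2\<^sup>k (1 - |\<zeta>|\<^sup>2)\<close>, and in each ball both
  remaining variables are localized, so the testing hypothesis meets the ball condition.\<close>

lemma Theta_bound:
  assumes s: "0 \<le> s" "tested (s ^ 4)" and E: "E \<in> sets dA" "E \<subseteq> cball 0 r"
  shows "(\<integral>z. indicator (cball 0 r) z * ((cmod (f z))\<^sup>2 * (Theta (weight_on E) z)\<^sup>2) \<partial>dA) \<le> 256 * s\<^sup>2 * A * mass E"
proof -
  interpret kernel_weight r "weight_on E" by (rule kernel_weight_weight_on[OF E])
  have Em [measurable]: "E \<in> sets dA" by (rule E(1))
  have Nm [measurable]: "weight_on E \<in> borel_measurable dA" by (rule \<alpha>_measurable)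
  define \<theta> where "\<theta> z \<zeta> = (1 - (cmod \<zeta>)\<^sup>2) / (cmod (1 - cnj \<zeta> * z)) ^ 3" for z \<zeta>
  have \<theta>m [measurable]: "(\<lambda>(z, \<zeta>). \<theta> z \<zeta>) \<in> borel_measurable (dA \<Otimes>\<^sub>M dA)" unfolding \<theta>_def by measurable
  have \<theta>m1 [measurable]: "\<theta> z \<in> borel_measurable dA" for z unfolding \<theta>_def[abs_def] by measurable
  let ?W = "\<lambda>z. ennreal ((cmod (f z))\<^sup>2 * indicator (cball 0 r) z)"
  let ?a = "\<lambda>z \<zeta>. ennreal (weight_on E \<zeta> * \<theta> z \<zeta>)"
  let ?S = "\<lambda>z \<zeta>. {\<zeta>'. cmod (1 - cnj \<zeta>' * z) \<le> cmod (1 - cnj \<zeta> * z)}"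
  let ?I = "\<lambda>z \<zeta>. \<integral>\<^sup>+\<zeta>'. ?a z \<zeta>' * indicator (?S z \<zeta>) \<zeta>' \<partial>dA"
  have Im: "(\<lambda>(z, \<zeta>). ?I z \<zeta>) \<in> borel_measurable (dA \<Otimes>\<^sub>M dA)"
    unfolding case_prod_beta
  proof (rule dA.borel_measurable_nn_integral)
    have "(\<lambda>(x, y). ennreal (weight_on E y * \<theta> (fst x) y) * (if cmod (1 - cnj y * fst x) \<le> cmod (1 - cnj (snd x) * fst x) then 1 else 0))
      \<in> borel_measurable ((dA \<Otimes>\<^sub>M dA) \<Otimes>\<^sub>M dA)" unfolding \<theta>_def by measurable
    then show "(\<lambda>(x, y). ?a (fst x) y * indicator (?S (fst x) (snd x)) y) \<in> borel_measurable ((dA \<Otimes>\<^sub>M dA) \<Otimes>\<^sub>M dA)"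
      by (simp add: indicator_def)
  qed
  have Tz: "ennreal (Theta (weight_on E) z) = (\<integral>\<^sup>+\<zeta>. ?a z \<zeta> \<partial>dA)" if z: "cmod z < 1" for z
  proof -
    have "AE \<zeta> in dA. 0 \<le> weight_on E \<zeta> * \<theta> z \<zeta>"
      using \<alpha>0 by (intro AE_I2 mult_nonneg_nonneg) (auto simp: \<theta>_def power_le_one intro!: divide_nonneg_nonneg)
    from nn_integral_eq_integral[OF integrable_Theta[OF z, folded \<theta>_def] this]
    show ?thesis by (simp add: Theta_eq \<theta>_def)
  qed
  have "ennreal (\<integral>z. indicator (cball 0 r) z * ((cmod (f z))\<^sup>2 * (Theta (weight_on E) z)\<^sup>2) \<partial>dA)
    = (\<integral>\<^sup>+z. ennreal (indicator (cball 0 r) z * ((cmod (f z))\<^sup>2 * (Theta (weight_on E) z)\<^sup>2)) \<partial>dA)"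
    by (intro nn_integral_eq_integral[symmetric] integrable_f_Theta E AE_I2) simp
  also have "\<dots> \<le> (\<integral>\<^sup>+z. ?W z * (2 * (\<integral>\<^sup>+\<zeta>. ?a z \<zeta> * ?I z \<zeta> \<partial>dA)) \<partial>dA)"
  proof (rule nn_integral_mono)
    fix z assume "z \<in> space dA"
    then have z: "cmod z < 1" by simp
    have "ennreal (indicator (cball 0 r) z * ((cmod (f z))\<^sup>2 * (Theta (weight_on E) z)\<^sup>2)) = ?W z * (ennreal (Theta (weight_on E) z))\<^sup>2"
      using Theta_bounds(1)[OF z] by (simp add: ennreal_mult' mult_ac ennreal_power)
    also have "\<dots> \<le> ?W z * (2 * (\<integral>\<^sup>+\<zeta>. ?a z \<zeta> * ?I z \<zeta> \<partial>dA))"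
      unfolding Tz[OF z] by (intro mult_left_mono nn_integral_square_ordered) auto
    finally show "ennreal (indicator (cball 0 r) z * ((cmod (f z))\<^sup>2 * (Theta (weight_on E) z)\<^sup>2)) \<le> ?W z * (2 * (\<integral>\<^sup>+\<zeta>. ?a z \<zeta> * ?I z \<zeta> \<partial>dA))" .
  qed
  also have "\<dots> = (\<integral>\<^sup>+z. (\<integral>\<^sup>+\<zeta>. 2 * (ennreal (weight_on E \<zeta>) * (?W z * (ennreal (\<theta> z \<zeta>) * ?I z \<zeta>))) \<partial>dA) \<partial>dA)"
  proof (rule nn_integral_cong)
    fix z assume "z \<in> space dA"
    have "(\<lambda>\<zeta>. ?I z \<zeta>) \<in> borel_measurable dA" using measurable_Pair2[OF Im \<open>z \<in> space dA\<close>] by simp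
    then have "?W z * (2 * (\<integral>\<^sup>+\<zeta>. ?a z \<zeta> * ?I z \<zeta> \<partial>dA)) = (\<integral>\<^sup>+\<zeta>. (?W z * 2) * (?a z \<zeta> * ?I z \<zeta>) \<partial>dA)"
      by (subst nn_integral_cmult) (auto simp: mult.assoc)
    also have "\<dots> = (\<integral>\<^sup>+\<zeta>. 2 * (ennreal (weight_on E \<zeta>) * (?W z * (ennreal (\<theta> z \<zeta>) * ?I z \<zeta>))) \<partial>dA)"
    proof (rule nn_integral_cong)
      fix \<zeta>
      have e: "?a z \<zeta> = ennreal (weight_on E \<zeta>) * ennreal (\<theta> z \<zeta>)" by (rule ennreal_mult'[OF \<alpha>0])
      show "(?W z * 2) * (?a z \<zeta> * ?I z \<zeta>) = 2 * (ennreal (weight_on E \<zeta>) * (?W z * (ennreal (\<theta> z \<zeta>) * ?I z \<zeta>)))"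
        unfolding e by (simp only: mult.commute mult.left_commute mult.assoc)
    qed
    finally show "?W z * (2 * (\<integral>\<^sup>+\<zeta>. ?a z \<zeta> * ?I z \<zeta> \<partial>dA)) = (\<integral>\<^sup>+\<zeta>. 2 * (ennreal (weight_on E \<zeta>) * (?W z * (ennreal (\<theta> z \<zeta>) * ?I z \<zeta>))) \<partial>dA)" .
  qed
  \<comment> \<open>The point with the larger |1 - cnj \<zeta> z| becomes the outermost variable, as
    the bound at fixed \<zeta> requires. The 2 from ordering the pairs makes 256 out of 128.\<close>
  also have "\<dots> = (\<integral>\<^sup>+\<zeta>. (\<integral>\<^sup>+z. 2 * (ennreal (weight_on E \<zeta>) * (?W z * (ennreal (\<theta> z \<zeta>) * ?I z \<zeta>))) \<partial>dA) \<partial>dA)"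
    using Im by (intro dA2.Fubini'[symmetric]) (simp add: case_prod_beta')
  also have "\<dots> \<le> (\<integral>\<^sup>+\<zeta>. ennreal (256 * s\<^sup>2 * A) * ennreal (weight_on E \<zeta>) \<partial>dA)"
  proof (rule nn_integral_mono)
    fix \<zeta> assume "\<zeta> \<in> space dA"
    have Iz: "(\<lambda>z. ?I z \<zeta>) \<in> borel_measurable dA" using measurable_Pair1[OF Im \<open>\<zeta> \<in> space dA\<close>] by simp
    have tz: "(\<lambda>z. \<theta> z \<zeta>) \<in> borel_measurable dA" unfolding \<theta>_def by measurable
    show "(\<integral>\<^sup>+z. 2 * (ennreal (weight_on E \<zeta>) * (?W z * (ennreal (\<theta> z \<zeta>) * ?I z \<zeta>))) \<partial>dA) \<le> ennreal (256 * s\<^sup>2 * A) * ennreal (weight_on E \<zeta>)"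
    proof (cases "\<zeta> \<in> cball 0 r")
      case True
      have "(\<integral>\<^sup>+z. 2 * (ennreal (weight_on E \<zeta>) * (?W z * (ennreal (\<theta> z \<zeta>) * ?I z \<zeta>))) \<partial>dA)
        = 2 * (ennreal (weight_on E \<zeta>) * (\<integral>\<^sup>+z. ?W z * (ennreal (\<theta> z \<zeta>) * ?I z \<zeta>) \<partial>dA))"
        using Iz tz by (simp add: nn_integral_cmult)
      also have "\<dots> \<le> 2 * (ennreal (weight_on E \<zeta>) * ennreal (128 * s\<^sup>2 * A))"
        unfolding \<theta>_def by (intro mult_left_mono Theta_inner_bound[OF s E True]) auto
      also have "\<dots> = ennreal (256 * s\<^sup>2 * A) * ennreal (weight_on E \<zeta>)"
      proof -
        have "ennreal (256 * s\<^sup>2 * A) = 2 * ennreal (128 * s\<^sup>2 * A)"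
          using ennreal_mult'[of 2 "128 * s\<^sup>2 * A"] by (simp add: mult.assoc)
        then show ?thesis by (simp only: mult_ac)
      qed
      finally show ?thesis .
    next
      case False
      then show ?thesis by (simp add: \<alpha>supp)
    qed
  qed
  also have "\<dots> = ennreal (256 * s\<^sup>2 * A) * ennreal (mass E)"
    using \<alpha>0 \<alpha>int by (simp add: nn_integral_cmult nn_integral_eq_integral mass_def weight_on_def[abs_def])
  also have "\<dots> = ennreal (256 * s\<^sup>2 * A * mass E)"
    using A0 by (simp add: ennreal_mult')
  finally show ?thesis using A0 mass_nonneg by (simp add: ennreal_le_iff)
qed

text \<open>Cauchy-Schwarz on the mixed term of the Hardy inequality: its two factors are s^4 and
  256 s^2 A times the mass, with geometric mean 16 sqrt A s^3. Then 2304 = 144 * 16.\<close>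

lemma tested_improve:
  assumes bb: "berg_bounded f g C" and s: "0 \<le> s" "tested (s ^ 4)"
  shows "tested (2304 * sqrt A * s ^ 3 + 8 * C\<^sup>2)"
  unfolding tested_def
proof (intro allI impI)
  fix E assume E: "E \<in> sets dA" "E \<subseteq> cball 0 r"
  interpret kernel_weight r "weight_on E" by (rule kernel_weight_weight_on[OF E])
  have [measurable]: "weight_on E \<in> borel_measurable dA" by (rule \<alpha>_measurable)
  let ?J = "\<lambda>h. \<integral>z. indicator (cball 0 r) z * ((cmod (f z))\<^sup>2 * h z) \<partial>dA"
  let ?P = "Phi (weight_on E)" and ?T = "Theta (weight_on E)"
  have h: "?J (\<lambda>z. (?P z)\<^sup>2) \<le> 144 * ?J (\<lambda>z. ?P z * ?T z) + 8 * ?J (\<lambda>z. (cmod (Berg (weight_on E) z))\<^sup>2)"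
    by (rule hardy_inequality[OF f_holo r4])
  have b: "?J (\<lambda>z. (cmod (Berg (weight_on E) z))\<^sup>2) \<le> C\<^sup>2 * mass E"
    using bb r E unfolding berg_bounded_def mass_def weight_on_def[abs_def] by blast
  let ?x = "\<lambda>z. indicator (cball 0 r) z * (cmod (f z) * ?P z)" and ?y = "\<lambda>z. indicator (cball 0 r) z * (cmod (f z) * ?T z)"
  have x2: "(?x z)\<^sup>2 = indicator (cball 0 r) z * ((cmod (f z))\<^sup>2 * (?P z)\<^sup>2)"
    and y2: "(?y z)\<^sup>2 = indicator (cball 0 r) z * ((cmod (f z))\<^sup>2 * (?T z)\<^sup>2)"
    and xy: "?x z * ?y z = indicator (cball 0 r) z * ((cmod (f z))\<^sup>2 * (?P z * ?T z))" for z
    by (simp_all add: power_mult_distrib indicator_def power2_eq_square)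
  have ix: "integrable dA (\<lambda>z. (?x z)\<^sup>2)" unfolding x2 by (rule integrable_f_Phi[OF E])
  have iy: "integrable dA (\<lambda>z. (?y z)\<^sup>2)" unfolding y2 by (rule integrable_f_Theta[OF E])
  have xm: "?x \<in> borel_measurable dA" and ym: "?y \<in> borel_measurable dA" by measurable
  have "(?J (\<lambda>z. ?P z * ?T z))\<^sup>2 \<le> ?J (\<lambda>z. (?P z)\<^sup>2) * ?J (\<lambda>z. (?T z)\<^sup>2)"
    using Cauchy_Schwarz_integral(2)[OF xm ix ym iy] unfolding x2 y2 xy .
  also have "\<dots> \<le> (s ^ 4 * mass E) * (256 * s\<^sup>2 * A * mass E)"
  proof (rule mult_mono)
    show "?J (\<lambda>z. (?P z)\<^sup>2) \<le> s ^ 4 * mass E" using s(2) E by (simp add: tested_def)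
    show "?J (\<lambda>z. (?T z)\<^sup>2) \<le> 256 * s\<^sup>2 * A * mass E" by (rule Theta_bound[OF s E])
  qed (use mass_nonneg in \<open>auto intro!: integral_nonneg_AE\<close>)
  also have "\<dots> = (16 * sqrt A * s ^ 3 * mass E)\<^sup>2"
  proof -
    have "(sqrt A)\<^sup>2 = A" using A0 by simp
    moreover have "(s ^ 3)\<^sup>2 = s ^ 4 * s\<^sup>2" by (simp flip: power_mult power_add)
    moreover have "(16 * sqrt A * s ^ 3 * mass E)\<^sup>2 = 256 * (sqrt A)\<^sup>2 * (s ^ 3)\<^sup>2 * (mass E)\<^sup>2"
      by (simp add: power_mult_distrib)
    ultimately show ?thesis by (simp only: power2_eq_square mult.commute mult.left_commute mult.assoc)
  qed
  finally have "?J (\<lambda>z. ?P z * ?T z) \<le> 16 * sqrt A * s ^ 3 * mass E"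
    by (rule power2_le_imp_le) (use A0 s(1) mass_nonneg in simp)
  with h b have "?J (\<lambda>z. (?P z)\<^sup>2) \<le> 144 * (16 * sqrt A * s ^ 3 * mass E) + 8 * (C\<^sup>2 * mass E)"
    by linarith
  also have "\<dots> = (2304 * sqrt A * s ^ 3 + 8 * C\<^sup>2) * mass E" by (simp add: algebra_simps)
  finally show "?J (\<lambda>z. (?P z)\<^sup>2) \<le> (2304 * sqrt A * s ^ 3 + 8 * C\<^sup>2) * mass E" .
qed

text \<open>The improvement is sublinear in the testing constant, so the best constant on \<open>cball 0 r\<close>,
  which is finite, is bounded independently of \<open>r\<close>.\<close>

lemma tested_uniform:
  assumes bb: "berg_bounded f g C"
  shows "tested ((max 1 (2304 * sqrt A + 8 * C\<^sup>2)) ^ 4)"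
proof -
  define V where "V = {\<tau>. 0 \<le> \<tau> \<and> tested \<tau>}"
  define \<tau> where "\<tau> = Inf V"
  have "norm2sq f * (mass disc * (1 / (1 - r)) ^ 4) \<in> V"
    unfolding V_def tested_def using tested_ex mass_nonneg r by (auto intro!: mult_nonneg_nonneg)
  then have V: "V \<noteq> {}" by blast
  have bdd: "bdd_below V" unfolding V_def by (intro bdd_belowI[of _ 0]) auto
  have \<tau>0: "0 \<le> \<tau>" unfolding \<tau>_def using V by (intro cInf_greatest) (auto simp: V_def)
  \<comment> \<open>The infimum is attained, the testing inequality being closed in the constant.
    Sets of zero mass are treated apart because the mass is divided out.\<close>
  have t: "tested \<tau>" unfolding tested_def
  proof (intro allI impI)
    fix E assume E: "E \<in> sets dA" "E \<subseteq> cball 0 r"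
    let ?L = "\<integral>z. indicator (cball 0 r) z * ((cmod (f z))\<^sup>2 * (Phi (weight_on E) z)\<^sup>2) \<partial>dA"
    have le: "?L \<le> v * mass E" if "v \<in> V" for v using that E by (auto simp: V_def tested_def)
    show "?L \<le> \<tau> * mass E"
    proof (cases "mass E = 0")
      case True
      then show ?thesis using le V by auto
    next
      case False
      then have m: "0 < mass E" using mass_nonneg[of E] by simp
      have "?L / mass E \<le> \<tau>" unfolding \<tau>_def
        using V le m by (intro cInf_greatest) (auto simp: pos_divide_le_eq)
      then show ?thesis using m by (simp add: pos_divide_le_eq)
    qed
  qed
  define s where "s = root 4 \<tau>"
  have s: "0 \<le> s" "s ^ 4 = \<tau>" using \<tau>0 by (auto simp: s_def)
  let ?m = "2304 * sqrt A + 8 * C\<^sup>2"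
  have "2304 * sqrt A * s ^ 3 + 8 * C\<^sup>2 \<in> V"
    using tested_improve[OF bb s(1)] t s A0 by (simp add: V_def)
  then have "\<tau> \<le> 2304 * sqrt A * s ^ 3 + 8 * C\<^sup>2"
    unfolding \<tau>_def using bdd by (intro cInf_lower)
  then have le: "s ^ 4 \<le> 2304 * sqrt A * s ^ 3 + 8 * C\<^sup>2" using s by simp
  \<comment> \<open>For s > 1 the constant term is at most its product with s^3, and s^3 cancels
    from s^4 <= ?m s^3.\<close>
  have "s \<le> max 1 ?m"
  proof (cases "s \<le> 1")
    case False
    then have s3: "1 \<le> s ^ 3" by (intro one_le_power) simp
    have "s * s ^ 3 \<le> 2304 * sqrt A * s ^ 3 + 8 * C\<^sup>2 * 1" using le by (simp add: power4_eq_xxxx power3_eq_cube)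
    also have "\<dots> \<le> 2304 * sqrt A * s ^ 3 + 8 * C\<^sup>2 * s ^ 3"
      by (intro add_left_mono mult_left_mono s3) simp
    also have "\<dots> = ?m * s ^ 3" by (simp add: algebra_simps)
    finally have "s * s ^ 3 \<le> ?m * s ^ 3" .
    then have "s \<le> ?m" by (rule mult_right_le_imp_le) (use s3 in linarith)
    then show ?thesis by simp
  qed simp
  then have "\<tau> \<le> (max 1 ?m) ^ 4" unfolding s(2)[symmetric] using s(1) by (intro power_mono) auto
  then show ?thesis
    using t mass_nonneg unfolding tested_def by (meson mult_right_mono order.trans)
qed

end

section \<open>The maximal Bergman projection\<close>

text \<open>The extended real version of \<open>Phi\<close>, for which monotone limits and exchange
  of integrals involve no integrability conditions.\<close>

definition max_potential :: "(complex \<Rightarrow> real) \<Rightarrow> complex \<Rightarrow> ennreal" where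
  "max_potential \<alpha> z = (\<integral>\<^sup>+\<zeta>. ennreal (\<alpha> \<zeta> / (cmod (1 - cnj \<zeta> * z))\<^sup>2) \<partial>dA)"

lemma max_potential_measurable [measurable]:
  assumes [measurable]: "\<alpha> \<in> borel_measurable dA"
  shows "max_potential \<alpha> \<in> borel_measurable dA"
  unfolding max_potential_def[abs_def] by (rule dA.borel_measurable_nn_integral) measurable

lemma integrable_div_kernel:
  fixes \<alpha> :: "complex \<Rightarrow> 'b::{real_normed_field,banach,second_countable_topology}"
  assumes int: "integrable dA \<alpha>" and z: "cmod z < 1"
  shows "integrable dA (\<lambda>\<zeta>. \<alpha> \<zeta> / of_real ((cmod (1 - cnj \<zeta> * z))\<^sup>2))"
proof (rule Bochner_Integration.integrable_bound)
  show "integrable dA (\<lambda>\<zeta>. \<alpha> \<zeta> * of_real (1 / (1 - cmod z)\<^sup>2))" using int by (rule integrable_mult_left)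
  have [measurable]: "\<alpha> \<in> borel_measurable dA" using int by auto
  have "(\<lambda>\<zeta>. \<alpha> \<zeta> * of_real (1 / (cmod (1 - cnj \<zeta> * z))\<^sup>2)) \<in> borel_measurable dA" by measurable
  then show "(\<lambda>\<zeta>. \<alpha> \<zeta> / of_real ((cmod (1 - cnj \<zeta> * z))\<^sup>2)) \<in> borel_measurable dA"
    by (simp add: divide_inverse)
  show "AE \<zeta> in dA. norm (\<alpha> \<zeta> / of_real ((cmod (1 - cnj \<zeta> * z))\<^sup>2)) \<le> norm (\<alpha> \<zeta> * of_real (1 / (1 - cmod z)\<^sup>2) :: 'b)"
  proof (rule AE_I2)
    fix \<zeta> assume "\<zeta> \<in> space dA"
    then have "1 / (cmod (1 - cnj \<zeta> * z))\<^sup>2 \<le> 1 / (1 - cmod z)\<^sup>2"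
      using kernel_bound(1,4)[of z \<zeta>] z by (intro divide_left_mono power_mono) auto
    from mult_left_mono[OF this norm_ge_zero[of "\<alpha> \<zeta>"]]
    show "norm (\<alpha> \<zeta> / of_real ((cmod (1 - cnj \<zeta> * z))\<^sup>2)) \<le> norm (\<alpha> \<zeta> * of_real (1 / (1 - cmod z)\<^sup>2) :: 'b)"
      by (simp only: norm_mult norm_divide norm_of_real abs_power2 abs_divide abs_one times_divide_eq_right mult_1_right)
  qed
qed

lemma max_potential_eq_Phi:
  assumes "integrable dA \<alpha>" "\<And>\<zeta>. 0 \<le> \<alpha> \<zeta>" "cmod z < 1"
  shows "max_potential \<alpha> z = ennreal (Phi \<alpha> z)"
  unfolding max_potential_def Phi_def using integrable_div_kernel[OF assms(1,3)] assms(2)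
  by (intro nn_integral_eq_integral) auto

lemma max_bergman_proj_of_real: "max_bergman_proj (\<lambda>\<zeta>. complex_of_real (\<alpha> \<zeta>)) z = complex_of_real (Phi \<alpha> z)"
  unfolding max_bergman_proj_def Phi_def by (simp only: integral_complex_of_real flip: of_real_divide)

lemma max_bergman_proj_le_max_potential:
  assumes int: "integrable dA v" and z: "cmod z < 1"
  shows "ennreal (cmod (max_bergman_proj v z)) \<le> max_potential (\<lambda>\<zeta>. cmod (v \<zeta>)) z"
  using integral_norm_bound_ennreal[OF integrable_div_kernel[OF int z]]
  by (simp only: max_bergman_proj_def max_potential_def norm_divide norm_of_real abs_power2)

lemma bergman_proj_le_max_potential:
  assumes int: "integrable dA v" and z: "cmod z < 1"
  shows "ennreal (cmod (bergman_proj v z)) \<le> max_potential (\<lambda>\<zeta>. cmod (v \<zeta>)) z"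
proof -
  have [measurable]: "v \<in> borel_measurable dA" using int by auto
  have "integrable dA (\<lambda>\<zeta>. v \<zeta> / (1 - cnj \<zeta> * z)\<^sup>2)"
    by (rule Bochner_Integration.integrable_bound[OF integrable_div_kernel[OF int z]])
       (measurable, simp add: norm_divide norm_power)
  from integral_norm_bound_ennreal[OF this] show ?thesis
    by (simp add: bergman_proj_def max_potential_def norm_divide norm_power)
qed

lemma sqnorm_max_eq:
  assumes "integrable dA \<alpha>" "\<And>\<zeta>. 0 \<le> \<alpha> \<zeta>"
  shows "sqnorm (\<lambda>z. cabs f z * max_bergman_proj (\<lambda>\<zeta>. complex_of_real (\<alpha> \<zeta>)) z)
    = (\<integral>\<^sup>+z. ennreal ((cmod (f z))\<^sup>2) * (max_potential \<alpha> z)\<^sup>2 \<partial>dA)"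
  unfolding sqnorm_def
proof (rule nn_integral_cong)
  fix z assume "z \<in> space dA"
  then have z: "cmod z < 1" by simp
  have P: "0 \<le> Phi \<alpha> z" unfolding Phi_def using assms(2) by (intro integral_nonneg_AE AE_I2) simp
  show "ennreal ((cmod (cabs f z * max_bergman_proj (\<lambda>\<zeta>. complex_of_real (\<alpha> \<zeta>)) z))\<^sup>2) = ennreal ((cmod (f z))\<^sup>2) * (max_potential \<alpha> z)\<^sup>2"
    unfolding max_potential_eq_Phi[OF assms z] max_bergman_proj_of_real using P
    by (simp add: norm_mult power_mult_distrib ennreal_mult ennreal_power)
qed

lemma max_potential_truncation_tendsto:
  assumes [measurable]: "\<alpha> \<in> borel_measurable dA" and pos: "\<And>\<zeta>. 0 \<le> \<alpha> \<zeta>"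
  shows "(\<lambda>k. max_potential (\<lambda>\<zeta>. \<alpha> \<zeta> * indicator (cball 0 (exhaust k)) \<zeta>) z) \<longlonglongrightarrow> max_potential \<alpha> z"
proof -
  have [measurable]: "cball 0 (exhaust k) \<in> sets dA" for k by (rule cball_sets_dA) (rule exhaust)
  define h where "h k \<zeta> = ennreal (\<alpha> \<zeta> / (cmod (1 - cnj \<zeta> * z))\<^sup>2) * indicator (cball 0 (exhaust k)) \<zeta>" for k \<zeta>
  have mono: "incseq exhaust" by (rule incseq_SucI) (rule exhaust)
  have "(\<lambda>k. \<integral>\<^sup>+\<zeta>. h k \<zeta> \<partial>dA) \<longlonglongrightarrow> (\<integral>\<^sup>+\<zeta>. ennreal (\<alpha> \<zeta> / (cmod (1 - cnj \<zeta> * z))\<^sup>2) * indicator disc \<zeta> \<partial>dA)"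
  proof (rule nn_integral_LIMSEQ)
    show "incseq h"
    proof (intro incseq_SucI le_funI)
      fix k \<zeta> show "h k \<zeta> \<le> h (Suc k) \<zeta>"
        unfolding h_def using exhaust(3)[of k] by (intro mult_left_mono) (auto simp: indicator_def)
    qed
    show "h k \<in> borel_measurable dA" for k unfolding h_def[abs_def] by measurable
    show "(\<lambda>k. h k \<zeta>) \<longlonglongrightarrow> ennreal (\<alpha> \<zeta> / (cmod (1 - cnj \<zeta> * z))\<^sup>2) * indicator disc \<zeta>" for \<zeta>
    proof (cases "cmod \<zeta> < 1")
      case True
      have "eventually (\<lambda>k. h k \<zeta> = ennreal (\<alpha> \<zeta> / (cmod (1 - cnj \<zeta> * z))\<^sup>2) * indicator disc \<zeta>) sequentially"
        using eventually_in_cball_exhaust[OF True] by eventually_elim (use True in \<open>simp add: h_def\<close>)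
      then show ?thesis by (rule tendsto_eventually)
    next
      case False
      then have "h k \<zeta> = 0" for k using exhaust(2)[of k] by (auto simp: h_def indicator_def)
      then show ?thesis using False by simp
    qed
  qed
  moreover have "(\<integral>\<^sup>+\<zeta>. ennreal (\<alpha> \<zeta> / (cmod (1 - cnj \<zeta> * z))\<^sup>2) * indicator disc \<zeta> \<partial>dA) = max_potential \<alpha> z"
    unfolding max_potential_def by (intro nn_integral_cong) simp
  moreover have "(\<integral>\<^sup>+\<zeta>. h k \<zeta> \<partial>dA) = max_potential (\<lambda>\<zeta>. \<alpha> \<zeta> * indicator (cball 0 (exhaust k)) \<zeta>) z" for k
    unfolding max_potential_def h_def by (intro nn_integral_cong) (simp add: indicator_def)
  ultimately show ?thesis by simp
qed

text \<open>Fatou's lemma reduces an estimate to weights and sources living on compact discs, where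
  everything is finite. A bound for large k is enough, so small radii can be discarded.\<close>

lemma max_potential_truncation:
  assumes [measurable]: "\<alpha> \<in> borel_measurable dA" "f \<in> borel_measurable dA" and pos: "\<And>\<zeta>. 0 \<le> \<alpha> \<zeta>"
    and le: "eventually (\<lambda>k. (\<integral>\<^sup>+z. ennreal ((cmod (f z))\<^sup>2) * indicator (cball 0 (exhaust k)) z *
        (max_potential (\<lambda>\<zeta>. \<alpha> \<zeta> * indicator (cball 0 (exhaust k)) \<zeta>) z)\<^sup>2 \<partial>dA) \<le> B) sequentially"
  shows "(\<integral>\<^sup>+z. ennreal ((cmod (f z))\<^sup>2) * (max_potential \<alpha> z)\<^sup>2 \<partial>dA) \<le> B"
proof -
  have [measurable]: "cball 0 (exhaust k) \<in> sets dA" for k by (rule cball_sets_dA) (rule exhaust)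
  let ?h = "\<lambda>k z. ennreal ((cmod (f z))\<^sup>2) * indicator (cball 0 (exhaust k)) z *
        (max_potential (\<lambda>\<zeta>. \<alpha> \<zeta> * indicator (cball 0 (exhaust k)) \<zeta>) z)\<^sup>2"
  have lim: "(\<lambda>k. ?h k z) \<longlonglongrightarrow> ennreal ((cmod (f z))\<^sup>2) * (max_potential \<alpha> z)\<^sup>2" if z: "cmod z < 1" for z
  proof -
    note t = max_potential_truncation_tendsto[OF assms(1) pos, of z]
    have "(\<lambda>k. (max_potential (\<lambda>\<zeta>. \<alpha> \<zeta> * indicator (cball 0 (exhaust k)) \<zeta>) z)\<^sup>2) \<longlonglongrightarrow> (max_potential \<alpha> z)\<^sup>2"
      unfolding power2_eq_square by (intro tendsto_mult_ennreal t) auto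
    then have "(\<lambda>k. ennreal ((cmod (f z))\<^sup>2) * (max_potential (\<lambda>\<zeta>. \<alpha> \<zeta> * indicator (cball 0 (exhaust k)) \<zeta>) z)\<^sup>2)
      \<longlonglongrightarrow> ennreal ((cmod (f z))\<^sup>2) * (max_potential \<alpha> z)\<^sup>2"
      by (intro ennreal_tendsto_cmult) auto
    moreover have "eventually (\<lambda>k. ennreal ((cmod (f z))\<^sup>2) * (max_potential (\<lambda>\<zeta>. \<alpha> \<zeta> * indicator (cball 0 (exhaust k)) \<zeta>) z)\<^sup>2 = ?h k z) sequentially"
      using eventually_in_cball_exhaust[OF z] by eventually_elim simp
    ultimately show ?thesis by (blast intro: Lim_transform_eventually)
  qed
  have "(\<integral>\<^sup>+z. ennreal ((cmod (f z))\<^sup>2) * (max_potential \<alpha> z)\<^sup>2 \<partial>dA) = (\<integral>\<^sup>+z. liminf (\<lambda>k. ?h k z) \<partial>dA)"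
    by (intro nn_integral_cong lim_imp_Liminf[symmetric] lim) auto
  also have "\<dots> \<le> liminf (\<lambda>k. \<integral>\<^sup>+z. ?h k z \<partial>dA)"
    by (rule nn_integral_liminf) measurable
  also have "\<dots> \<le> B" by (intro Liminf_le le) simp
  finally show ?thesis .
qed

text \<open>Here u ranges over all nonnegative measurable functions. For u of infinite norm the
  inequality is trivial if K > 0, but not if K = 0, as 0 times infinity is 0 in
  \<open>ennreal\<close>.\<close>

definition max_bounded :: "(complex \<Rightarrow> complex) \<Rightarrow> (complex \<Rightarrow> complex) \<Rightarrow> real \<Rightarrow> bool" where
  "max_bounded f g K \<longleftrightarrow> (\<forall>u\<in>borel_measurable dA. (\<forall>z. 0 \<le> u z) \<longrightarrow>
     (\<integral>\<^sup>+z. ennreal ((cmod (f z))\<^sup>2) * (max_potential (\<lambda>\<zeta>. cmod (g \<zeta>) * u \<zeta>) z)\<^sup>2 \<partial>dA) \<le> ennreal K * (\<integral>\<^sup>+z. ennreal ((u z)\<^sup>2) \<partial>dA))"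

text \<open>Stated for any T dominated by the positive potential, so that it covers both
  \<open>bergman_proj\<close> and \<open>max_bergman_proj\<close>.\<close>

lemma max_bounded_op:
  assumes g: "g \<in> L2" and bd: "max_bounded f g K" and u: "u \<in> L2"
    and T: "\<And>v z. integrable dA v \<Longrightarrow> cmod z < 1 \<Longrightarrow> ennreal (cmod (T v z)) \<le> max_potential (\<lambda>\<zeta>. cmod (v \<zeta>)) z"
  shows "sqnorm (\<lambda>z. cabs f z * T (\<lambda>\<zeta>. cabs g \<zeta> * u \<zeta>) z) \<le> ennreal K * sqnorm u"
proof -
  have [measurable]: "u \<in> borel_measurable dA" using u by (rule L2_measurable)
  have int: "integrable dA (\<lambda>\<zeta>. cabs g \<zeta> * u \<zeta>)" by (rule L2_mult(1)[OF cabs_L2[OF g] u])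
  have "sqnorm (\<lambda>z. cabs f z * T (\<lambda>\<zeta>. cabs g \<zeta> * u \<zeta>) z)
    \<le> (\<integral>\<^sup>+z. ennreal ((cmod (f z))\<^sup>2) * (max_potential (\<lambda>\<zeta>. cmod (g \<zeta>) * cmod (u \<zeta>)) z)\<^sup>2 \<partial>dA)"
    unfolding sqnorm_def
  proof (rule nn_integral_mono)
    fix z assume "z \<in> space dA"
    then have "ennreal (cmod (T (\<lambda>\<zeta>. cabs g \<zeta> * u \<zeta>) z)) \<le> max_potential (\<lambda>\<zeta>. cmod (g \<zeta>) * cmod (u \<zeta>)) z"
      using T[OF int, of z] by (simp add: norm_mult)
    then have "(ennreal (cmod (T (\<lambda>\<zeta>. cabs g \<zeta> * u \<zeta>) z)))\<^sup>2 \<le> (max_potential (\<lambda>\<zeta>. cmod (g \<zeta>) * cmod (u \<zeta>)) z)\<^sup>2"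
      by (rule power_mono) simp
    then show "ennreal ((cmod (cabs f z * T (\<lambda>\<zeta>. cabs g \<zeta> * u \<zeta>) z))\<^sup>2)
      \<le> ennreal ((cmod (f z))\<^sup>2) * (max_potential (\<lambda>\<zeta>. cmod (g \<zeta>) * cmod (u \<zeta>)) z)\<^sup>2"
      by (auto simp: norm_mult power_mult_distrib ennreal_mult ennreal_power intro!: mult_left_mono)
  qed
  also have "\<dots> \<le> ennreal K * (\<integral>\<^sup>+z. ennreal ((cmod (u z))\<^sup>2) \<partial>dA)"
  proof -
    have "(\<lambda>z. cmod (u z)) \<in> borel_measurable dA" by measurable
    then show ?thesis using bd by (auto simp: max_bounded_def)
  qed
  finally show ?thesis by (simp add: sqnorm_def)
qed

lemma max_bounded_iff:
  assumes f: "f \<in> L2" and g: "g \<in> L2"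
  shows "(\<exists>C::real. \<forall>u \<in> L2. sqnorm (\<lambda>z. cabs f z * max_bergman_proj (\<lambda>\<zeta>. cabs g \<zeta> * u \<zeta>) z) \<le> ennreal (C\<^sup>2) * sqnorm u)
    \<longleftrightarrow> (\<exists>K>0. max_bounded f g K)"
proof
  assume "\<exists>C::real. \<forall>u \<in> L2. sqnorm (\<lambda>z. cabs f z * max_bergman_proj (\<lambda>\<zeta>. cabs g \<zeta> * u \<zeta>) z) \<le> ennreal (C\<^sup>2) * sqnorm u"
  then obtain C :: real where C: "\<And>u. u \<in> L2 \<Longrightarrow>
    sqnorm (\<lambda>z. cabs f z * max_bergman_proj (\<lambda>\<zeta>. cabs g \<zeta> * u \<zeta>) z) \<le> ennreal (C\<^sup>2) * sqnorm u" by blast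
  \<comment> \<open>Adding 1 keeps the constant positive when C = 0, which functions u of infinite
    norm require.\<close>
  have "max_bounded f g (C\<^sup>2 + 1)" unfolding max_bounded_def
  proof (intro ballI impI)
    fix u :: "complex \<Rightarrow> real" assume [measurable]: "u \<in> borel_measurable dA" and pos: "\<forall>z. 0 \<le> u z"
    show "(\<integral>\<^sup>+z. ennreal ((cmod (f z))\<^sup>2) * (max_potential (\<lambda>\<zeta>. cmod (g \<zeta>) * u \<zeta>) z)\<^sup>2 \<partial>dA)
      \<le> ennreal (C\<^sup>2 + 1) * (\<integral>\<^sup>+z. ennreal ((u z)\<^sup>2) \<partial>dA)"
    proof (cases "(\<integral>\<^sup>+z. ennreal ((u z)\<^sup>2) \<partial>dA) = \<infinity>")
      case True
      have "ennreal (C\<^sup>2 + 1) * \<infinity> = \<infinity>" by (simp add: ennreal_mult_top add_nonneg_pos)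
      then show ?thesis using True by simp
    next
      case False
      let ?u = "\<lambda>z. complex_of_real (u z)"
      have u: "?u \<in> L2" using False by (auto simp: L2_def sqnorm_def less_top)
      have e: "(\<lambda>\<zeta>. cabs g \<zeta> * ?u \<zeta>) = (\<lambda>\<zeta>. complex_of_real (cmod (g \<zeta>) * u \<zeta>))"
        by (simp add: cabs_def)
      have int: "integrable dA (\<lambda>\<zeta>. cmod (g \<zeta>) * u \<zeta>)"
        using L2_mult(1)[OF cabs_L2[OF g] u] unfolding e complex_of_real_integrable_eq .
      have "(\<integral>\<^sup>+z. ennreal ((cmod (f z))\<^sup>2) * (max_potential (\<lambda>\<zeta>. cmod (g \<zeta>) * u \<zeta>) z)\<^sup>2 \<partial>dA) \<le> ennreal (C\<^sup>2) * sqnorm ?u"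
        using C[OF u] unfolding e by (subst (asm) sqnorm_max_eq[OF int]) (use pos in auto)
      also have "\<dots> \<le> ennreal (C\<^sup>2 + 1) * sqnorm ?u" by (intro mult_right_mono ennreal_leI) auto
      finally show ?thesis by (simp add: sqnorm_def)
    qed
  qed
  moreover have "0 < C\<^sup>2 + 1" by (simp add: add_nonneg_pos)
  ultimately show "\<exists>K>0. max_bounded f g K" by blast
next
  assume "\<exists>K>0. max_bounded f g K"
  then obtain K where K: "0 < K" "max_bounded f g K" by blast
  from max_bounded_op[OF g K(2) _ max_bergman_proj_le_max_potential] K(1)
  show "\<exists>C::real. \<forall>u \<in> L2. sqnorm (\<lambda>z. cabs f z * max_bergman_proj (\<lambda>\<zeta>. cabs g \<zeta> * u \<zeta>) z) \<le> ennreal (C\<^sup>2) * sqnorm u"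
    by (intro exI[of _ "sqrt K"]) simp
qed

lemma op_bounded_of_max_bounded:
  assumes "g \<in> L2" "max_bounded f g K" "0 \<le> K"
  shows "op_bounded f g (sqrt K)"
  unfolding op_bounded_def using max_bounded_op[OF assms(1,2) _ bergman_proj_le_max_potential] assms(3) by simp

section \<open>Duality for the positive operator\<close>

lemma max_potential_symmetric:
  assumes [measurable]: "\<alpha> \<in> borel_measurable dA" "\<beta> \<in> borel_measurable dA"
    and pos: "\<And>\<zeta>. 0 \<le> \<alpha> \<zeta>" "\<And>\<zeta>. 0 \<le> \<beta> \<zeta>"
  shows "(\<integral>\<^sup>+z. ennreal (\<alpha> z) * max_potential \<beta> z \<partial>dA) = (\<integral>\<^sup>+z. ennreal (\<beta> z) * max_potential \<alpha> z \<partial>dA)"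
proof -
  have "(\<integral>\<^sup>+z. ennreal (\<alpha> z) * max_potential \<beta> z \<partial>dA) = (\<integral>\<^sup>+z. (\<integral>\<^sup>+\<zeta>. ennreal (\<alpha> z) * ennreal (\<beta> \<zeta> / (cmod (1 - cnj \<zeta> * z))\<^sup>2) \<partial>dA) \<partial>dA)"
    unfolding max_potential_def by (intro nn_integral_cong nn_integral_cmult[symmetric]) measurable
  also have "\<dots> = (\<integral>\<^sup>+\<zeta>. (\<integral>\<^sup>+z. ennreal (\<alpha> z) * ennreal (\<beta> \<zeta> / (cmod (1 - cnj \<zeta> * z))\<^sup>2) \<partial>dA) \<partial>dA)"
    by (rule dA2.Fubini'[symmetric]) measurable
  also have "\<dots> = (\<integral>\<^sup>+\<zeta>. (\<integral>\<^sup>+z. ennreal (\<beta> \<zeta>) * ennreal (\<alpha> z / (cmod (1 - cnj z * \<zeta>))\<^sup>2) \<partial>dA) \<partial>dA)"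
  proof (intro nn_integral_cong)
    fix \<zeta> z
    have "cmod (1 - cnj \<zeta> * z) = cmod (cnj (1 - cnj \<zeta> * z))" by (rule complex_mod_cnj[symmetric])
    also have "cnj (1 - cnj \<zeta> * z) = 1 - cnj z * \<zeta>" by (simp add: mult.commute)
    finally show "ennreal (\<alpha> z) * ennreal (\<beta> \<zeta> / (cmod (1 - cnj \<zeta> * z))\<^sup>2) = ennreal (\<beta> \<zeta>) * ennreal (\<alpha> z / (cmod (1 - cnj z * \<zeta>))\<^sup>2)"
      using pos by (simp add: mult.commute flip: ennreal_mult')
  qed
  also have "\<dots> = (\<integral>\<^sup>+z. ennreal (\<beta> z) * max_potential \<alpha> z \<partial>dA)"
    unfolding max_potential_def by (intro nn_integral_cong nn_integral_cmult) measurable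
  finally show ?thesis .
qed

text \<open>Prepares duality arguments in which the truncated output u serves as its own test
  function. As \<open>Phi a\<close> is bounded on D and g is square integrable, the norm of u is
  finite and may be cancelled.\<close>

lemma truncated_potential:
  fixes h :: "complex \<Rightarrow> real" and k :: nat
  assumes f: "f \<in> L2" and g: "g \<in> L2" and hm [measurable]: "h \<in> borel_measurable dA" and h: "\<And>z. 0 \<le> h z"
    and fin: "(\<integral>\<^sup>+z. ennreal ((h z)\<^sup>2) \<partial>dA) < \<infinity>"
    and D_def: "D = cball 0 (exhaust k)"
    and a_def: "a = (\<lambda>\<zeta>. cmod (f \<zeta>) * h \<zeta> * indicator D \<zeta>)"
    and u_def: "u = (\<lambda>z. cmod (g z) * Phi a z * indicator D z)"
  shows "integrable dA a" "u \<in> borel_measurable dA" "0 \<le> u z" "integrable dA (\<lambda>z. (u z)\<^sup>2)"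
    "(\<integral>\<^sup>+z. ennreal ((cmod (g z))\<^sup>2) * indicator D z * (max_potential a z)\<^sup>2 \<partial>dA) = (\<integral>\<^sup>+z. ennreal ((u z)\<^sup>2) \<partial>dA)"
proof -
  have [measurable]: "f \<in> borel_measurable dA" "g \<in> borel_measurable dA" using f g by (auto dest: L2_measurable)
  have D [measurable]: "D \<in> sets dA" unfolding D_def by (rule cball_sets_dA) (rule exhaust)
  let ?h = "\<lambda>z. complex_of_real (h z)"
  have hL: "?h \<in> L2" using fin by (auto simp: L2_def sqnorm_def)
  have "(\<lambda>\<zeta>. cabs f \<zeta> * ?h \<zeta>) = (\<lambda>\<zeta>. complex_of_real (cmod (f \<zeta>) * h \<zeta>))"
    by (simp add: cabs_def)
  with L2_mult(1)[OF cabs_L2[OF f] hL] have "integrable dA (\<lambda>\<zeta>. cmod (f \<zeta>) * h \<zeta>)"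
    by (simp only: complex_of_real_integrable_eq)
  then show ai: "integrable dA a" unfolding a_def by (rule integrable_real_mult_indicator[OF D])
  have am [measurable]: "a \<in> borel_measurable dA" unfolding a_def by measurable
  have a0: "0 \<le> a \<zeta>" for \<zeta> using h by (simp add: a_def)
  show um [measurable]: "u \<in> borel_measurable dA" unfolding u_def by measurable
  have P0: "0 \<le> Phi a z" for z unfolding Phi_def using a0 by (intro integral_nonneg_AE AE_I2) simp
  show "0 \<le> u z" using P0 by (simp add: u_def)
  define M where "M = (\<integral>\<zeta>. a \<zeta> \<partial>dA) * (1 / (1 - exhaust k)\<^sup>2)"
  have PM: "Phi a z \<le> M" if z: "z \<in> D" for z
  proof -
    have z1: "cmod z < 1" using z exhaust(2)[of k] by (auto simp: D_def)
    have "Phi a z \<le> (\<integral>\<zeta>. a \<zeta> * (1 / (1 - exhaust k)\<^sup>2) \<partial>dA)"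
      unfolding Phi_def
    proof (rule integral_mono)
      show "integrable dA (\<lambda>\<zeta>. a \<zeta> / (cmod (1 - cnj \<zeta> * z))\<^sup>2)"
        using integrable_div_kernel[OF ai z1] by simp
      show "integrable dA (\<lambda>\<zeta>. a \<zeta> * (1 / (1 - exhaust k)\<^sup>2))" by (rule integrable_mult_left[OF ai])
      fix \<zeta> assume "\<zeta> \<in> space dA"
      then have "1 - exhaust k \<le> cmod (1 - cnj \<zeta> * z)" using kernel_bound(1)[OF z1, of \<zeta>] z by (auto simp: D_def)
      then have "1 / (cmod (1 - cnj \<zeta> * z))\<^sup>2 \<le> 1 / (1 - exhaust k)\<^sup>2"
        using exhaust(2)[of k] by (intro divide_left_mono power_mono mult_pos_pos) auto
      from mult_left_mono[OF this a0[of \<zeta>]]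
      show "a \<zeta> / (cmod (1 - cnj \<zeta> * z))\<^sup>2 \<le> a \<zeta> * (1 / (1 - exhaust k)\<^sup>2)" by simp
    qed
    then show ?thesis by (simp add: M_def)
  qed
  have le: "(u z)\<^sup>2 \<le> M\<^sup>2 * (cmod (g z))\<^sup>2" for z
    using mult_right_mono[OF power_mono[OF PM[of z] P0, of 2], of "(cmod (g z))\<^sup>2"]
    by (cases "z \<in> D") (auto simp: u_def power_mult_distrib mult.commute)
  show "integrable dA (\<lambda>z. (u z)\<^sup>2)"
  proof (rule Bochner_Integration.integrable_bound)
    show "integrable dA (\<lambda>z. M\<^sup>2 * (cmod (g z))\<^sup>2)" using L2_integrable_sq[OF g] by (rule integrable_mult_right)
    show "AE z in dA. norm ((u z)\<^sup>2) \<le> norm (M\<^sup>2 * (cmod (g z))\<^sup>2)" using le by simp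
  qed measurable
  show "(\<integral>\<^sup>+z. ennreal ((cmod (g z))\<^sup>2) * indicator D z * (max_potential a z)\<^sup>2 \<partial>dA) = (\<integral>\<^sup>+z. ennreal ((u z)\<^sup>2) \<partial>dA)"
  proof (rule nn_integral_cong)
    fix z assume "z \<in> space dA"
    then have z: "cmod z < 1" by simp
    show "ennreal ((cmod (g z))\<^sup>2) * indicator D z * (max_potential a z)\<^sup>2 = ennreal ((u z)\<^sup>2)"
      unfolding max_potential_eq_Phi[OF ai a0 z] using P0[of z]
      by (simp add: u_def power_mult_distrib ennreal_mult ennreal_power indicator_def)
  qed
qed

text \<open>The kernel modulus is symmetric, so the operator with f and g exchanged is the adjoint.
  If X is the squared norm of the truncated output and H that of h, then X^2 <= H K X, and X is
  finite.\<close>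

lemma max_bounded_swap:
  assumes f: "f \<in> L2" and g: "g \<in> L2" and bd: "max_bounded f g K" and K: "0 < K"
  shows "max_bounded g f K"
  unfolding max_bounded_def
proof (intro ballI impI)
  fix h :: "complex \<Rightarrow> real" assume hm [measurable]: "h \<in> borel_measurable dA" and h: "\<forall>z. 0 \<le> h z"
  have [measurable]: "f \<in> borel_measurable dA" "g \<in> borel_measurable dA" using f g by (auto dest: L2_measurable)
  let ?H = "\<integral>\<^sup>+z. ennreal ((h z)\<^sup>2) \<partial>dA"
  show "(\<integral>\<^sup>+z. ennreal ((cmod (g z))\<^sup>2) * (max_potential (\<lambda>\<zeta>. cmod (f \<zeta>) * h \<zeta>) z)\<^sup>2 \<partial>dA) \<le> ennreal K * ?H"
  proof (cases "?H = \<infinity>")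
    case True
    then show ?thesis using K by (simp add: ennreal_mult_top)
  next
    case False
    then have fin: "?H < \<infinity>" by (simp add: less_top)
    show ?thesis
    proof (rule max_potential_truncation, goal_cases)
      case 4
      have "(\<integral>\<^sup>+z. ennreal ((cmod (g z))\<^sup>2) * indicator (cball 0 (exhaust k)) z *
        (max_potential (\<lambda>\<zeta>. cmod (f \<zeta>) * h \<zeta> * indicator (cball 0 (exhaust k)) \<zeta>) z)\<^sup>2 \<partial>dA) \<le> ennreal K * ?H" (is "?X \<le> _") for k
      proof -
        let ?D = "cball 0 (exhaust k) :: complex set"
        define a where "a = (\<lambda>\<zeta>. cmod (f \<zeta>) * h \<zeta> * indicator ?D \<zeta>)"
        define u where "u = (\<lambda>z. cmod (g z) * Phi a z * indicator ?D z)"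
        note tp = truncated_potential[OF f g hm h[rule_format] fin refl a_def u_def]
        have a0: "0 \<le> a \<zeta>" for \<zeta> using h by (simp add: a_def)
        have am [measurable]: "a \<in> borel_measurable dA" and um [measurable]: "u \<in> borel_measurable dA"
          using tp(1,2) by auto
        have u0: "0 \<le> u z" for z by (rule tp(3))
        have X: "?X = (\<integral>\<^sup>+z. ennreal ((u z)\<^sup>2) \<partial>dA)"
          unfolding a_def[symmetric] by (rule tp(5))
        have fin: "?X < \<infinity>" unfolding X using tp(4) by (simp add: nn_integral_eq_integral)
        have "?X = (\<integral>\<^sup>+z. ennreal (cmod (g z) * u z) * max_potential a z \<partial>dA)"
          unfolding X
        proof (rule nn_integral_cong)
          fix z assume "z \<in> space dA"
          then have z: "cmod z < 1" by simp
          show "ennreal ((u z)\<^sup>2) = ennreal (cmod (g z) * u z) * max_potential a z"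
            unfolding max_potential_eq_Phi[OF tp(1) a0 z] using u0[of z] integral_nonneg_AE[OF AE_I2, of dA "\<lambda>\<zeta>. a \<zeta> / (cmod (1 - cnj \<zeta> * z))\<^sup>2", folded Phi_def] a0
            by (auto simp: u_def power2_eq_square indicator_def mult_ac simp flip: ennreal_mult')
        qed
        also have "\<dots> = (\<integral>\<^sup>+z. ennreal (a z) * max_potential (\<lambda>z. cmod (g z) * u z) z \<partial>dA)"
          using u0 a0 by (intro max_potential_symmetric) auto
        also have "\<dots> \<le> (\<integral>\<^sup>+z. ennreal (h z) * (ennreal (cmod (f z)) * max_potential (\<lambda>z. cmod (g z) * u z) z) \<partial>dA)"
        proof (rule nn_integral_mono)
          fix z
          have "ennreal (a z) \<le> ennreal (h z) * ennreal (cmod (f z))"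
            using h by (auto simp: a_def indicator_def mult.commute simp flip: ennreal_mult')
          from mult_right_mono[OF this]
          show "ennreal (a z) * max_potential (\<lambda>z. cmod (g z) * u z) z \<le> ennreal (h z) * (ennreal (cmod (f z)) * max_potential (\<lambda>z. cmod (g z) * u z) z)"
            by (simp add: mult.assoc)
        qed
        finally have "?X\<^sup>2 \<le> (\<integral>\<^sup>+z. ennreal (h z) * (ennreal (cmod (f z)) * max_potential (\<lambda>z. cmod (g z) * u z) z) \<partial>dA)\<^sup>2"
          by (rule power_mono) simp
        also have "\<dots> \<le> (\<integral>\<^sup>+z. (ennreal (h z))\<^sup>2 \<partial>dA) * (\<integral>\<^sup>+z. (ennreal (cmod (f z)) * max_potential (\<lambda>z. cmod (g z) * u z) z)\<^sup>2 \<partial>dA)"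
          by (rule Cauchy_Schwarz_nn_integral) measurable
        also have "(\<integral>\<^sup>+z. (ennreal (h z))\<^sup>2 \<partial>dA) = ?H" using h by (simp add: ennreal_power)
        also have "(\<integral>\<^sup>+z. (ennreal (cmod (f z)) * max_potential (\<lambda>z. cmod (g z) * u z) z)\<^sup>2 \<partial>dA)
          = (\<integral>\<^sup>+z. ennreal ((cmod (f z))\<^sup>2) * (max_potential (\<lambda>z. cmod (g z) * u z) z)\<^sup>2 \<partial>dA)"
          by (simp add: power_mult_distrib ennreal_power)
        also have "?H * \<dots> \<le> ?H * (ennreal K * ?X)"
          unfolding X using bd u0 um by (intro mult_left_mono) (auto simp: max_bounded_def)
        finally have le: "?X * ?X \<le> ?X * (ennreal K * ?H)" by (simp only: power2_eq_square mult_ac)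
        show ?thesis
        proof (cases "?X = 0")
          case False
          then show ?thesis using le fin by (subst (asm) ennreal_mult_le_mult_iff) auto
        qed simp
      qed
      then show ?case by simp
    qed (use h in auto)
  qed
qed

text \<open>Condition (4)(a) with a general set in place of the Carleson box, and K in place of the
  square of the constant. Condition (4)(b) is the same with f and g exchanged.\<close>

definition set_tested :: "(complex \<Rightarrow> complex) \<Rightarrow> (complex \<Rightarrow> complex) \<Rightarrow> real \<Rightarrow> complex set \<Rightarrow> bool" where
  "set_tested f g K E \<longleftrightarrow>
     (\<integral>\<^sup>+z. ennreal ((cmod (f z))\<^sup>2) * (max_potential (\<lambda>\<zeta>. (cmod (g \<zeta>))\<^sup>2 * indicator E \<zeta>) z)\<^sup>2 \<partial>dA)
       \<le> ennreal K * (\<integral>\<^sup>+z. ennreal ((cmod (g z))\<^sup>2 * indicator E z) \<partial>dA)"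

lemma set_tested_of_max_bounded:
  assumes g: "g \<in> L2" and bd: "max_bounded f g K" and E [measurable]: "E \<in> sets dA"
  shows "set_tested f g K E"
proof -
  have [measurable]: "g \<in> borel_measurable dA" using g by (rule L2_measurable)
  have "(\<lambda>\<zeta>. cmod (g \<zeta>) * indicator E \<zeta>) \<in> borel_measurable dA" by measurable
  from bd[unfolded max_bounded_def, rule_format, OF this]
  have "(\<integral>\<^sup>+z. ennreal ((cmod (f z))\<^sup>2) * (max_potential (\<lambda>\<zeta>. cmod (g \<zeta>) * (cmod (g \<zeta>) * indicator E \<zeta>)) z)\<^sup>2 \<partial>dA)
    \<le> ennreal K * (\<integral>\<^sup>+z. ennreal ((cmod (g z) * indicator E z)\<^sup>2) \<partial>dA)" by simp
  moreover have "(cmod (g z) * indicator E z)\<^sup>2 = (cmod (g z))\<^sup>2 * indicator E z"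
    "cmod (g z) * (cmod (g z) * indicator E z) = (cmod (g z))\<^sup>2 * indicator E z" for z
    by (simp_all add: indicator_def power2_eq_square)
  ultimately show ?thesis by (simp only: set_tested_def)
qed

text \<open>The testing constant found on discs of radius r is the same for all r near 1, so the
  truncation can be removed in the limit.\<close>

lemma set_tested_of_berg_bounded:
  assumes f: "f \<in> A2" and g: "g \<in> L2" and bb: "berg_bounded f g C" and A0: "0 \<le> A"
    and ball: "\<And>a R. cmod a < 1 \<Longrightarrow> 0 < R \<Longrightarrow>
      (\<integral>z. (cmod (f z))\<^sup>2 * indicator {z\<in>disc. cmod (1 - cnj a * z) < R} z \<partial>dA)
       * (\<integral>z. (cmod (g z))\<^sup>2 * indicator {z\<in>disc. cmod (1 - cnj a * z) < R} z \<partial>dA) \<le> A\<^sup>2 * R ^ 4"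
    and E [measurable]: "E \<in> sets dA"
  shows "set_tested f g ((max 1 (2304 * sqrt A + 8 * C\<^sup>2)) ^ 4) E" (is "set_tested f g ?K E")
  unfolding set_tested_def
proof (rule max_potential_truncation, goal_cases)
  case 4
  have "(\<integral>\<^sup>+z. ennreal ((cmod (f z))\<^sup>2) * indicator (cball 0 (exhaust k)) z *
      (max_potential (\<lambda>\<zeta>. (cmod (g \<zeta>))\<^sup>2 * indicator E \<zeta> * indicator (cball 0 (exhaust k)) \<zeta>) z)\<^sup>2 \<partial>dA)
      \<le> ennreal ?K * (\<integral>\<^sup>+z. ennreal ((cmod (g z))\<^sup>2 * indicator E z) \<partial>dA)" if k: "14 \<le> k" for k
  proof -
    have r4: "3 / 4 \<le> exhaust k ^ 4"
    proof -
      \<comment> \<open>The bound 14 on k is chosen here: \<open>exhaust 14\<close> is 15/16, whose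
        fourth power exceeds the 3/4 of the Hardy inequality.\<close>
      have "15 / 16 \<le> exhaust k" using k by (simp add: exhaust_def field_simps)
      then have "(15 / 16) ^ 4 \<le> exhaust k ^ 4" by (intro power_mono) auto
      moreover have "(3 / 4 :: real) \<le> (15 / 16) ^ 4" by (simp add: power4_eq_xxxx)
      ultimately show ?thesis by linarith
    qed
    interpret toeplitz_weights f g "exhaust k" A
      by unfold_locales (use f g r4 A0 ball in \<open>auto simp: A2_D exhaust\<close>)
    let ?D = "cball 0 (exhaust k) :: complex set"
    have ED: "E \<inter> ?D \<in> sets dA" "E \<inter> ?D \<subseteq> ?D" by auto
    interpret kw: kernel_weight "exhaust k" "weight_on (E \<inter> ?D)" by (rule kernel_weight_weight_on[OF ED])
    have e: "(\<lambda>\<zeta>. (cmod (g \<zeta>))\<^sup>2 * indicator E \<zeta> * indicator ?D \<zeta>) = weight_on (E \<inter> ?D)"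
      by (simp add: weight_on_def[abs_def] indicator_inter_arith mult.assoc)
    have "(\<integral>\<^sup>+z. ennreal ((cmod (f z))\<^sup>2) * indicator ?D z * (max_potential (weight_on (E \<inter> ?D)) z)\<^sup>2 \<partial>dA)
      = (\<integral>\<^sup>+z. ennreal (indicator ?D z * ((cmod (f z))\<^sup>2 * (Phi (weight_on (E \<inter> ?D)) z)\<^sup>2)) \<partial>dA)"
    proof (rule nn_integral_cong)
      fix z assume "z \<in> space dA"
      then have z: "cmod z < 1" by simp
      show "ennreal ((cmod (f z))\<^sup>2) * indicator ?D z * (max_potential (weight_on (E \<inter> ?D)) z)\<^sup>2
        = ennreal (indicator ?D z * ((cmod (f z))\<^sup>2 * (Phi (weight_on (E \<inter> ?D)) z)\<^sup>2))"
        unfolding max_potential_eq_Phi[OF kw.\<alpha>int kw.\<alpha>0 z] using kw.Phi_nonneg[of z]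
        by (simp add: indicator_def ennreal_mult ennreal_power)
    qed
    also have "\<dots> = ennreal (\<integral>z. indicator ?D z * ((cmod (f z))\<^sup>2 * (Phi (weight_on (E \<inter> ?D)) z)\<^sup>2) \<partial>dA)"
      by (intro nn_integral_eq_integral integrable_f_Phi ED AE_I2) simp
    also have "\<dots> \<le> ennreal (?K * mass (E \<inter> ?D))"
      using tested_uniform[OF bb] ED by (intro ennreal_leI) (simp add: tested_def)
    also have "\<dots> = ennreal ?K * (\<integral>\<^sup>+z. ennreal (weight_on (E \<inter> ?D) z) \<partial>dA)"
      using kw.\<alpha>int kw.\<alpha>0 mass_nonneg
      by (subst nn_integral_eq_integral) (auto simp: mass_def weight_on_def[abs_def] ennreal_mult)
    also have "\<dots> \<le> ennreal ?K * (\<integral>\<^sup>+z. ennreal ((cmod (g z))\<^sup>2 * indicator E z) \<partial>dA)"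
      by (intro mult_left_mono nn_integral_mono) (auto simp: weight_on_def indicator_def)
    finally show ?thesis unfolding e .
  qed
  then show ?case by (auto simp: eventually_sequentially)
qed (use f g in \<open>auto dest: A2_D L2_measurable\<close>)

section \<open>Dyadic Carleson boxes\<close>

text \<open>The angle counted in turns from the starting direction s and reduced to [0, 1).
  Different s give different dyadic grids.\<close>

definition angle_frac :: "real \<Rightarrow> complex \<Rightarrow> real" where
  "angle_frac s z = frac (Arg z / (2 * pi) - s)"

text \<open>The full Carleson box down to the circle, not only its top half, over a half-open arc.
  Half-open arcs make any two boxes of one grid disjoint or nested.\<close>

definition dyadic_box :: "real \<Rightarrow> nat \<times> int \<Rightarrow> complex set" where
  "dyadic_box s p = {z\<in>disc. 1 - cmod z \<le> (1 / 2) ^ fst p \<and> \<lfloor>2 ^ fst p * angle_frac s z\<rfloor> = snd p}"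

definition box_index :: "nat \<Rightarrow> (nat \<times> int) set" where
  "box_index N = (SIGMA n:{..N}. {0..<2 ^ n})"

lemma angle_frac_bounds: "0 \<le> angle_frac s z" "angle_frac s z < 1"
  by (auto simp: angle_frac_def frac_lt_1)

lemma finite_box_index: "finite (box_index N)"
  by (simp add: box_index_def)

lemma angle_frac_floor_range: "\<lfloor>2 ^ n * angle_frac s z\<rfloor> \<in> {0..<2 ^ n}"
proof -
  have "2 ^ n * angle_frac s z < 2 ^ n" using angle_frac_bounds[of s z] by simp
  then show ?thesis using angle_frac_bounds[of s z] by (simp add: floor_less_iff)
qed

lemma angle_frac_measurable: "angle_frac s \<in> borel_measurable borel"
proof -
  have "Arg z = (if z = 0 then 0 else Im (Ln z))" for z by (simp add: Arg_eq_Im_Ln Arg_zero)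
  then have "Arg = (\<lambda>z. if z = 0 then 0 else Im (Ln z))" by blast
  moreover have "(\<lambda>z. if z = 0 then 0 else Im (Ln z)) \<in> borel_measurable borel" by measurable
  ultimately have [measurable]: "Arg \<in> borel_measurable borel" by simp
  have [measurable]: "(\<lambda>x::real. real_of_int \<lfloor>x\<rfloor>) \<in> borel_measurable borel" by (rule borel_measurable_real_floor)
  show ?thesis unfolding angle_frac_def[abs_def] frac_def by measurable
qed

lemma dyadic_box_sets: "dyadic_box s p \<in> sets dA"
proof -
  have [measurable]: "angle_frac s \<in> borel_measurable dA" by (rule measurable_dA[OF angle_frac_measurable])
  have "{z \<in> space dA. 1 - cmod z \<le> (1 / 2) ^ fst p \<and> of_int (snd p) \<le> 2 ^ fst p * angle_frac s z \<and> 2 ^ fst p * angle_frac s z < of_int (snd p) + 1} \<in> sets dA"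
    by measurable
  also have "{z \<in> space dA. 1 - cmod z \<le> (1 / 2) ^ fst p \<and> of_int (snd p) \<le> 2 ^ fst p * angle_frac s z \<and> 2 ^ fst p * angle_frac s z < of_int (snd p) + 1} = dyadic_box s p"
    by (auto simp: dyadic_box_def floor_eq_iff)
  finally show ?thesis .
qed

text \<open>The index of the dyadic ancestor is an integer quotient, hence determined by the index
  of the finer cell.\<close>

lemma floor_coarser:
  fixes y :: real assumes "n \<le> m"
  shows "\<lfloor>2 ^ n * y\<rfloor> = \<lfloor>2 ^ m * y\<rfloor> div 2 ^ (m - n)"
proof -
  have "(2 :: real) ^ m = 2 ^ n * 2 ^ (m - n)" using assms by (simp flip: power_add)
  then have "2 ^ n * y = 2 ^ m * y / of_int (2 ^ (m - n))" by simp
  then show ?thesis by (simp only: floor_divide_real_eq_div zero_le_power zero_le_numeral)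
qed

lemma dyadic_box_laminar: "dyadic_box s p \<inter> dyadic_box s q = {} \<or> dyadic_box s p \<subseteq> dyadic_box s q \<or> dyadic_box s q \<subseteq> dyadic_box s p"
proof -
  have *: "dyadic_box s p \<inter> dyadic_box s q = {} \<or> dyadic_box s q \<subseteq> dyadic_box s p" if le: "fst p \<le> fst q" for p q
  proof (cases "snd p = snd q div 2 ^ (fst q - fst p)")
    case True
    have "(1 / 2 :: real) ^ fst q \<le> (1 / 2) ^ fst p" using le by (intro power_decreasing) auto
    then show ?thesis using True floor_coarser[OF le] by (auto simp: dyadic_box_def intro: order.trans)
  next
    case False
    then show ?thesis using floor_coarser[OF le] by (auto simp: dyadic_box_def)
  qed
  show ?thesis using *[of p q] *[of q p] by (cases "fst p \<le> fst q") auto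
qed

section \<open>The kernel in polar form and its comparison with dyadic sums\<close>

lemma cis_Arg_angle_frac: "cis (Arg z) = cis (2 * pi * (s + angle_frac s z))"
proof -
  have "2 * pi * (s + angle_frac s z) = Arg z + 2 * pi * of_int (- \<lfloor>Arg z / (2 * pi) - s\<rfloor>)"
    by (simp add: angle_frac_def frac_def field_simps)
  then show ?thesis by (simp only: cis_mult[symmetric] cis_multiple_2pi Ints_of_int mult_1_right)
qed

lemma polar_angle_frac: "z = of_real (cmod z) * cis (2 * pi * (s + angle_frac s z))"
  using rcis_cmod_Arg[of z] by (simp add: rcis_def cis_Arg_angle_frac[of z s])

lemma kernel_polar: "cnj \<zeta> * z = of_real (cmod \<zeta> * cmod z) * cis (Arg z - Arg \<zeta>)"
proof -
  have "cnj (of_real (cmod \<zeta>) * cis (Arg \<zeta>)) * (of_real (cmod z) * cis (Arg z)) = of_real (cmod \<zeta> * cmod z) * cis (Arg z - Arg \<zeta>)"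
  proof -
    have "cnj (cis (Arg \<zeta>)) * cis (Arg z) = cis (Arg z - Arg \<zeta>)" by (simp add: cis_cnj cis_mult)
    then show ?thesis by simp
  qed
  then show ?thesis unfolding rcis_cmod_Arg[unfolded rcis_def] .
qed

lemma cmod_one_minus_cis: "cmod (1 - cis t) = 2 * \<bar>sin (t / 2)\<bar>"
proof -
  have "(cmod (1 - cis t))\<^sup>2 = (2 * \<bar>sin (t / 2)\<bar>)\<^sup>2"
  proof -
    have c: "cos t = 1 - 2 * (sin (t / 2))\<^sup>2" using cos_double_sin[of "t / 2"] by simp
    have "(cmod (1 - cis t))\<^sup>2 = (1 - cos t)\<^sup>2 + (sin t)\<^sup>2" by (simp add: cmod_power2)
    also have "\<dots> = 2 - 2 * cos t" using sin_cos_squared_add[of t] by (simp add: power2_eq_square algebra_simps)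
    also have "\<dots> = (2 * \<bar>sin (t / 2)\<bar>)\<^sup>2" unfolding c by (simp add: power_mult_distrib)
    finally show ?thesis .
  qed
  then show ?thesis by (rule power2_eq_imp_eq) auto
qed

text \<open>The 10 is 2 + 8. The moduli contribute at most (1 - |z|) + (1 - |\<zeta>|), and angles
  that differ by at most 2^(-n) turns contribute at most 2 pi 2^(-n) <= 8 * 2^(-n).\<close>

lemma kernel_le_of_common_dyadic_box:
  assumes "z \<in> dyadic_box s p" "\<zeta> \<in> dyadic_box s p"
  shows "cmod (1 - cnj \<zeta> * z) \<le> 10 * (1 / 2) ^ fst p"
proof -
  have z: "cmod z < 1" "1 - cmod z \<le> (1 / 2) ^ fst p" "\<lfloor>2 ^ fst p * angle_frac s z\<rfloor> = snd p"
    and \<zeta>: "cmod \<zeta> < 1" "1 - cmod \<zeta> \<le> (1 / 2) ^ fst p" "\<lfloor>2 ^ fst p * angle_frac s \<zeta>\<rfloor> = snd p"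
    using assms by (auto simp: dyadic_box_def)
  define d where "d = angle_frac s z - angle_frac s \<zeta>"
  define t where "t = cmod \<zeta> * cmod z"
  have "\<bar>2 ^ fst p * angle_frac s z - 2 ^ fst p * angle_frac s \<zeta>\<bar> < 1"
    using z(3) \<zeta>(3) by (simp add: floor_eq_iff abs_less_iff)
  then have "2 ^ fst p * \<bar>d\<bar> < 1" by (simp add: d_def abs_mult flip: right_diff_distrib)
  then have d: "\<bar>d\<bar> \<le> (1 / 2) ^ fst p" by (simp add: power_one_over field_simps)
  have "cis (Arg z - Arg \<zeta>) = cis (Arg z) / cis (Arg \<zeta>)" by (simp add: cis_divide)
  also have "\<dots> = cis (2 * pi * d)"
    unfolding cis_Arg_angle_frac[of z s] cis_Arg_angle_frac[of \<zeta> s] cis_divide by (simp add: d_def algebra_simps)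
  finally have w: "cnj \<zeta> * z = of_real t * cis (2 * pi * d)" by (simp only: kernel_polar t_def)
  have t: "0 \<le> t" "t \<le> 1" unfolding t_def using z(1) \<zeta>(1) by (auto intro: mult_le_one)
  have t1: "1 - t \<le> 2 * (1 / 2) ^ fst p"
  proof -
    have "0 \<le> (1 - cmod z) * (1 - cmod \<zeta>)" using z(1) \<zeta>(1) by simp
    then have "1 - t \<le> (1 - cmod z) + (1 - cmod \<zeta>)" by (simp add: t_def algebra_simps)
    then show ?thesis using z(2) \<zeta>(2) by simp
  qed
  have "1 - cnj \<zeta> * z = of_real (1 - t) + of_real t * (1 - cis (2 * pi * d))" unfolding w by (simp add: algebra_simps)
  then have "cmod (1 - cnj \<zeta> * z) \<le> cmod (of_real (1 - t)) + cmod (of_real t * (1 - cis (2 * pi * d)))"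
    by (simp only: norm_triangle_ineq)
  also have "\<dots> = (1 - t) + t * cmod (1 - cis (2 * pi * d))" using t by (simp only: norm_mult norm_of_real abs_of_nonneg diff_ge_0_iff_ge)
  also have "t * cmod (1 - cis (2 * pi * d)) \<le> 1 * (8 * (1 / 2) ^ fst p)"
  proof (rule mult_mono)
    have "\<bar>sin (pi * d)\<bar> \<le> pi * \<bar>d\<bar>" using abs_sin_x_le_abs_x[of "pi * d"] by (simp add: abs_mult)
    also have "\<dots> \<le> 4 * (1 / 2) ^ fst p" using d pi_less_4 by (intro mult_mono) auto
    finally show "cmod (1 - cis (2 * pi * d)) \<le> 8 * (1 / 2) ^ fst p" by (simp add: cmod_one_minus_cis)
  qed (use t in auto)
  finally show ?thesis using t1 by simp
qed

text \<open>At each level a single box can contain z, and it contains \<zeta> only if \<rho> = |1 -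
  cnj \<zeta> z| is at most 10 * 2^(-n). The geometric sum is at most 4/3 of its last term, which is
  at most 100 / \<rho>^2, and 400/3 < 134.\<close>

lemma sum_common_dyadic_box_le:
  assumes z: "cmod z < 1" and \<zeta>: "cmod \<zeta> < 1"
  shows "(\<Sum>p\<in>box_index N. 4 ^ fst p * indicator (dyadic_box s p) z * indicator (dyadic_box s p) \<zeta>) \<le> 134 / (cmod (1 - cnj \<zeta> * z))\<^sup>2"
proof -
  define \<rho> where "\<rho> = cmod (1 - cnj \<zeta> * z)"
  have \<rho>: "0 < \<rho>" using kernel_bound(4)[OF z \<zeta>] by (simp add: \<rho>_def)
  define S where "S = {n\<in>{..N}. \<rho> \<le> 10 * (1 / 2) ^ n}"
  have fS: "finite S" by (simp add: S_def)
  let ?c = "\<lambda>n j. 4 ^ n * indicator (dyadic_box s (n, j)) z * indicator (dyadic_box s (n, j)) \<zeta> :: real"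
  have "(\<Sum>p\<in>box_index N. 4 ^ fst p * indicator (dyadic_box s p) z * indicator (dyadic_box s p) \<zeta> :: real)
    = (\<Sum>n\<in>{..N}. \<Sum>j\<in>{0..<2 ^ n}. ?c n j)"
    unfolding box_index_def by (subst sum.Sigma) (auto simp: split_beta)
  also have "\<dots> \<le> (\<Sum>n\<in>{..N}. if n \<in> S then 4 ^ n else 0)"
  proof (rule sum_mono)
    fix n assume n: "n \<in> {..N}"
    let ?j = "\<lfloor>2 ^ n * angle_frac s z\<rfloor>"
    have "(\<Sum>j\<in>{0..<2 ^ n}. ?c n j) = (\<Sum>j\<in>{0..<2 ^ n}. if j = ?j then ?c n ?j else 0)"
      by (intro sum.cong) (auto simp: indicator_def dyadic_box_def)
    also have "\<dots> = ?c n ?j" using angle_frac_floor_range[of n s z] by (simp add: sum.delta)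
    also have "\<dots> \<le> (if n \<in> S then 4 ^ n else 0)"
      using kernel_le_of_common_dyadic_box[of z s "(n, ?j)" \<zeta>] n by (auto simp: indicator_def S_def \<rho>_def)
    finally show "(\<Sum>j\<in>{0..<2 ^ n}. ?c n j) \<le> (if n \<in> S then 4 ^ n else 0)" .
  qed
  also have "\<dots> = (\<Sum>n\<in>S. 4 ^ n)"
  proof -
    have "{n \<in> {..N}. n \<in> S} = S" by (auto simp: S_def)
    then show ?thesis by (simp add: sum.inter_filter[symmetric])
  qed
  also have "\<dots> \<le> 134 / \<rho>\<^sup>2"
  proof (cases "S = {}")
    case False
    define M where "M = Max S"
    have M: "M \<in> S" unfolding M_def using fS False by (rule Max_in)
    have "(\<Sum>n\<in>S. 4 ^ n :: real) \<le> (\<Sum>n<Suc M. 4 ^ n)"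
      using fS by (intro sum_mono2) (auto simp: M_def less_Suc_eq_le)
    also have "\<dots> = (4 * 4 ^ M - 1) / 3" by (subst sum_gp_strict) (simp_all add: field_simps)
    also have "\<dots> \<le> (4 / 3) * 4 ^ M" by simp
    also have "\<dots> \<le> (4 / 3) * (100 / \<rho>\<^sup>2)"
    proof (intro mult_left_mono)
      have "2 ^ M * \<rho> \<le> 10" using M by (simp add: S_def power_one_over field_simps)
      then have "(2 ^ M * \<rho>)\<^sup>2 \<le> 10\<^sup>2" using \<rho> by (intro power_mono) auto
      moreover have "(2 ^ M :: real)\<^sup>2 = 4 ^ M" by (simp add: power2_eq_square flip: power_mult_distrib)
      ultimately show "4 ^ M \<le> 100 / \<rho>\<^sup>2" using \<rho> by (simp add: power_mult_distrib pos_le_divide_eq)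
    qed simp
    also have "\<dots> \<le> 134 / \<rho>\<^sup>2" using \<rho> by (simp add: divide_simps)
    finally show ?thesis .
  qed simp
  finally show ?thesis by (simp add: \<rho>_def)
qed

text \<open>On [0, 1/3] from sin x >= x / 2, valid while the cosine is at least 1/2; on [1/3, 1/2]
  from sin (pi/6) = 1/2 and monotonicity.\<close>

lemma sin_pi_ge: assumes "\<bar>d\<bar> \<le> 1 / 2" shows "\<bar>d\<bar> \<le> \<bar>sin (pi * d)\<bar>"
proof -
  have *: "d \<le> sin (pi * d)" if d: "0 \<le> d" "d \<le> 1 / 2" for d
  proof (cases "d \<le> 1 / 3")
    case True
    have "sin 0 - 0 / 2 \<le> sin (pi * d) - pi * d / 2"
    proof (rule DERIV_nonneg_imp_nondecreasing[of 0 "pi * d" "\<lambda>x. sin x - x / 2"])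
      fix x assume x: "0 \<le> x" "x \<le> pi * d"
      have "pi * d \<le> pi * (1 / 3)" using True by (intro mult_left_mono) auto
      then have "x \<le> pi / 3" using x(2) by linarith
      then have "cos (pi / 3) \<le> cos x" using x by (intro cos_monotone_0_pi_le) auto
      then have "0 \<le> cos x - 1 / 2" by (simp add: cos_60)
      then show "\<exists>y. ((\<lambda>x. sin x - x / 2) has_real_derivative y) (at x) \<and> 0 \<le> y"
        by (intro exI[of _ "cos x - 1 / 2"]) (auto intro!: derivative_eq_intros)
    qed (use d in simp)
    moreover have "d * 2 \<le> d * pi" using pi_ge_two d by (intro mult_left_mono) auto
    ultimately show ?thesis by (simp add: mult.commute)
  next
    case False
    then have "pi * (1 / 3) \<le> pi * d" "pi * d \<le> pi * (1 / 2)" using d by (intro mult_left_mono; simp)+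
    then have "sin (pi / 6) \<le> sin (pi * d)" by (intro sin_monotone_2pi_le) auto
    then show ?thesis using d by (simp add: sin_30)
  qed
  show ?thesis using *[of d] *[of "- d"] assms by (cases "0 \<le> d") (auto simp: abs_if)
qed

text \<open>If both equalities fail, the short interval between X and Y contains an integer and also
  an integer translate of 2^n / 3. They differ by less than 1/3, so |3 m - 2^n| < 1 for some integer
  m, and 3 would divide a power of 2.\<close>

lemma third_shift:
  fixes X Y :: real
  assumes "\<bar>X - Y\<bar> \<le> 1 / 3"
  shows "\<lfloor>X\<rfloor> = \<lfloor>Y\<rfloor> \<or> \<lfloor>X - 2 ^ n / 3\<rfloor> = \<lfloor>Y - 2 ^ n / 3\<rfloor>"
proof -
  have *: "\<lfloor>X\<rfloor> = \<lfloor>Y\<rfloor> \<or> \<lfloor>X - 2 ^ n / 3\<rfloor> = \<lfloor>Y - 2 ^ n / 3\<rfloor>" if le: "X \<le> Y" "Y - X \<le> 1 / 3" for X Y :: real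
  proof (rule ccontr)
    assume "\<not> ?thesis"
    then have ne: "\<lfloor>X\<rfloor> \<noteq> \<lfloor>Y\<rfloor>" "\<lfloor>X - 2 ^ n / 3\<rfloor> \<noteq> \<lfloor>Y - 2 ^ n / 3\<rfloor>" by auto
    define k where "k = \<lfloor>Y\<rfloor>"
    define l where "l = \<lfloor>Y - 2 ^ n / 3\<rfloor>"
    have "\<lfloor>X\<rfloor> < k" using ne(1) floor_mono[OF le(1)] by (simp add: k_def)
    then have k: "X < of_int k" "of_int k \<le> Y" by (auto simp: k_def floor_less_iff)
    have "\<lfloor>X - 2 ^ n / 3\<rfloor> < l" using ne(2) floor_mono[of "X - 2 ^ n / 3" "Y - 2 ^ n / 3"] le(1) by (simp add: l_def)
    then have l: "X - 2 ^ n / 3 < of_int l" "of_int l \<le> Y - 2 ^ n / 3" by (auto simp: l_def floor_less_iff)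
    have "\<bar>of_int (3 * (k - l) - 2 ^ n)\<bar> < (1 :: real)" using k l le by (simp add: abs_less_iff)
    then have "\<bar>3 * (k - l) - 2 ^ n\<bar> < 1" by linarith
    then have "2 ^ n = 3 * (k - l)" by simp
    then have "(3 :: int) dvd 2 ^ n" by simp
    moreover have "prime (3 :: int)" by simp
    ultimately have "(3 :: int) dvd 2" by (blast intro: prime_dvd_power)
    then show False by simp
  qed
  show ?thesis using *[of X Y] *[of Y X] assms by (cases "X \<le> Y") auto
qed

text \<open>Integers are end points of dyadic cells, so two numbers in one cell have the same
  integer part and reduction modulo 1 shifts both alike.\<close>

lemma floor_frac_eq:
  fixes a b :: real assumes "\<lfloor>2 ^ n * a\<rfloor> = \<lfloor>2 ^ n * b\<rfloor>"
  shows "\<lfloor>2 ^ n * frac a\<rfloor> = \<lfloor>2 ^ n * frac b\<rfloor>"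
proof -
  have f: "\<lfloor>2 ^ n * frac x\<rfloor> = \<lfloor>2 ^ n * x\<rfloor> - 2 ^ n * \<lfloor>x\<rfloor>" for x :: real
  proof -
    have "2 ^ n * frac x = 2 ^ n * x - of_int (2 ^ n * \<lfloor>x\<rfloor>)" by (simp add: frac_def algebra_simps)
    then show ?thesis by (simp only: floor_diff_of_int)
  qed
  have "\<lfloor>a\<rfloor> = \<lfloor>b\<rfloor>" using floor_coarser[of 0 n a] floor_coarser[of 0 n b] assms by simp
  then show ?thesis using assms by (simp add: f)
qed

text \<open>One-third trick: two nearby points share a box of comparable size in one of the two grids.\<close>

lemma kernel_le_sum_common_dyadic_box:
  assumes z: "z \<in> cball 0 r" and \<zeta>: "\<zeta> \<in> cball 0 r" and r: "r < 1" and N: "(1 / 2) ^ N \<le> 1 - r"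
  shows "1 / (cmod (1 - cnj \<zeta> * z))\<^sup>2 \<le> 36 * (\<Sum>s\<in>{0, 1 / 3}. \<Sum>p\<in>box_index N. 4 ^ fst p * indicator (dyadic_box s p) z * indicator (dyadic_box s p) \<zeta>)"
proof -
  have z1: "cmod z < 1" and \<zeta>1: "cmod \<zeta> < 1" using z \<zeta> r by auto
  define \<rho> where "\<rho> = cmod (1 - cnj \<zeta> * z)"
  have \<rho>0: "0 < \<rho>" using kernel_bound(4)[OF z1 \<zeta>1] by (simp add: \<rho>_def)
  define x where "x = Arg z / (2 * pi)"
  define y where "y = Arg \<zeta> / (2 * pi)"
  \<comment> \<open>Subtracting the nearest integer makes d the signed angular distance in turns, at
    most one half.\<close>
  define k where "k = round (x - y)"
  define d where "d = x - (y + of_int k)"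
  have d: "\<bar>d\<bar> \<le> 1 / 2" using of_int_round_abs_le[of "x - y"] by (simp add: d_def k_def abs_minus_commute algebra_simps)
  have "Arg z - Arg \<zeta> = 2 * pi * d + 2 * pi * of_int k" by (simp add: d_def x_def y_def field_simps)
  then have c: "cis (Arg z - Arg \<zeta>) = cis (2 * pi * d)"
    by (simp only: cis_mult[symmetric] cis_multiple_2pi Ints_of_int mult_1_right)
  have d\<rho>: "\<bar>d\<bar> \<le> \<rho>"
  proof -
    define t where "t = cmod \<zeta> * cmod z"
    have t: "0 \<le> t" "t \<le> cmod z" unfolding t_def using z1 \<zeta>1 by (auto simp: mult_left_le_one_le)
    have w: "1 - cnj \<zeta> * z = 1 - of_real t * cis (2 * pi * d)" by (simp only: kernel_polar c t_def)
    have "1 - t \<le> \<rho>" unfolding \<rho>_def w using norm_triangle_ineq2[of 1 "of_real t * cis (2 * pi * d)"] t by (simp add: norm_mult)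
    have "1 - cis (2 * pi * d) = (1 - cnj \<zeta> * z) - of_real (1 - t) * cis (2 * pi * d)" unfolding w by (simp add: algebra_simps)
    then have "cmod (1 - cis (2 * pi * d)) \<le> cmod (1 - cnj \<zeta> * z) + cmod (of_real (1 - t) * cis (2 * pi * d))"
      by (simp only: norm_triangle_ineq4)
    also have "cmod (of_real (1 - t) * cis (2 * pi * d)) = 1 - t"
      using t z1 by (simp only: norm_mult norm_of_real norm_cis mult_1_right)
    finally have "2 * \<bar>sin (pi * d)\<bar> \<le> 2 * \<rho>" using \<open>1 - t \<le> \<rho>\<close> by (simp add: cmod_one_minus_cis \<rho>_def)
    then show ?thesis using sin_pi_ge[OF d] by simp
  qed
  \<comment> \<open>The least admissible side of a common box: it must cover both distances to the
    circle, and be three times the angular distance for the one-third trick.\<close>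
  define m where "m = max (1 - cmod z) (max (1 - cmod \<zeta>) (3 * \<bar>d\<bar>))"
  have m\<rho>: "m \<le> 3 * \<rho>" using kernel_bound(1,2)[OF z1 \<zeta>1] d\<rho> \<rho>0 by (auto simp: m_def \<rho>_def)
  have mr: "1 - r \<le> m" using z by (auto simp: m_def)
  \<comment> \<open>The smallest dyadic side that is still at least m; level N suffices because m >=
    1 - r >= 2^(-N). If m > 1 the choice is n = 0, where the box is the whole disc and no angular
    condition is needed.\<close>
  obtain n where n: "n \<le> N" "1 - cmod z \<le> (1 / 2) ^ n" "1 - cmod \<zeta> \<le> (1 / 2) ^ n"
      "n = 0 \<or> 3 * \<bar>d\<bar> \<le> (1 / 2) ^ n" "(1 / 2) ^ n \<le> 2 * m"
  proof (cases "m \<le> 1")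
    case False
    then show ?thesis using that[of 0] by auto
  next
    case True
    let ?P = "\<lambda>n. n \<le> N \<and> m \<le> (1 / 2) ^ n"
    define n where "n = (GREATEST n. ?P n)"
    have n: "?P n" unfolding n_def by (rule GreatestI_nat[of ?P 0 N]) (use True in auto)
    have "(1 / 2) ^ Suc n \<le> m"
    proof (cases "n = N")
      case True
      have "(1 / 2 :: real) ^ Suc N \<le> (1 / 2) ^ N" by (rule power_decreasing) auto
      then show ?thesis unfolding True using N mr by linarith
    next
      case False
      have "\<not> ?P (Suc n)"
      proof
        assume "?P (Suc n)"
        then have "Suc n \<le> n" unfolding n_def by (intro Greatest_le_nat[of ?P _ N]) auto
        then show False by simp
      qed
      then show ?thesis using n False by simp
    qed
    then show ?thesis using n by (intro that[of n]) (auto simp: m_def)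
  qed
  obtain s :: real where s: "s \<in> {0, 1 / 3}" "\<lfloor>2 ^ n * angle_frac s z\<rfloor> = \<lfloor>2 ^ n * angle_frac s \<zeta>\<rfloor>"
  proof (cases "n = 0")
    case True
    then have "\<lfloor>2 ^ n * angle_frac 0 z\<rfloor> = \<lfloor>2 ^ n * angle_frac 0 \<zeta>\<rfloor>" using angle_frac_bounds[of 0 z] angle_frac_bounds[of 0 \<zeta>] floor_eq_iff[of "angle_frac 0 z" 0] floor_eq_iff[of "angle_frac 0 \<zeta>" 0] by simp
    then show ?thesis using that[of 0] by simp
  next
    case False
    then have "3 * \<bar>d\<bar> \<le> (1 / 2) ^ n" using n(4) by simp
    then have "2 ^ n * \<bar>d\<bar> \<le> 1 / 3" by (simp add: power_one_over field_simps)
    then have "\<bar>2 ^ n * x - 2 ^ n * (y + of_int k)\<bar> \<le> 1 / 3" by (simp add: d_def abs_mult flip: right_diff_distrib)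
    from third_shift[OF this, of n]
    have "\<exists>s\<in>{0, 1 / 3}. \<lfloor>2 ^ n * (x - s)\<rfloor> = \<lfloor>2 ^ n * (y + of_int k - s)\<rfloor>"
      by (auto simp: right_diff_distrib)
    then obtain s :: real where s: "s \<in> {0, 1 / 3}" "\<lfloor>2 ^ n * (x - s)\<rfloor> = \<lfloor>2 ^ n * (y + of_int k - s)\<rfloor>" by blast
    have "\<lfloor>(y - s) + of_int k\<rfloor> = \<lfloor>y - s\<rfloor> + k" by (rule floor_add_int[symmetric])
    then have "frac (y + of_int k - s) = frac (y - s)" by (simp add: frac_def algebra_simps)
    then show ?thesis using that[OF s(1)] floor_frac_eq[OF s(2)] by (simp add: angle_frac_def x_def y_def)
  qed
  define p where "p = (n, \<lfloor>2 ^ n * angle_frac s z\<rfloor>)"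
  have p: "p \<in> box_index N" using n(1) angle_frac_floor_range[of n s z] by (simp add: p_def box_index_def)
  have zp: "z \<in> dyadic_box s p" "\<zeta> \<in> dyadic_box s p" using z1 \<zeta>1 n s(2) by (auto simp: dyadic_box_def p_def)
  \<comment> \<open>A factor 2 from the choice of n and 3 from m <= 3 \<rho>; its square is the 36
    of the statement.\<close>
  have "(1 / 2) ^ n \<le> 6 * \<rho>" using n(5) m\<rho> by simp
  then have "1 \<le> 6 * (2 ^ n * \<rho>)" by (simp add: power_one_over field_simps)
  then have "1\<^sup>2 \<le> (6 * (2 ^ n * \<rho>))\<^sup>2" by (intro power_mono) auto
  moreover have "(2 ^ n :: real)\<^sup>2 = 4 ^ n" by (simp add: power2_eq_square flip: power_mult_distrib)
  ultimately have "1 / \<rho>\<^sup>2 \<le> 36 * 4 ^ n" using \<rho>0 by (simp add: power_mult_distrib pos_divide_le_eq mult.assoc)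
  also have "\<dots> = 36 * (4 ^ fst p * indicator (dyadic_box s p) z * indicator (dyadic_box s p) \<zeta>)" using zp by (simp add: p_def)
  also have "\<dots> \<le> 36 * (\<Sum>p\<in>box_index N. 4 ^ fst p * indicator (dyadic_box s p) z * indicator (dyadic_box s p) \<zeta>)"
    using p by (intro mult_left_mono member_le_sum finite_box_index) auto
  also have "\<dots> \<le> 36 * (\<Sum>s\<in>{0, 1 / 3}. \<Sum>p\<in>box_index N. 4 ^ fst p * indicator (dyadic_box s p) z * indicator (dyadic_box s p) \<zeta>)"
    using s(1) by (intro mult_left_mono member_le_sum sum_nonneg) auto
  finally show ?thesis by (simp add: \<rho>_def)
qed

section \<open>Carleson boxes against dyadic boxes\<close>

lemma carleson_box_subset_disc:
  assumes "l \<le> 1" shows "carleson_box a l \<subseteq> disc"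
  using assms by (auto simp: carleson_box_def arc_def norm_mult)

text \<open>Adding the boundary arc gives a compact image of a closed rectangle, and intersecting
  with the disc removes exactly what was added.\<close>

lemma carleson_box_sets:
  assumes l: "l \<le> 1" shows "carleson_box a l \<in> sets dA"
proof -
  let ?h = "\<lambda>x::real \<times> real. complex_of_real (fst x) * cis (2 * pi * snd x)"
  have "compact (?h ` ({1 - l..1} \<times> {a..a + l}))"
    by (intro compact_continuous_image compact_Times compact_Icc continuous_intros)
  then have c: "closed (?h ` ({1 - l..1} \<times> {a..a + l}))" by (rule compact_imp_closed)
  have "carleson_box a l = ?h ` ({1 - l..1} \<times> {a..a + l}) \<inter> disc"
  proof
    show "carleson_box a l \<subseteq> ?h ` ({1 - l..1} \<times> {a..a + l}) \<inter> disc"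
      using carleson_box_subset_disc[OF l, of a]
      by (force simp: carleson_box_def arc_def)
    show "?h ` ({1 - l..1} \<times> {a..a + l}) \<inter> disc \<subseteq> carleson_box a l"
      using l by (fastforce simp: carleson_box_def arc_def norm_mult)
  qed
  then show ?thesis using c by (auto simp: sets_dA_iff open_disc)
qed

text \<open>The closed arc exceeds the half-open one by its upper end point, which adds part of a
  ray. That ray, and the origin, where the angle is a convention, lie on the line ?L through 0, a
  null set.\<close>

lemma dyadic_box_AE_carleson_box:
  assumes p: "p \<in> box_index N"
  shows "AE z in dA. z \<in> carleson_box (s + of_int (snd p) / 2 ^ fst p) ((1 / 2) ^ fst p) \<longleftrightarrow> z \<in> dyadic_box s p"
proof -
  obtain n j where pn: "p = (n, j)" by (cases p)
  have j: "0 \<le> j" "j < 2 ^ n" using p by (auto simp: box_index_def pn)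
  define e where "e = cis (2 * pi * (s + of_int j / 2 ^ n + (1 / 2) ^ n))"
  let ?Q = "carleson_box (s + of_int j / 2 ^ n) ((1 / 2) ^ n)"
  let ?L = "{z. (\<i> * e) \<bullet> z = 0}"
  have sub: "z \<in> ?Q" if z: "z \<in> dyadic_box s p" for z
  proof -
    have zd: "cmod z < 1" "1 - cmod z \<le> (1 / 2) ^ n" "\<lfloor>2 ^ n * angle_frac s z\<rfloor> = j" using z by (auto simp: dyadic_box_def pn)
    then have "of_int j \<le> 2 ^ n * angle_frac s z" "2 ^ n * angle_frac s z \<le> of_int j + 1" by linarith+
    then have t: "of_int j / 2 ^ n \<le> angle_frac s z" "angle_frac s z \<le> of_int j / 2 ^ n + (1 / 2) ^ n"
      by (simp_all add: power_one_over field_simps)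
    show ?thesis unfolding carleson_box_def arc_def
      using zd t polar_angle_frac[of z s] by (intro CollectI exI[of _ "cmod z"] exI[of _ "cis (2 * pi * (s + angle_frac s z))"]) auto
  qed
  have sup: "z \<in> dyadic_box s p" if z: "z \<in> ?Q" and zL: "z \<notin> ?L" for z
  proof -
    obtain \<rho> t where t: "z = of_real \<rho> * cis (2 * pi * t)" "1 - (1 / 2) ^ n \<le> \<rho>" "\<rho> < 1"
      "s + of_int j / 2 ^ n \<le> t" "t \<le> s + of_int j / 2 ^ n + (1 / 2) ^ n"
      using z by (auto simp: carleson_box_def arc_def)
    have "(1 / 2 :: real) ^ n \<le> 1" by (simp add: power_le_one)
    then have \<rho>: "0 \<le> \<rho>" using t(2) by simp
    have z0: "z \<noteq> 0" using zL by auto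
    have cz: "cmod z = \<rho>" using t(1) \<rho> by (simp add: norm_mult)
    have "t \<noteq> s + of_int j / 2 ^ n + (1 / 2) ^ n"
    proof
      assume "t = s + of_int j / 2 ^ n + (1 / 2) ^ n"
      then have "z = of_real \<rho> * e" using t(1) by (simp add: e_def)
      then have "z \<in> ?L" by (simp add: inner_complex_def algebra_simps)
      then show False using zL by simp
    qed
    then have tu: "t < s + of_int j / 2 ^ n + (1 / 2) ^ n" using t(5) by simp
    have b: "of_int j \<le> 2 ^ n * (t - s)" "2 ^ n * (t - s) < of_int j + 1"
      using t(4) tu by (simp_all add: power_one_over field_simps)
    have "of_int j + 1 \<le> (2 ^ n :: real)"
    proof -
      have "of_int (j + 1) \<le> (of_int (2 ^ n) :: real)" using j by (subst of_int_le_iff) simp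
      then show ?thesis by simp
    qed
    then have "2 ^ n * (t - s) < 2 ^ n * 1" using b by linarith
    then have u1: "t - s < 1" by (subst (asm) mult_less_cancel_left_pos) auto
    have u0: "0 \<le> t - s" using t(4) j by (auto intro: order.trans[rotated] divide_nonneg_nonneg simp: le_diff_eq)
    have "cis (Arg z) = cis (2 * pi * t)"
    proof -
      have "of_real \<rho> * cis (Arg z) = of_real \<rho> * cis (2 * pi * t)"
        using rcis_cmod_Arg[of z, unfolded rcis_def cz] t(1) by (rule trans)
      moreover have "\<rho> \<noteq> 0" using z0 cz by auto
      ultimately show ?thesis by simp
    qed
    then obtain k :: int where k: "Arg z = 2 * pi * t + of_int k * (2 * pi)"
      using sin_cos_eq_iff[of "Arg z" "2 * pi * t"] by (auto simp: complex_eq_iff mult_ac)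
    have "Arg z / (2 * pi) - s = (t - s) + of_int k" using k by (simp add: field_simps)
    then have "angle_frac s z = t - s" unfolding angle_frac_def using u0 u1 by (simp add: frac_unique_iff)
    then show ?thesis using b t cz by (auto simp: dyadic_box_def pn floor_eq_iff)
  qed
  have "negligible ?L"
  proof (rule negligible_hyperplane)
    have "e \<noteq> 0" by (simp add: e_def)
    then show "\<i> * e \<noteq> 0 \<or> (0::real) \<noteq> 0" by simp
  qed
  then have "?L \<in> null_sets lebesgue" by (simp add: negligible_iff_null_sets)
  moreover have "closed ?L" by (rule closed_hyperplane)
  ultimately have "?L \<in> null_sets lborel" by (simp add: null_sets_completion_iff)
  then have "?L \<inter> disc \<in> null_sets dA"
    by (auto simp: null_sets_dA_iff open_disc intro: null_set_Int2)
  then have "AE z in dA. z \<notin> ?L \<inter> disc" by (rule AE_not_in)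
  then show ?thesis
  proof (rule AE_mp, intro AE_I2 impI)
    fix z assume "z \<in> space dA" "z \<notin> ?L \<inter> disc"
    then show "z \<in> carleson_box (s + of_int (snd p) / 2 ^ fst p) ((1 / 2) ^ fst p) \<longleftrightarrow> z \<in> dyadic_box s p"
      using sub[of z] sup[of z] by (auto simp: pn)
  qed
qed

section \<open>From testing to boundedness\<close>

lemma set_tested_cong_AE:
  assumes "AE z in dA. z \<in> E \<longleftrightarrow> z \<in> F"
  shows "set_tested f g K E \<longleftrightarrow> set_tested f g K F"
proof -
  have "max_potential (\<lambda>\<zeta>. (cmod (g \<zeta>))\<^sup>2 * indicator E \<zeta>) z = max_potential (\<lambda>\<zeta>. (cmod (g \<zeta>))\<^sup>2 * indicator F \<zeta>) z" for z
    unfolding max_potential_def using assms by (intro nn_integral_cong_AE) (auto simp: indicator_def elim: eventually_mono)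
  moreover have "(\<integral>\<^sup>+z. ennreal ((cmod (g z))\<^sup>2 * indicator E z) \<partial>dA) = (\<integral>\<^sup>+z. ennreal ((cmod (g z))\<^sup>2 * indicator F z) \<partial>dA)"
    using assms by (intro nn_integral_cong_AE) (auto simp: indicator_def elim: eventually_mono)
  ultimately show ?thesis by (simp add: set_tested_def)
qed

text \<open>The two-weight theorem sums over sets, not over indices. Collecting all indices that
  produce J makes the two sums agree without a proof that \<open>dyadic_box s\<close> is
  injective.\<close>

definition box_weight :: "real \<Rightarrow> nat \<Rightarrow> complex set \<Rightarrow> real" where
  "box_weight s N J = (\<Sum>p\<in>{p\<in>box_index N. dyadic_box s p = J}. 4 ^ fst p)"

lemma box_weight_nonneg: "0 \<le> box_weight s N J"
  by (simp add: box_weight_def sum_nonneg)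

lemma sum_box_weight: "(\<Sum>J\<in>dyadic_box s ` box_index N. box_weight s N J * F J) = (\<Sum>p\<in>box_index N. 4 ^ fst p * F (dyadic_box s p))"
proof -
  have "(\<Sum>p\<in>box_index N. 4 ^ fst p * F (dyadic_box s p)) = (\<Sum>J\<in>dyadic_box s ` box_index N. \<Sum>p\<in>{p. p \<in> box_index N \<and> dyadic_box s p = J}. 4 ^ fst p * F (dyadic_box s p))"
    by (rule sum.image_gen[OF finite_box_index])
  also have "\<dots> = (\<Sum>J\<in>dyadic_box s ` box_index N. box_weight s N J * F J)"
    unfolding box_weight_def sum_distrib_right by (intro sum.cong) auto
  finally show ?thesis by simp
qed

text \<open>For boxes inside S only the part of |g|^2 on S matters, and the dyadic kernel is at most
  134 times the positive kernel. The localized dyadic operator is thus dominated by the potential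
  that the hypothesis tests.\<close>

lemma dyadic_test:
  assumes f: "f \<in> L2" and g: "g \<in> L2" and K: "0 < K" and S: "S \<in> dyadic_box s ` box_index N" and t: "set_tested f g K S"
  shows "(\<integral>z. (cmod (f z) * (\<Sum>J\<in>{J\<in>dyadic_box s ` box_index N. J \<subseteq> S}.
      box_weight s N J * (\<integral>\<zeta>. (cmod (g \<zeta>))\<^sup>2 * indicator J \<zeta> \<partial>dA) * indicator J z))\<^sup>2 \<partial>dA)
    \<le> (134 * sqrt K)\<^sup>2 * (\<integral>\<zeta>. (cmod (g \<zeta>))\<^sup>2 * indicator S \<zeta> \<partial>dA)"
proof -
  have [measurable]: "f \<in> borel_measurable dA" "g \<in> borel_measurable dA" using f g by (auto dest: L2_measurable)
  define D where "D = dyadic_box s ` box_index N"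
  let ?D = "{J\<in>D. J \<subseteq> S}"
  have finD: "finite D" by (simp add: D_def finite_box_index)
  have Dm: "J \<in> sets dA" if "J \<in> D" for J using that by (auto simp: D_def dyadic_box_sets)
  have Sm [measurable]: "S \<in> sets dA" using S by (auto simp: dyadic_box_sets)
  define G where "G \<zeta> = (cmod (g \<zeta>))\<^sup>2 * indicator S \<zeta>" for \<zeta>
  have G0: "0 \<le> G \<zeta>" for \<zeta> by (simp add: G_def)
  have Gi: "integrable dA G" unfolding G_def[abs_def] by (rule integrable_real_mult_indicator[OF Sm L2_integrable_sq[OF g]])
  have GJ: "integrable dA (\<lambda>\<zeta>. G \<zeta> * indicator J \<zeta>)" if "J \<in> D" for J
    by (rule integrable_real_mult_indicator[OF Dm[OF that] Gi])
  define H where "H z = (\<Sum>J\<in>?D. box_weight s N J * (\<integral>\<zeta>. (cmod (g \<zeta>))\<^sup>2 * indicator J \<zeta> \<partial>dA) * indicator J z)" for z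
  have Hm [measurable]: "H \<in> borel_measurable dA"
    unfolding H_def[abs_def] using Dm by (intro borel_measurable_sum borel_measurable_times borel_measurable_const borel_measurable_indicator) auto
  have sg0: "0 \<le> (\<integral>\<zeta>. (cmod (g \<zeta>))\<^sup>2 * indicator J \<zeta> \<partial>dA)" for J by (intro integral_nonneg_AE AE_I2) simp
  have H0: "0 \<le> H z" for z unfolding H_def by (intro sum_nonneg mult_nonneg_nonneg sg0 box_weight_nonneg) simp
  define B where "B = (\<Sum>J\<in>?D. box_weight s N J * (\<integral>\<zeta>. (cmod (g \<zeta>))\<^sup>2 * indicator J \<zeta> \<partial>dA))"
  have HB: "H z \<le> B" for z
    unfolding H_def B_def by (intro sum_mono mult_right_le_one_le mult_nonneg_nonneg sg0 box_weight_nonneg) auto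
  have HP: "H z \<le> 134 * Phi G z" if z: "cmod z < 1" for z
  proof -
    have "H z = (\<Sum>J\<in>?D. \<integral>\<zeta>. box_weight s N J * indicator J z * (G \<zeta> * indicator J \<zeta>) \<partial>dA)"
      unfolding H_def
    proof (rule sum.cong)
      fix J assume J: "J \<in> ?D"
      have "(\<integral>\<zeta>. (cmod (g \<zeta>))\<^sup>2 * indicator J \<zeta> \<partial>dA) = (\<integral>\<zeta>. G \<zeta> * indicator J \<zeta> \<partial>dA)"
        using J by (intro Bochner_Integration.integral_cong) (auto simp: G_def indicator_def)
      then show "box_weight s N J * (\<integral>\<zeta>. (cmod (g \<zeta>))\<^sup>2 * indicator J \<zeta> \<partial>dA) * indicator J z
        = (\<integral>\<zeta>. box_weight s N J * indicator J z * (G \<zeta> * indicator J \<zeta>) \<partial>dA)" by simp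
    qed simp
    also have "\<dots> = (\<integral>\<zeta>. (\<Sum>J\<in>?D. box_weight s N J * indicator J z * (G \<zeta> * indicator J \<zeta>)) \<partial>dA)"
      using GJ by (intro Bochner_Integration.integral_sum[symmetric] integrable_mult_right) auto
    also have "\<dots> \<le> (\<integral>\<zeta>. 134 * (G \<zeta> / (cmod (1 - cnj \<zeta> * z))\<^sup>2) \<partial>dA)"
    proof (rule integral_mono)
      show "integrable dA (\<lambda>\<zeta>. \<Sum>J\<in>?D. box_weight s N J * indicator J z * (G \<zeta> * indicator J \<zeta>))"
        using GJ by (intro Bochner_Integration.integrable_sum integrable_mult_right) auto
      show "integrable dA (\<lambda>\<zeta>. 134 * (G \<zeta> / (cmod (1 - cnj \<zeta> * z))\<^sup>2))"
        using integrable_div_kernel[OF Gi z] by (intro integrable_mult_right) simp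
      fix \<zeta> assume "\<zeta> \<in> space dA"
      then have \<zeta>: "cmod \<zeta> < 1" by simp
      have "(\<Sum>J\<in>?D. box_weight s N J * indicator J z * (G \<zeta> * indicator J \<zeta>))
        = G \<zeta> * (\<Sum>J\<in>?D. box_weight s N J * (indicator J z * indicator J \<zeta>))"
        by (simp add: sum_distrib_left mult_ac)
      also have "\<dots> \<le> G \<zeta> * (\<Sum>J\<in>D. box_weight s N J * (indicator J z * indicator J \<zeta>))"
        using finD box_weight_nonneg by (intro mult_left_mono G0 sum_mono2) auto
      also have "\<dots> = G \<zeta> * (\<Sum>p\<in>box_index N. 4 ^ fst p * indicator (dyadic_box s p) z * indicator (dyadic_box s p) \<zeta>)"
        unfolding D_def sum_box_weight by (simp add: mult.assoc)
      also have "\<dots> \<le> G \<zeta> * (134 / (cmod (1 - cnj \<zeta> * z))\<^sup>2)"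
        by (intro mult_left_mono G0 sum_common_dyadic_box_le z \<zeta>)
      finally show "(\<Sum>J\<in>?D. box_weight s N J * indicator J z * (G \<zeta> * indicator J \<zeta>)) \<le> 134 * (G \<zeta> / (cmod (1 - cnj \<zeta> * z))\<^sup>2)"
        by (simp add: mult.commute)
    qed
    also have "\<dots> = 134 * Phi G z" unfolding Phi_def by (rule integral_mult_right_zero)
    finally show ?thesis .
  qed
  have int: "integrable dA (\<lambda>z. (cmod (f z) * H z)\<^sup>2)"
  proof (rule Bochner_Integration.integrable_bound)
    show "integrable dA (\<lambda>z. (cmod (f z))\<^sup>2 * B\<^sup>2)" using L2_integrable_sq[OF f] by (rule integrable_mult_left)
    show "AE z in dA. norm ((cmod (f z) * H z)\<^sup>2) \<le> norm ((cmod (f z))\<^sup>2 * B\<^sup>2)"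
      using power_mono[OF HB H0, of _ 2] by (intro AE_I2) (simp add: power_mult_distrib mult_left_mono)
  qed measurable
  have "ennreal (\<integral>z. (cmod (f z) * H z)\<^sup>2 \<partial>dA) = (\<integral>\<^sup>+z. ennreal ((cmod (f z) * H z)\<^sup>2) \<partial>dA)"
    by (intro nn_integral_eq_integral[symmetric] int) simp
  also have "\<dots> \<le> (\<integral>\<^sup>+z. ennreal (134\<^sup>2) * (ennreal ((cmod (f z))\<^sup>2) * (max_potential G z)\<^sup>2) \<partial>dA)"
  proof (rule nn_integral_mono)
    fix z assume "z \<in> space dA"
    then have z: "cmod z < 1" by simp
    have P: "0 \<le> Phi G z" unfolding Phi_def using G0 by (intro integral_nonneg_AE AE_I2) simp
    have "(cmod (f z) * H z)\<^sup>2 \<le> 134\<^sup>2 * ((cmod (f z))\<^sup>2 * (Phi G z)\<^sup>2)"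
      using power_mono[OF HP[OF z] H0, of 2] mult_left_mono[of "(H z)\<^sup>2" "(134 * Phi G z)\<^sup>2" "(cmod (f z))\<^sup>2"]
      by (simp add: power_mult_distrib)
    then show "ennreal ((cmod (f z) * H z)\<^sup>2) \<le> ennreal (134\<^sup>2) * (ennreal ((cmod (f z))\<^sup>2) * (max_potential G z)\<^sup>2)"
      unfolding max_potential_eq_Phi[OF Gi G0 z] using P by (simp only: ennreal_power ennreal_leI zero_le_power2 flip: ennreal_mult')
  qed
  also have "\<dots> = ennreal (134\<^sup>2) * (\<integral>\<^sup>+z. ennreal ((cmod (f z))\<^sup>2) * (max_potential G z)\<^sup>2 \<partial>dA)"
    using Gi by (intro nn_integral_cmult borel_measurable_times_ennreal borel_measurable_power max_potential_measurable) auto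
  also have "\<dots> \<le> ennreal (134\<^sup>2) * (ennreal K * (\<integral>\<^sup>+z. ennreal (G z) \<partial>dA))"
    using t unfolding set_tested_def G_def by (intro mult_left_mono) auto
  also have "(\<integral>\<^sup>+z. ennreal (G z) \<partial>dA) = ennreal (\<integral>z. G z \<partial>dA)"
    using Gi G0 by (intro nn_integral_eq_integral) auto
  also have "ennreal (134\<^sup>2) * (ennreal K * ennreal (\<integral>z. G z \<partial>dA)) = ennreal ((134 * sqrt K)\<^sup>2 * (\<integral>z. G z \<partial>dA))"
    using K by (simp add: power_mult_distrib mult.assoc ennreal_mult')
  finally have "(\<integral>z. (cmod (f z) * H z)\<^sup>2 \<partial>dA) \<le> (134 * sqrt K)\<^sup>2 * (\<integral>z. G z \<partial>dA)"
    using G0 by (subst (asm) ennreal_le_iff) (auto intro!: mult_nonneg_nonneg integral_nonneg_AE)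
  then show ?thesis by (simp only: H_def G_def D_def)
qed

lemma dyadic_bilinear:
  assumes f: "f \<in> L2" and g: "g \<in> L2" and K: "0 < K"
    and tf: "\<And>p. p \<in> box_index N \<Longrightarrow> set_tested f g K (dyadic_box s p)"
    and tg: "\<And>p. p \<in> box_index N \<Longrightarrow> set_tested g f K (dyadic_box s p)"
    and u: "u \<in> borel_measurable dA" "\<And>z. 0 \<le> u z" "integrable dA (\<lambda>z. (u z)\<^sup>2)"
    and v: "v \<in> borel_measurable dA" "\<And>z. 0 \<le> v z" "integrable dA (\<lambda>z. (v z)\<^sup>2)"
  shows "(\<Sum>p\<in>box_index N. 4 ^ fst p * ((\<integral>z. cmod (g z) * u z * indicator (dyadic_box s p) z \<partial>dA) *
      (\<integral>z. cmod (f z) * v z * indicator (dyadic_box s p) z \<partial>dA)))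
    \<le> 25 * (134 * sqrt K) * ((\<integral>z. (u z)\<^sup>2 \<partial>dA) + (\<integral>z. (v z)\<^sup>2 \<partial>dA))"
proof -
  have [measurable]: "f \<in> borel_measurable dA" "g \<in> borel_measurable dA" using f g by (auto dest: L2_measurable)
  let ?a = "\<lambda>J. \<integral>z. cmod (g z) * u z * indicator J z \<partial>dA" and ?b = "\<lambda>J. \<integral>z. cmod (f z) * v z * indicator J z \<partial>dA"
  have "(\<Sum>J\<in>dyadic_box s ` box_index N. box_weight s N J * ?a J * ?b J) \<le> 25 * (134 * sqrt K) * ((\<integral>z. (u z)\<^sup>2 \<partial>dA) + (\<integral>z. (v z)\<^sup>2 \<partial>dA))"
  proof (rule laminar_two_weight[where f = "\<lambda>z. cmod (f z)" and g = "\<lambda>z. cmod (g z)"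
        and sg = "\<lambda>J. \<integral>z. (cmod (g z))\<^sup>2 * indicator J z \<partial>dA" and sf = "\<lambda>J. \<integral>z. (cmod (f z))\<^sup>2 * indicator J z \<partial>dA"])
    show "dyadic_box s ` box_index N \<subseteq> sets dA" by (auto simp: dyadic_box_sets)
    show "A \<inter> B = {} \<or> A \<subseteq> B \<or> B \<subseteq> A" if "A \<in> dyadic_box s ` box_index N" "B \<in> dyadic_box s ` box_index N" for A B
      using that dyadic_box_laminar by blast
  next
    fix S assume S: "S \<in> dyadic_box s ` box_index N"
    then have "set_tested f g K S" "set_tested g f K S" using tf tg by auto
    from dyadic_test[OF f g K S this(1)] dyadic_test[OF g f K S this(2)]
    show "(\<integral>z. (cmod (f z) * (\<Sum>J\<in>{J\<in>dyadic_box s ` box_index N. J \<subseteq> S}. box_weight s N J * (\<integral>\<zeta>. (cmod (g \<zeta>))\<^sup>2 * indicator J \<zeta> \<partial>dA) * indicator J z))\<^sup>2 \<partial>dA)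
      \<le> (134 * sqrt K)\<^sup>2 * (\<integral>\<zeta>. (cmod (g \<zeta>))\<^sup>2 * indicator S \<zeta> \<partial>dA)"
      and "(\<integral>z. (cmod (g z) * (\<Sum>J\<in>{J\<in>dyadic_box s ` box_index N. J \<subseteq> S}. box_weight s N J * (\<integral>\<zeta>. (cmod (f \<zeta>))\<^sup>2 * indicator J \<zeta> \<partial>dA) * indicator J z))\<^sup>2 \<partial>dA)
      \<le> (134 * sqrt K)\<^sup>2 * (\<integral>\<zeta>. (cmod (f \<zeta>))\<^sup>2 * indicator S \<zeta> \<partial>dA)" .
  qed (use K u v L2_integrable_sq[OF f] L2_integrable_sq[OF g] in \<open>auto simp: finite_box_index box_weight_nonneg\<close>)
  then show ?thesis using sum_box_weight[of s N "\<lambda>J. ?a J * ?b J"] by (simp add: mult.assoc)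
qed

text \<open>The truncated output v is paired with itself. The two grids dominate the kernel, so the
  squared norm of v is at most 36 times the sum of two dyadic bilinear forms in w and v. Since the
  bound for these forms is a sum of squared norms, v is rescaled to make its share
  absorbable.\<close>

lemma max_bounded_of_set_tested:
  assumes f: "f \<in> L2" and g: "g \<in> L2" and K: "0 < K"
    and t: "\<And>a l. 0 < l \<Longrightarrow> l \<le> 1 \<Longrightarrow> set_tested f g K (carleson_box a l) \<and> set_tested g f K (carleson_box a l)"
  shows "max_bounded f g ((3600 * (134 * sqrt K))\<^sup>2)"
  unfolding max_bounded_def
proof (intro ballI impI)
  define \<tau> where "\<tau> = 134 * sqrt K"
  have \<tau>: "0 < \<tau>" using K by (simp add: \<tau>_def)
  fix u :: "complex \<Rightarrow> real" assume um [measurable]: "u \<in> borel_measurable dA" and u: "\<forall>z. 0 \<le> u z"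
  have [measurable]: "f \<in> borel_measurable dA" "g \<in> borel_measurable dA" using f g by (auto dest: L2_measurable)
  have td: "set_tested f g K (dyadic_box s p)" "set_tested g f K (dyadic_box s p)" if p: "p \<in> box_index N" for N s p
    using t[of "(1 / 2) ^ fst p" "s + of_int (snd p) / 2 ^ fst p"] set_tested_cong_AE[OF dyadic_box_AE_carleson_box[OF p]]
    by (auto simp: power_le_one)
  let ?U = "\<integral>\<^sup>+z. ennreal ((u z)\<^sup>2) \<partial>dA"
  show "(\<integral>\<^sup>+z. ennreal ((cmod (f z))\<^sup>2) * (max_potential (\<lambda>\<zeta>. cmod (g \<zeta>) * u \<zeta>) z)\<^sup>2 \<partial>dA) \<le> ennreal ((3600 * (134 * sqrt K))\<^sup>2) * ?U"
    unfolding \<tau>_def[symmetric]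
  proof (cases "?U = \<infinity>")
    case True
    then show "(\<integral>\<^sup>+z. ennreal ((cmod (f z))\<^sup>2) * (max_potential (\<lambda>\<zeta>. cmod (g \<zeta>) * u \<zeta>) z)\<^sup>2 \<partial>dA) \<le> ennreal ((3600 * \<tau>)\<^sup>2) * ?U"
      using \<tau> by (simp add: ennreal_mult_top)
  next
    case False
    then have fin: "?U < \<infinity>" by (simp add: less_top)
    show "(\<integral>\<^sup>+z. ennreal ((cmod (f z))\<^sup>2) * (max_potential (\<lambda>\<zeta>. cmod (g \<zeta>) * u \<zeta>) z)\<^sup>2 \<partial>dA) \<le> ennreal ((3600 * \<tau>)\<^sup>2) * ?U"
    proof (rule max_potential_truncation, goal_cases)
      case 4
      have "(\<integral>\<^sup>+z. ennreal ((cmod (f z))\<^sup>2) * indicator (cball 0 (exhaust k)) z *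
        (max_potential (\<lambda>\<zeta>. cmod (g \<zeta>) * u \<zeta> * indicator (cball 0 (exhaust k)) \<zeta>) z)\<^sup>2 \<partial>dA) \<le> ennreal ((3600 * \<tau>)\<^sup>2) * ?U" for k
      proof -
        let ?D = "cball 0 (exhaust k) :: complex set"
        have D [measurable]: "?D \<in> sets dA" by (rule cball_sets_dA) (rule exhaust)
        define a where "a = (\<lambda>\<zeta>. cmod (g \<zeta>) * u \<zeta> * indicator ?D \<zeta>)"
        define v where "v = (\<lambda>z. cmod (f z) * Phi a z * indicator ?D z)"
        note tp = truncated_potential[OF g f um u[rule_format] fin refl a_def v_def]
        have a0: "0 \<le> a \<zeta>" for \<zeta> using u by (simp add: a_def)
        have v0: "0 \<le> v z" for z by (rule tp(3))
        note vm [measurable] = tp(2)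
        define w where "w z = u z * indicator ?D z" for z
        have wm [measurable]: "w \<in> borel_measurable dA" unfolding w_def[abs_def] by measurable
        have w0: "0 \<le> w z" for z using u by (simp add: w_def)
        have ui: "integrable dA (\<lambda>z. (u z)\<^sup>2)" using fin by (intro integrableI_nonneg) auto
        have wi: "integrable dA (\<lambda>z. (w z)\<^sup>2)"
          by (rule Bochner_Integration.integrable_bound[OF ui]) (measurable, auto simp: w_def indicator_def)
        have fv: "integrable dA (\<lambda>z. cmod (f z) * v z)"
          by (rule Cauchy_Schwarz_integral(1)) (use L2_integrable_sq[OF f] tp(4) in auto)
        \<comment> \<open>Source and evaluation points stay in a fixed smaller disc, so finitely
          many dyadic levels suffice.\<close>
        obtain N where N: "(1 / 2 :: real) ^ N \<le> 1 - exhaust k"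
          using real_arch_pow_inv[of "1 - exhaust k" "1 / 2"] exhaust(2)[of k] by (auto intro: less_imp_le)
        let ?G = "{0, 1 / 3} :: real set"
        let ?A = "\<lambda>s p. \<integral>\<zeta>. cmod (g \<zeta>) * w \<zeta> * indicator (dyadic_box s p) \<zeta> \<partial>dA"
        let ?B = "\<lambda>s p. \<integral>\<zeta>. cmod (f \<zeta>) * v \<zeta> * indicator (dyadic_box s p) \<zeta> \<partial>dA"
        have aw: "a = (\<lambda>\<zeta>. cmod (g \<zeta>) * w \<zeta>)" by (simp add: a_def w_def mult.assoc)
        have ai: "integrable dA (\<lambda>\<zeta>. a \<zeta> * indicator (dyadic_box s p) \<zeta>)" for s p
          by (rule integrable_real_mult_indicator[OF dyadic_box_sets tp(1)])
        have P: "Phi a z \<le> 36 * (\<Sum>s\<in>?G. \<Sum>p\<in>box_index N. 4 ^ fst p * indicator (dyadic_box s p) z * ?A s p)" if z: "z \<in> ?D" for z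
        proof -
          have z1: "cmod z < 1" using z exhaust(2)[of k] by auto
          have "Phi a z \<le> (\<integral>\<zeta>. 36 * (\<Sum>s\<in>?G. \<Sum>p\<in>box_index N. 4 ^ fst p * indicator (dyadic_box s p) z * (a \<zeta> * indicator (dyadic_box s p) \<zeta>)) \<partial>dA)"
            unfolding Phi_def
          proof (rule integral_mono)
            show "integrable dA (\<lambda>\<zeta>. a \<zeta> / (cmod (1 - cnj \<zeta> * z))\<^sup>2)"
              using integrable_div_kernel[OF tp(1) z1] by simp
            show "integrable dA (\<lambda>\<zeta>. 36 * (\<Sum>s\<in>?G. \<Sum>p\<in>box_index N. 4 ^ fst p * indicator (dyadic_box s p) z * (a \<zeta> * indicator (dyadic_box s p) \<zeta>)))"
              by (intro integrable_mult_right Bochner_Integration.integrable_sum ai)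
            fix \<zeta>
            show "a \<zeta> / (cmod (1 - cnj \<zeta> * z))\<^sup>2 \<le> 36 * (\<Sum>s\<in>?G. \<Sum>p\<in>box_index N. 4 ^ fst p * indicator (dyadic_box s p) z * (a \<zeta> * indicator (dyadic_box s p) \<zeta>))"
            proof (cases "\<zeta> \<in> ?D")
              case True
              from mult_left_mono[OF kernel_le_sum_common_dyadic_box[OF z True exhaust(2) N] a0[of \<zeta>]]
              show ?thesis by (simp only: sum_distrib_left mult_ac times_divide_eq_right mult_1_right)
            qed (simp add: a_def)
          qed
          also have "\<dots> = 36 * (\<Sum>s\<in>?G. \<Sum>p\<in>box_index N. \<integral>\<zeta>. 4 ^ fst p * indicator (dyadic_box s p) z * (a \<zeta> * indicator (dyadic_box s p) \<zeta>) \<partial>dA)"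
            by (simp only: integral_mult_right_zero Bochner_Integration.integral_sum Bochner_Integration.integrable_sum integrable_mult_right ai)
          finally show ?thesis by (simp only: integral_mult_right_zero aw)
        qed
        have "(\<integral>z. (v z)\<^sup>2 \<partial>dA) \<le> (\<integral>z. 36 * (\<Sum>s\<in>?G. \<Sum>p\<in>box_index N. 4 ^ fst p * ?A s p * (cmod (f z) * v z * indicator (dyadic_box s p) z)) \<partial>dA)"
        proof (rule integral_mono[OF tp(4)])
          show "integrable dA (\<lambda>z. 36 * (\<Sum>s\<in>?G. \<Sum>p\<in>box_index N. 4 ^ fst p * ?A s p * (cmod (f z) * v z * indicator (dyadic_box s p) z)))"
            by (intro integrable_mult_right Bochner_Integration.integrable_sum integrable_real_mult_indicator dyadic_box_sets fv)
          fix z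
          show "(v z)\<^sup>2 \<le> 36 * (\<Sum>s\<in>?G. \<Sum>p\<in>box_index N. 4 ^ fst p * ?A s p * (cmod (f z) * v z * indicator (dyadic_box s p) z))"
          proof (cases "z \<in> ?D")
            case True
            have "(v z)\<^sup>2 = cmod (f z) * v z * Phi a z" using True by (simp add: v_def power2_eq_square)
            also have "\<dots> \<le> cmod (f z) * v z * (36 * (\<Sum>s\<in>?G. \<Sum>p\<in>box_index N. 4 ^ fst p * indicator (dyadic_box s p) z * ?A s p))"
              using v0 by (intro mult_left_mono P True) auto
            finally show ?thesis by (simp only: sum_distrib_left mult_ac)
          qed (simp add: v_def)
        qed
        also have "\<dots> = 36 * (\<Sum>s\<in>?G. \<Sum>p\<in>box_index N. \<integral>z. 4 ^ fst p * ?A s p * (cmod (f z) * v z * indicator (dyadic_box s p) z) \<partial>dA)"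
          by (simp only: integral_mult_right_zero Bochner_Integration.integral_sum Bochner_Integration.integrable_sum integrable_mult_right
              integrable_real_mult_indicator[OF dyadic_box_sets fv])
        also have "\<dots> = 36 * (\<Sum>s\<in>?G. \<Sum>p\<in>box_index N. 4 ^ fst p * (?A s p * ?B s p))"
          by (simp only: integral_mult_right_zero mult.assoc)
        finally have X: "(\<integral>z. (v z)\<^sup>2 \<partial>dA) \<le> 36 * (\<Sum>s\<in>?G. \<Sum>p\<in>box_index N. 4 ^ fst p * (?A s p * ?B s p))" .
        \<comment> \<open>The constants multiply to 36 * 2 * 25 = 1800, so with this \<kappa> the
          term 1800 \<tau> \<kappa>^2 ?V is half of \<kappa> ?V.\<close>
        define \<kappa> where "\<kappa> = 1 / (3600 * \<tau>)"
        have \<kappa>: "0 < \<kappa>" using \<tau> by (simp add: \<kappa>_def)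
        let ?V = "\<integral>z. (v z)\<^sup>2 \<partial>dA" and ?W = "\<integral>z. (w z)\<^sup>2 \<partial>dA"
        have dy: "\<kappa> * (\<Sum>p\<in>box_index N. 4 ^ fst p * (?A s p * ?B s p)) \<le> 25 * \<tau> * (?W + \<kappa>\<^sup>2 * ?V)" for s
        proof -
          have "(\<Sum>p\<in>box_index N. 4 ^ fst p * (?A s p * (\<integral>z. cmod (f z) * (\<kappa> * v z) * indicator (dyadic_box s p) z \<partial>dA)))
            \<le> 25 * (134 * sqrt K) * (?W + (\<integral>z. (\<kappa> * v z)\<^sup>2 \<partial>dA))"
            using w0 v0 \<kappa> tp(4) by (intro dyadic_bilinear[OF f g K td wm w0 wi]) (auto simp: power_mult_distrib)
          moreover have "(\<integral>z. cmod (f z) * (\<kappa> * v z) * indicator (dyadic_box s p) z \<partial>dA) = \<kappa> * ?B s p" for p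
          proof -
            have "cmod (f z) * (\<kappa> * v z) * indicator (dyadic_box s p) z = \<kappa> * (cmod (f z) * v z * indicator (dyadic_box s p) z)" for z
              by (simp only: mult_ac)
            then show ?thesis by (simp only: integral_mult_right_zero)
          qed
          ultimately show ?thesis by (simp add: power_mult_distrib \<tau>_def sum_distrib_left mult_ac)
        qed
        have "\<kappa> * ?V \<le> 36 * (\<Sum>s\<in>?G. \<kappa> * (\<Sum>p\<in>box_index N. 4 ^ fst p * (?A s p * ?B s p)))"
          using mult_left_mono[OF X, of \<kappa>] \<kappa> by (simp only: sum_distrib_left mult_ac less_imp_le)
        also have "\<dots> \<le> 36 * (\<Sum>s\<in>?G. 25 * \<tau> * (?W + \<kappa>\<^sup>2 * ?V))"
          by (intro mult_left_mono sum_mono dy) simp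
        also have "\<dots> = 1800 * \<tau> * ?W + \<kappa> * ?V / 2"
          using \<tau> by (simp add: \<kappa>_def power2_eq_square field_simps)
        finally have "\<kappa> * ?V \<le> 3600 * \<tau> * ?W" by simp
        then have "?V \<le> (3600 * \<tau>)\<^sup>2 * ?W" using \<tau> by (simp add: \<kappa>_def power2_eq_square field_simps)
        also have "\<dots> \<le> (3600 * \<tau>)\<^sup>2 * (\<integral>z. (u z)\<^sup>2 \<partial>dA)"
          by (intro mult_left_mono integral_mono wi ui) (auto simp: w_def indicator_def)
        finally have "ennreal ?V \<le> ennreal ((3600 * \<tau>)\<^sup>2) * ennreal (\<integral>z. (u z)\<^sup>2 \<partial>dA)"
          by (simp add: ennreal_leI flip: ennreal_mult')
        then show ?thesis
          unfolding a_def[symmetric] tp(5) using tp(4) ui by (simp add: nn_integral_eq_integral)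
      qed
      then show ?case by simp
    qed (use u in auto)
  qed
qed

section \<open>The equivalence\<close>

lemma set_tested_iff:
  assumes g: "g \<in> L2" and E: "E \<in> sets dA"
  shows "set_tested f g (C\<^sup>2) E \<longleftrightarrow>
    sqnorm (\<lambda>z. cabs f z * max_bergman_proj (\<lambda>\<zeta>. cabs g \<zeta> * cabs g \<zeta> * indicator E \<zeta>) z)
      \<le> ennreal (C\<^sup>2) * sqnorm (\<lambda>z. cabs g z * indicator E z)"
proof -
  have e: "(\<lambda>\<zeta>. cabs g \<zeta> * cabs g \<zeta> * indicator E \<zeta>) = (\<lambda>\<zeta>. complex_of_real ((cmod (g \<zeta>))\<^sup>2 * indicator E \<zeta>))"
    by (auto simp: cabs_def indicator_def power2_eq_square)
  have "integrable dA (\<lambda>\<zeta>. (cmod (g \<zeta>))\<^sup>2 * indicator E \<zeta>)"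
    by (rule integrable_real_mult_indicator[OF E L2_integrable_sq[OF g]])
  moreover have "sqnorm (\<lambda>z. cabs g z * indicator E z) = (\<integral>\<^sup>+z. ennreal ((cmod (g z))\<^sup>2 * indicator E z) \<partial>dA)"
    unfolding sqnorm_def by (intro nn_integral_cong) (simp add: norm_mult power_mult_distrib indicator_def)
  ultimately show ?thesis unfolding e set_tested_def by (subst sqnorm_max_eq) auto
qed

lemma set_tested_mono: "set_tested f g K E \<Longrightarrow> K \<le> K' \<Longrightarrow> set_tested f g K' E"
  unfolding set_tested_def by (erule order.trans) (intro mult_right_mono ennreal_leI, auto)

text \<open>The ball condition is symmetric in f and g, and the testing inequality for the Bergman
  projection passes to the adjoint, so one bounded operator yields both testing conditions. The 324
  is the square root of 104976.\<close>

lemma set_tested_of_op_bounded: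
  assumes f: "f \<in> A2" and g: "g \<in> A2" and bd: "op_bounded f g C"
  obtains K where "0 < K" "\<And>E. E \<in> sets dA \<Longrightarrow> set_tested f g K E \<and> set_tested g f K E"
proof -
  define A where "A = 324 * \<bar>C\<bar>"
  have fL: "f \<in> L2" and gL: "g \<in> L2" using f g by (auto dest: A2_D)
  have A: "0 \<le> A" "A\<^sup>2 = 104976 * C\<^sup>2" by (auto simp: A_def power_mult_distrib)
  have bb: "berg_bounded f g C" by (rule berg_bounded_of_op_bounded[OF fL gL bd])
  have bb': "berg_bounded g f C" by (rule berg_bounded_adjoint[OF fL gL bd])
  let ?K = "(max 1 (2304 * sqrt A + 8 * C\<^sup>2)) ^ 4"
  have "set_tested f g ?K E \<and> set_tested g f ?K E" if E: "E \<in> sets dA" for E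
  proof
    show "set_tested f g ?K E"
      by (rule set_tested_of_berg_bounded[OF f gL bb A(1) _ E])
         (unfold A(2), rule ball_condition(2)[OF fL gL bd])
    show "set_tested g f ?K E"
      by (rule set_tested_of_berg_bounded[OF g fL bb' A(1) _ E])
         (unfold A(2), subst mult.commute, rule ball_condition(2)[OF fL gL bd])
  qed
  then show ?thesis using that[of ?K] by (auto intro: zero_less_power)
qed

theorem theorem1p4:
  fixes f g :: "complex \<Rightarrow> complex"
  assumes "f \<in> A2" and "g \<in> A2"
  shows
   "((\<exists>C::real. \<forall>p \<in> polys. \<exists>w. is_toeplitz_adj g p w \<and>
        sqnorm (toeplitz f w) \<le> ennreal (C\<^sup>2) * sqnorm p)
   \<longleftrightarrow> (\<exists>C::real. \<forall>u \<in> L2.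
        sqnorm (\<lambda>z. cabs f z * bergman_proj (\<lambda>\<zeta>. cabs g \<zeta> * u \<zeta>) z)
          \<le> ennreal (C\<^sup>2) * sqnorm u))
  \<and> ((\<exists>C::real. \<forall>u \<in> L2.
        sqnorm (\<lambda>z. cabs f z * bergman_proj (\<lambda>\<zeta>. cabs g \<zeta> * u \<zeta>) z)
          \<le> ennreal (C\<^sup>2) * sqnorm u)
   \<longleftrightarrow> (\<exists>C::real. \<forall>u \<in> L2.
        sqnorm (\<lambda>z. cabs f z * max_bergman_proj (\<lambda>\<zeta>. cabs g \<zeta> * u \<zeta>) z)
          \<le> ennreal (C\<^sup>2) * sqnorm u))
  \<and> ((\<exists>C::real. \<forall>u \<in> L2.
        sqnorm (\<lambda>z. cabs f z * max_bergman_proj (\<lambda>\<zeta>. cabs g \<zeta> * u \<zeta>) z)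
          \<le> ennreal (C\<^sup>2) * sqnorm u)
   \<longleftrightarrow> (\<exists>C0::real. \<forall>a l. 0 < l \<and> l \<le> 1 \<longrightarrow>
        sqnorm (\<lambda>z. cabs f z * max_bergman_proj
                   (\<lambda>\<zeta>. cabs g \<zeta> * cabs g \<zeta> * indicator (carleson_box a l) \<zeta>) z)
          \<le> ennreal (C0\<^sup>2) * sqnorm (\<lambda>z. cabs g z * indicator (carleson_box a l) z)
      \<and> sqnorm (\<lambda>z. cabs g z * max_bergman_proj
                   (\<lambda>\<zeta>. cabs f \<zeta> * cabs f \<zeta> * indicator (carleson_box a l) \<zeta>) z)
          \<le> ennreal (C0\<^sup>2) * sqnorm (\<lambda>z. cabs f z * indicator (carleson_box a l) z)))"
proof (intro conjI)
  have f: "f \<in> L2" and g: "g \<in> L2" using assms by (auto dest: A2_D)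
  note max_iff = max_bounded_iff[OF f g]
  show "(\<exists>C::real. \<forall>p \<in> polys. \<exists>w. is_toeplitz_adj g p w \<and>
        sqnorm (toeplitz f w) \<le> ennreal (C\<^sup>2) * sqnorm p)
   \<longleftrightarrow> (\<exists>C::real. \<forall>u \<in> L2.
        sqnorm (\<lambda>z. cabs f z * bergman_proj (\<lambda>\<zeta>. cabs g \<zeta> * u \<zeta>) z)
          \<le> ennreal (C\<^sup>2) * sqnorm u)"
    by (rule toeplitz_bounded_iff[OF assms])
  show "(\<exists>C::real. \<forall>u \<in> L2.
        sqnorm (\<lambda>z. cabs f z * bergman_proj (\<lambda>\<zeta>. cabs g \<zeta> * u \<zeta>) z)
          \<le> ennreal (C\<^sup>2) * sqnorm u)
   \<longleftrightarrow> (\<exists>C::real. \<forall>u \<in> L2.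
        sqnorm (\<lambda>z. cabs f z * max_bergman_proj (\<lambda>\<zeta>. cabs g \<zeta> * u \<zeta>) z)
          \<le> ennreal (C\<^sup>2) * sqnorm u)"
    unfolding max_iff op_bounded_def[symmetric]
  proof
    assume "\<exists>C. op_bounded f g C"
    then obtain C where "op_bounded f g C" by blast
    then obtain K where "0 < K" "\<And>E. E \<in> sets dA \<Longrightarrow> set_tested f g K E \<and> set_tested g f K E"
      by (rule set_tested_of_op_bounded[OF assms]) blast
    then have "max_bounded f g ((3600 * (134 * sqrt K))\<^sup>2)"
      by (intro max_bounded_of_set_tested f g) (auto intro: carleson_box_sets)
    then show "\<exists>K>0. max_bounded f g K" using \<open>0 < K\<close> by (intro exI[of _ "(3600 * (134 * sqrt K))\<^sup>2"]) simp
  next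
    assume "\<exists>K>0. max_bounded f g K"
    then show "\<exists>C. op_bounded f g C" using op_bounded_of_max_bounded[OF g] by (meson less_imp_le)
  qed
  show "(\<exists>C::real. \<forall>u \<in> L2.
        sqnorm (\<lambda>z. cabs f z * max_bergman_proj (\<lambda>\<zeta>. cabs g \<zeta> * u \<zeta>) z)
          \<le> ennreal (C\<^sup>2) * sqnorm u)
   \<longleftrightarrow> (\<exists>C0::real. \<forall>a l. 0 < l \<and> l \<le> 1 \<longrightarrow>
        sqnorm (\<lambda>z. cabs f z * max_bergman_proj
                   (\<lambda>\<zeta>. cabs g \<zeta> * cabs g \<zeta> * indicator (carleson_box a l) \<zeta>) z)
          \<le> ennreal (C0\<^sup>2) * sqnorm (\<lambda>z. cabs g z * indicator (carleson_box a l) z)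
      \<and> sqnorm (\<lambda>z. cabs g z * max_bergman_proj
                   (\<lambda>\<zeta>. cabs f \<zeta> * cabs f \<zeta> * indicator (carleson_box a l) \<zeta>) z)
          \<le> ennreal (C0\<^sup>2) * sqnorm (\<lambda>z. cabs f z * indicator (carleson_box a l) z))"
    (is "?max \<longleftrightarrow> (\<exists>C0. \<forall>a l. 0 < l \<and> l \<le> 1 \<longrightarrow> ?test C0 a l)")
  proof -
    have test: "?test C0 a l \<longleftrightarrow> set_tested f g (C0\<^sup>2) (carleson_box a l) \<and> set_tested g f (C0\<^sup>2) (carleson_box a l)"
      if "l \<le> 1" for C0 a l
      using set_tested_iff[OF f carleson_box_sets[OF that]] set_tested_iff[OF g carleson_box_sets[OF that]] by blast
    show ?thesis unfolding max_iff
    proof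
      assume "\<exists>K>0. max_bounded f g K"
      then obtain K where K: "0 < K" "max_bounded f g K" by blast
      then have "(sqrt K)\<^sup>2 = K" by simp
      then have "?test (sqrt K) a l" if "l \<le> 1" for a l
        unfolding test[OF that] using set_tested_of_max_bounded[OF g K(2) carleson_box_sets[OF that]]
          set_tested_of_max_bounded[OF f max_bounded_swap[OF f g K(2,1)] carleson_box_sets[OF that]] by simp
      then have "\<forall>a l. 0 < l \<and> l \<le> 1 \<longrightarrow> ?test (sqrt K) a l" by blast
      then show "\<exists>C0. \<forall>a l. 0 < l \<and> l \<le> 1 \<longrightarrow> ?test C0 a l" by blast
    next
      assume "\<exists>C0. \<forall>a l. 0 < l \<and> l \<le> 1 \<longrightarrow> ?test C0 a l"
      then obtain C0 where C0: "\<forall>a l. 0 < l \<and> l \<le> 1 \<longrightarrow> ?test C0 a l" by blast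
      \<comment> \<open>C0 may be 0, while the passage from testing to boundedness asks for a
        positive constant.\<close>
      have K: "0 < C0\<^sup>2 + 1" by (simp add: add_nonneg_pos)
      have "max_bounded f g ((3600 * (134 * sqrt (C0\<^sup>2 + 1)))\<^sup>2)"
      proof (rule max_bounded_of_set_tested[OF f g K])
        fix a l :: real assume "0 < l" "l \<le> 1"
        with C0 have "?test C0 a l" by blast
        then have "set_tested f g (C0\<^sup>2) (carleson_box a l)" "set_tested g f (C0\<^sup>2) (carleson_box a l)"
          unfolding test[OF \<open>l \<le> 1\<close>] by blast+
        then show "set_tested f g (C0\<^sup>2 + 1) (carleson_box a l) \<and> set_tested g f (C0\<^sup>2 + 1) (carleson_box a l)"
          by (auto elim: set_tested_mono)
      qed
      then show "\<exists>K>0. max_bounded f g K" using K by (intro exI[of _ "(3600 * (134 * sqrt (C0\<^sup>2 + 1)))\<^sup>2"]) simp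
    qed
  qed
qed

end
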